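(* Let $x,y,z$ be non-negative integers. (i) For all non-negative integers $a,b$, $$M(H^{(6)}_{x,y,z}(a,b))=\frac{P'_{y,y+2a,b}\,P_{z+b-1,z+b-1,a}\,K(a,b,x,y+z)}{P_{y+z+b-1,y+z+b-1,a}}\cdot\frac{V(2a+2b+3,y+z-2,y)}{V(2x+2a+2b+3,y+z-2,y)}\cdot\frac{T(x+b+1,y+z+2a-1,y)\,T(2a+b+1,y+b-1,b)\,T(z+1,y+b-1,b)}{T(b+1,y+z+2a-1,y)\,T(x+2a+b+1,y+b-1,b)\,T(x+z+1,y+b-1,b)}.$$ (ii) For every $k\ge 2$ and every sequence $\mathbf a=(a_1,\dots,a_{2k})$ of non-negative integers, write $\mathrm O=\mathrm O(\mathbf a)$, $\mathrm E=\mathrm E(\mathbf a)$, $e_i=e_i(\mathbf a)$, $o_i=o_i(\mathbf a)$, $\sigma_i=s_{2i-1}(\mathbf a)+s_{2k}(\mathbf a)$ and $T_i(u)=T(u,\,a_{2i-2}+o_i-1,\,o_i)$. Then $$M(H^{(6)}_{x,y,z}(a_1,\dots,a_{2k}))=2^{a_1}M(H^{(6)}_{x,y,z}(\mathrm O,\mathrm E))\,\frac{Q'(0,a_1,a_2,\dots,a_{2k},y)\,K(a_1,\dots,a_{2k-1},a_{2k}+z)}{P'_{y,y+2\mathrm O,\mathrm E}\,P_{z+\mathrm E-1,z+\mathrm E-1,\mathrm O}}$$ $$\times\prod_{i=2}^{k}\frac{T_i(x+z+e_i+1)\,T_i(y+e_i+1)}{T_i(x+y+e_i+1)\,T_i(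z+e_i+1)}\cdot\frac{T_i(x+y+\sigma_i+1)\,T_i(z+\sigma_i+1)}{T_i(x+z+\sigma_i+1)\,T_i(y+\sigma_i+1)}.$$
   Context: Geometry. Work on the triangular lattice with unit equilateral triangles and horizontal lattice lines; consecutive horizontal lattice lines are one level apart. East, west, NE, NW, SE, SW denote the six unit lattice steps. An up-pointing (down-pointing) triangle has a horizontal bottom (top) side. A lozenge is the union of two unit triangles sharing an edge; it is vertical if the shared edge is horizontal. A tiling of a region (finite union of unit triangles) is a covering by lozenges without gaps or overlaps. Lozenges may carry weights (weight 1 unless stated otherwise); the weight of a tiling is the product of the weights of its lozenges, and $M(R)$ is the sum of the weights of all tilings of $R$. Polygons are described by their boundary path, starting at the upper-left corner and going counterclockwise; $(\mathrm{SW},\mathrm{SE})^m$ means the two steps repeated $m$ times. Numbers $P,P'$. For $0\le a\le b$, $c\ge0$, take the polygon with boundary $(\mathrm{SW},\mathrm{SE})^{a}$, then $b-a$ steps SE, $c$ steps east, $a$ steps NE, $b$ steps NW, $c$ steps west. $P_{a,b,c}$ is its number of (unweighted) tilings; $P'_{a,b,c}$ is its weighted tiling number when each vertical lozenge whose two left sides both lie on the zigzag part $(\mathrm{SW},\mathrm{SE})^a$ has weight $\frac12$. Sequences. For a finite sequence $\mathbf t=(t_1,t_2,\dots)$ of non-negative integers: $\mathrm O(\mathbf t)=\sum_{i\text{ odd}}t_i$, $\mathrm E(\mathbf t)=\sum_{i\text{ even}}t_i$, $s_m(\mathbf t)=\sum_{i=1}^m t_i$, $o_m(\mathbf t)=\sum_{i\ge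 m}t_{2i-1}$, $e_m(\mathbf t)=\sum_{i\ge m}t_{2i}$. Numbers $Q'$, $K$. For $\mathbf t=(t_1,\dots,t_{2l})$, take the polygon with boundary $(\mathrm{SW},\mathrm{SE})^{\mathrm E(\mathbf t)}$, then $\mathrm E(\mathbf t)+\mathrm O(\mathbf t)$ steps east, $2\mathrm E(\mathbf t)$ steps NW, $\mathrm O(\mathbf t)$ steps west; divide the bottom side from left to right into segments of lengths $t_1,\dots,t_{2l}$, and for each $i$ remove the up-pointing triangle of side $t_{2i}$ whose bottom side is the $2i$-th segment (intersected with the polygon). $Q'(\mathbf t)$ is the weighted tiling number of this region when each vertical lozenge whose two left sides both lie on the western zigzag has weight $\frac12$. For $\mathrm E(\mathbf t)\ge1$, $K(\mathbf t)$ is the number of (unweighted) tilings of the region obtained by the same removals from the polygon with boundary $(\mathrm{SW},\mathrm{SE})^{\mathrm E(\mathbf t)-1}$, one step SW, then $\mathrm E(\mathbf t)+\mathrm O(\mathbf t)$ steps east, $2\mathrm E(\mathbf t)-1$ steps NW, $\mathrm O(\mathbf t)$ steps west. Region $H^{(6)}_{x,y,z}(a_1,\dots,a_k)$. With $\mathrm O=\mathrm O(\mathbf a)$, $\mathrm E=\mathrm E(\mathbf a)$, take the polygon with boundary $(\mathrm{SW},\mathrm{SE})^{y+\mathrm O}$ (arriving at a point $W_0$), $(\mathrm{SE},\mathrm{SW})^{z+\mathrm E-1}$, one step SE, then $x+\mathrm O$ steps east, $y+z+2\mathrm E-1$ steps NE, $y+z+2\mathrm O$ steps NW, $x+\mathrm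 E$ steps west (this makes sense when $z+\mathrm E\ge1$). Let $L$ be the horizontal lattice line through $W_0$; starting at $W_0$ mark on $L$ from left to right consecutive segments of lengths $a_1,\dots,a_k$. Remove: for $i=1$, the part of the polygon above $L$ and to the left of the line going from the right endpoint of the first segment in direction NW (half of an up-pointing triangle of side $2a_1$); for odd $i\ge3$, the up-pointing triangle of side $a_i$ whose bottom side is the $i$-th segment; for even $i$, the down-pointing triangle of side $a_i$ whose top side is the $i$-th segment. Give weight $\frac12$ to each vertical lozenge whose two left sides both lie on the part of the western boundary above $L$; all other lozenges have weight 1. Products. $(u)_n=u(u+1)\cdots(u+n-1)$ for $n>0$, $(u)_0=1$, $(u)_n=\frac1{(u-1)(u-2)\cdots(u+n)}$ for $n<0$. $[u]_n=u(u+2)\cdots(u+2(n-1))$ for $n>0$, $[u]_0=1$, $[u]_n=\frac1{(u-2)(u-4)\cdots(u+2n)}$ for $n<0$. $T(u,n,m)=\prod_{i=0}^{m-1}(u+i)_{n-2i}$ and $V(u,n,m)=\prod_{i=0}^{m-1}[u+2i]_{n-2i}$ (empty products $=1$).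
   Formalization: In (ii), σ_i is taken as s_{2i-3}(a)+s_{2k}(a) instead of s_{2i-1}(a)+s_{2k}(a); as printed, the formula fails: for x=1, y=0, z=1, a=(0,1,1,0) it gives 243/28, while the weighted tiling number is 9. *)

theory Defs
  imports Complex_Main "HOL-Library.Disjoint_Sets" "HOL-Library.Product_Plus"
begin

section \<open>The triangular lattice\<close>

text \<open>The lattice point (i,j) is the point reached from the origin by i unit steps east and
  j unit steps north-east; so j is the level, and the horizontal lattice lines are the lines
  j = const, the lines in direction NE/SW are i = const, those in direction NW/SE are
  i + j = const.\<close>

type_synonym point = "int \<times> int"

datatype dir = East | West | NE | NW | SE | SW

fun vec :: "dir \<Rightarrow> point" where
  "vec East = (1, 0)"
| "vec West = (-1, 0)"
| "vec NE = (0, 1)"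
| "vec NW = (-1, 1)"
| "vec SE = (1, -1)"
| "vec SW = (0, -1)"

text \<open>Up i j has vertices (i,j), (i+1,j), (i,j+1); Down i j is its mirror image in the edge from
  (i+1,j) to (i,j+1). Both lie in the row between the levels j and j+1.\<close>

datatype tri = Up int int | Down int int

fun verts :: "tri \<Rightarrow> point set" where
  "verts (Up i j) = {(i, j), (i + 1, j), (i, j + 1)}"
| "verts (Down i j) = {(i + 1, j), (i, j + 1), (i + 1, j + 1)}"

fun row :: "tri \<Rightarrow> int" where
  "row (Up i j) = j"
| "row (Down i j) = j"

text \<open>The slanted unit edges of the row between levels j and j+1 are numbered from west to east by
  the sum of the first coordinates of their two endpoints. The triangle t of that row lies between
  the edges number col t and col t + 1.\<close>

fun col :: "tri \<Rightarrow> int" where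
  "col (Up i j) = 2 * i"
| "col (Down i j) = 2 * i + 1"

section \<open>Lozenges, tilings, weighted counts\<close>

type_synonym lozenge = "tri set"

text \<open>The vertical lozenge whose westernmost vertex is (i,j).\<close>

definition vert_lozenge :: "int \<Rightarrow> int \<Rightarrow> lozenge" where
  "vert_lozenge i j = {Up i j, Down i (j - 1)}"

definition lozenges :: "lozenge set" where
  "lozenges = {vert_lozenge i j |i j. True}
     \<union> {{Up i j, Down i j} |i j. True}
     \<union> {{Up i j, Down (i - 1) j} |i j. True}"

definition tilings :: "tri set \<Rightarrow> lozenge set set" where
  "tilings R = {T. T \<subseteq> lozenges \<and> partition_on R T}"

definition weighted_tilings :: "(lozenge \<Rightarrow> real) \<Rightarrow> tri set \<Rightarrow> real" where
  "weighted_tilings w R = (\<Sum>T\<in>tilings R. \<Prod>l\<in>T. w l)"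

definition num_tilings :: "tri set \<Rightarrow> real" where
  "num_tilings R = weighted_tilings (\<lambda>_. 1) R"

section \<open>Lattice paths and polygons\<close>

fun steps_from :: "point \<Rightarrow> dir list \<Rightarrow> (point \<times> point) list" where
  "steps_from p [] = []"
| "steps_from p (d # ds) = (p, p + vec d) # steps_from (p + vec d) ds"

text \<open>All boundary paths start at the origin, which is thus the upper-left corner of the polygon.\<close>

definition path_steps :: "dir list \<Rightarrow> (point \<times> point) list" where
  "path_steps ds = steps_from (0, 0) ds"

definition path_end :: "dir list \<Rightarrow> point" where
  "path_end ds = sum_list (map vec ds)"

definition rep :: "nat \<Rightarrow> dir list \<Rightarrow> dir list" where
  "rep m ds = concat (replicate m ds)"

text \<open>Winding number of a closed lattice path around (the centre of) a unit triangle, computed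
  along the ray going west from the triangle: downward steps crossing it count 1, upward steps -1.
  The polygon is the set of unit triangles enclosed by the path; the winding number makes this
  meaningful also when, for small parameters, the path runs along some lattice edge twice.\<close>

definition winding :: "dir list \<Rightarrow> tri \<Rightarrow> int" where
  "winding ds t = (\<Sum>(p, q)\<leftarrow>path_steps ds.
     if fst p + fst q \<le> col t
     then (if snd p = row t + 1 \<and> snd q = row t then 1
           else if snd p = row t \<and> snd q = row t + 1 then -1 else 0)
     else 0)"

definition polygon :: "dir list \<Rightarrow> tri set" where
  "polygon ds = {t. winding ds t \<noteq> 0}"

text \<open>Weight 1/2 for the vertical lozenges both of whose left sides (which, traversed downwards, go
  from (i,j+1) to (i,j) and from (i,j) to (i+1,j-1)) are steps of the path ds. It is only used for
  paths ds that go down.\<close>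

definition west_weight :: "dir list \<Rightarrow> lozenge \<Rightarrow> real" where
  "west_weight ds l =
     (if \<exists>i j. l = vert_lozenge i j
            \<and> ((i, j + 1), (i, j)) \<in> set (path_steps ds)
            \<and> ((i, j), (i + 1, j - 1)) \<in> set (path_steps ds)
      then 1 / 2 else 1)"

text \<open>The up-pointing triangle of side s with lower-left vertex p, and the down-pointing triangle of
  side s with upper-left vertex p.\<close>

definition up_triangle :: "point \<Rightarrow> nat \<Rightarrow> tri set" where
  "up_triangle p s = {t. \<forall>v\<in>verts t.
     fst p \<le> fst v \<and> snd p \<le> snd v \<and> fst v + snd v \<le> fst p + snd p + int s}"

definition down_triangle :: "point \<Rightarrow> nat \<Rightarrow> tri set" where
  "down_triangle p s = {t. \<forall>v\<in>verts t.
     fst v \<le> fst p + int s \<and> snd v \<le> snd p \<and> fst p + snd p \<le> fst v + snd v}"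

text \<open>The part of the plane above the horizontal line through q and to the left of the line through
  q in direction NW.\<close>

definition above_left :: "point \<Rightarrow> tri set" where
  "above_left q = {t. \<forall>v\<in>verts t. snd q \<le> snd v \<and> fst v + snd v \<le> fst q + snd q}"

section \<open>Sequences\<close>

text \<open>The entries of a sequence are numbered from 1.\<close>

definition entry :: "nat list \<Rightarrow> nat \<Rightarrow> nat" where
  "entry t i = (if 1 \<le> i \<and> i \<le> length t then t ! (i - 1) else 0)"

definition odd_sum :: "nat list \<Rightarrow> nat" where
  "odd_sum t = (\<Sum>i | i \<in> {1..length t} \<and> odd i. entry t i)"

definition even_sum :: "nat list \<Rightarrow> nat" where
  "even_sum t = (\<Sum>i | i \<in> {1..length t} \<and> even i. entry t i)"

definition s_sum :: "nat \<Rightarrow> nat list \<Rightarrow> nat" where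
  "s_sum m t = (\<Sum>i=1..m. entry t i)"

definition o_sum :: "nat \<Rightarrow> nat list \<Rightarrow> nat" where
  "o_sum m t = (\<Sum>i | m \<le> i \<and> 1 \<le> i \<and> 2 * i - 1 \<le> length t. entry t (2 * i - 1))"

definition e_sum :: "nat \<Rightarrow> nat list \<Rightarrow> nat" where
  "e_sum m t = (\<Sum>i | m \<le> i \<and> 1 \<le> i \<and> 2 * i \<le> length t. entry t (2 * i))"

section \<open>The tiling numbers\<close>

definition P_polygon :: "nat \<Rightarrow> nat \<Rightarrow> nat \<Rightarrow> tri set" where
  "P_polygon a b c = polygon (rep a [SW, SE] @ replicate (b - a) SE @ replicate c East
     @ replicate a NE @ replicate b NW @ replicate c West)"

definition P_num :: "nat \<Rightarrow> nat \<Rightarrow> nat \<Rightarrow> real" where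
  "P_num a b c = num_tilings (P_polygon a b c)"

definition P'_num :: "nat \<Rightarrow> nat \<Rightarrow> nat \<Rightarrow> real" where
  "P'_num a b c = weighted_tilings (west_weight (rep a [SW, SE])) (P_polygon a b c)"

text \<open>The triangles to be removed along a bottom side with left endpoint p.\<close>

definition bottom_triangles :: "point \<Rightarrow> nat list \<Rightarrow> tri set" where
  "bottom_triangles p t = (\<Union>i\<in>{i. i \<in> {1..length t} \<and> even i}.
     up_triangle (p + (int (s_sum (i - 1) t), 0)) (entry t i))"

definition Q'_num :: "nat list \<Rightarrow> real" where
  "Q'_num t =
    (let zigzag = rep (even_sum t) [SW, SE]
     in weighted_tilings (west_weight zigzag)
          (polygon (zigzag @ replicate (even_sum t + odd_sum t) East
              @ replicate (2 * even_sum t) NW @ replicate (odd_sum t) West)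
           - bottom_triangles (path_end zigzag) t))"

text \<open>Only meaningful if even_sum t is positive.\<close>

definition K_num :: "nat list \<Rightarrow> real" where
  "K_num t =
    (let zigzag = rep (even_sum t - 1) [SW, SE] @ [SW]
     in num_tilings
          (polygon (zigzag @ replicate (even_sum t + odd_sum t) East
              @ replicate (2 * even_sum t - 1) NW @ replicate (odd_sum t) West)
           - bottom_triangles (path_end zigzag) t))"

section \<open>The region with removed triangles along a horizontal line\<close>

text \<open>The part of the western boundary above the line L; it ends at the point W0 on L.\<close>

definition H6_west :: "nat \<Rightarrow> nat list \<Rightarrow> dir list" where
  "H6_west y a = rep (y + odd_sum a) [SW, SE]"

text \<open>Only meaningful if z + even_sum a is positive.\<close>

definition H6_polygon :: "nat \<Rightarrow> nat \<Rightarrow> nat \<Rightarrow> nat list \<Rightarrow> tri set" where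
  "H6_polygon x y z a = polygon (H6_west y a @ rep (z + even_sum a - 1) [SE, SW] @ [SE]
     @ replicate (x + odd_sum a) East
     @ replicate (y + z + 2 * even_sum a - 1) NE
     @ replicate (y + z + 2 * odd_sum a) NW
     @ replicate (x + even_sum a) West)"

definition H6_removed :: "nat \<Rightarrow> nat list \<Rightarrow> tri set" where
  "H6_removed y a =
    (let W0 = path_end (H6_west y a)
     in (\<Union>i\<in>{1..length a}.
           if i = 1 then above_left (W0 + (int (entry a 1), 0))
           else if odd i then up_triangle (W0 + (int (s_sum (i - 1) a), 0)) (entry a i)
           else down_triangle (W0 + (int (s_sum (i - 1) a), 0)) (entry a i)))"

definition H6_region :: "nat \<Rightarrow> nat \<Rightarrow> nat \<Rightarrow> nat list \<Rightarrow> tri set" where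
  "H6_region x y z a = H6_polygon x y z a - H6_removed y a"

definition M_H6 :: "nat \<Rightarrow> nat \<Rightarrow> nat \<Rightarrow> nat list \<Rightarrow> real" where
  "M_H6 x y z a = weighted_tilings (west_weight (H6_west y a)) (H6_region x y z a)"

section \<open>Products\<close>

definition rising :: "real \<Rightarrow> int \<Rightarrow> real" where
  "rising u n = (if 0 \<le> n then pochhammer u (nat n)
                 else 1 / (\<Prod>i=1..nat (- n). u - of_nat i))"

definition rising2 :: "real \<Rightarrow> int \<Rightarrow> real" where
  "rising2 u n = (if 0 \<le> n then \<Prod>i<nat n. u + 2 * of_nat i
                  else 1 / (\<Prod>i=1..nat (- n). u - 2 * of_nat i))"

definition T_prod :: "real \<Rightarrow> int \<Rightarrow> nat \<Rightarrow> real" where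
  "T_prod u n m = (\<Prod>i<m. rising (u + of_nat i) (n - 2 * int i))"

definition V_prod :: "real \<Rightarrow> int \<Rightarrow> nat \<Rightarrow> real" where
  "V_prod u n m = (\<Prod>i<m. rising2 (u + 2 * of_nat i) (n - 2 * int i))"

definition T_seq :: "nat list \<Rightarrow> nat \<Rightarrow> nat \<Rightarrow> real" where
  "T_seq a i u = T_prod (of_nat u) (int (entry a (2 * i - 2)) + int (o_sum i a) - 1) (o_sum i a)"

text \<open>The first index is 2i-3. With 2i-1 in its place the product formula fails: for x = 1, y = 0,
  z = 1 and a = (0,1,1,0) it would give 243/28, whereas the weighted tiling number of the region
  is 9.\<close>

definition sigma :: "nat list \<Rightarrow> nat \<Rightarrow> nat" where
  "sigma a i = s_sum (2 * i - 3) a + s_sum (length a) a"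

end

theory Submission
  imports Defs "HOL-Library.FuncSet" "Jordan_Normal_Form.Determinant"
begin

text \<open>
  Call the sequence of segments removed along the marked line a fern. The region is cut along this
  line, both parts are counted by product formulas, and the sum over the ways to join them is
  evaluated as a function of the width.

  Encode unit triangles as cells (u,k), where u numbers the rows and k is the position relative to
  the western zigzag. The regions counted by Q' and K are then trapezoids without some triangles
  along the bottom side, and removing such a triangle has the same effect as removing the
  up-pointing unit triangles on its base, since the rest of it is forced (\<open>bcov_utri\<close>).
  In a tiling, the vertical lozenges in consecutive rows interlace (\<open>sum_rowcov\<close>).
  Measure positions by their distance from the zigzag, or from the line half a step to the left of
  it, and write Vandermonde products in the squares of these distances as determinants in the Newton
  bases at 1, 3, 5, ... and at 0, 2, 4, ...; then the sum over interlacing positions is a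
  telescoping sum in every column. This gives the product formula \<open>dented_product\<close>:
  with dents at distances d, the count is a constant times the product of the differences of the
  squared distances, times the product of the d for an even number of rows.

  A tiling of the region H is determined by the set S of positions on the marked line where a
  vertical lozenge crosses it, and by tilings of the two parts (\<open>M_H6_sum\<close>); the
  removed half triangle accounts for the power of 2. Each of the first m = O + E positions is a dent
  of exactly one of the two parts, so that S interacts with all of them in the same way for every
  fern. Therefore (\<open>M_H6_formula\<close>) the weighted tiling number is an explicit product
  times a sum \<open>Zsum\<close> depending only on m and x, y, z.

  For a fern of 2k segments compared with the fern (O,E), that sum cancels. The remaining products
  compare the odd segments of the fern with a single segment of length O; moving the odd segments
  one after the other past the even ones (\<open>cr_odpos_ratio\<close>) contributes a quotient of
  two products T for each i.

  For the fern (a,b), let n = min(y,z) and N = x + n. In \<open>Zsum\<close>, write one Vandermonde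
  factor in a Newton basis growing to the right of the range of summation and the other one in a
  Newton basis descending from its right end. Every sum in the Leibniz expansion is then a one-point
  sum with a product formula (\<open>one_point_sum\<close>), and its dependence on N factors so that
  the permutations do not matter (\<open>Zsum_proportional\<close>). So the dependence on x of both
  sides of the formula for (a,b) is explicit, both have the same ratio from x to x + 1
  (\<open>region_factor_step\<close>, \<open>formula_factor_step\<close>), and for x = 0 the sum has
  one term (\<open>M_H6_width_0\<close>).
\<close>

text \<open>The rows and columns below are those of unit triangles, not of matrices.\<close>

hide_const (open) Matrix.row Matrix.col Matrix.vec

section \<open>Weighted coverings by tiles\<close>

text \<open>Tilings with an arbitrary set L of admissible tiles, so that lozenges and their images
  under a change of coordinates are treated alike.\<close>

definition covers :: "'a set set \<Rightarrow> 'a set \<Rightarrow> 'a set set set" where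
  "covers L R = {T. T \<subseteq> L \<and> partition_on R T}"

text \<open>The weighted number of coverings of R by tiles from L.\<close>

definition cov :: "'a set set \<Rightarrow> ('a set \<Rightarrow> real) \<Rightarrow> 'a set \<Rightarrow> real" where
  "cov L w R = (\<Sum>T\<in>covers L R. \<Prod>l\<in>T. w l)"

lemma weighted_tilings_eq_cov: "weighted_tilings w R = cov lozenges w R"
  by (simp add: weighted_tilings_def cov_def covers_def tilings_def)

lemma covers_iff: "T \<in> covers L R \<longleftrightarrow> T \<subseteq> L \<and> \<Union>T = R \<and> disjoint T \<and> {} \<notin> T"
  by (auto simp: covers_def partition_on_def)

lemma finite_covers: "finite R \<Longrightarrow> finite (covers L R)"
  by (rule finite_subset[of _ "Pow (Pow R)"]) (auto simp: covers_iff)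

lemma finite_cover: "finite R \<Longrightarrow> T \<in> covers L R \<Longrightarrow> finite T"
  by (rule finite_subset[of _ "Pow R"]) (auto simp: covers_iff)

lemma cov_empty [simp]: "cov L w {} = 1"
proof -
  have "covers L {} = {{}}"
    by (auto simp: covers_iff)
  then show ?thesis
    by (simp add: cov_def)
qed

lemma cov_cong:
  assumes "\<And>l. l \<in> L \<Longrightarrow> l \<subseteq> R \<Longrightarrow> w l = w' l"
  shows "cov L w R = cov L w' R"
  unfolding cov_def
  by (intro sum.cong prod.cong refl assms) (auto simp: covers_iff)

text \<open>Transport along an injective change of coordinates that matches the two sets of
  tiles.\<close>

lemma cov_image:
  assumes inj: "inj f" and L: "(`) f ` L = {l \<in> L'. l \<subseteq> range f}"
  shows "cov L' w (f ` R) = cov L (\<lambda>l. w (f ` l)) R"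
proof -
  have injf: "inj ((`) f)"
    using inj by (simp add: inj_image_eq_iff inj_def)
  have bij: "bij_betw ((`) ((`) f)) (covers L R) (covers L' (f ` R))"
  proof (rule bij_betwI')
    fix T T' show "((`) f ` T = (`) f ` T') = (T = T')"
      using injf by (simp add: inj_image_eq_iff)
  next
    fix T assume T: "T \<in> covers L R"
    have "disjoint ((`) f ` T)"
    proof (rule disjointI)
      fix p q assume pq: "p \<in> (`) f ` T" "q \<in> (`) f ` T" "p \<noteq> q"
      then obtain a b where ab: "a \<in> T" "b \<in> T" "p = f ` a" "q = f ` b" "a \<noteq> b"
        by auto
      then have "a \<inter> b = {}"
        using T by (simp add: covers_iff disjoint_def)
      then show "p \<inter> q = {}"
        using inj ab by (simp add: image_Int[symmetric])
    qed
    moreover have "(`) f ` T \<subseteq> L'"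
      using T L by (auto simp: covers_iff)
    moreover have "\<Union>((`) f ` T) = f ` R"
      using T by (auto simp: covers_iff)
    ultimately show "(`) f ` T \<in> covers L' (f ` R)"
      using T by (auto simp: covers_iff)
  next
    fix S assume S: "S \<in> covers L' (f ` R)"
    define T where "T = {l \<in> L. f ` l \<in> S}"
    have ST: "S = (`) f ` T"
    proof -
      have "l \<in> (`) f ` L" if "l \<in> S" for l
      proof -
        have "l \<subseteq> f ` R" "l \<in> L'"
          using that S by (auto simp: covers_iff)
        then have "l \<in> {l \<in> L'. l \<subseteq> range f}"
          by auto
        then show ?thesis
          by (simp only: L)
      qed
      then have "S \<subseteq> (`) f ` T"
        unfolding T_def by blast
      moreover have "(`) f ` T \<subseteq> S"
        unfolding T_def by blast
      ultimately show ?thesis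
        by (rule equalityI)
    qed
    have "disjoint T"
    proof (rule disjointI)
      fix a b assume ab: "a \<in> T" "b \<in> T" "a \<noteq> b"
      then have "f ` a \<in> S" "f ` b \<in> S" "f ` a \<noteq> f ` b"
        using inj by (auto simp: T_def inj_image_eq_iff)
      moreover have "disjoint S"
        using S by (simp add: covers_iff)
      ultimately have "f ` a \<inter> f ` b = {}"
        by (simp add: disjointD)
      then show "a \<inter> b = {}"
        by blast
    qed
    moreover have "\<Union>T = R"
    proof -
      have "f ` \<Union>T = f ` R"
        using S by (simp add: covers_iff ST image_UN image_Union)
      then show ?thesis
        using inj by (simp add: inj_image_eq_iff)
    qed
    moreover have "{} \<notin> T"
      using S by (auto simp: covers_iff T_def)
    ultimately have "T \<in> covers L R"
      by (auto simp: covers_iff T_def)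
    then show "\<exists>T\<in>covers L R. S = (`) f ` T"
      using ST by blast
  qed
  have "cov L' w (f ` R) = (\<Sum>T\<in>covers L R. \<Prod>l\<in>(`) f ` T. w l)"
    unfolding cov_def by (rule sum.reindex_bij_betw[OF bij, symmetric])
  also have "\<dots> = cov L (\<lambda>l. w (f ` l)) R"
  proof -
    have "(\<Prod>l\<in>(`) f ` T. w l) = (\<Prod>l\<in>T. w (f ` l))" for T
      by (subst prod.reindex[OF inj_on_subset[OF injf subset_UNIV]]) simp
    then show ?thesis
      by (simp add: cov_def)
  qed
  finally show ?thesis .
qed

lemma sum_times_product:
  fixes c :: real
  shows "(\<Sum>(a, b)\<in>X \<times> Y. c * f a * g b) = c * sum f X * sum g Y"
  unfolding sum.cartesian_product[symmetric] sum_distrib_left[symmetric] sum_distrib_right[symmetric] ..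

text \<open>A covering of a region cut into two pieces A and B consists of the set C of tiles that
  meet both pieces and of coverings of what C leaves of each piece.\<close>

lemma cov_split:
  assumes fin: "finite A" "finite B" and AB: "A \<inter> B = {}"
  shows "cov L w (A \<union> B) =
    (\<Sum>C\<in>{C. C \<subseteq> L \<and> disjoint C \<and> (\<forall>l\<in>C. l \<subseteq> A \<union> B \<and> l \<inter> A \<noteq> {} \<and> l \<inter> B \<noteq> {})}.
       (\<Prod>l\<in>C. w l) * cov L w (A - \<Union>C) * cov L w (B - \<Union>C))"
proof -
  let ?Cs = "{C. C \<subseteq> L \<and> disjoint C \<and> (\<forall>l\<in>C. l \<subseteq> A \<union> B \<and> l \<inter> A \<noteq> {} \<and> l \<inter> B \<noteq> {})}"
  let ?S = "Sigma ?Cs (\<lambda>C. covers L (A - \<Union>C) \<times> covers L (B - \<Union>C))"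
  have finC: "finite ?Cs"
    by (rule finite_subset[of _ "Pow (Pow (A \<union> B))"]) (use fin in auto)
  have finC': "finite C" if "C \<in> ?Cs" for C
    by (rule finite_subset[of _ "Pow (A \<union> B)"]) (use fin that in auto)
  let ?f = "\<lambda>(C, T1, T2). C \<union> T1 \<union> T2"
  let ?g = "\<lambda>T. ({l \<in> T. l \<inter> A \<noteq> {} \<and> l \<inter> B \<noteq> {}}, {l \<in> T. l \<subseteq> A}, {l \<in> T. l \<subseteq> B})"
  have "cov L w (A \<union> B) = (\<Sum>(C, T1, T2)\<in>?S. (\<Prod>l\<in>C. w l) * (\<Prod>l\<in>T1. w l) * (\<Prod>l\<in>T2. w l))"
    unfolding cov_def
  proof (rule sum.reindex_bij_witness[where i = ?f and j = ?g])
    fix T assume T: "T \<in> covers L (A \<union> B)"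
    then have sub: "l \<subseteq> A \<union> B" "l \<noteq> {}" "l \<in> L" if "l \<in> T" for l
      using that by (auto simp: covers_iff)
    have U: "\<Union>T = A \<union> B" and dis: "disjoint T" and ne: "{} \<notin> T"
      using T by (auto simp: covers_iff)
    have "l \<in> fst (?g T) \<union> fst (snd (?g T)) \<union> snd (snd (?g T))" if "l \<in> T" for l
      using sub(1)[OF that] that by simp blast
    then show "?f (?g T) = T"
      by auto
    have d: "\<And>l m. l \<in> T \<Longrightarrow> m \<in> T \<Longrightarrow> x \<in> l \<Longrightarrow> x \<in> m \<Longrightarrow> l = m" for x
      using dis by (auto simp: disjoint_def)
    define C where "C = {l \<in> T. l \<inter> A \<noteq> {} \<and> l \<inter> B \<noteq> {}}"
    have C: "C \<in> ?Cs"
      using sub(1,3) dis by (simp add: C_def disjoint_def subset_iff) blast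
    have m1: "{l \<in> T. l \<subseteq> A} \<in> covers L (A - \<Union>C)"
    proof -
      have "\<Union>{l \<in> T. l \<subseteq> A} = A - \<Union>C"
      proof (intro equalityI subsetI)
        fix x assume "x \<in> \<Union>{l \<in> T. l \<subseteq> A}"
        then obtain l where l: "l \<in> T" "l \<subseteq> A" "x \<in> l"
          by auto
        then have "x \<notin> m" if "m \<in> C" for m
          using d[of l m x] that AB by (auto simp: C_def)
        then show "x \<in> A - \<Union>C"
          using l by auto
      next
        fix x assume x: "x \<in> A - \<Union>C"
        then obtain l where l: "l \<in> T" "x \<in> l"
          using U by blast
        then have "l \<inter> B = {}"
          using x by (auto simp: C_def)
        then have "l \<subseteq> A"
          using sub(1)[OF l(1)] by auto
        then show "x \<in> \<Union>{l \<in> T. l \<subseteq> A}"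
          using l by auto
      qed
      then show ?thesis
        using sub(3) dis ne by (auto simp: covers_iff disjoint_def)
    qed
    have m2: "{l \<in> T. l \<subseteq> B} \<in> covers L (B - \<Union>C)"
    proof -
      have "\<Union>{l \<in> T. l \<subseteq> B} = B - \<Union>C"
      proof (intro equalityI subsetI)
        fix x assume "x \<in> \<Union>{l \<in> T. l \<subseteq> B}"
        then obtain l where l: "l \<in> T" "l \<subseteq> B" "x \<in> l"
          by auto
        then have "x \<notin> m" if "m \<in> C" for m
          using d[of l m x] that AB by (auto simp: C_def)
        then show "x \<in> B - \<Union>C"
          using l by auto
      next
        fix x assume x: "x \<in> B - \<Union>C"
        then obtain l where l: "l \<in> T" "x \<in> l"
          using U by blast
        then have "l \<inter> A = {}"
          using x by (auto simp: C_def)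
        then have "l \<subseteq> B"
          using sub(1)[OF l(1)] by auto
        then show "x \<in> \<Union>{l \<in> T. l \<subseteq> B}"
          using l by auto
      qed
      then show ?thesis
        using sub(3) dis ne by (auto simp: covers_iff disjoint_def)
    qed
    show "?g T \<in> ?S"
      using C m1 m2 by (simp add: C_def)
    have fT: "finite T"
      using finite_cover[of "A \<union> B"] fin T by blast
    have "(\<Prod>l\<in>T. w l) = (\<Prod>l\<in>C \<union> {l \<in> T. l \<subseteq> A} \<union> {l \<in> T. l \<subseteq> B}. w l)"
      using \<open>?f (?g T) = T\<close> by (simp add: C_def)
    also have "\<dots> = (\<Prod>l\<in>C. w l) * (\<Prod>l\<in>{l \<in> T. l \<subseteq> A}. w l) * (\<Prod>l\<in>{l \<in> T. l \<subseteq> B}. w l)"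
    proof -
      have "C \<inter> {l \<in> T. l \<subseteq> A} = {}" "(C \<union> {l \<in> T. l \<subseteq> A}) \<inter> {l \<in> T. l \<subseteq> B} = {}"
      proof -
        have "l \<noteq> {}" if "l \<in> T" for l
          using sub(2) that .
        then have "\<not> (l \<subseteq> A \<and> l \<subseteq> B)" if "l \<in> T" for l
          using AB that by blast
        then show "C \<inter> {l \<in> T. l \<subseteq> A} = {}" "(C \<union> {l \<in> T. l \<subseteq> A}) \<inter> {l \<in> T. l \<subseteq> B} = {}"
          using AB unfolding C_def by (blast, blast)
      qed
      then show ?thesis
        using fT by (subst prod.union_disjoint; (simp add: C_def)?)+
    qed
    finally show "(case ?g T of (C, T1, T2) \<Rightarrow> (\<Prod>l\<in>C. w l) * (\<Prod>l\<in>T1. w l) * (\<Prod>l\<in>T2. w l)) =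
        (\<Prod>l\<in>T. w l)"
      by (simp add: C_def)
  next
    fix p assume "p \<in> ?S"
    then obtain C T1 T2 where p: "p = (C, T1, T2)" and C: "C \<in> ?Cs"
      and T1: "T1 \<in> covers L (A - \<Union>C)" and T2: "T2 \<in> covers L (B - \<Union>C)"
      by auto
    have s1: "l \<subseteq> A" "l \<noteq> {}" "l \<inter> \<Union>C = {}" "l \<in> L" if "l \<in> T1" for l
      using T1 that by (auto simp: covers_iff)
    have s2: "l \<subseteq> B" "l \<noteq> {}" "l \<inter> \<Union>C = {}" "l \<in> L" if "l \<in> T2" for l
      using T2 that by (auto simp: covers_iff)
    have U: "\<Union>T1 = A - \<Union>C" "\<Union>T2 = B - \<Union>C"
      using T1 T2 by (auto simp: covers_iff)
    have in1: "x \<in> A \<and> x \<notin> \<Union>C" if "l \<in> T1" "x \<in> l" for l x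
      using U(1) that by blast
    have in2: "x \<in> B \<and> x \<notin> \<Union>C" if "l \<in> T2" "x \<in> l" for l x
      using U(2) that by blast
    have d12: "disjoint T1" "disjoint T2" "disjoint C"
      using T1 T2 C by (auto simp: covers_iff)
    have "disjoint (C \<union> T1 \<union> T2)"
    proof (rule disjointI)
      fix a b assume ab: "a \<in> C \<union> T1 \<union> T2" "b \<in> C \<union> T1 \<union> T2" "a \<noteq> b"
      show "a \<inter> b = {}"
      proof (rule ccontr)
        assume "a \<inter> b \<noteq> {}"
        then obtain x where x: "x \<in> a" "x \<in> b" by auto
        have C_iff: "l \<in> C \<longleftrightarrow> x \<in> \<Union>C" if "l \<in> C \<union> T1 \<union> T2" "x \<in> l" for l
          using that in1[of l x] in2[of l x] by blast
        have A_iff: "l \<in> T1 \<longleftrightarrow> x \<in> A" if "l \<in> C \<union> T1 \<union> T2" "x \<in> l" "l \<notin> C" for l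
          using that in1[of l x] in2[of l x] AB by blast
        consider "a \<in> C" "b \<in> C" | "a \<in> T1" "b \<in> T1" | "a \<in> T2" "b \<in> T2"
          using C_iff[OF ab(1) x(1)] C_iff[OF ab(2) x(2)] A_iff[OF ab(1) x(1)] A_iff[OF ab(2) x(2)] ab
          by blast
        then have "a \<inter> b = {}"
          by cases (use d12 ab(3) in \<open>auto dest: disjointD\<close>)
        then show False
          using x by auto
      qed
    qed
    moreover have "\<Union>(C \<union> T1 \<union> T2) = A \<union> B"
    proof -
      have "\<Union>C \<subseteq> A \<union> B"
        using C by (simp add: Union_least)
      then show ?thesis
        unfolding Union_Un_distrib U by blast
    qed
    moreover have "{} \<notin> C \<union> T1 \<union> T2"
      using C s1(2) s2(2) by auto
    ultimately show "?f p \<in> covers L (A \<union> B)"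
      using C s1(4) s2(4) by (auto simp: p covers_iff)
    have kind: "l \<inter> A \<noteq> {}" "l \<inter> B \<noteq> {}" "\<not> l \<subseteq> A" "\<not> l \<subseteq> B" if "l \<in> C" for l
      using C that AB by blast+
    have kind1: "l \<inter> B = {}" "l \<subseteq> A" "\<not> l \<subseteq> B" if "l \<in> T1" for l
      using s1(1,2)[OF that] AB by blast+
    have kind2: "l \<inter> A = {}" "l \<subseteq> B" "\<not> l \<subseteq> A" if "l \<in> T2" for l
      using s2(1,2)[OF that] AB by blast+
    have "{l \<in> C \<union> T1 \<union> T2. l \<inter> A \<noteq> {} \<and> l \<inter> B \<noteq> {}} = C"
    proof (rule Set.set_eqI)
      fix l
      show "l \<in> {l \<in> C \<union> T1 \<union> T2. l \<inter> A \<noteq> {} \<and> l \<inter> B \<noteq> {}} \<longleftrightarrow> l \<in> C"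
        unfolding mem_Collect_eq Un_iff using kind(1,2)[of l] kind1(1)[of l] kind2(1)[of l] by argo
    qed
    moreover have "{l \<in> C \<union> T1 \<union> T2. l \<subseteq> A} = T1"
    proof (rule Set.set_eqI)
      fix l
      show "l \<in> {l \<in> C \<union> T1 \<union> T2. l \<subseteq> A} \<longleftrightarrow> l \<in> T1"
        unfolding mem_Collect_eq Un_iff using kind(3)[of l] kind1(2)[of l] kind2(3)[of l] by argo
    qed
    moreover have "{l \<in> C \<union> T1 \<union> T2. l \<subseteq> B} = T2"
    proof (rule Set.set_eqI)
      fix l
      show "l \<in> {l \<in> C \<union> T1 \<union> T2. l \<subseteq> B} \<longleftrightarrow> l \<in> T2"
        unfolding mem_Collect_eq Un_iff using kind(4)[of l] kind1(3)[of l] kind2(2)[of l] by argo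
    qed
    ultimately show "?g (?f p) = p"
      by (simp add: p)
  qed
  also have "\<dots> = (\<Sum>C\<in>?Cs. \<Sum>(T1, T2)\<in>covers L (A - \<Union>C) \<times> covers L (B - \<Union>C).
      (\<Prod>l\<in>C. w l) * (\<Prod>l\<in>T1. w l) * (\<Prod>l\<in>T2. w l))"
    using finC fin by (subst sum.Sigma[symmetric]) (simp_all add: finite_covers)
  also have "\<dots> = (\<Sum>C\<in>?Cs. (\<Prod>l\<in>C. w l) * cov L w (A - \<Union>C) * cov L w (B - \<Union>C))"
    unfolding cov_def sum_times_product ..
  finally show ?thesis .
qed

text \<open>Summation over the tile that covers a given point t.\<close>

lemma cov_expand:
  assumes fin: "finite R" and t: "t \<in> R" and L: "{t} \<notin> L"
  shows "cov L w R = (\<Sum>l\<in>{l \<in> L. t \<in> l \<and> l \<subseteq> R}. w l * cov L w (R - l))"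
proof -
  let ?Cs = "{C. C \<subseteq> L \<and> disjoint C \<and>
      (\<forall>l\<in>C. l \<subseteq> {t} \<union> (R - {t}) \<and> l \<inter> {t} \<noteq> {} \<and> l \<inter> (R - {t}) \<noteq> {})}"
  let ?Ls = "{l \<in> L. t \<in> l \<and> l \<subseteq> R}"
  have Cs: "?Cs = insert {} ((\<lambda>l. {l}) ` ?Ls)"
  proof (intro equalityI subsetI)
    fix C assume C: "C \<in> ?Cs"
    show "C \<in> insert {} ((\<lambda>l. {l}) ` ?Ls)"
    proof (cases "C = {}")
      case False
      then obtain l where l: "l \<in> C" by auto
      have "l' = l" if "l' \<in> C" for l'
      proof (rule ccontr)
        assume "l' \<noteq> l"
        then have "l' \<inter> l = {}"
          using C l that by (simp add: disjoint_def)
        moreover have "t \<in> l'" "t \<in> l"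
          using C l that by auto
        ultimately show False
          by auto
      qed
      then have "C = {l}"
        using l by blast
      then show ?thesis
        using C t by auto
    qed simp
  next
    fix C assume C: "C \<in> insert {} ((\<lambda>l. {l}) ` ?Ls)"
    have "l \<inter> (R - {t}) \<noteq> {}" if "l \<in> ?Ls" for l
    proof -
      have "l \<noteq> {t}" using that L by auto
      then show ?thesis using that by blast
    qed
    then show "C \<in> ?Cs"
      using C t by (auto simp: disjoint_def)
  qed
  have z: "cov L w {t} = 0"
  proof -
    have "covers L {t} = {}"
    proof (rule ccontr)
      assume "covers L {t} \<noteq> {}"
      then obtain T where T: "T \<in> covers L {t}" by auto
      then obtain l where "l \<in> T" "t \<in> l"
        by (auto simp: covers_iff)
      then have "l = {t}"
        using T by (auto simp: covers_iff)
      then show False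
        using T L \<open>l \<in> T\<close> by (auto simp: covers_iff)
    qed
    then show ?thesis by (simp add: cov_def)
  qed
  have finL: "finite ?Ls"
    by (rule finite_subset[of _ "Pow R"]) (use fin in auto)
  have "cov L w R = cov L w ({t} \<union> (R - {t}))"
    using t by (simp add: insert_absorb)
  also have "\<dots> = (\<Sum>C\<in>?Cs. (\<Prod>l\<in>C. w l) * cov L w ({t} - \<Union>C) * cov L w (R - {t} - \<Union>C))"
    by (rule cov_split) (use fin in auto)
  also have "\<dots> = (\<Sum>C\<in>(\<lambda>l. {l}) ` ?Ls. (\<Prod>l\<in>C. w l) * cov L w ({t} - \<Union>C) * cov L w (R - {t} - \<Union>C))"
    unfolding Cs using finL z by (subst sum.insert) auto
  also have "\<dots> = (\<Sum>l\<in>?Ls. w l * cov L w (R - l))"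
  proof (subst sum.reindex)
    show "(\<Sum>x\<in>?Ls. ((\<lambda>C. (\<Prod>l\<in>C. w l) * cov L w ({t} - \<Union>C) * cov L w (R - {t} - \<Union>C)) \<circ> (\<lambda>l. {l})) x) =
        (\<Sum>l\<in>?Ls. w l * cov L w (R - l))"
    proof (rule sum.cong[OF refl])
      fix l assume l: "l \<in> ?Ls"
      then have "{t} - l = {}" "R - {t} - l = R - l"
        by auto
      then show "((\<lambda>C. (\<Prod>l\<in>C. w l) * cov L w ({t} - \<Union>C) * cov L w (R - {t} - \<Union>C)) \<circ> (\<lambda>l. {l})) l = w l * cov L w (R - l)"
        by simp
    qed
  qed (auto simp: inj_on_def)
  finally show ?thesis .
qed

section \<open>Lozenges in cell coordinates\<close>

text \<open>Unit triangles are encoded as cells (u,k) of the integer plane: u numbers the rows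
  downwards, k is the position in the row. The two kinds of non-vertical lozenges join two
  neighbours in one row.\<close>

definition hbrick :: "int \<Rightarrow> int \<Rightarrow> (int \<times> int) set" where
  "hbrick u k = {(u, k), (u, k + 1)}"

text \<open>A vertical lozenge joins two cells in consecutive rows; it is a lozenge only if u + k is
  even, that is, if (u,k) is an up-pointing triangle.\<close>

definition vbrick :: "int \<Rightarrow> int \<Rightarrow> (int \<times> int) set" where
  "vbrick u k = {(u, k), (u + 1, k)}"

definition bricks :: "(int \<times> int) set set" where
  "bricks = {hbrick u k |u k. True} \<union> {vbrick u k |u k. even (u + k)}"

text \<open>Positions are measured from the western zigzag, so the lozenges both of whose left sides
  lie on the zigzag are the vertical bricks with k = 0. They get the weight \<theta>.\<close>

definition axis_weight :: "real \<Rightarrow> (int \<times> int) set \<Rightarrow> real" where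
  "axis_weight \<theta> l = (if \<exists>u. l = vbrick u 0 then \<theta> else 1)"

abbreviation bcov :: "real \<Rightarrow> (int \<times> int) set \<Rightarrow> real" where
  "bcov \<theta> R \<equiv> cov bricks (axis_weight \<theta>) R"

lemma hbrick_eq [simp]: "hbrick u k = hbrick u' k' \<longleftrightarrow> u = u' \<and> k = k'"
  by (auto simp: hbrick_def doubleton_eq_iff)

lemma vbrick_eq [simp]: "vbrick u k = vbrick u' k' \<longleftrightarrow> u = u' \<and> k = k'"
  by (auto simp: vbrick_def doubleton_eq_iff)

lemma hbrick_neq_vbrick [simp]: "hbrick u k \<noteq> vbrick u' k'" "vbrick u' k' \<noteq> hbrick u k"
  by (auto simp: hbrick_def vbrick_def doubleton_eq_iff)

lemma axis_weight_simps [simp]: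
  "axis_weight \<theta> (hbrick u k) = 1" "axis_weight \<theta> (vbrick u k) = (if k = 0 then \<theta> else 1)"
  by (auto simp: axis_weight_def)

lemma singleton_not_brick [simp]: "{t} \<notin> bricks"
  by (auto simp: bricks_def hbrick_def vbrick_def)

text \<open>The lozenges through a given cell: one in each of the two horizontal directions and one
  vertical one, whose direction depends on the parity of the cell.\<close>

lemma bricks_through:
  "{l \<in> bricks. (u, k) \<in> l} = {hbrick u k, hbrick u (k - 1), if even (u + k) then vbrick u k else vbrick (u - 1) k}"
  (is "?A = ?B")
proof (intro equalityI subsetI)
  fix l assume "l \<in> ?A"
  then consider (h) u' k' where "l = hbrick u' k'" "(u, k) \<in> hbrick u' k'"
    | (v) u' k' where "l = vbrick u' k'" "even (u' + k')" "(u, k) \<in> vbrick u' k'"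
    by (auto simp: bricks_def)
  then show "l \<in> ?B"
  proof cases
    case h then show ?thesis by (auto simp: hbrick_def)
  next
    case v
    then have "k' = k" "u' = u \<or> u' = u - 1" by (auto simp: vbrick_def)
    then show ?thesis using v by auto
  qed
next
  fix l assume l: "l \<in> ?B"
  have "hbrick u k \<in> bricks" "hbrick u (k - 1) \<in> bricks" "even (u + k) \<Longrightarrow> vbrick u k \<in> bricks"
    "odd (u + k) \<Longrightarrow> vbrick (u - 1) k \<in> bricks"
    by (auto simp: bricks_def)
  moreover have "(u, k) \<in> l"
    using l by (auto simp: hbrick_def vbrick_def split: if_splits)
  ultimately show "l \<in> ?A"
    using l by (auto split: if_splits)
qed

lemma bcov_expand:
  assumes "finite R" "(u, k) \<in> R"
  shows "bcov \<theta> R =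
    (if (u, k + 1) \<in> R then bcov \<theta> (R - hbrick u k) else 0)
    + (if (u, k - 1) \<in> R then bcov \<theta> (R - hbrick u (k - 1)) else 0)
    + (if even (u + k) \<and> (u + 1, k) \<in> R then (if k = 0 then \<theta> else 1) * bcov \<theta> (R - vbrick u k) else 0)
    + (if odd (u + k) \<and> (u - 1, k) \<in> R then (if k = 0 then \<theta> else 1) * bcov \<theta> (R - vbrick (u - 1) k) else 0)"
proof -
  let ?f = "\<lambda>l. axis_weight \<theta> l * bcov \<theta> (R - l)"
  let ?v = "if even (u + k) then vbrick u k else vbrick (u - 1) k"
  have "bcov \<theta> R = (\<Sum>l\<in>{l \<in> bricks. (u, k) \<in> l \<and> l \<subseteq> R}. ?f l)"
    by (rule cov_expand) (use assms in auto)
  also have "{l \<in> bricks. (u, k) \<in> l \<and> l \<subseteq> R} = {l \<in> {hbrick u k, hbrick u (k - 1), ?v}. l \<subseteq> R}"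
    using bricks_through[of u k] by blast
  also have "(\<Sum>l\<in>\<dots>. ?f l) = (\<Sum>l\<in>{hbrick u k, hbrick u (k - 1), ?v}. if l \<subseteq> R then ?f l else 0)"
    by (simp add: sum.inter_filter[symmetric])
  also have "\<dots> = (if hbrick u k \<subseteq> R then ?f (hbrick u k) else 0)
      + (if hbrick u (k - 1) \<subseteq> R then ?f (hbrick u (k - 1)) else 0) + (if ?v \<subseteq> R then ?f ?v else 0)"
    by simp
  also have "hbrick u k \<subseteq> R \<longleftrightarrow> (u, k + 1) \<in> R"
    using assms by (simp add: hbrick_def)
  also have "hbrick u (k - 1) \<subseteq> R \<longleftrightarrow> (u, k - 1) \<in> R"
    using assms by (simp add: hbrick_def)
  also have "(if ?v \<subseteq> R then ?f ?v else 0) =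
      (if even (u + k) \<and> (u + 1, k) \<in> R then (if k = 0 then \<theta> else 1) * bcov \<theta> (R - vbrick u k) else 0)
    + (if odd (u + k) \<and> (u - 1, k) \<in> R then (if k = 0 then \<theta> else 1) * bcov \<theta> (R - vbrick (u - 1) k) else 0)"
  proof (cases "even (u + k)")
    case True
    then have "vbrick u k \<subseteq> R \<longleftrightarrow> (u + 1, k) \<in> R"
      using assms by (simp add: vbrick_def)
    then show ?thesis using True by simp
  next
    case False
    then have "vbrick (u - 1) k \<subseteq> R \<longleftrightarrow> (u - 1, k) \<in> R"
      using assms by (simp add: vbrick_def)
    then show ?thesis using False by simp
  qed
  finally show ?thesis by simp
qed

text \<open>A down-pointing triangle both of whose neighbours in its row are missing forces a
  vertical lozenge.\<close>

lemma bcov_forced: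
  assumes "finite R" "(u + 1, k) \<in> R" "(u, k) \<in> R" "even (u + k)" "(u + 1, k + 1) \<notin> R" "(u + 1, k - 1) \<notin> R"
  shows "bcov \<theta> R = (if k = 0 then \<theta> else 1) * bcov \<theta> (R - vbrick u k)"
  using bcov_expand[of R "u + 1" k \<theta>] assms by simp

section \<open>One row with holes\<close>

text \<open>The part {l..<r} of row u, without the cells at the positions Z. Only non-vertical
  lozenges fit.\<close>

definition rowcov :: "real \<Rightarrow> int \<Rightarrow> int \<Rightarrow> int \<Rightarrow> int set \<Rightarrow> real" where
  "rowcov \<theta> u l r Z = bcov \<theta> ({u} \<times> ({l..<r} - Z))"

lemma rowcov_cong: "{l..<r} - Z = {l..<r} - Z' \<Longrightarrow> rowcov \<theta> u l r Z = rowcov \<theta> u l r Z'"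
  by (simp add: rowcov_def)

lemma rowcov_end: "r \<le> l \<Longrightarrow> rowcov \<theta> u l r Z = 1"
  by (simp add: rowcov_def)

lemma rowcov_hole: "l \<in> Z \<Longrightarrow> rowcov \<theta> u l r Z = rowcov \<theta> u (l + 1) r Z"
proof -
  assume "l \<in> Z"
  then have "{l..<r} - Z = {l+1..<r} - Z"
    by (auto simp: le_less)
  then show ?thesis by (simp add: rowcov_def)
qed

lemma rowcov_step:
  assumes "l < r" "l \<notin> Z"
  shows "rowcov \<theta> u l r Z = (if l + 1 < r \<and> l + 1 \<notin> Z then rowcov \<theta> u (l + 2) r Z else 0)"
proof -
  have "{u} \<times> ({l..<r} - Z) - hbrick u l = {u} \<times> ({l + 2..<r} - Z)"
    by (auto simp: hbrick_def)
  then show ?thesis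
    unfolding rowcov_def using assms
    by (subst bcov_expand[of _ u l]) auto
qed

text \<open>The cells before the first hole are paired off from the left, so there is an even number
  of them.\<close>

lemma rowcov_gap:
  assumes "l \<le> z" "z < r" "z \<in> Z" "{l..<z} \<inter> Z = {}"
  shows "rowcov \<theta> u l r Z = (if even (z - l) then rowcov \<theta> u (z + 1) r Z else 0)"
  using assms
proof (induction "nat (z - l)" arbitrary: l rule: less_induct)
  case less
  consider "l = z" | "l + 1 = z" | "l + 2 \<le> z"
    using less.prems by linarith
  then show ?case
  proof cases
    case 1 then show ?thesis using less.prems by (simp add: rowcov_hole)
  next
    case 2
    then have "l \<notin> Z" using less.prems by auto
    then show ?thesis using 2 less.prems by (subst rowcov_step) auto
  next
    case 3
    then have "l \<in> {l..<z}" "l + 1 \<in> {l..<z}" by auto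
    then have nz: "l \<notin> Z" "l + 1 \<notin> Z" using less.prems(4) by blast+
    have "{l+2..<z} \<subseteq> {l..<z}" by auto
    then have "{l+2..<z} \<inter> Z = {}" using less.prems(4) by blast
    then have "rowcov \<theta> u (l + 2) r Z = (if even (z - (l + 2)) then rowcov \<theta> u (z + 1) r Z else 0)"
      using 3 less.prems by (intro less.hyps) auto
    then show ?thesis using 3 nz less.prems by (subst rowcov_step) auto
  qed
qed

lemma rowcov_no_hole:
  assumes "l \<le> r" "{l..<r} \<inter> Z = {}"
  shows "rowcov \<theta> u l r Z = (if even (r - l) then 1 else 0)"
proof -
  have "{l..<r} - Z = {l..<r} - insert r Z" by auto
  then have "rowcov \<theta> u l r Z = rowcov \<theta> u l (r + 1) (insert r Z)"
    using assms by (auto simp: rowcov_def intro!: arg_cong[of _ _ "cov bricks (axis_weight \<theta>)"])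
  also have "\<dots> = (if even (r - l) then rowcov \<theta> u (r + 1) (r + 1) (insert r Z) else 0)"
    using assms by (intro rowcov_gap) auto
  finally show ?thesis by (simp add: rowcov_end)
qed

text \<open>The positions from l up to r (exclusive) that have the parity of l.\<close>

definition par :: "int \<Rightarrow> int \<Rightarrow> int set" where
  "par l r = {y \<in> {l..<r}. even (y - l)}"

lemma par_iff: "y \<in> par l r \<longleftrightarrow> l \<le> y \<and> y < r \<and> even (y - l)"
  by (auto simp: par_def)

lemma finite_par [simp]: "finite (par l r)"
  by (rule finite_subset[of _ "{l..<r}"]) (auto simp: par_def)

text \<open>The lists of numbers interlacing a given list x1 < x2 < ...: the first number lies in
  [l,x1), the next one between x1 and x2, and so on. All of them have the parity of l if all xi have
  the other one.\<close>

fun interlacing :: "int \<Rightarrow> int list \<Rightarrow> int list set" where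
  "interlacing l [] = {[]}"
| "interlacing l (x # xs) = {y # ys |y ys. l \<le> y \<and> y < x \<and> even (y - l) \<and> ys \<in> interlacing (x + 1) xs}"

lemma interlacing_Cons_image:
  "interlacing l (x # xs) = (\<lambda>(y, ys). y # ys) ` (par l x \<times> interlacing (x + 1) xs)"
  by (auto simp: par_iff)

lemma sum_interlacing_Cons:
  "(\<Sum>ys\<in>interlacing l (x # xs). F ys) =
   (\<Sum>y\<in>par l x. \<Sum>ys\<in>interlacing (x + 1) xs. F (y # ys))"
  unfolding interlacing_Cons_image
  by (subst sum.reindex) (auto simp: inj_on_def sum.cartesian_product split_def)

text \<open>After the last hole an odd number of cells remains up to r, and these cannot be paired
  off.\<close>

lemma rowcov_two_odd:
  assumes Z: "\<forall>z\<in>Z \<inter> {l..<r}. even (z - l)" and "even (r - l)" "l \<le> r" "Z \<inter> {l..<r} \<noteq> {}"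
  shows "rowcov \<theta> u l r Z = 0"
proof -
  define f where "f = Min (Z \<inter> {l..<r})"
  have fin: "finite (Z \<inter> {l..<r})" by auto
  have f: "f \<in> Z" "l \<le> f" "f < r" using Min_in[OF fin assms(4)] by (auto simp: f_def)
  have fmin: "f \<le> z" if "z \<in> Z" "l \<le> z" "z < r" for z
    unfolding f_def using that fin by (intro Min_le) auto
  have fpar: "even (f - l)" using Z f by auto
  have "rowcov \<theta> u l r Z = rowcov \<theta> u (f + 1) r Z"
    using f fmin fpar by (subst rowcov_gap[of l f]) force+
  also have "\<dots> = 0"
  proof (cases "Z \<inter> {f + 1..<r} = {}")
    case True
    then have "rowcov \<theta> u (f + 1) r Z = (if even (r - (f + 1)) then 1 else 0)"
      using f by (intro rowcov_no_hole) auto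
    moreover have "odd (r - (f + 1))" using assms(2) fpar by presburger
    ultimately show ?thesis by simp
  next
    case False
    define g where "g = Min (Z \<inter> {f + 1..<r})"
    have fin': "finite (Z \<inter> {f + 1..<r})" by auto
    have g: "g \<in> Z" "f + 1 \<le> g" "g < r" using Min_in[OF fin' False] by (auto simp: g_def)
    have gmin: "g \<le> z" if "z \<in> Z" "f + 1 \<le> z" "z < r" for z
      unfolding g_def using that fin' by (intro Min_le) auto
    have "even (g - l)" using Z g f by auto
    then have "odd (g - (f + 1))" using fpar by presburger
    then show ?thesis
      using g gmin by (subst rowcov_gap[of "f + 1" g]) force+
  qed
  finally show ?thesis .
qed

text \<open>Summing over the positions of the holes of one parity in a row, given those of the other
  parity: only the interlacing configurations contribute.\<close>

lemma sum_rowcov: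
  assumes "sorted_wrt (<) xs" "set xs \<subseteq> {l..<r}" "\<forall>x\<in>set xs. odd (x - l)" "even (r - l)" "l \<le> r"
  shows "(\<Sum>Y\<in>Pow (par l r). rowcov \<theta> u l r (set xs \<union> Y) * F Y) =
    (\<Sum>ys\<in>interlacing l xs. F (set ys))"
  using assms
proof (induction xs arbitrary: l F)
  case Nil
  have "rowcov \<theta> u l r (set [] \<union> Y) * F Y = (if Y = {} then F {} else 0)"
    if "Y \<in> Pow (par l r)" for Y
  proof (cases "Y = {}")
    case True
    then show ?thesis using Nil by (simp add: rowcov_no_hole)
  next
    case False
    then have "rowcov \<theta> u l r Y = 0"
    proof (intro rowcov_two_odd)
      obtain y where "y \<in> Y" using False by auto
      then have "y \<in> Y \<inter> {l..<r}" using that by (auto simp: par_iff)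
      then show "Y \<inter> {l..<r} \<noteq> {}" by auto
      show "\<forall>z\<in>Y \<inter> {l..<r}. even (z - l)" using that by (auto simp: par_iff subset_iff simp del: even_diff)
    qed (use Nil in auto)
    then show ?thesis using False by simp
  qed
  then have "(\<Sum>Y\<in>Pow (par l r). rowcov \<theta> u l r (set [] \<union> Y) * F Y) =
      (\<Sum>Y\<in>Pow (par l r). if Y = {} then F {} else 0)"
    by (intro sum.cong refl)
  then show ?case by simp
next
  case (Cons x xs)
  let ?Y = "par l r"
  let ?A = "par l x"
  let ?B = "par (x + 1) r"
  have x: "l \<le> x" "x < r" "odd (x - l)" and xs: "\<forall>x'\<in>set xs. x < x'"
    using Cons.prems by auto
  have YAB: "?Y = ?A \<union> ?B" "?A \<inter> ?B = {}"
  proof -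
    have "y \<in> par l r \<longleftrightarrow> y \<in> par l x \<or> y \<in> par (x + 1) r" for y
      unfolding par_iff using x by presburger
    then show "par l r = par l x \<union> par (x + 1) r" by auto
    show "par l x \<inter> par (x + 1) r = {}" by (auto simp: par_iff)
  qed
  have AB: "(\<Sum>Y\<in>Pow ?Y. G Y) = (\<Sum>A\<in>Pow ?A. \<Sum>B\<in>Pow ?B. G (A \<union> B))" for G :: "int set \<Rightarrow> real"
  proof -
    have "(\<Sum>Y\<in>Pow ?Y. G Y) = (\<Sum>(A, B)\<in>Pow ?A \<times> Pow ?B. G (A \<union> B))"
    proof (rule sum.reindex_bij_witness[where i = "\<lambda>(A, B). A \<union> B" and j = "\<lambda>Y. (Y \<inter> ?A, Y \<inter> ?B)"])
      fix Y assume "Y \<in> Pow ?Y"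
      then have *: "Y \<inter> ?A \<union> Y \<inter> ?B = Y" unfolding YAB(1) by blast
      then show "(case (Y \<inter> ?A, Y \<inter> ?B) of (A, B) \<Rightarrow> A \<union> B) = Y"
        "(case (Y \<inter> ?A, Y \<inter> ?B) of (A, B) \<Rightarrow> G (A \<union> B)) = G Y" by simp_all
    next
      fix p assume "p \<in> Pow ?A \<times> Pow ?B"
      then obtain A B where p: "p = (A, B)" "A \<subseteq> ?A" "B \<subseteq> ?B" by auto
      then have "(A \<union> B) \<inter> ?A = A" "(A \<union> B) \<inter> ?B = B" using YAB(2) by blast+
      then show "((case p of (A, B) \<Rightarrow> A \<union> B) \<inter> ?A, (case p of (A, B) \<Rightarrow> A \<union> B) \<inter> ?B) = p"
        using p by simp
      show "(case p of (A, B) \<Rightarrow> A \<union> B) \<in> Pow ?Y" unfolding YAB(1) p(1) using p by blast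
    qed auto
    then show ?thesis by (simp add: sum.cartesian_product)
  qed
  \<comment> \<open>Before the hole x there must be exactly one hole of the other parity.\<close>
  have key: "rowcov \<theta> u l r (set (x # xs) \<union> (A \<union> B)) =
      (if card A = 1 then rowcov \<theta> u (x + 1) r (set xs \<union> B) else 0)"
    if A: "A \<in> Pow ?A" and B: "B \<in> Pow ?B" for A B
  proof -
    have inA: "l \<le> a" "a < x" "even (a - l)" if "a \<in> A" for a
      using A that unfolding par_def by auto
    have inB: "x < b" if "b \<in> B" for b
      using B that by (auto simp: par_def)
    have low: "\<forall>a. a \<in> set (x # xs) \<union> (A \<union> B) \<longrightarrow> a < x \<longrightarrow> a \<in> A"
      using xs inB by (auto dest: less_asym)
    have empty: "{c..<d} \<inter> (set (x # xs) \<union> (A \<union> B)) = {}"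
      if "d \<le> x" "\<forall>a\<in>A. \<not> (c \<le> a \<and> a < d)" for c d
    proof (rule ccontr)
      assume "{c..<d} \<inter> (set (x # xs) \<union> (A \<union> B)) \<noteq> {}"
      then obtain z where "z \<in> {c..<d}" "z \<in> set (x # xs) \<union> (A \<union> B)" by blast
      then show False using low that by auto
    qed
    show ?thesis
  proof (cases "A = {}")
    case True
    have "{l..<x} \<inter> (set (x # xs) \<union> (A \<union> B)) = {}" using True by (intro empty) auto
    then show ?thesis using True x by (subst rowcov_gap[of l x]) auto
  next
    case False
    let ?Z = "set (x # xs) \<union> (A \<union> B)"
    have finA: "finite A" using A finite_subset[of A "par l x"] by auto
    define f where "f = Min A"
    have f: "f \<in> A" using finA False by (simp add: f_def)
    have fmin: "\<And>a. a \<in> A \<Longrightarrow> f \<le> a" using finA by (simp add: f_def)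
    have fb: "l \<le> f" "f < x" "even (f - l)" using inA[OF f] by auto
    have "{l..<f} \<inter> ?Z = {}" using fmin fb by (intro empty) force+
    then have 1: "rowcov \<theta> u l r ?Z = rowcov \<theta> u (f + 1) r ?Z"
      using fb f x by (subst rowcov_gap[of l f]) auto
    show ?thesis
    proof (cases "A = {f}")
      case True
      have "{f + 1..<x} \<inter> ?Z = {}" using True by (intro empty) auto
      moreover have "even (x - (f + 1))" using fb x by presburger
      ultimately have "rowcov \<theta> u (f + 1) r ?Z = rowcov \<theta> u (x + 1) r ?Z"
        using fb x by (subst rowcov_gap[of "f + 1" x]) auto
      moreover have "rowcov \<theta> u (x + 1) r ?Z = rowcov \<theta> u (x + 1) r (set xs \<union> B)"
        using True fb by (intro rowcov_cong) auto
      ultimately show ?thesis using 1 True by simp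
    next
      case ne: False
      have ne': "A - {f} \<noteq> {}" using ne False f by auto
      define g where "g = Min (A - {f})"
      have g: "g \<in> A - {f}" unfolding g_def using finA ne' by (intro Min_in) auto
      have gmin: "g \<le> a" if "a \<in> A" "a \<noteq> f" for a unfolding g_def using finA that by (intro Min_le) auto
      have gb: "f < g" "g < x" "even (g - l)" using g fmin[of g] inA[of g] by auto
      have "{f + 1..<g} \<inter> ?Z = {}" using gmin gb by (intro empty) force+
      moreover have "odd (g - (f + 1))" using fb gb by presburger
      ultimately have "rowcov \<theta> u (f + 1) r ?Z = 0"
        using fb gb g x by (subst rowcov_gap[of "f + 1" g]) auto
      moreover have "card A \<noteq> 1" using ne f by (auto simp: card_1_singleton_iff)
      ultimately show ?thesis using 1 by simp
    qed
  qed
  qed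
  have sing: "{A \<in> Pow ?A. card A = 1} = (\<lambda>y. {y}) ` ?A"
    by (auto simp: card_1_singleton_iff)
  have IH: "(\<Sum>B\<in>Pow ?B. rowcov \<theta> u (x + 1) r (set xs \<union> B) * G B) = (\<Sum>ys\<in>interlacing (x + 1) xs. G (set ys))" for G
  proof (rule Cons.IH)
    show "\<forall>x'\<in>set xs. odd (x' - (x + 1))"
    proof
      fix x' assume "x' \<in> set xs"
      then have "odd (x' - l)" using Cons.prems by auto
      then show "odd (x' - (x + 1))" using x by presburger
    qed
    show "even (r - (x + 1))" using x Cons.prems(4) by presburger
    show "set xs \<subseteq> {x + 1..<r}" using xs Cons.prems(2) by (auto simp: subset_iff)
    show "sorted_wrt (<) xs" "x + 1 \<le> r" using x Cons.prems(1) by auto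
  qed
  have "(\<Sum>Y\<in>Pow ?Y. rowcov \<theta> u l r (set (x # xs) \<union> Y) * F Y) =
      (\<Sum>A\<in>Pow ?A. \<Sum>B\<in>Pow ?B. rowcov \<theta> u l r (set (x # xs) \<union> (A \<union> B)) * F (A \<union> B))"
    by (rule AB)
  also have "\<dots> = (\<Sum>A\<in>Pow ?A. if card A = 1 then \<Sum>B\<in>Pow ?B. rowcov \<theta> u (x + 1) r (set xs \<union> B) * F (A \<union> B) else 0)"
    by (intro sum.cong refl) (simp add: key if_distrib[of "\<lambda>c. c * _"] del: list.set)
  also have "\<dots> = (\<Sum>A\<in>{A \<in> Pow ?A. card A = 1}. \<Sum>B\<in>Pow ?B. rowcov \<theta> u (x + 1) r (set xs \<union> B) * F (A \<union> B))"
    by (subst sum.inter_filter) auto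
  also have "\<dots> = (\<Sum>y\<in>?A. \<Sum>B\<in>Pow ?B. rowcov \<theta> u (x + 1) r (set xs \<union> B) * F ({y} \<union> B))"
    unfolding sing by (subst sum.reindex) auto
  also have "\<dots> = (\<Sum>ys\<in>interlacing l (x # xs). F (set ys))"
    unfolding sum_interlacing_Cons by (intro sum.cong refl) (simp add: IH)
  finally show ?case .
qed

text \<open>The same when the row starts with the parity of the given holes; the sum is then over the
  lists that interlace strictly between the given numbers.\<close>

lemma sum_rowcov_inner:
  assumes "sorted_wrt (<) (x # xs)" "set (x # xs) \<subseteq> {l..<r}" "\<forall>x'\<in>set (x # xs). even (x' - l)"
    "odd (r - l)"
  shows "(\<Sum>Y\<in>Pow (par (l + 1) r). rowcov \<theta> u l r (set (x # xs) \<union> Y) * F Y) =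
    (\<Sum>ys\<in>interlacing (x + 1) xs. F (set ys))"
proof -
  let ?Y = "par (l + 1) r"
  let ?B = "par (x + 1) r"
  have x: "l \<le> x" "x < r" "even (x - l)" and xs: "\<forall>x'\<in>set xs. x < x'"
    using assms by auto
  have "y \<in> par (l + 1) r" if "y \<in> par (x + 1) r" for y
    using that x unfolding par_iff by presburger
  then have sub: "Pow ?B \<subseteq> Pow ?Y" by auto
  have z: "rowcov \<theta> u l r (set (x # xs) \<union> Y) = 0" if Y: "Y \<in> Pow ?Y - Pow ?B" for Y
  proof -
    let ?Z = "set (x # xs) \<union> Y"
    have inY: "l \<le> y" "y < r" "odd (y - l)" if "y \<in> Y" for y
    proof -
      have "y \<in> ?Y" using Y that by blast
      then show "l \<le> y" "y < r" "odd (y - l)" unfolding par_iff by presburger+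
    qed
    define A where "A = {y \<in> Y. y < x}"
    have finA: "finite A" using Y by (intro finite_subset[of A ?Y]) (auto simp: A_def)
    obtain y where y: "y \<in> Y" "y \<notin> ?B" using Y by blast
    have "y < x" using inY[OF y(1)] y(2) x unfolding par_iff by presburger
    then have "A \<noteq> {}" using y by (auto simp: A_def)
    define f where "f = Min A"
    have f: "f \<in> A" using finA \<open>A \<noteq> {}\<close> by (simp add: f_def)
    have fmin: "\<And>a. a \<in> A \<Longrightarrow> f \<le> a" using finA by (simp add: f_def)
    have fb: "l \<le> f" "f < x" "odd (f - l)" "f \<in> Y" using f inY[of f] by (auto simp: A_def)
    have "{l..<f} \<inter> ?Z = {}"
    proof (rule ccontr)
      assume "{l..<f} \<inter> ?Z \<noteq> {}"
      then obtain z where "z \<in> {l..<f}" "z \<in> ?Z" by blast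
      then have z: "l \<le> z" "z < f" "z \<in> ?Z" by simp_all
      then have "z \<in> A" using fb xs by (auto simp: A_def)
      then show False using fmin z by force
    qed
    then show ?thesis using fb x by (subst rowcov_gap[of l f]) auto
  qed
  have "(\<Sum>Y\<in>Pow ?Y. rowcov \<theta> u l r (set (x # xs) \<union> Y) * F Y) =
      (\<Sum>Y\<in>Pow ?B. rowcov \<theta> u l r (set (x # xs) \<union> Y) * F Y)"
    using sub z by (intro sum.mono_neutral_right) auto
  also have "\<dots> = (\<Sum>Y\<in>Pow ?B. rowcov \<theta> u (x + 1) r (set xs \<union> Y) * F Y)"
  proof (intro sum.cong refl arg_cong2[of _ _ _ _ "(*)"])
    fix Y assume Y: "Y \<in> Pow ?B"
    have "x < y" if "y \<in> Y" for y using Y that by (auto simp: par_def)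
    then have "\<forall>y\<in>set (x # xs) \<union> Y. x \<le> y" using xs by (auto intro: less_imp_le)
    then have "{l..<x} \<inter> (set (x # xs) \<union> Y) = {}" unfolding disjoint_iff Ball_def atLeastLessThan_iff by (meson not_le)
    then have "rowcov \<theta> u l r (set (x # xs) \<union> Y) = rowcov \<theta> u (x + 1) r (set (x # xs) \<union> Y)"
      using x by (subst rowcov_gap[of l x]) auto
    also have "\<dots> = rowcov \<theta> u (x + 1) r (set xs \<union> Y)"
      by (intro rowcov_cong) auto
    finally show "rowcov \<theta> u l r (set (x # xs) \<union> Y) = rowcov \<theta> u (x + 1) r (set xs \<union> Y)" .
  qed
  also have "\<dots> = (\<Sum>ys\<in>interlacing (x + 1) xs. F (set ys))"
  proof (rule sum_rowcov)
    show "\<forall>x'\<in>set xs. odd (x' - (x + 1))"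
    proof
      fix x' assume "x' \<in> set xs"
      then have "even (x' - l)" using assms by auto
      then show "odd (x' - (x + 1))" using x by presburger
    qed
    show "even (r - (x + 1))" using x assms(4) by presburger
    show "set xs \<subseteq> {x + 1..<r}" using xs assms(2) by (auto simp: subset_iff)
    show "sorted_wrt (<) xs" "x + 1 \<le> r" using x assms(1) by auto
  qed
  finally show ?thesis .
qed

section \<open>Determinants of Vandermonde type\<close>

text \<open>Determinants of real matrices given by their entries.\<close>

definition fdet :: "nat \<Rightarrow> (nat \<Rightarrow> nat \<Rightarrow> real) \<Rightarrow> real" where
  "fdet n f = det (mat n n (\<lambda>(i, j). f i j))"

lemma fdet_leibniz: "fdet n f = (\<Sum>p | p permutes {0..<n}. signof p * (\<Prod>i = 0..<n. f i (p i)))"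
proof -
  have "p i < n" if "p permutes {0..<n}" "i < n" for p i
    using permutes_in_image[OF that(1), of i] that by simp
  then show ?thesis
    unfolding fdet_def by (subst det_def'[of _ n]) (auto intro!: sum.cong prod.cong)
qed

lemma fdet_cong: "(\<And>i j. i < n \<Longrightarrow> j < n \<Longrightarrow> f i j = g i j) \<Longrightarrow> fdet n f = fdet n g"
  unfolding fdet_def by (rule arg_cong[of _ _ det]) (auto intro!: eq_matI)

lemma fdet_rows: "fdet n (\<lambda>i j. c i * f i j) = (\<Prod>i = 0..<n. c i) * fdet n f"
  unfolding fdet_leibniz by (simp add: prod.distrib sum_distrib_left mult_ac)

lemma fdet_cols: "fdet n (\<lambda>i j. c j * f i j) = (\<Prod>j = 0..<n. c j) * fdet n f"
proof -
  have "(\<Prod>i = 0..<n. c (p i)) = (\<Prod>i = 0..<n. c i)" if "p permutes {0..<n}" for p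
    using prod.permute[OF that, of c] by (simp add: comp_def)
  then show ?thesis
    unfolding fdet_leibniz sum_distrib_left
    by (intro sum.cong refl) (simp add: prod.distrib mult_ac)
qed

lemma fdet_mult: "fdet n (\<lambda>i j. \<Sum>k = 0..<n. f i k * g k j) = fdet n f * fdet n g"
proof -
  have "mat n n (\<lambda>(i, j). \<Sum>k = 0..<n. f i k * g k j) = mat n n (\<lambda>(i, j). f i j) * mat n n (\<lambda>(i, j). g i j)"
    by (rule eq_matI) (auto simp: scalar_prod_def)
  then show ?thesis
    unfolding fdet_def by (simp add: det_mult[of _ n])
qed

lemma fdet_lower: "(\<And>i j. i < j \<Longrightarrow> j < n \<Longrightarrow> f i j = 0) \<Longrightarrow> fdet n f = (\<Prod>i = 0..<n. f i i)"
  unfolding fdet_def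
  by (subst det_lower_triangular[of n]) (auto simp: prod_list_diag_prod)

lemma fdet_upper: "(\<And>i j. j < i \<Longrightarrow> i < n \<Longrightarrow> f i j = 0) \<Longrightarrow> fdet n f = (\<Prod>i = 0..<n. f i i)"
  unfolding fdet_def
  by (subst det_upper_triangular[of _ n]) (auto simp: prod_list_diag_prod upper_triangular_def)

lemma fdet_row_differences: "fdet n (\<lambda>i j. f i j - (if i = 0 then 0 else f (i - 1) j)) = fdet n f"
proof -
  let ?L = "\<lambda>i k. if k = i then 1 else if Suc k = i then -1 else (0::real)"
  have "fdet n (\<lambda>i j. f i j - (if i = 0 then 0 else f (i - 1) j)) = fdet n (\<lambda>i j. \<Sum>k = 0..<n. ?L i k * f k j)"
  proof (rule fdet_cong)
    fix i j assume ij: "i < n" "j < n"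
    have "(\<Sum>k = 0..<n. ?L i k * f k j) = (\<Sum>k\<in>(if i = 0 then {i} else {i, i - 1}). ?L i k * f k j)"
      using ij by (intro sum.mono_neutral_right) auto
    then show "f i j - (if i = 0 then 0 else f (i - 1) j) = (\<Sum>k = 0..<n. ?L i k * f k j)"
      by (cases i) auto
  qed
  also have "\<dots> = fdet n ?L * fdet n f"
    by (rule fdet_mult)
  also have "fdet n ?L = 1"
    by (subst fdet_lower) auto
  finally show ?thesis by simp
qed

lemma fdet_first_column:
  assumes "f 0 0 = 1" "\<And>i. 0 < i \<Longrightarrow> i < Suc n \<Longrightarrow> f i 0 = 0"
  shows "fdet (Suc n) f = fdet n (\<lambda>i j. f (Suc i) (Suc j))"
proof -
  let ?A = "mat (Suc n) (Suc n) (\<lambda>(i, j). f i j)"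
  have "det ?A = (\<Sum>i<Suc n. ?A $$ (i, 0) * cofactor ?A i 0)"
    by (rule laplace_expansion_column) auto
  also have "\<dots> = (\<Sum>i\<in>{0}. ?A $$ (i, 0) * cofactor ?A i 0)"
    using assms by (intro sum.mono_neutral_right) auto
  also have "\<dots> = det (mat_delete ?A 0 0)"
    using assms by (simp add: cofactor_def)
  also have "mat_delete ?A 0 0 = mat n n (\<lambda>(i, j). f (Suc i) (Suc j))"
    by (rule eq_matI) (auto simp: mat_delete_def)
  finally show ?thesis by (simp add: fdet_def)
qed

text \<open>The Vandermonde determinant, for an arbitrary family of monic polynomials of degrees
  0, 1, 2, ...: every such family differs from the monomials by a unitriangular matrix, and for the
  Newton basis at the given points the matrix itself is triangular.\<close>

lemma monic_newton_poly:
  fixes c :: "nat \<Rightarrow> real"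
  shows "degree (\<Prod>k = 0..<j. [:- c k, 1:]) = j" "lead_coeff (\<Prod>k = 0..<j. [:- c k, 1:]) = 1"
proof -
  have "degree (\<Prod>k = 0..<j. [:- c k, 1:]) = j \<and> lead_coeff (\<Prod>k = 0..<j. [:- c k, 1:]) = 1"
  proof (induction j)
    case (Suc j)
    let ?N = "\<Prod>k = 0..<j. [:- c k, 1:]"
    have *: "(\<Prod>k = 0..<Suc j. [:- c k, 1:]) = ?N * [:- c j, 1:]"
      by (simp only: prod.op_ivl_Suc) simp
    have "?N \<noteq> 0" using Suc by auto
    then have "degree (?N * [:- c j, 1:]) = Suc j"
      using Suc by (subst degree_mult_eq) auto
    moreover have "lead_coeff (?N * [:- c j, 1:]) = 1"
      unfolding lead_coeff_mult Suc[THEN conjunct2] by simp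
    ultimately show ?case unfolding * by simp
  qed simp
  then show "degree (\<Prod>k = 0..<j. [:- c k, 1:]) = j" "lead_coeff (\<Prod>k = 0..<j. [:- c k, 1:]) = 1"
    by blast+
qed

lemma vandermonde_monic:
  fixes P :: "nat \<Rightarrow> real poly"
  assumes "\<And>j. degree (P j) = j" "\<And>j. lead_coeff (P j) = 1"
  shows "fdet n (\<lambda>i j. poly (P j) (t i)) = (\<Prod>i = 0..<n. \<Prod>j = 0..<i. t i - t j)"
proof -
  have mono: "fdet n (\<lambda>i j. poly (P j) (t i)) = fdet n (\<lambda>i j. t i ^ j)"
    if P: "\<And>j. degree (P j) = j" "\<And>j. lead_coeff (P j) = 1" for P :: "nat \<Rightarrow> real poly"
  proof -
    have "fdet n (\<lambda>i j. poly (P j) (t i)) = fdet n (\<lambda>i j. \<Sum>k = 0..<n. t i ^ k * coeff (P j) k)"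
    proof (rule fdet_cong)
      fix i j assume "i < n" "j < n"
      have "poly (P j) (t i) = (\<Sum>k\<le>j. coeff (P j) k * t i ^ k)"
        by (simp add: poly_altdef P)
      also have "\<dots> = (\<Sum>k = 0..<n. coeff (P j) k * t i ^ k)"
        using \<open>j < n\<close> by (intro sum.mono_neutral_left) (auto simp: coeff_eq_0 P)
      finally show "poly (P j) (t i) = (\<Sum>k = 0..<n. t i ^ k * coeff (P j) k)"
        by (simp add: mult.commute)
    qed
    also have "\<dots> = fdet n (\<lambda>i k. t i ^ k) * fdet n (\<lambda>k j. coeff (P j) k)"
      by (rule fdet_mult)
    also have "fdet n (\<lambda>k j. coeff (P j) k) = (\<Prod>i = 0..<n. coeff (P i) i)"
      by (rule fdet_upper) (simp add: coeff_eq_0 P)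
    also have "\<dots> = 1"
      using P by (intro prod.neutral) metis
    finally show ?thesis by simp
  qed
  \<comment> \<open>For the Newton basis at the points themselves the matrix is triangular.\<close>
  define N where "N = (\<lambda>j. \<Prod>k = 0..<j. [:- t k, 1:])"
  have N: "degree (N j) = j" "lead_coeff (N j) = 1" for j
    unfolding N_def by (rule monic_newton_poly)+
  have "fdet n (\<lambda>i j. poly (P j) (t i)) = fdet n (\<lambda>i j. poly (N j) (t i))"
    using mono[of P, OF assms] mono[of N, OF N] by simp
  also have "\<dots> = (\<Prod>i = 0..<n. poly (N i) (t i))"
    by (rule fdet_lower) (auto simp: N_def poly_prod)
  also have "\<dots> = (\<Prod>i = 0..<n. \<Prod>j = 0..<i. t i - t j)"
    by (simp add: N_def poly_prod)
  finally show ?thesis .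
qed

lemma vandermonde_newton:
  "fdet n (\<lambda>i j. \<Prod>k = 0..<j. t i - c k) = (\<Prod>i = 0..<n. \<Prod>j = 0..<i. t i - (t j :: real))"
proof -
  define N where "N = (\<lambda>j. \<Prod>k = 0..<j. [:- c k, 1:])"
  have N: "degree (N j) = j" "lead_coeff (N j) = 1" for j
    unfolding N_def by (rule monic_newton_poly)+
  have "fdet n (\<lambda>i j. \<Prod>k = 0..<j. t i - c k) = fdet n (\<lambda>i j. poly (N j) (t i))"
    by (simp add: N_def poly_prod)
  then show ?thesis
    using vandermonde_monic[of N, OF N] by simp
qed

section \<open>Summation over interlacing lists\<close>

lemma length_interlacing: "ys \<in> interlacing l xs \<Longrightarrow> length ys = length xs"
  by (induction xs arbitrary: l ys) auto

lemma interlacing_sorted: "ys \<in> interlacing l xs \<Longrightarrow> sorted_wrt (<) ys \<and> (\<forall>y\<in>set ys. l \<le> y)"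
proof (induction xs arbitrary: l ys)
  case (Cons x xs)
  then obtain y ys' where y: "ys = y # ys'" "l \<le> y" "y < x" and ys': "ys' \<in> interlacing (x + 1) xs"
    by auto
  have "sorted_wrt (<) ys'" "\<forall>z\<in>set ys'. x + 1 \<le> z"
    using Cons.IH[OF ys'] by auto
  then show ?case using y by force
qed simp

lemma sum_interlacing_prod:
  fixes h :: "nat \<Rightarrow> int \<Rightarrow> real"
  shows "(\<Sum>ys\<in>interlacing l xs. \<Prod>i = 0..<length xs. h i (ys ! i)) =
    (\<Prod>i = 0..<length xs. \<Sum>y\<in>par (if i = 0 then l else xs ! (i - 1) + 1) (xs ! i). h i y)"
proof (induction xs arbitrary: l h)
  case (Cons x xs)
  have shift: "(\<Prod>i = 0..<Suc n. g i) = g 0 * (\<Prod>i = 0..<n. g (Suc i))" for g :: "nat \<Rightarrow> real" and n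
    by (subst prod.atLeast0_lessThan_Suc_shift) simp
  have "(\<Sum>ys\<in>interlacing l (x # xs). \<Prod>i = 0..<length (x # xs). h i (ys ! i)) =
      (\<Sum>y\<in>par l x. \<Sum>ys\<in>interlacing (x + 1) xs. h 0 y * (\<Prod>i = 0..<length xs. h (Suc i) (ys ! i)))"
    unfolding sum_interlacing_Cons by (simp add: shift del: prod.op_ivl_Suc)
  also have "\<dots> = (\<Sum>y\<in>par l x. h 0 y) * (\<Sum>ys\<in>interlacing (x + 1) xs. \<Prod>i = 0..<length xs. h (Suc i) (ys ! i))"
    by (simp add: sum_product)
  also have "(\<Sum>ys\<in>interlacing (x + 1) xs. \<Prod>i = 0..<length xs. h (Suc i) (ys ! i)) =
      (\<Prod>i = 0..<length xs. \<Sum>y\<in>par (if i = 0 then x + 1 else xs ! (i - 1) + 1) (xs ! i). h (Suc i) y)"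
    by (rule Cons.IH)
  also have "\<dots> = (\<Prod>i = 0..<length xs. \<Sum>y\<in>par ((x # xs) ! i + 1) (xs ! i). h (Suc i) y)"
    by (intro prod.cong refl sum.cong) (auto simp: nth_Cons split: nat.splits)
  finally show ?case
    by (simp add: shift del: prod.op_ivl_Suc)
qed simp

lemma sum_interlacing_fdet:
  fixes \<phi> :: "nat \<Rightarrow> int \<Rightarrow> real"
  assumes "n = length xs"
  shows "(\<Sum>ys\<in>interlacing l xs. fdet n (\<lambda>i j. \<phi> j (ys ! i))) =
    fdet n (\<lambda>i j. \<Sum>y\<in>par (if i = 0 then l else xs ! (i - 1) + 1) (xs ! i). \<phi> j y)"
proof -
  have "(\<Sum>ys\<in>interlacing l xs. fdet n (\<lambda>i j. \<phi> j (ys ! i))) =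
      (\<Sum>p | p permutes {0..<n}. signof p * (\<Sum>ys\<in>interlacing l xs. \<Prod>i = 0..<n. \<phi> (p i) (ys ! i)))"
    unfolding fdet_leibniz sum_distrib_left by (rule sum.swap)
  then show ?thesis
    unfolding fdet_leibniz assms sum_interlacing_prod[of "\<lambda>i. \<phi> (_ i)"] .
qed

lemma sum_par_telescope:
  fixes \<Phi> :: "int \<Rightarrow> real"
  assumes "l \<le> r + 1" "odd (r - l)"
  shows "(\<Sum>y\<in>par l r. \<Phi> (y + 1) - \<Phi> (y - 1)) = \<Phi> r - \<Phi> (l - 1)"
  using assms
proof (induction "nat (r + 1 - l)" arbitrary: r rule: less_induct)
  case less
  show ?case
  proof (cases "r = l - 1")
    case True
    then have "par l r = {}" by (auto simp: par_iff)
    then show ?thesis using True by simp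
  next
    case False
    then have r: "r > l - 1" using less.prems by simp
    moreover have "r \<noteq> l" using less.prems by auto
    ultimately have r': "l \<le> r - 2 + 1" by simp
    have "y \<in> par l r \<longleftrightarrow> y = r - 1 \<or> y \<in> par l (r - 2)" for y
      unfolding par_iff using r' less.prems(2) by presburger
    then have "par l r = insert (r - 1) (par l (r - 2))" by auto
    moreover have "r - 1 \<notin> par l (r - 2)" by (simp add: par_iff)
    moreover have "(\<Sum>y\<in>par l (r - 2). \<Phi> (y + 1) - \<Phi> (y - 1)) = \<Phi> (r - 2) - \<Phi> (l - 1)"
      using r' less.prems by (intro less.hyps) auto
    ultimately show ?thesis by simp
  qed
qed

text \<open>The Newton basis of the even polynomials at the odd numbers 1, 3, 5, ... and at the even
  numbers 0, 2, 4, ...; up to the factor x, summation with step 2 exchanges the two bases.\<close>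

definition odd_newton :: "nat \<Rightarrow> real \<Rightarrow> real" where
  "odd_newton j x = (\<Prod>i = 0..<j. x\<^sup>2 - (2 * real i + 1)\<^sup>2)"

definition even_newton :: "nat \<Rightarrow> real \<Rightarrow> real" where
  "even_newton j x = (\<Prod>i = 0..<j. x\<^sup>2 - (2 * real i)\<^sup>2)"

lemma newton_shift:
  "odd_newton j (x + 1) * x = even_newton j x * (x + 2 * real j)"
  "odd_newton j (x - 1) * x = even_newton j x * (x - 2 * real j)"
proof (induction j)
  case (Suc j)
  have "odd_newton (Suc j) (x + 1) * x = odd_newton j (x + 1) * x * ((x + 1)\<^sup>2 - (2 * real j + 1)\<^sup>2)"
    by (simp add: odd_newton_def)
  also have "\<dots> = even_newton j x * (x + 2 * real j) * ((x + 1)\<^sup>2 - (2 * real j + 1)\<^sup>2)"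
    by (simp add: Suc)
  also have "\<dots> = even_newton (Suc j) x * (x + 2 * real (Suc j))"
    by (simp add: even_newton_def) (simp add: algebra_simps power2_eq_square)
  finally show "odd_newton (Suc j) (x + 1) * x = even_newton (Suc j) x * (x + 2 * real (Suc j))" .
  have "odd_newton (Suc j) (x - 1) * x = odd_newton j (x - 1) * x * ((x - 1)\<^sup>2 - (2 * real j + 1)\<^sup>2)"
    by (simp add: odd_newton_def)
  also have "\<dots> = even_newton j x * (x - 2 * real j) * ((x - 1)\<^sup>2 - (2 * real j + 1)\<^sup>2)"
    by (simp add: Suc)
  also have "\<dots> = even_newton (Suc j) x * (x - 2 * real (Suc j))"
    by (simp add: even_newton_def) (simp add: algebra_simps power2_eq_square)
  finally show "odd_newton (Suc j) (x - 1) * x = even_newton (Suc j) x * (x - 2 * real (Suc j))" .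
qed (simp_all add: odd_newton_def even_newton_def)

lemma even_newton_antidifference:
  "(x + 1) * odd_newton j (x + 1) - (x - 1) * odd_newton j (x - 1) = 2 * (2 * real j + 1) * even_newton j x"
proof (cases "x = 0")
  case True
  have "odd_newton j 1 = (if j = 0 then 1 else 0)" "odd_newton j (-1) = (if j = 0 then 1 else 0)"
    "even_newton j 0 = (if j = 0 then 1 else 0)"
    by (auto simp: odd_newton_def even_newton_def intro!: prod_zero bexI[of _ 0])
  then show ?thesis using True by simp
next
  case False
  have "((x + 1) * odd_newton j (x + 1) - (x - 1) * odd_newton j (x - 1)) * x =
      (x + 1) * (odd_newton j (x + 1) * x) - (x - 1) * (odd_newton j (x - 1) * x)"
    by (simp add: algebra_simps)
  also have "\<dots> = 2 * (2 * real j + 1) * even_newton j x * x"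
    unfolding newton_shift by (simp add: algebra_simps)
  finally show ?thesis using False by simp
qed

lemma newton_shift':
  "even_newton (Suc j) (x + 1) = odd_newton j x * (x + 1) * (x + 2 * real j + 1)"
  "even_newton (Suc j) (x - 1) = odd_newton j x * (x - 1) * (x - 2 * real j - 1)"
proof (induction j)
  case (Suc j)
  have "even_newton (Suc (Suc j)) (x + 1) = even_newton (Suc j) (x + 1) * ((x + 1)\<^sup>2 - (2 * real (Suc j))\<^sup>2)"
    by (simp add: even_newton_def del: of_nat_Suc)
  also have "\<dots> = odd_newton j x * (x + 1) * (x + 2 * real j + 1) * ((x + 1)\<^sup>2 - (2 * real (Suc j))\<^sup>2)"
    by (simp add: Suc)
  also have "\<dots> = odd_newton j x * (x + 1) * ((x + 2 * real j + 1) * ((x + 1)\<^sup>2 - (2 * real (Suc j))\<^sup>2))"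
    by (simp only: mult.assoc)
  also have "(x + 2 * real j + 1) * ((x + 1)\<^sup>2 - (2 * real (Suc j))\<^sup>2) =
      (x\<^sup>2 - (2 * real j + 1)\<^sup>2) * (x + 2 * real (Suc j) + 1)"
    by (simp add: algebra_simps power2_eq_square)
  also have "odd_newton j x * (x + 1) * ((x\<^sup>2 - (2 * real j + 1)\<^sup>2) * (x + 2 * real (Suc j) + 1)) =
      odd_newton (Suc j) x * (x + 1) * (x + 2 * real (Suc j) + 1)"
    by (simp add: odd_newton_def)
  finally show "even_newton (Suc (Suc j)) (x + 1) = odd_newton (Suc j) x * (x + 1) * (x + 2 * real (Suc j) + 1)" .
  have "even_newton (Suc (Suc j)) (x - 1) = even_newton (Suc j) (x - 1) * ((x - 1)\<^sup>2 - (2 * real (Suc j))\<^sup>2)"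
    by (simp add: even_newton_def del: of_nat_Suc)
  also have "\<dots> = odd_newton j x * (x - 1) * (x - 2 * real j - 1) * ((x - 1)\<^sup>2 - (2 * real (Suc j))\<^sup>2)"
    by (simp add: Suc)
  also have "\<dots> = odd_newton j x * (x - 1) * ((x - 2 * real j - 1) * ((x - 1)\<^sup>2 - (2 * real (Suc j))\<^sup>2))"
    by (simp only: mult.assoc)
  also have "(x - 2 * real j - 1) * ((x - 1)\<^sup>2 - (2 * real (Suc j))\<^sup>2) =
      (x\<^sup>2 - (2 * real j + 1)\<^sup>2) * (x - 2 * real (Suc j) - 1)"
    by (simp add: algebra_simps power2_eq_square)
  also have "odd_newton j x * (x - 1) * ((x\<^sup>2 - (2 * real j + 1)\<^sup>2) * (x - 2 * real (Suc j) - 1)) =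
      odd_newton (Suc j) x * (x - 1) * (x - 2 * real (Suc j) - 1)"
    by (simp add: odd_newton_def)
  finally show "even_newton (Suc (Suc j)) (x - 1) = odd_newton (Suc j) x * (x - 1) * (x - 2 * real (Suc j) - 1)" .
qed (simp_all add: odd_newton_def even_newton_def power2_eq_square)

lemma odd_newton_antidifference:
  "even_newton (Suc j) (x + 1) - even_newton (Suc j) (x - 1) = 4 * (real j + 1) * (x * odd_newton j x)"
  unfolding newton_shift' by (simp add: algebra_simps)

text \<open>The Vandermonde product in the squares of the entries.\<close>

definition sqdiff :: "real list \<Rightarrow> real" where
  "sqdiff xs = (\<Prod>i = 0..<length xs. \<Prod>j = 0..<i. (xs ! i)\<^sup>2 - (xs ! j)\<^sup>2)"

lemma fdet_odd_newton: "fdet (length xs) (\<lambda>i j. odd_newton j (xs ! i)) = sqdiff xs"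
  unfolding odd_newton_def sqdiff_def by (rule vandermonde_newton)

lemma fdet_even_newton: "fdet (length xs) (\<lambda>i j. even_newton j (xs ! i)) = sqdiff xs"
  unfolding even_newton_def sqdiff_def by (rule vandermonde_newton)

text \<open>The distances of the positions xs from an axis: the zigzag itself for shift 0, the line
  one half step to the left of it for shift 1.\<close>

definition shifted :: "real \<Rightarrow> int list \<Rightarrow> real list" where
  "shifted \<delta> xs = map (\<lambda>x. of_int x + \<delta>) xs"

lemma length_shifted [simp]: "length (shifted \<delta> xs) = length xs"
  by (simp add: shifted_def)

lemma nth_shifted [simp]: "i < length xs \<Longrightarrow> shifted \<delta> xs ! i = of_int (xs ! i) + \<delta>"
  by (simp add: shifted_def)

lemma prod_list_nth: "prod_list xs = (\<Prod>i = 0..<length xs. xs ! i :: real)"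
  by (metis map_nth prod.distinct_set_conv_list distinct_upt set_upt)

text \<open>One step from an even to an odd number of rows: with the determinant in the odd Newton
  basis, every column sums to a difference of values of the even Newton basis. The resulting
  differences of consecutive rows come from the determinant for x # xs, whose first column is
  constant 1.\<close>

lemma sum_interlacing_inner:
  assumes "sorted_wrt (<) (x # xs)" "\<forall>x'\<in>set xs. even (x' - x)"
  shows "(\<Sum>ys\<in>interlacing (x + 1) xs. prod_list (shifted \<delta> ys) * sqdiff (shifted \<delta> ys)) =
    (\<Prod>j = 0..<length xs. 1 / (4 * (real j + 1))) * sqdiff (shifted \<delta> (x # xs))"
proof -
  let ?n = "length xs"
  let ?r = "\<lambda>y :: int. of_int y + \<delta>"
  let ?c = "\<lambda>j. 1 / (4 * (real j + 1))"
  let ?E = "\<lambda>i j. even_newton j (?r ((x # xs) ! i))"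
  have "(\<Sum>ys\<in>interlacing (x + 1) xs. prod_list (shifted \<delta> ys) * sqdiff (shifted \<delta> ys)) =
      (\<Sum>ys\<in>interlacing (x + 1) xs. fdet ?n (\<lambda>i j. ?r (ys ! i) * odd_newton j (?r (ys ! i))))"
  proof (rule sum.cong[OF refl])
    fix ys assume "ys \<in> interlacing (x + 1) xs"
    then have l: "length ys = ?n" by (rule length_interlacing)
    have "sqdiff (shifted \<delta> ys) = fdet ?n (\<lambda>i j. odd_newton j (shifted \<delta> ys ! i))"
      using fdet_odd_newton[of "shifted \<delta> ys"] l by simp
    also have "\<dots> = fdet ?n (\<lambda>i j. odd_newton j (?r (ys ! i)))"
      using l by (intro fdet_cong) simp
    finally show "prod_list (shifted \<delta> ys) * sqdiff (shifted \<delta> ys) = fdet ?n (\<lambda>i j. ?r (ys ! i) * odd_newton j (?r (ys ! i)))"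
      using l by (simp add: fdet_rows prod_list_nth)
  qed
  also have "\<dots> = fdet ?n (\<lambda>i j. \<Sum>y\<in>par (if i = 0 then x + 1 else xs ! (i - 1) + 1) (xs ! i). ?r y * odd_newton j (?r y))"
    by (rule sum_interlacing_fdet) simp
  also have "\<dots> = fdet ?n (\<lambda>i j. ?c j * (?E (Suc i) (Suc j) - ?E i (Suc j)))"
  proof (rule fdet_cong)
    fix i j assume i: "i < ?n"
    have lo: "(if i = 0 then x + 1 else xs ! (i - 1) + 1) = (x # xs) ! i + 1"
      by (simp add: nth_Cons split: nat.splits)
    have "(x # xs) ! i < (x # xs) ! Suc i"
      using assms(1) i by (intro sorted_wrt_nth_less[of "(<)"]) auto
    then have lt: "(x # xs) ! i < xs ! i" by simp
    have "even (xs ! i - x)" "even ((x # xs) ! i - x)"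
      using assms(2) i by (auto simp: nth_Cons split: nat.splits)
    then have od: "odd (xs ! i - ((x # xs) ! i + 1))" by presburger
    have "(\<Sum>y\<in>par ((x # xs) ! i + 1) (xs ! i). ?r y * odd_newton j (?r y)) =
        (\<Sum>y\<in>par ((x # xs) ! i + 1) (xs ! i). ?c j * even_newton (Suc j) (?r (y + 1)) - ?c j * even_newton (Suc j) (?r (y - 1)))"
    proof (rule sum.cong[OF refl])
      fix y
      have "?c j * even_newton (Suc j) (?r (y + 1)) - ?c j * even_newton (Suc j) (?r (y - 1)) =
          ?c j * (even_newton (Suc j) (?r y + 1) - even_newton (Suc j) (?r y - 1))"
        by (simp add: algebra_simps)
      also have "\<dots> = ?r y * odd_newton j (?r y)"
        unfolding odd_newton_antidifference by (simp add: field_simps)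
      finally show "?r y * odd_newton j (?r y) = ?c j * even_newton (Suc j) (?r (y + 1)) - ?c j * even_newton (Suc j) (?r (y - 1))" ..
    qed
    also have "\<dots> = ?c j * even_newton (Suc j) (?r (xs ! i)) - ?c j * even_newton (Suc j) (?r ((x # xs) ! i + 1 - 1))"
      using lt od by (intro sum_par_telescope) auto
    finally show "(\<Sum>y\<in>par (if i = 0 then x + 1 else xs ! (i - 1) + 1) (xs ! i). ?r y * odd_newton j (?r y)) =
        ?c j * (?E (Suc i) (Suc j) - ?E i (Suc j))"
      unfolding lo by (simp add: algebra_simps)
  qed
  also have "\<dots> = (\<Prod>j = 0..<?n. ?c j) * fdet ?n (\<lambda>i j. ?E (Suc i) (Suc j) - ?E i (Suc j))"
    by (rule fdet_cols)
  also have "fdet ?n (\<lambda>i j. ?E (Suc i) (Suc j) - ?E i (Suc j)) =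
      fdet (Suc ?n) (\<lambda>i j. ?E i j - (if i = 0 then 0 else ?E (i - 1) j))"
    \<comment> \<open>In the extended matrix the first column is constant 1, so taking row
      differences leaves (1,0,...,0).\<close>
    by (subst fdet_first_column) (auto simp: even_newton_def)
  also have "\<dots> = fdet (Suc ?n) ?E"
    by (rule fdet_row_differences)
  also have "\<dots> = fdet (length (shifted \<delta> (x # xs))) (\<lambda>i j. even_newton j (shifted \<delta> (x # xs) ! i))"
    by (simp, intro fdet_cong) (simp add: shifted_def flip: list.map)
  also have "\<dots> = sqdiff (shifted \<delta> (x # xs))"
    by (rule fdet_even_newton)
  finally show ?thesis .
qed

text \<open>One step from an odd to an even number of rows: the same for lists whose first entry is
  bounded below only by the axis. The summand is an even function of the distance to the axis. With
  weight 1/2 for the position 0 on the axis (shift 0), or with no position on the axis (shift 1),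
  the sum over the first entry is half of a sum over an interval symmetric about the axis, so that
  no boundary term remains at its lower end.\<close>

lemma sum_interlacing_axis:
  assumes "sorted_wrt (<) xs" "\<forall>x\<in>set xs. 0 \<le> x \<and> odd x" and \<theta>\<delta>: "(\<theta> = 1 / 2 \<and> \<delta> = 0) \<or> (\<theta> = 1 \<and> \<delta> = 1)"
  shows "(\<Sum>ys\<in>interlacing 0 xs. (if 0 \<in> set ys then \<theta> else 1) * sqdiff (shifted \<delta> ys)) =
    (\<Prod>j = 0..<length xs. 1 / (2 * (2 * real j + 1))) * (prod_list (shifted \<delta> xs) * sqdiff (shifted \<delta> xs))"
proof -
  let ?n = "length xs"
  let ?r = "\<lambda>y :: int. of_int y + \<delta>"
  let ?c = "\<lambda>j. 1 / (2 * (2 * real j + 1))"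
  let ?w = "\<lambda>y :: int. if y = 0 then \<theta> else 1"
  let ?\<Phi> = "\<lambda>j y. ?c j * (?r y * odd_newton j (?r y))"
  have diff: "even_newton j (?r y) = ?\<Phi> j (y + 1) - ?\<Phi> j (y - 1)" for j y
  proof -
    have "?\<Phi> j (y + 1) - ?\<Phi> j (y - 1) =
        ?c j * ((?r y + 1) * odd_newton j (?r y + 1) - (?r y - 1) * odd_newton j (?r y - 1))"
      by (simp add: algebra_simps)
    also have "\<dots> = even_newton j (?r y)"
      unfolding even_newton_antidifference by (simp add: field_simps)
    finally show ?thesis ..
  qed
  have weight: "(if 0 \<in> set ys then \<theta> else 1) = (\<Prod>i = 0..<length ys. ?w (ys ! i))"
    if "ys \<in> interlacing 0 xs" for ys
  proof -
    have "distinct ys"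
      using interlacing_sorted[OF that] by (auto simp: strict_sorted_iff)
    have "(\<Prod>i = 0..<length ys. ?w (ys ! i)) = (\<Prod>y\<in>set ys. ?w y)"
      using prod.distinct_set_conv_list[OF \<open>distinct ys\<close>, of ?w] by (simp add: prod_list_nth)
    also have "\<dots> = (\<Prod>y\<in>set ys \<inter> {0}. \<theta>)"
      by (intro prod.mono_neutral_cong_right) auto
    finally show ?thesis by auto
  qed
  have "(\<Sum>ys\<in>interlacing 0 xs. (if 0 \<in> set ys then \<theta> else 1) * sqdiff (shifted \<delta> ys)) =
      (\<Sum>ys\<in>interlacing 0 xs. fdet ?n (\<lambda>i j. ?w (ys ! i) * even_newton j (?r (ys ! i))))"
  proof (rule sum.cong[OF refl])
    fix ys assume ys: "ys \<in> interlacing 0 xs"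
    then have l: "length ys = ?n" by (rule length_interlacing)
    have "sqdiff (shifted \<delta> ys) = fdet ?n (\<lambda>i j. even_newton j (shifted \<delta> ys ! i))"
      using fdet_even_newton[of "shifted \<delta> ys"] l by simp
    also have "\<dots> = fdet ?n (\<lambda>i j. even_newton j (?r (ys ! i)))"
      using l by (intro fdet_cong) simp
    finally show "(if 0 \<in> set ys then \<theta> else 1) * sqdiff (shifted \<delta> ys) =
        fdet ?n (\<lambda>i j. ?w (ys ! i) * even_newton j (?r (ys ! i)))"
      unfolding weight[OF ys] l by (simp only: fdet_rows)
  qed
  also have "\<dots> = fdet ?n (\<lambda>i j. \<Sum>y\<in>par (if i = 0 then 0 else xs ! (i - 1) + 1) (xs ! i). ?w y * even_newton j (?r y))"
    by (rule sum_interlacing_fdet) simp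
  also have "\<dots> = fdet ?n (\<lambda>i j. ?\<Phi> j (xs ! i) - (if i = 0 then 0 else ?\<Phi> j (xs ! (i - 1))))"
  proof (rule fdet_cong)
    fix i j assume i: "i < ?n"
    then have xi: "0 \<le> xs ! i" "odd (xs ! i)" using assms(2) by auto
    show "(\<Sum>y\<in>par (if i = 0 then 0 else xs ! (i - 1) + 1) (xs ! i). ?w y * even_newton j (?r y)) =
        ?\<Phi> j (xs ! i) - (if i = 0 then 0 else ?\<Phi> j (xs ! (i - 1)))"
    proof (cases "i = 0")
      case False
      have lt: "xs ! (i - 1) < xs ! i"
        using assms(1) i False by (intro sorted_wrt_nth_less[of "(<)"]) auto
      have xi': "0 \<le> xs ! (i - 1)" "odd (xs ! (i - 1))" using assms(2) i by auto
      have "(\<Sum>y\<in>par (xs ! (i - 1) + 1) (xs ! i). ?w y * even_newton j (?r y)) =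
          (\<Sum>y\<in>par (xs ! (i - 1) + 1) (xs ! i). ?\<Phi> j (y + 1) - ?\<Phi> j (y - 1))"
        using xi' by (intro sum.cong refl, subst diff) (auto simp: par_iff)
      also have "\<dots> = ?\<Phi> j (xs ! i) - ?\<Phi> j (xs ! (i - 1) + 1 - 1)"
        using lt xi xi' by (intro sum_par_telescope) auto
      finally show ?thesis using False by simp
    next
      case True
      have 0: "0 \<in> par 0 (xs ! i)" using xi by (auto simp: par_iff le_less)
      have "(\<Sum>y\<in>par 0 (xs ! i). ?w y * even_newton j (?r y)) =
          \<theta> * even_newton j (?r 0) + (\<Sum>y\<in>par 0 (xs ! i) - {0}. even_newton j (?r y))"
        using 0 by (subst sum.remove[of _ 0]) auto
      also have "(\<Sum>y\<in>par 0 (xs ! i) - {0}. even_newton j (?r y)) = (\<Sum>y\<in>par 0 (xs ! i). even_newton j (?r y)) - even_newton j (?r 0)"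
        using 0 by (subst sum_diff1) auto
      also have "(\<Sum>y\<in>par 0 (xs ! i). even_newton j (?r y)) = (\<Sum>y\<in>par 0 (xs ! i). ?\<Phi> j (y + 1) - ?\<Phi> j (y - 1))"
        by (intro sum.cong refl diff)
      also have "\<dots> = ?\<Phi> j (xs ! i) - ?\<Phi> j (0 - 1)"
        using xi by (intro sum_par_telescope) auto
      also have "\<theta> * even_newton j (?r 0) + (?\<Phi> j (xs ! i) - ?\<Phi> j (0 - 1) - even_newton j (?r 0)) = ?\<Phi> j (xs ! i)"
      proof -
        \<comment> \<open>The boundary term at -1 cancels the missing part of the weight at 0: with
          shift 0 and weight 1/2 it is half the value at 0, and with shift 1 it vanishes.\<close>
        have "odd_newton j (-1) = odd_newton j 1" by (simp add: odd_newton_def)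
        then have "(1 - \<theta>) * even_newton j (?r 0) = - ?\<Phi> j (0 - 1)"
          using \<theta>\<delta> diff[of j 0] by auto
        then show ?thesis by (simp add: algebra_simps)
      qed
      finally show ?thesis using True by simp
    qed
  qed
  also have "\<dots> = fdet ?n (\<lambda>i j. ?c j * (?r (xs ! i) * odd_newton j (?r (xs ! i))))"
    by (rule fdet_row_differences)
  also have "\<dots> = (\<Prod>j = 0..<?n. ?c j) * ((\<Prod>i = 0..<?n. ?r (xs ! i)) * fdet ?n (\<lambda>i j. odd_newton j (?r (xs ! i))))"
    by (simp only: fdet_cols fdet_rows)
  also have "(\<Prod>i = 0..<?n. ?r (xs ! i)) = prod_list (shifted \<delta> xs)"
    by (simp add: prod_list_nth)
  also have "fdet ?n (\<lambda>i j. odd_newton j (?r (xs ! i))) = fdet (length (shifted \<delta> xs)) (\<lambda>i j. odd_newton j (shifted \<delta> xs ! i))"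
    by (simp, intro fdet_cong) simp
  also have "\<dots> = sqdiff (shifted \<delta> xs)"
    by (rule fdet_odd_newton)
  finally show ?thesis .
qed

section \<open>Dented trapezoids\<close>

lemma interlacing_bound: "ys \<in> interlacing l xs \<Longrightarrow> y \<in> set ys \<Longrightarrow> \<exists>x\<in>set xs. y < x"
proof (induction xs arbitrary: l ys)
  case (Cons x xs)
  then obtain y' ys' where y': "ys = y' # ys'" "y' < x" and ys': "ys' \<in> interlacing (x + 1) xs"
    by auto
  then show ?case
    using Cons.IH[OF ys'] Cons.prems(2) by (cases "y = y'") auto
qed simp

lemma interlacing_parity:
  "ys \<in> interlacing l xs \<Longrightarrow> \<forall>x\<in>set xs. odd (x - l) \<Longrightarrow> y \<in> set ys \<Longrightarrow> even (y - l)"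
proof (induction xs arbitrary: l ys)
  case (Cons x xs)
  then obtain y' ys' where y: "ys = y' # ys'" "even (y' - l)" and ys': "ys' \<in> interlacing (x + 1) xs"
    by auto
  have x: "odd (x - l)" using Cons.prems by simp
  have "\<forall>x'\<in>set xs. odd (x' - (x + 1))"
  proof
    fix x' assume "x' \<in> set xs"
    then have "odd (x' - l)" using Cons.prems by simp
    then show "odd (x' - (x + 1))" using x by presburger
  qed
  then have "even (y - (x + 1))" if "y \<in> set ys'"
    using Cons.IH[OF ys'] that by simp
  then have "y = y' \<or> even (y - (x + 1))"
    using Cons.prems(3) y by auto
  then show ?case
    using x y by presburger
qed simp

text \<open>The polygon with h zigzag steps on the western side, a top side of length c and a
  straight eastern side.\<close>

definition trapezoid :: "nat \<Rightarrow> nat \<Rightarrow> (int \<times> int) set" where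
  "trapezoid h c = {(u, k). 0 \<le> u \<and> u < int h \<and> 0 \<le> k \<and> k \<le> 2 * int c + u}"

text \<open>The trapezoid without the cells of its bottom row at the positions X.\<close>

definition dented :: "real \<Rightarrow> nat \<Rightarrow> nat \<Rightarrow> int set \<Rightarrow> real" where
  "dented \<theta> h c X = bcov \<theta> (trapezoid h c - {int h - 1} \<times> X)"

lemma finite_trapezoid [simp]: "finite (trapezoid h c)"
  by (rule finite_subset[of _ "{0..int h} \<times> {0..2 * int c + int h}"]) (auto simp: trapezoid_def)

text \<open>Summation over the positions Y of the vertical lozenges that reach into the bottom
  row.\<close>

lemma dented_transfer:
  assumes h: "h \<ge> 1" and X: "\<forall>x\<in>X. even (x + int h)"
  shows "dented \<theta> (Suc h) c X =
    (\<Sum>Y\<in>Pow (par (if odd h then 0 else 1) (2 * int c + int h + 1)).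
       rowcov \<theta> (int h) 0 (2 * int c + int h + 1) (X \<union> Y) * ((if 0 \<in> Y then \<theta> else 1) * dented \<theta> h c Y))"
proof -
  let ?r = "2 * int c + int h + 1"
  let ?P = "par (if odd h then 0 else 1) ?r"
  let ?A = "trapezoid h c"
  let ?B = "{int h} \<times> ({0..<?r} - X)"
  let ?v = "vbrick (int h - 1)"
  let ?Cs = "{C. C \<subseteq> bricks \<and> disjoint C \<and> (\<forall>l\<in>C. l \<subseteq> ?A \<union> ?B \<and> l \<inter> ?A \<noteq> {} \<and> l \<inter> ?B \<noteq> {})}"
  have P: "k \<in> ?P \<longleftrightarrow> 0 \<le> k \<and> k < ?r \<and> even (int h - 1 + k)" for k
    unfolding par_iff by (cases "odd h") (auto, presburger+)
  have reg: "trapezoid (Suc h) c - {int (Suc h) - 1} \<times> X = ?A \<union> ?B"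
    by (auto simp: trapezoid_def)
  \<comment> \<open>The lozenges meeting both parts are vertical and have their lower halves in the
    bottom row.\<close>
  have cross: "l \<in> bricks \<and> l \<subseteq> ?A \<union> ?B \<and> l \<inter> ?A \<noteq> {} \<and> l \<inter> ?B \<noteq> {} \<longleftrightarrow> l \<in> ?v ` ?P" for l
  proof
    assume l: "l \<in> bricks \<and> l \<subseteq> ?A \<union> ?B \<and> l \<inter> ?A \<noteq> {} \<and> l \<inter> ?B \<noteq> {}"
    then consider (h) u k where "l = hbrick u k" | (v) u k where "l = vbrick u k" "even (u + k)"
      by (auto simp: bricks_def)
    then show "l \<in> ?v ` ?P"
    proof cases
      case h
      then show ?thesis using l by (auto simp: hbrick_def trapezoid_def)
    next
      case v
      then have "u = int h - 1" "0 \<le> k" "k < ?r"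
        using l by (auto simp: vbrick_def trapezoid_def)
      then show ?thesis using v P by auto
    qed
  next
    assume "l \<in> ?v ` ?P"
    then obtain k where k: "l = ?v k" "k \<in> ?P" by blast
    then have k': "0 \<le> k" "k < ?r" "even (int h - 1 + k)" unfolding P by auto
    have "k \<noteq> 2 * int c + int h" using k'(3) by presburger
    then have "(int h - 1, k) \<in> ?A" using k' h by (auto simp: trapezoid_def)
    moreover have "k \<notin> X"
    proof
      assume "k \<in> X"
      then have "even (k + int h)" using X by auto
      then show False using k'(3) by presburger
    qed
    then have "(int h, k) \<in> ?B" using k' by auto
    moreover have "l \<in> bricks" using k k' by (auto simp: bricks_def)
    ultimately show "l \<in> bricks \<and> l \<subseteq> ?A \<union> ?B \<and> l \<inter> ?A \<noteq> {} \<and> l \<inter> ?B \<noteq> {}"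
      using k(1) by (auto simp: vbrick_def)
  qed
  have dis: "disjoint (?v ` Y)" for Y
    by (auto simp: disjoint_def vbrick_def)
  have gen: "C \<subseteq> L \<and> disjoint C \<and> (\<forall>l\<in>C. Q l) \<longleftrightarrow> disjoint C \<and> (\<forall>l\<in>C. l \<in> L \<and> Q l)"
    for C L :: "(int \<times> int) set set" and Q
    by blast
  have mem: "C \<in> ?Cs \<longleftrightarrow> disjoint C \<and> C \<subseteq> ?v ` ?P" for C
    unfolding mem_Collect_eq gen cross by (simp only: subset_eq)
  have "C \<in> (`) ?v ` Pow ?P \<longleftrightarrow> disjoint C \<and> C \<subseteq> ?v ` ?P" for C
    unfolding image_Pow_surj[OF refl] Pow_iff
  proof (rule iffI)
    assume "C \<subseteq> ?v ` ?P"
    moreover from this obtain Y where "C = ?v ` Y"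
      by (rule subset_imageE)
    ultimately show "disjoint C \<and> C \<subseteq> ?v ` ?P"
      using dis by simp
  qed simp
  then have Cs: "?Cs = (`) ?v ` Pow ?P"
    using mem by (intro Set.set_eqI) (simp only:)
  have inj: "inj_on ((`) ?v) (Pow ?P)"
    by (rule inj_on_image_Pow) (simp add: inj_on_def)
  have "dented \<theta> (Suc h) c X = bcov \<theta> (?A \<union> ?B)"
    unfolding dented_def reg ..
  also have "\<dots> = (\<Sum>C\<in>?Cs. (\<Prod>l\<in>C. axis_weight \<theta> l) * bcov \<theta> (?A - \<Union>C) * bcov \<theta> (?B - \<Union>C))"
    by (rule cov_split, rule finite_trapezoid) (auto simp: trapezoid_def)
  also have "\<dots> = (\<Sum>Y\<in>Pow ?P. (\<Prod>l\<in>?v ` Y. axis_weight \<theta> l) * bcov \<theta> (?A - \<Union>(?v ` Y)) * bcov \<theta> (?B - \<Union>(?v ` Y)))"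
    unfolding Cs by (subst sum.reindex[OF inj]) (simp only: comp_def)
  also have "\<dots> = (\<Sum>Y\<in>Pow ?P. rowcov \<theta> (int h) 0 ?r (X \<union> Y) * ((if 0 \<in> Y then \<theta> else 1) * dented \<theta> h c Y))"
  proof (rule sum.cong[OF refl])
    fix Y assume Y: "Y \<in> Pow ?P"
    then have fin: "finite Y" using finite_subset[OF _ finite_par] by blast
    have "(\<Prod>l\<in>?v ` Y. axis_weight \<theta> l) = (\<Prod>k\<in>Y. if k = 0 then \<theta> else 1)"
      by (subst prod.reindex) (auto simp: inj_on_def)
    also have "\<dots> = (if 0 \<in> Y then \<theta> else 1)"
      using fin by (simp add: prod.delta)
    finally have w: "(\<Prod>l\<in>?v ` Y. axis_weight \<theta> l) = (if 0 \<in> Y then \<theta> else 1)" .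
    have a: "?A - \<Union>(?v ` Y) = trapezoid h c - {int h - 1} \<times> Y"
      by (auto simp: vbrick_def trapezoid_def)
    have b: "?B - \<Union>(?v ` Y) = {int h} \<times> ({0..<?r} - (X \<union> Y))"
      by (auto simp: vbrick_def)
    show "(\<Prod>l\<in>?v ` Y. axis_weight \<theta> l) * bcov \<theta> (?A - \<Union>(?v ` Y)) * bcov \<theta> (?B - \<Union>(?v ` Y)) =
        rowcov \<theta> (int h) 0 ?r (X \<union> Y) * ((if 0 \<in> Y then \<theta> else 1) * dented \<theta> h c Y)"
      unfolding w a b by (simp add: dented_def rowcov_def)
  qed
  finally show ?thesis .
qed

text \<open>The product of the constants of the summation steps; the argument is the number of
  rows.\<close>

fun dent_const :: "nat \<Rightarrow> real" where
  "dent_const 0 = 1"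
| "dent_const (Suc 0) = 1"
| "dent_const (Suc (Suc h)) = dent_const (Suc h) *
     (\<Prod>j = 0..<Suc (Suc h) div 2. if even h then 1 / (2 * (2 * real j + 1)) else 1 / (4 * (real j + 1)))"

lemma dent_const_pos: "dent_const h > 0"
proof (induction h rule: dent_const.induct)
  case (3 h)
  then show ?case
    unfolding dent_const.simps by (intro mult_pos_pos prod_pos) auto
qed simp_all

text \<open>Product formula for dented trapezoids. The vertical lozenges in consecutive rows
  interlace, and each additional row is one of the two summations above. The weight 1/2 goes with
  distances measured from the zigzag, weight 1 with distances measured from half a step to the left
  of it.\<close>

theorem dented_product:
  assumes \<theta>\<delta>: "(\<theta> = 1 / 2 \<and> \<delta> = 0) \<or> (\<theta> = 1 \<and> \<delta> = 1)"
    and "sorted_wrt (<) xs" "length xs = Suc (Suc h) div 2"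
    and "\<forall>x\<in>set xs. 0 \<le> x \<and> x < 2 * int c + int (Suc h) \<and> even (x + int h)"
  shows "dented \<theta> (Suc h) c (set xs) =
    dent_const (Suc h) * (if odd h then prod_list (shifted \<delta> xs) else 1) * sqdiff (shifted \<delta> xs)"
  using assms(2-)
proof (induction h arbitrary: xs)
  case 0
  then obtain x where xs: "xs = [x]"
    by (auto simp: length_Suc_conv)
  have "trapezoid (Suc 0) c - {0} \<times> {x} = {0} \<times> ({0..<2 * int c + 1} - {x})"
    by (auto simp: trapezoid_def)
  then have "dented \<theta> (Suc 0) c (set xs) = rowcov \<theta> 0 0 (2 * int c + 1) {x}"
    by (simp add: dented_def rowcov_def xs)
  also have "\<dots> = rowcov \<theta> 0 (x + 1) (2 * int c + 1) {x}"
    using 0 xs by (subst rowcov_gap[of 0 x]) auto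
  also have "\<dots> = 1"
    using 0 xs by (subst rowcov_no_hole) auto
  finally show ?case by (simp add: xs sqdiff_def)
next
  case (Suc h)
  let ?H = "Suc h"
  let ?r = "2 * int c + int ?H + 1"
  have tr: "dented \<theta> (Suc ?H) c (set xs) =
    (\<Sum>Y\<in>Pow (par (if odd ?H then 0 else 1) ?r).
       rowcov \<theta> (int ?H) 0 ?r (set xs \<union> Y) * ((if 0 \<in> Y then \<theta> else 1) * dented \<theta> ?H c Y))"
    by (rule dented_transfer) (use Suc.prems in auto)
  show ?case
  proof (cases "odd ?H")
    case True
    then have h: "even h" by simp
    have par: "\<forall>x\<in>set xs. 0 \<le> x \<and> odd x" "\<forall>x\<in>set xs. odd (x - 0)"
      using Suc.prems(3) h by auto
    have "dented \<theta> (Suc ?H) c (set xs) = (\<Sum>ys\<in>interlacing 0 xs. (if 0 \<in> set ys then \<theta> else 1) * dented \<theta> ?H c (set ys))"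
      unfolding tr if_P[OF True] by (rule sum_rowcov) (use Suc.prems par h in auto)
    also have "\<dots> = (\<Sum>ys\<in>interlacing 0 xs. dent_const ?H * ((if 0 \<in> set ys then \<theta> else 1) * sqdiff (shifted \<delta> ys)))"
    proof (rule sum.cong[OF refl])
      fix ys assume ys: "ys \<in> interlacing 0 xs"
      have "dented \<theta> ?H c (set ys) = dent_const ?H * (if odd h then prod_list (shifted \<delta> ys) else 1) * sqdiff (shifted \<delta> ys)"
      proof (rule Suc.IH)
        show "sorted_wrt (<) ys" using interlacing_sorted[OF ys] by simp
        show "length ys = Suc (Suc h) div 2"
          using length_interlacing[OF ys] Suc.prems(2) h by simp
        show "\<forall>y\<in>set ys. 0 \<le> y \<and> y < 2 * int c + int (Suc h) \<and> even (y + int h)"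
        proof
          fix y assume y: "y \<in> set ys"
          obtain x where "x \<in> set xs" "y < x" using interlacing_bound[OF ys y] by blast
          moreover have "0 \<le> y" using interlacing_sorted[OF ys] y by simp
          moreover have "even y" using interlacing_parity[OF ys par(2) y] by simp
          ultimately show "0 \<le> y \<and> y < 2 * int c + int (Suc h) \<and> even (y + int h)"
            using Suc.prems(3) h by force
        qed
      qed
      then show "(if 0 \<in> set ys then \<theta> else 1) * dented \<theta> ?H c (set ys) =
          dent_const ?H * ((if 0 \<in> set ys then \<theta> else 1) * sqdiff (shifted \<delta> ys))"
        using h by simp
    qed
    also have "\<dots> = dent_const ?H * ((\<Prod>j = 0..<length xs. 1 / (2 * (2 * real j + 1))) * (prod_list (shifted \<delta> xs) * sqdiff (shifted \<delta> xs)))"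
      unfolding sum_distrib_left[symmetric]
      by (subst sum_interlacing_axis[OF Suc.prems(1) par(1) \<theta>\<delta>]) (rule refl)
    finally show ?thesis
      using h Suc.prems(2) by simp
  next
    case False
    then have h: "odd h" by simp
    obtain x xs' where xs: "xs = x # xs'"
      using Suc.prems(2) by (cases xs) auto
    have x0: "0 \<le> x" using Suc.prems(3) xs by simp
    have par: "\<forall>x'\<in>set (x # xs'). even (x' - 0)" "\<forall>x'\<in>set xs'. even (x' - x)" "\<forall>x'\<in>set xs'. odd (x' - (x + 1))"
      using Suc.prems(3) h by (auto simp: xs)
    have "dented \<theta> (Suc ?H) c (set xs) = (\<Sum>ys\<in>interlacing (x + 1) xs'. (if 0 \<in> set ys then \<theta> else 1) * dented \<theta> ?H c (set ys))"
    proof -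
      have sub: "set (x # xs') \<subseteq> {0..<?r}"
        using Suc.prems(3) by (force simp: xs)
      have "dented \<theta> (Suc ?H) c (set xs) = (\<Sum>Y\<in>Pow (par (0 + 1) ?r).
          rowcov \<theta> (int ?H) 0 ?r (set (x # xs') \<union> Y) * ((if 0 \<in> Y then \<theta> else 1) * dented \<theta> ?H c Y))"
        unfolding tr if_not_P[OF False] unfolding xs by simp
      also have "\<dots> = (\<Sum>ys\<in>interlacing (x + 1) xs'. (if 0 \<in> set ys then \<theta> else 1) * dented \<theta> ?H c (set ys))"
        by (rule sum_rowcov_inner) (use Suc.prems(1) par sub h in \<open>auto simp: xs\<close>)
      finally show ?thesis .
    qed
    also have "\<dots> = (\<Sum>ys\<in>interlacing (x + 1) xs'. dent_const ?H * (prod_list (shifted \<delta> ys) * sqdiff (shifted \<delta> ys)))"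
    proof (rule sum.cong[OF refl])
      fix ys assume ys: "ys \<in> interlacing (x + 1) xs'"
      have pos: "0 < y" if "y \<in> set ys" for y
        using interlacing_sorted[OF ys] that x0 by force
      have "dented \<theta> ?H c (set ys) = dent_const ?H * (if odd h then prod_list (shifted \<delta> ys) else 1) * sqdiff (shifted \<delta> ys)"
      proof (rule Suc.IH)
        show "sorted_wrt (<) ys" using interlacing_sorted[OF ys] by simp
        show "length ys = Suc (Suc h) div 2"
          using length_interlacing[OF ys] Suc.prems(2) h xs by (auto elim!: oddE)
        show "\<forall>y\<in>set ys. 0 \<le> y \<and> y < 2 * int c + int (Suc h) \<and> even (y + int h)"
        proof
          fix y assume y: "y \<in> set ys"
          obtain x' where x': "x' \<in> set xs'" "y < x'" using interlacing_bound[OF ys y] by blast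
          then have "x' < 2 * int c + int (Suc ?H)" using Suc.prems(3) xs by simp
          moreover have "0 < y" by (rule pos[OF y])
          moreover have "odd y" using interlacing_parity[OF ys par(3) y] par(1) by auto
          ultimately show "0 \<le> y \<and> y < 2 * int c + int (Suc h) \<and> even (y + int h)"
            using h x' by auto
        qed
      qed
      then show "(if 0 \<in> set ys then \<theta> else 1) * dented \<theta> ?H c (set ys) =
          dent_const ?H * (prod_list (shifted \<delta> ys) * sqdiff (shifted \<delta> ys))"
        using h pos[of 0] by auto
    qed
    also have "\<dots> = dent_const ?H * ((\<Prod>j = 0..<length xs'. 1 / (4 * (real j + 1))) * sqdiff (shifted \<delta> xs))"
      unfolding sum_distrib_left[symmetric] using Suc.prems(1) par(2) xs
      by (subst sum_interlacing_inner) auto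
    finally show ?thesis
      using h Suc.prems(2) xs by (auto elim!: oddE)
  qed
qed

section \<open>From sums over subsets to sums over tuples\<close>

lemma prod_offdiag:
  fixes g :: "'a::linorder \<Rightarrow> 'a \<Rightarrow> real"
  assumes "finite A" and sym: "\<And>a b. g a b = g b a"
  shows "(\<Prod>a\<in>A. \<Prod>b\<in>A - {a}. g a b) = (\<Prod>a\<in>A. \<Prod>b\<in>{b \<in> A. b < a}. g a b)\<^sup>2"
proof -
  have "(\<Prod>a\<in>A. \<Prod>b\<in>A - {a}. g a b) = (\<Prod>a\<in>A. (\<Prod>b\<in>{b \<in> A. b < a}. g a b) * (\<Prod>b\<in>{b \<in> A. a < b}. g a b))"
  proof (rule prod.cong[OF refl])
    fix a assume "a \<in> A"
    have eq: "A - {a} = {b \<in> A. b < a} \<union> {b \<in> A. a < b}" by auto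
    have disj: "{b \<in> A. b < a} \<inter> {b \<in> A. a < b} = {}" by auto
    show "(\<Prod>b\<in>A - {a}. g a b) = (\<Prod>b\<in>{b \<in> A. b < a}. g a b) * (\<Prod>b\<in>{b \<in> A. a < b}. g a b)"
      unfolding eq by (rule prod.union_disjoint[OF _ _ disj]) (use assms(1) in simp_all)
  qed
  also have "\<dots> = (\<Prod>a\<in>A. \<Prod>b\<in>{b \<in> A. b < a}. g a b) * (\<Prod>a\<in>A. \<Prod>b\<in>{b \<in> A. a < b}. g a b)"
    by (rule prod.distrib)
  also have "(\<Prod>a\<in>A. \<Prod>b\<in>{b \<in> A. a < b}. g a b) = (\<Prod>b\<in>A. \<Prod>a\<in>{a \<in> A. a < b}. g a b)"
    by (rule prod.swap_restrict[OF assms(1) assms(1)])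
  also have "\<dots> = (\<Prod>a\<in>A. \<Prod>b\<in>{b \<in> A. b < a}. g a b)"
    by (rule prod.cong[OF refl], rule prod.cong[OF refl], rule sym)
  finally show ?thesis by (simp add: power2_eq_square)
qed

text \<open>The enumerations of a set of n elements.\<close>

lemma card_bij_PiE:
  assumes "finite S" "card S = n"
  shows "card {f \<in> {0..<n} \<rightarrow>\<^sub>E S. f ` {0..<n} = S} = fact n"
proof -
  let ?I = "{0..<n}"
  obtain e where e: "bij_betw e ?I S"
    using ex_bij_betw_nat_finite[OF assms(1)] assms(2) by auto
  have inj: "inj_on f ?I" if "f ` ?I = S" for f
    using that assms by (intro eq_card_imp_inj_on) auto
  have "bij_betw (\<lambda>p. restrict (e \<circ> p) ?I) {p. p permutes ?I} {f \<in> ?I \<rightarrow>\<^sub>E S. f ` ?I = S}"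
  proof (rule bij_betw_imageI)
    show "inj_on (\<lambda>p. restrict (e \<circ> p) ?I) {p. p permutes ?I}"
    proof (rule inj_onI)
      fix p q assume pq: "p \<in> {p. p permutes ?I}" "q \<in> {p. p permutes ?I}" "restrict (e \<circ> p) ?I = restrict (e \<circ> q) ?I"
      show "p = q"
      proof
        fix i
        show "p i = q i"
        proof (cases "i \<in> ?I")
          case True
          have "e (p i) = e (q i)" using fun_cong[OF pq(3), of i] True by simp
          moreover have "p i \<in> ?I" "q i \<in> ?I" using pq True by (auto simp: permutes_in_image simp del: atLeastLessThan_iff)
          ultimately show ?thesis using e by (meson bij_betw_def inj_onD)
        next
          case False
          then show ?thesis using pq by (simp add: permutes_not_in del: atLeastLessThan_iff)
        qed
      qed
    qed
    show "(\<lambda>p. restrict (e \<circ> p) ?I) ` {p. p permutes ?I} = {f \<in> ?I \<rightarrow>\<^sub>E S. f ` ?I = S}"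
    proof (intro equalityI subsetI)
      fix f assume "f \<in> (\<lambda>p. restrict (e \<circ> p) ?I) ` {p. p permutes ?I}"
      then obtain p where p: "p permutes ?I" "f = restrict (e \<circ> p) ?I" by auto
      have "f ` ?I = e ` (p ` ?I)" using p(2) by (auto simp: image_image)
      also have "\<dots> = S" using permutes_image[OF p(1)] e by (simp add: bij_betw_def)
      finally have "f ` ?I = S" .
      then show "f \<in> {f \<in> ?I \<rightarrow>\<^sub>E S. f ` ?I = S}" using p(2) by auto
    next
      fix f assume f: "f \<in> {f \<in> ?I \<rightarrow>\<^sub>E S. f ` ?I = S}"
      let ?p = "\<lambda>i. if i \<in> ?I then inv_into ?I e (f i) else i"
      have fS: "f i \<in> S" if "i \<in> ?I" for i using f that by auto
      have "bij_betw f ?I S" using f inj by (auto simp: bij_betw_def)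
      then have "bij_betw (inv_into ?I e \<circ> f) ?I ?I"
        using bij_betw_inv_into[OF e] by (rule bij_betw_trans)
      then have "bij_betw ?p ?I ?I" by (rule bij_betw_cong[THEN iffD1, rotated]) simp
      then have "?p permutes ?I" by (rule bij_imp_permutes) simp
      moreover have "f = restrict (e \<circ> ?p) ?I"
      proof
        fix i
        show "f i = restrict (e \<circ> ?p) ?I i"
        proof (cases "i \<in> ?I")
          case True
          then have "e (inv_into ?I e (f i)) = f i"
            using fS e by (intro f_inv_into_f) (auto simp: bij_betw_def)
          then show ?thesis using True by simp
        next
          case False
          then show ?thesis using f by (auto simp: PiE_def extensional_def)
        qed
      qed
      ultimately show "f \<in> (\<lambda>p. restrict (e \<circ> p) ?I) ` {p. p permutes ?I}" by blast
    qed
  qed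
  then have "card {f \<in> ?I \<rightarrow>\<^sub>E S. f ` ?I = S} = card {p. p permutes ?I}"
    by (rule bij_betw_same_card[symmetric])
  then show ?thesis by (simp add: card_permutations)
qed

text \<open>The Vandermonde product of the values of t on a finite set.\<close>

definition vdm :: "('a::linorder \<Rightarrow> real) \<Rightarrow> 'a set \<Rightarrow> real" where
  "vdm t S = (\<Prod>p\<in>S. \<Prod>q\<in>{q \<in> S. q < p}. t p - t q)"

lemma vdm_square: "finite S \<Longrightarrow> (vdm t S)\<^sup>2 = (\<Prod>p\<in>S. \<Prod>q\<in>S - {p}. \<bar>t p - t q\<bar>)"
  using prod_offdiag[of S "\<lambda>p q. \<bar>t p - t q\<bar>"]
  by (simp add: vdm_def abs_minus_commute flip: abs_prod)

text \<open>Tuples with a repeated entry contribute nothing, and each subset is enumerated by n!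
  tuples.\<close>

lemma sum_tuples_subsets:
  fixes t w :: "'a::linorder \<Rightarrow> real"
  assumes P: "finite P"
  shows "(\<Sum>f\<in>{0..<n} \<rightarrow>\<^sub>E P. (\<Prod>i = 0..<n. \<Prod>j = 0..<i. t (f i) - t (f j))\<^sup>2 * (\<Prod>i = 0..<n. w (f i))) =
    fact n * (\<Sum>S\<in>{S \<in> Pow P. card S = n}. (vdm t S)\<^sup>2 * (\<Prod>p\<in>S. w p))" (is "(\<Sum>f\<in>?F. ?g f) = fact n * (\<Sum>S\<in>?S. ?h S)")
proof -
  let ?I = "{0..<n}"
  have finF: "finite ?F" using P by (simp add: finite_PiE)
  let ?F' = "{f \<in> ?F. inj_on f ?I}"
  have lt: "{j \<in> ?I. j < i} = {0..<i}" if "i < n" for i :: nat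
    using that by auto
  have "(\<Sum>f\<in>?F. ?g f) = (\<Sum>f\<in>?F'. ?g f)"
  proof (rule sum.mono_neutral_right[OF finF])
    show "\<forall>f\<in>?F - ?F'. ?g f = 0"
    proof
      fix f assume "f \<in> ?F - ?F'"
      then have "\<not> inj_on f ?I" by auto
      then obtain i j where ij: "i \<in> ?I" "j \<in> ?I" "f i = f j" "j < i"
        unfolding inj_on_def by (metis linorder_neqE_nat)
      then have "(\<Prod>i = 0..<n. \<Prod>j = 0..<i. t (f i) - t (f j)) = 0"
        by (intro prod_zero bexI[of _ i] bexI[of _ j]) auto
      then show "?g f = 0" by simp
    qed
  qed auto
  also have "\<dots> = (\<Sum>f\<in>?F'. ?h (f ` ?I))"
  proof (rule sum.cong[OF refl])
    fix f assume "f \<in> ?F'"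
    then have inj: "inj_on f ?I" by auto
    have "(\<Prod>i = 0..<n. \<Prod>j = 0..<i. t (f i) - t (f j)) = vdm (\<lambda>i. t (f i)) ?I"
      unfolding vdm_def by (intro prod.cong refl) (auto simp: lt)
    then have "(\<Prod>i = 0..<n. \<Prod>j = 0..<i. t (f i) - t (f j))\<^sup>2 = (\<Prod>i\<in>?I. \<Prod>j\<in>?I - {i}. \<bar>t (f i) - t (f j)\<bar>)"
      by (simp add: vdm_square)
    also have "\<dots> = (\<Prod>i\<in>?I. \<Prod>q\<in>f ` ?I - {f i}. \<bar>t (f i) - t q\<bar>)"
    proof (rule prod.cong[OF refl])
      fix i assume i: "i \<in> ?I"
      have "f ` ?I - {f i} = f ` (?I - {i})" using inj i by (auto simp: inj_on_def)
      moreover have "inj_on f (?I - {i})" using inj by (rule inj_on_subset) auto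
      ultimately show "(\<Prod>j\<in>?I - {i}. \<bar>t (f i) - t (f j)\<bar>) = (\<Prod>q\<in>f ` ?I - {f i}. \<bar>t (f i) - t q\<bar>)"
        by (simp add: prod.reindex)
    qed
    also have "\<dots> = (\<Prod>p\<in>f ` ?I. \<Prod>q\<in>f ` ?I - {p}. \<bar>t p - t q\<bar>)"
      using inj by (simp add: prod.reindex)
    also have "\<dots> = (vdm t (f ` ?I))\<^sup>2"
      by (simp add: vdm_square)
    finally show "?g f = ?h (f ` ?I)" using inj by (simp add: prod.reindex)
  qed
  also have "\<dots> = (\<Sum>S\<in>?S. \<Sum>f\<in>{f \<in> ?F'. f ` ?I = S}. ?h (f ` ?I))"
  proof (rule sum.group[symmetric])
    show "finite ?F'" using finF by simp
    show "finite ?S" using P by simp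
    show "(\<lambda>f. f ` ?I) ` ?F' \<subseteq> ?S" by (auto simp: card_image)
  qed
  also have "\<dots> = (\<Sum>S\<in>?S. fact n * ?h S)"
  proof (rule sum.cong[OF refl])
    fix S assume S: "S \<in> ?S"
    then have fin: "finite S" using P finite_subset by auto
    have "f \<in> {f \<in> ?F'. f ` ?I = S} \<longleftrightarrow> f \<in> {f \<in> ?I \<rightarrow>\<^sub>E S. f ` ?I = S}" for f
    proof
      assume "f \<in> {f \<in> ?I \<rightarrow>\<^sub>E S. f ` ?I = S}"
      then have f: "f \<in> ?I \<rightarrow>\<^sub>E S" "f ` ?I = S" by auto
      have "f \<in> ?F" using f(1) S PiE_mono[of ?I "\<lambda>_. S" "\<lambda>_. P"] by auto
      moreover have "inj_on f ?I" using f(2) S by (intro eq_card_imp_inj_on) auto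
      ultimately show "f \<in> {f \<in> ?F'. f ` ?I = S}" using f(2) by simp
    qed (auto simp: PiE_def)
    then have "{f \<in> ?F'. f ` ?I = S} = {f \<in> ?I \<rightarrow>\<^sub>E S. f ` ?I = S}" by (rule Set.set_eqI)
    then have "card {f \<in> ?F'. f ` ?I = S} = fact n"
      using card_bij_PiE[OF fin] S by simp
    moreover have "(\<Sum>f\<in>{f \<in> ?F'. f ` ?I = S}. ?h (f ` ?I)) = (\<Sum>f\<in>{f \<in> ?F'. f ` ?I = S}. ?h S)"
      by (intro sum.cong refl) auto
    ultimately show "(\<Sum>f\<in>{f \<in> ?F'. f ` ?I = S}. ?h (f ` ?I)) = fact n * ?h S"
      by simp
  qed
  finally show ?thesis by (simp add: sum_distrib_left)
qed

lemma sum_tuples_fdet: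
  fixes F G :: "nat \<Rightarrow> 'a \<Rightarrow> real"
  assumes P: "finite P"
  shows "(\<Sum>f\<in>{0..<n} \<rightarrow>\<^sub>E P. fdet n (\<lambda>a i. F i (f a)) * fdet n (\<lambda>a i. G i (f a)) * (\<Prod>a = 0..<n. w (f a))) =
    (\<Sum>p | p permutes {0..<n}. \<Sum>q | q permutes {0..<n}. signof p * signof q *
      (\<Prod>a = 0..<n. \<Sum>s\<in>P. F (p a) s * G (q a) s * w s))"
proof -
  let ?Q = "{p. p permutes {0..<n}}"
  have "(\<Sum>f\<in>{0..<n} \<rightarrow>\<^sub>E P. fdet n (\<lambda>a i. F i (f a)) * fdet n (\<lambda>a i. G i (f a)) * (\<Prod>a = 0..<n. w (f a))) =
      (\<Sum>f\<in>{0..<n} \<rightarrow>\<^sub>E P. \<Sum>p\<in>?Q. \<Sum>q\<in>?Q. signof p * signof q * (\<Prod>a = 0..<n. F (p a) (f a) * G (q a) (f a) * w (f a)))"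
  proof (rule sum.cong[OF refl])
    fix f
    have "fdet n (\<lambda>a i. F i (f a)) * fdet n (\<lambda>a i. G i (f a)) =
        (\<Sum>p\<in>?Q. \<Sum>q\<in>?Q. (signof p * (\<Prod>a = 0..<n. F (p a) (f a))) * (signof q * (\<Prod>a = 0..<n. G (q a) (f a))))"
      unfolding fdet_leibniz sum_product ..
    then show "fdet n (\<lambda>a i. F i (f a)) * fdet n (\<lambda>a i. G i (f a)) * (\<Prod>a = 0..<n. w (f a)) =
        (\<Sum>p\<in>?Q. \<Sum>q\<in>?Q. signof p * signof q * (\<Prod>a = 0..<n. F (p a) (f a) * G (q a) (f a) * w (f a)))"
      by (simp only: sum_distrib_right prod.distrib mult.assoc mult.left_commute)
  qed
  also have "\<dots> = (\<Sum>p\<in>?Q. \<Sum>q\<in>?Q. \<Sum>f\<in>{0..<n} \<rightarrow>\<^sub>E P. signof p * signof q * (\<Prod>a = 0..<n. F (p a) (f a) * G (q a) (f a) * w (f a)))"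
    by (subst sum.swap, intro sum.cong refl, rule sum.swap)
  also have "\<dots> = (\<Sum>p\<in>?Q. \<Sum>q\<in>?Q. signof p * signof q * (\<Prod>a = 0..<n. \<Sum>s\<in>P. F (p a) s * G (q a) s * w s))"
  proof (intro sum.cong refl)
    fix p q
    have "(\<Prod>a = 0..<n. \<Sum>s\<in>P. F (p a) s * G (q a) s * w s) =
        (\<Sum>f\<in>{0..<n} \<rightarrow>\<^sub>E P. \<Prod>a = 0..<n. F (p a) (f a) * G (q a) (f a) * w (f a))"
      using prod_sum_PiE[of "{0..<n}" "\<lambda>_. P" "\<lambda>a s. F (p a) s * G (q a) s * w s"] P by simp
    then show "(\<Sum>f\<in>{0..<n} \<rightarrow>\<^sub>E P. signof p * signof q * (\<Prod>a = 0..<n. F (p a) (f a) * G (q a) (f a) * w (f a))) =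
        signof p * signof q * (\<Prod>a = 0..<n. \<Sum>s\<in>P. F (p a) s * G (q a) s * w s)"
      by (simp add: sum_distrib_left)
  qed
  finally show ?thesis .
qed

section \<open>The one-point sum\<close>

text \<open>The distance of the p-th position on a line from the axis, in half steps. Positions are
  numbered from 1.\<close>

definition val :: "nat \<Rightarrow> real" where
  "val p = 2 * real p - 1"

text \<open>The weight of one point p in {m+1..m+N}: the distance val p, times the differences of squared
  distances to the positions 1..m to its left and to the d positions m+N+1..m+N+d to its
  right.\<close>

definition wt :: "nat \<Rightarrow> nat \<Rightarrow> nat \<Rightarrow> nat \<Rightarrow> real" where
  "wt m N d p = val p * (\<Prod>q\<in>{1..m}. (val p)\<^sup>2 - (val q)\<^sup>2) * (\<Prod>q\<in>{m+N+1..m+N+d}. (val q)\<^sup>2 - (val p)\<^sup>2)"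

definition beta_const :: "nat \<Rightarrow> nat \<Rightarrow> real" where
  "beta_const m d = 4 ^ (m + d) * fact m * fact d / fact (m + d + 1)"

lemma odd_newton_val: "odd_newton m x = (\<Prod>q\<in>{1..m}. x\<^sup>2 - (val q)\<^sup>2)"
  by (induction m) (auto simp: odd_newton_def val_def add_ac)

lemma even_newton_double:
  "even_newton (Suc m) (2 * real (N + m)) = 4 ^ Suc m * pochhammer (real N) (Suc m) * pochhammer (real (N + m)) (Suc m)"
proof -
  have "even_newton (Suc m) (2 * real (N + m)) = (\<Prod>i = 0..<Suc m. 4 * ((real (N + m) - real i) * (real (N + m) + real i)))"
    unfolding even_newton_def by (intro prod.cong refl) (simp add: power2_eq_square algebra_simps)
  also have "\<dots> = 4 ^ Suc m * (\<Prod>i = 0..<Suc m. real (N + m) - real i) * (\<Prod>i = 0..<Suc m. real (N + m) + real i)"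
    by (simp only: prod.distrib) simp
  also have "(\<Prod>i = 0..<Suc m. real (N + m) - real i) = (\<Prod>i = 0..<Suc m. real N + real i)"
    by (rule prod.reindex_bij_witness[where i = "\<lambda>i. m - i" and j = "\<lambda>i. m - i"]) (auto simp: of_nat_diff)
  finally show ?thesis by (simp only: pochhammer_prod)
qed

text \<open>By induction on d: the last factor, at e = m+N+d+1, is the difference of a constant and
  the factor at m+1, by which the weight for (m,N) becomes the one for (m+1,N-1).\<close>

lemma one_point_sum:
  "(\<Sum>p\<in>{m+1..m+N}. wt m N d p) =
    beta_const m d * pochhammer (real N) (m + d + 1) * pochhammer (real (N + m)) (m + d + 1)"
proof (induction d arbitrary: m N)
  case 0
  have "(\<Sum>p\<in>{m+1..m+N}. wt m N 0 p) = (\<Sum>p\<in>{m+1..m+N}. val p * odd_newton m (val p))"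
    by (intro sum.cong refl) (simp add: wt_def odd_newton_val)
  also have "\<dots> = (\<Sum>p\<in>{m+1..m+N}. (even_newton (Suc m) (2 * real p) - even_newton (Suc m) (2 * real (p - 1))) / (4 * (real m + 1)))"
  proof (rule sum.cong[OF refl])
    fix p assume p: "p \<in> {m+1..m+N}"
    have "even_newton (Suc m) (val p + 1) - even_newton (Suc m) (val p - 1) = 4 * (real m + 1) * (val p * odd_newton m (val p))"
      by (rule odd_newton_antidifference)
    moreover have "val p + 1 = 2 * real p" "val p - 1 = 2 * real (p - 1)"
      using p by (auto simp: val_def of_nat_diff)
    ultimately have "even_newton (Suc m) (2 * real p) - even_newton (Suc m) (2 * real (p - 1)) = 4 * (real m + 1) * (val p * odd_newton m (val p))"
      by simp
    then show "val p * odd_newton m (val p) =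
        (even_newton (Suc m) (2 * real p) - even_newton (Suc m) (2 * real (p - 1))) / (4 * (real m + 1))"
      by (simp add: field_simps)
  qed
  also have "\<dots> = (even_newton (Suc m) (2 * real (m + N)) - even_newton (Suc m) (2 * real m)) / (4 * (real m + 1))"
  proof (induction N)
    case (Suc N)
    have "{m+1..m+Suc N} = insert (m + Suc N) {m+1..m+N}" by auto
    then show ?case using Suc by (simp add: diff_divide_distrib del: of_nat_Suc of_nat_add)
  qed simp
  also have "even_newton (Suc m) (2 * real m) = 0"
    by (simp add: even_newton_def)
  also have "even_newton (Suc m) (2 * real (m + N)) = 4 ^ Suc m * pochhammer (real N) (Suc m) * pochhammer (real (N + m)) (Suc m)"
    using even_newton_double[of m N] by (simp only: add.commute)
  finally have "(\<Sum>p\<in>{m+1..m+N}. wt m N 0 p) =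
      4 ^ Suc m / (4 * (real m + 1)) * pochhammer (real N) (Suc m) * pochhammer (real (N + m)) (Suc m)"
    by simp
  moreover have "beta_const m 0 = 4 ^ Suc m / (4 * (real m + 1))"
  proof -
    have "fact (m + 1) = (real m + 1) * fact m" by (simp add: add.commute)
    then show ?thesis by (simp add: beta_const_def) (simp add: field_simps)
  qed
  ultimately show ?case by simp
next
  case (Suc d)
  show ?case
  proof (cases "N = 0")
    case True
    then show ?thesis by (simp add: pochhammer_0_left)
  next
    case False
    then obtain N' where N: "N = Suc N'" by (cases N) auto
    let ?e = "val (m + N + d + 1)" and ?P1 = "pochhammer (real N) (m + d + 1)" and ?P2 = "pochhammer (real (N + m)) (m + d + 1)"
    have "(\<Sum>p\<in>{m+1..m+N}. wt m N (Suc d) p) =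
        (\<Sum>p\<in>{m+1..m+N}. (?e\<^sup>2 - (val (m + 1))\<^sup>2) * wt m N d p - wt (m + 1) N' d p)"
    proof (rule sum.cong[OF refl])
      fix p
      have 1: "{m+N+1..m+N+Suc d} = insert (m+N+d+1) {m+N+1..m+N+d}" by auto
      have 2: "{1..m+1} = insert (m+1) {1..m}" by auto
      have 3: "{m+1+N'+1..m+1+N'+d} = {m+N+1..m+N+d}" using N by simp
      \<comment> \<open>The factor at e is the difference of a constant and the factor at m +
        1.\<close>
      show "wt m N (Suc d) p = (?e\<^sup>2 - (val (m + 1))\<^sup>2) * wt m N d p - wt (m + 1) N' d p"
        unfolding wt_def 1 2 3 by (simp add: algebra_simps)
    qed
    also have "\<dots> = (?e\<^sup>2 - (val (m + 1))\<^sup>2) * (\<Sum>p\<in>{m+1..m+N}. wt m N d p) - (\<Sum>p\<in>{m+1..m+N}. wt (m + 1) N' d p)"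
      by (simp add: sum_subtractf sum_distrib_left)
    also have "(\<Sum>p\<in>{m+1..m+N}. wt (m + 1) N' d p) = (\<Sum>p\<in>{(m+1)+1..(m+1)+N'}. wt (m + 1) N' d p)"
    proof (rule sum.mono_neutral_right)
      have "wt (m + 1) N' d (m + 1) = 0"
        by (simp add: wt_def)
      moreover have "{m+1..m+N} - {(m+1)+1..(m+1)+N'} \<subseteq> {m + 1}"
        using N by auto
      ultimately show "\<forall>p\<in>{m+1..m+N} - {(m+1)+1..(m+1)+N'}. wt (m + 1) N' d p = 0"
        by blast
    qed (use N in auto)
    also have "\<dots> = beta_const (m + 1) d * pochhammer (real N') (m + 1 + d + 1) * pochhammer (real (N' + (m + 1))) (m + 1 + d + 1)"
      by (rule Suc.IH)
    also have "(\<Sum>p\<in>{m+1..m+N}. wt m N d p) = beta_const m d * pochhammer (real N) (m + d + 1) * pochhammer (real (N + m)) (m + d + 1)"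
      by (rule Suc.IH)
    also have "pochhammer (real N') (m + 1 + d + 1) = (real N - 1) * pochhammer (real N) (m + d + 1)"
      using N by (simp add: pochhammer_rec)
    also have "real (N' + (m + 1)) = real (N + m)"
      using N by simp
    also have "pochhammer (real (N + m)) (m + 1 + d + 1) = pochhammer (real (N + m)) (m + d + 1) * (real N + 2 * real m + real d + 1)"
      by (simp add: pochhammer_Suc add_ac)
    also have "?e\<^sup>2 - (val (m + 1))\<^sup>2 = 4 * (real N + real d) * (real N + 2 * real m + real d + 1)"
      by (simp add: val_def power2_eq_square algebra_simps)
    also have "beta_const (m + 1) d = beta_const m d * (4 * (real m + 1) / (real m + real d + 2))"
      by (simp add: beta_const_def field_simps)
    finally have sum: "(\<Sum>p\<in>{m+1..m+N}. wt m N (Suc d) p) =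
        4 * (real N + real d) * (real N + 2 * real m + real d + 1) * (beta_const m d * ?P1 * ?P2)
        - beta_const m d * (4 * (real m + 1) / (real m + real d + 2)) * ((real N - 1) * ?P1) * (?P2 * (real N + 2 * real m + real d + 1))" .
    have "beta_const m (Suc d) = beta_const m d * (4 * (real d + 1) / (real m + real d + 2))"
      by (simp add: beta_const_def field_simps)
    moreover have "pochhammer (real N) (m + Suc d + 1) = ?P1 * (real N + real m + real d + 1)"
      by (simp add: pochhammer_Suc add_ac)
    moreover have "pochhammer (real (N + m)) (m + Suc d + 1) = ?P2 * (real N + 2 * real m + real d + 1)"
      by (simp add: pochhammer_Suc add_ac)
    moreover have "(real N + real d) - (real m + 1) / (real m + real d + 2) * (real N - 1) =
        (real d + 1) / (real m + real d + 2) * (real N + real m + real d + 1)"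
    proof -
      have "real m + real d + 2 > 0" by simp
      then show ?thesis by (simp add: field_simps)
    qed
    then have "4 * (real N + 2 * real m + real d + 1) * (beta_const m d * ?P1 * ?P2) * ((real N + real d) - (real m + 1) / (real m + real d + 2) * (real N - 1)) =
        4 * (real N + 2 * real m + real d + 1) * (beta_const m d * ?P1 * ?P2) * ((real d + 1) / (real m + real d + 2) * (real N + real m + real d + 1))"
      by (simp only:)
    ultimately show ?thesis
      unfolding sum by (simp only: right_diff_distrib times_divide_eq_left times_divide_eq_right mult_ac)
  qed
qed

section \<open>The multiple sum\<close>

text \<open>The sum over all sets of n among N consecutive positions, weighted by the square of the
  Vandermonde product and the weights of the points.\<close>

definition Zsum :: "nat \<Rightarrow> nat \<Rightarrow> nat \<Rightarrow> nat \<Rightarrow> real" where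
  "Zsum m n N d = (\<Sum>S\<in>{S \<in> Pow {m+1..m+N}. card S = n}. (vdm (\<lambda>p. (val p)\<^sup>2) S)\<^sup>2 * (\<Prod>p\<in>S. wt m N d p))"

text \<open>The part of Zsum that depends on N.\<close>

definition Zprod :: "nat \<Rightarrow> nat \<Rightarrow> nat \<Rightarrow> nat \<Rightarrow> real" where
  "Zprod m n N d = (\<Prod>i = 0..<n. pochhammer (real N - real i) (m + d + 1 + 2 * i) *
     pochhammer (real (N + m) - real i) (m + d + 1 + 2 * i))"

text \<open>Multiplying the weight by the next i factors on the right and the last j factors inside
  the range of summation gives again a weight of the same form.\<close>

lemma multi_entry:
  assumes "j \<le> N"
  shows "(\<Sum>s\<in>{m+1..m+N}. (\<Prod>k = 0..<i. (val (m + N + d + 1 + k))\<^sup>2 - (val s)\<^sup>2) *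
      (\<Prod>k = 0..<j. (val (m + N - k))\<^sup>2 - (val s)\<^sup>2) * wt m N d s) =
    beta_const m (d + i + j) *
    (pochhammer (real N) (m + d + 1 + i) * pochhammer (real (N + m)) (m + d + 1 + i)) *
    (pochhammer (real N - real j) j * pochhammer (real (N + m) - real j) j)"
proof -
  let ?g = "\<lambda>s q. (val q)\<^sup>2 - (val s)\<^sup>2"
  let ?f = "\<lambda>s. (\<Prod>k = 0..<i. ?g s (m + N + d + 1 + k)) * (\<Prod>k = 0..<j. ?g s (m + N - k)) * wt m N d s"
  have f: "?f s = wt m (N - j) (d + i + j) s" for s
  proof -
    have top: "(\<Prod>k = 0..<i. ?g s (m + N + d + 1 + k)) = (\<Prod>q\<in>{m+N+d+1..m+N+d+i}. ?g s q)"
      by (rule prod.reindex_bij_witness[where i = "\<lambda>q. q - (m + N + d + 1)" and j = "\<lambda>k. m + N + d + 1 + k"]) auto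
    have low: "(\<Prod>k = 0..<j. ?g s (m + N - k)) = (\<Prod>q\<in>{m+N-j+1..m+N}. ?g s q)"
      by (rule prod.reindex_bij_witness[where i = "\<lambda>q. m + N - q" and j = "\<lambda>k. m + N - k"]) (use assms in auto)
    have un: "{m + (N - j) + 1..m + (N - j) + (d + i + j)} = {m+N-j+1..m+N} \<union> ({m+N+1..m+N+d} \<union> {m+N+d+1..m+N+d+i})"
      using assms by auto
    have "(\<Prod>q\<in>{m + (N - j) + 1..m + (N - j) + (d + i + j)}. ?g s q) =
        (\<Prod>q\<in>{m+N-j+1..m+N}. ?g s q) * ((\<Prod>q\<in>{m+N+1..m+N+d}. ?g s q) * (\<Prod>q\<in>{m+N+d+1..m+N+d+i}. ?g s q))"
      unfolding un by (subst prod.union_disjoint; (subst prod.union_disjoint)?; auto)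
    then show ?thesis
      unfolding top low wt_def by (simp add: mult_ac)
  qed
  have "(\<Sum>s\<in>{m+1..m+N}. ?f s) = (\<Sum>s\<in>{m+1..m+(N-j)}. ?f s)"
  proof (rule sum.mono_neutral_right)
    show "\<forall>s\<in>{m+1..m+N} - {m+1..m+(N-j)}. ?f s = 0"
    proof
      fix s assume s: "s \<in> {m+1..m+N} - {m+1..m+(N-j)}"
      have "(\<Prod>k = 0..<j. ?g s (m + N - k)) = 0"
        by (rule prod_zero) (use s assms in \<open>auto intro!: bexI[of _ "m + N - s"]\<close>)
      then show "?f s = 0" by simp
    qed
  qed (use assms in auto)
  also have "\<dots> = (\<Sum>s\<in>{m+1..m+(N-j)}. wt m (N - j) (d + i + j) s)"
    by (simp only: f)
  also have "\<dots> = beta_const m (d + i + j) * pochhammer (real (N - j)) (m + (d + i + j) + 1) *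
      pochhammer (real (N - j + m)) (m + (d + i + j) + 1)"
    by (rule one_point_sum)
  also have "m + (d + i + j) + 1 = j + (m + d + 1 + i)"
    by simp
  also have "pochhammer (real (N - j)) (j + (m + d + 1 + i)) = pochhammer (real N - real j) j * pochhammer (real N) (m + d + 1 + i)"
    using assms by (subst pochhammer_product') (simp add: of_nat_diff)
  also have "pochhammer (real (N - j + m)) (j + (m + d + 1 + i)) = pochhammer (real (N + m) - real j) j * pochhammer (real (N + m)) (m + d + 1 + i)"
    using assms by (subst pochhammer_product') (simp add: of_nat_diff algebra_simps)
  finally show ?thesis by (simp add: mult_ac)
qed

text \<open>The two Vandermonde factors are written as determinants in two different Newton bases,
  one growing to the right of the range of summation, the other downwards from its right end. All
  sums that occur in the double Leibniz expansion are then one-point sums, and in each of them the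
  dependence on N splits into a factor depending on the row index i and one depending on the column
  index j. The product of these factors does not depend on the two permutations.\<close>

lemma Zsum_proportional:
  obtains c where "\<And>N. n \<le> N \<Longrightarrow> Zsum m n N d = c * Zprod m n N d"
proof -
  let ?Q = "{p. p permutes {0..<n}}"
  define c where "c = (\<Sum>p\<in>?Q. \<Sum>q\<in>?Q. signof p * signof q * (\<Prod>a = 0..<n. beta_const m (d + p a + q a))) / fact n"
  have "Zsum m n N d = c * Zprod m n N d" if N: "n \<le> N" for N
  proof -
    let ?P = "{m+1..m+N}"
    let ?t = "\<lambda>s. - (val s)\<^sup>2"
    let ?F = "\<lambda>i s. \<Prod>k = 0..<i. (val (m + N + d + 1 + k))\<^sup>2 - (val s)\<^sup>2"
    let ?G = "\<lambda>j s. \<Prod>k = 0..<j. (val (m + N - k))\<^sup>2 - (val s)\<^sup>2"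
    let ?R = "\<lambda>i. pochhammer (real N) (m + d + 1 + i) * pochhammer (real (N + m)) (m + d + 1 + i)"
    let ?C = "\<lambda>j. pochhammer (real N - real j) j * pochhammer (real (N + m) - real j) j"
    \<comment> \<open>With t the negative square, both determinants are the same Vandermonde
      product, without signs.\<close>
    have F: "fdet n (\<lambda>a i. ?F i (f a)) = (\<Prod>i = 0..<n. \<Prod>j = 0..<i. ?t (f i) - ?t (f j))" for f
      using vandermonde_newton[of n "\<lambda>a. ?t (f a)" "\<lambda>k. - (val (m + N + d + 1 + k))\<^sup>2"] by simp
    have G: "fdet n (\<lambda>a i. ?G i (f a)) = (\<Prod>i = 0..<n. \<Prod>j = 0..<i. ?t (f i) - ?t (f j))" for f
      using vandermonde_newton[of n "\<lambda>a. ?t (f a)" "\<lambda>k. - (val (m + N - k))\<^sup>2"] by simp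
    have "(vdm ?t S)\<^sup>2 = (vdm (\<lambda>p. (val p)\<^sup>2) S)\<^sup>2" if "S \<in> {S \<in> Pow ?P. card S = n}" for S
    proof -
      have "finite S" using that finite_subset by auto
      then show ?thesis by (simp add: vdm_square abs_minus_commute)
    qed
    then have "fact n * Zsum m n N d = fact n * (\<Sum>S\<in>{S \<in> Pow ?P. card S = n}. (vdm ?t S)\<^sup>2 * (\<Prod>p\<in>S. wt m N d p))"
      unfolding Zsum_def by (intro arg_cong2[of _ _ _ _ "(*)"] sum.cong refl) simp
    also have "\<dots> = (\<Sum>f\<in>{0..<n} \<rightarrow>\<^sub>E ?P. (\<Prod>i = 0..<n. \<Prod>j = 0..<i. ?t (f i) - ?t (f j))\<^sup>2 * (\<Prod>i = 0..<n. wt m N d (f i)))"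
      by (rule sum_tuples_subsets[symmetric]) simp
    also have "\<dots> = (\<Sum>f\<in>{0..<n} \<rightarrow>\<^sub>E ?P. fdet n (\<lambda>a i. ?F i (f a)) * fdet n (\<lambda>a i. ?G i (f a)) * (\<Prod>i = 0..<n. wt m N d (f i)))"
      by (intro sum.cong refl) (simp only: F G, subst power2_eq_square, rule refl)
    also have "\<dots> = (\<Sum>p\<in>?Q. \<Sum>q\<in>?Q. signof p * signof q * (\<Prod>a = 0..<n. \<Sum>s\<in>?P. ?F (p a) s * ?G (q a) s * wt m N d s))"
      by (rule sum_tuples_fdet) simp
    also have "\<dots> = (\<Sum>p\<in>?Q. \<Sum>q\<in>?Q. (signof p * signof q * (\<Prod>a = 0..<n. beta_const m (d + p a + q a))) * Zprod m n N d)"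
    proof (intro sum.cong refl)
      fix p q assume pq: "p \<in> ?Q" "q \<in> ?Q"
      have "(\<Prod>a = 0..<n. \<Sum>s\<in>?P. ?F (p a) s * ?G (q a) s * wt m N d s) =
          (\<Prod>a = 0..<n. beta_const m (d + p a + q a) * ?R (p a) * ?C (q a))"
      proof (intro prod.cong refl multi_entry)
        fix a assume "a \<in> {0..<n}"
        then have "q a \<in> {0..<n}" using pq by (simp add: permutes_in_image del: atLeastLessThan_iff)
        then show "q a \<le> N" using N by simp
      qed
      also have "\<dots> = (\<Prod>a = 0..<n. beta_const m (d + p a + q a)) * ((\<Prod>a = 0..<n. ?R (p a)) * (\<Prod>a = 0..<n. ?C (q a)))"
        by (simp only: prod.distrib mult.assoc)
      \<comment> \<open>A product over all rows or columns is not affected by the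
        permutation.\<close>
      also have "(\<Prod>a = 0..<n. ?R (p a)) = (\<Prod>a = 0..<n. ?R a)"
        using prod.permute[of p "{0..<n}" ?R] pq by (simp add: comp_def)
      also have "(\<Prod>a = 0..<n. ?C (q a)) = (\<Prod>a = 0..<n. ?C a)"
        using prod.permute[of q "{0..<n}" ?C] pq by (simp add: comp_def)
      also have "(\<Prod>a = 0..<n. ?R a) * (\<Prod>a = 0..<n. ?C a) = Zprod m n N d"
        unfolding Zprod_def prod.distrib[symmetric]
      proof (intro prod.cong refl)
        fix i
        have e: "m + d + 1 + 2 * i = i + (m + d + 1 + i)" by simp
        show "?R i * ?C i = pochhammer (real N - real i) (m + d + 1 + 2 * i) * pochhammer (real (N + m) - real i) (m + d + 1 + 2 * i)"
          unfolding e pochhammer_product'[of "_ - real i"] by (simp add: mult_ac)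
      qed
      finally show "signof p * signof q * (\<Prod>a = 0..<n. \<Sum>s\<in>?P. ?F (p a) s * ?G (q a) s * wt m N d s) =
          (signof p * signof q * (\<Prod>a = 0..<n. beta_const m (d + p a + q a))) * Zprod m n N d"
        by (simp only: mult.assoc)
    qed
    also have "\<dots> = (fact n * c) * Zprod m n N d"
      by (simp add: c_def sum_distrib_right[symmetric])
    finally show ?thesis by simp
  qed
  then show ?thesis by (rule that)
qed

lemma Zprod_pos: "n \<le> N \<Longrightarrow> Zprod m n N d > 0"
  unfolding Zprod_def by (intro prod_pos mult_pos_pos pochhammer_pos) auto

lemma Zsum_ratio:
  assumes "n \<le> N" "n \<le> N'"
  shows "Zsum m n N d * Zprod m n N' d = Zsum m n N' d * Zprod m n N d"
proof -
  obtain c where "\<And>N. n \<le> N \<Longrightarrow> Zsum m n N d = c * Zprod m n N d"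
    using Zsum_proportional[of n m d] by blast
  then show ?thesis using assms by simp
qed

lemma Zsum_base: "Zsum m n n d = (vdm (\<lambda>p. (val p)\<^sup>2) {m+1..m+n})\<^sup>2 * (\<Prod>p\<in>{m+1..m+n}. wt m n d p)"
proof -
  have "S = {m+1..m+n}" if "S \<subseteq> {m+1..m+n}" "card S = n" for S
    using that by (intro card_subset_eq) auto
  then have "{S \<in> Pow {m+1..m+n}. card S = n} = {{m+1..m+n}}" by auto
  then show ?thesis by (simp add: Zsum_def)
qed


section \<open>Unit triangles as cells\<close>

text \<open>The unit triangle in row -1 - u whose column number is u + k. With the boundary starting
  at the origin by a zigzag (SW,SE), the westernmost triangles have k = 0.\<close>

definition cell :: "int \<times> int \<Rightarrow> tri" where
  "cell = (\<lambda>(u, k). if even (u + k) then Up ((u + k) div 2) (-1 - u) else Down ((u + k) div 2) (-1 - u))"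

lemma row_cell [simp]: "row (cell (u, k)) = -1 - u"
  by (simp add: cell_def)

lemma col_cell [simp]: "col (cell (u, k)) = u + k"
  by (auto simp: cell_def elim!: oddE)

lemma inj_cell: "inj cell"
proof (rule injI)
  fix x y assume "cell x = cell y"
  then have "row (cell x) = row (cell y)" "col (cell x) = col (cell y)" by simp_all
  then show "x = y" by (cases x, cases y) simp
qed

lemma cell_surj: "t = cell (-1 - row t, col t + 1 + row t)"
  by (cases t) (auto simp: cell_def)

lemma range_cell [simp]: "range cell = UNIV"
  using cell_surj by blast

lemma cell_image_iff: "cell x \<in> cell ` R \<longleftrightarrow> x \<in> R"
  using inj_cell by (rule inj_image_mem_iff)

lemma set_as_cells: "A = cell ` {x. cell x \<in> A}"
proof -
  have "t \<in> cell ` {x. cell x \<in> A}" if "t \<in> A" for t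
    using that cell_surj[of t] by (metis (mono_tags) image_eqI mem_Collect_eq)
  then show ?thesis by blast
qed

lemma eq_cells: "(\<And>u k. cell (u, k) \<in> A \<longleftrightarrow> (u, k) \<in> R) \<Longrightarrow> A = cell ` R"
  using set_as_cells[of A] by (metis (mono_tags, lifting) Collect_cong mem_Collect_eq set_eq_iff surj_pair)

lemma cell_diff: "cell ` A - cell ` B = cell ` (A - B)"
  using inj_cell by (simp add: image_set_diff)

lemma cell_vbrick:
  assumes "even (u + k)"
  shows "cell ` vbrick u k = vert_lozenge ((u + k) div 2) (-1 - u)"
proof -
  have "(u + 1 + k) div 2 = (u + k) div 2" "odd (u + 1 + k)"
    using assms by presburger+
  then show ?thesis
    using assms by (simp add: vbrick_def vert_lozenge_def cell_def)
qed

lemma cell_bricks: "(`) cell ` bricks = lozenges"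
proof (intro equalityI subsetI)
  fix l assume "l \<in> (`) cell ` bricks"
  then consider (h) u k where "l = cell ` hbrick u k" | (v) u k where "l = cell ` vbrick u k" "even (u + k)"
    by (auto simp: bricks_def)
  then show "l \<in> lozenges"
  proof cases
    case h
    show ?thesis
    proof (cases "even (u + k)")
      case True
      then have "l = {Up ((u + k) div 2) (-1 - u), Down ((u + k) div 2) (-1 - u)}"
      proof -
        have "(u + (k + 1)) div 2 = (u + k) div 2" "odd (u + (k + 1))"
          using True by presburger+
        then show ?thesis
          unfolding h using True by (simp add: hbrick_def cell_def)
      qed
      then show ?thesis by (auto simp: lozenges_def)
    next
      case False
      then have "l = {Up ((u + k) div 2 + 1) (-1 - u), Down ((u + k) div 2 + 1 - 1) (-1 - u)}"
      proof -
        have "(u + (k + 1)) div 2 = (u + k) div 2 + 1" "even (u + (k + 1))"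
          using False by presburger+
        then show ?thesis
          unfolding h using False by (simp add: hbrick_def cell_def insert_commute)
      qed
      then show ?thesis unfolding lozenges_def by blast
    qed
  next
    case v
    then show ?thesis by (auto simp: cell_vbrick lozenges_def)
  qed
next
  fix l assume "l \<in> lozenges"
  then consider (v) i j where "l = vert_lozenge i j" | (r) i j where "l = {Up i j, Down i j}"
    | (s) i j where "l = {Up i j, Down (i - 1) j}"
    by (auto simp: lozenges_def)
  then show "l \<in> (`) cell ` bricks"
  proof cases
    case v
    have "l = cell ` vbrick (-1 - j) (2 * i + j + 1)"
      unfolding v by (subst cell_vbrick) auto
    moreover have "vbrick (-1 - j) (2 * i + j + 1) \<in> bricks" by (auto simp: bricks_def)
    ultimately show ?thesis by blast
  next
    case r
    have "l = cell ` hbrick (-1 - j) (2 * i + j + 1)"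
      unfolding r by (auto simp: hbrick_def cell_def)
    moreover have "hbrick (-1 - j) (2 * i + j + 1) \<in> bricks" by (auto simp: bricks_def)
    ultimately show ?thesis by blast
  next
    case s
    have "l = cell ` hbrick (-1 - j) (2 * i + j)"
      unfolding s by (auto simp: hbrick_def cell_def)
    moreover have "hbrick (-1 - j) (2 * i + j) \<in> bricks" by (auto simp: bricks_def)
    ultimately show ?thesis by blast
  qed
qed

lemma weighted_tilings_cells: "weighted_tilings w (cell ` R) = cov bricks (\<lambda>l. w (cell ` l)) R"
  unfolding weighted_tilings_eq_cov using cell_bricks by (intro cov_image inj_cell) simp

lemma num_tilings_cells: "num_tilings (cell ` R) = bcov 1 R"
  unfolding num_tilings_def weighted_tilings_cells by (intro cov_cong) (simp add: axis_weight_def)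

section \<open>Winding numbers\<close>

text \<open>The contribution of one step to the winding number.\<close>

definition wstep :: "point \<Rightarrow> dir \<Rightarrow> tri \<Rightarrow> int" where
  "wstep p d t = (if fst p + fst (p + vec d) \<le> col t
     then (if snd p = row t + 1 \<and> snd (p + vec d) = row t then 1
           else if snd p = row t \<and> snd (p + vec d) = row t + 1 then -1 else 0)
     else 0)"

lemma wstep_simps [simp]:
  "wstep p East t = 0" "wstep p West t = 0"
  "wstep (i, j) NE t = (if row t = j \<and> 2 * i \<le> col t then -1 else 0)"
  "wstep (i, j) NW t = (if row t = j \<and> 2 * i - 1 \<le> col t then -1 else 0)"
  "wstep (i, j) SE t = (if row t = j - 1 \<and> 2 * i + 1 \<le> col t then 1 else 0)"
  "wstep (i, j) SW t = (if row t = j - 1 \<and> 2 * i \<le> col t then 1 else 0)"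
  by (auto simp: wstep_def)

text \<open>The winding number of a path with starting point p.\<close>

fun wind :: "point \<Rightarrow> dir list \<Rightarrow> tri \<Rightarrow> int" where
  "wind p [] t = 0"
| "wind p (d # ds) t = wstep p d t + wind (p + vec d) ds t"

lemma path_end_simps [simp]: "path_end [] = 0" "path_end (d # ds) = vec d + path_end ds" "path_end (xs @ ys) = path_end xs + path_end ys"
  by (simp_all add: path_end_def)

lemma winding_eq_wind: "winding ds t = wind (0, 0) ds t"
proof -
  have "(\<Sum>(p, q)\<leftarrow>steps_from p ds. if fst p + fst q \<le> col t
     then (if snd p = row t + 1 \<and> snd q = row t then 1
           else if snd p = row t \<and> snd q = row t + 1 then -1 else 0)
     else 0) = wind p ds t" for p
    by (induction ds arbitrary: p) (simp_all add: wstep_def)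
  then show ?thesis
    by (simp add: winding_def path_steps_def)
qed

lemma wind_append [simp]: "wind p (xs @ ys) t = wind p xs t + wind (p + path_end xs) ys t"
  by (induction xs arbitrary: p) (simp_all add: add.assoc)

lemma rep_0 [simp]: "rep 0 ds = []"
  by (simp add: rep_def)

lemma rep_Suc: "rep (Suc n) ds = ds @ rep n ds"
  by (simp add: rep_def)

lemma path_end_replicate [simp]: "path_end (replicate n d) = (int n * fst (vec d), int n * snd (vec d))"
  by (induction n) (auto simp: zero_prod_def prod_eq_iff algebra_simps)

lemma path_end_rep [simp]: "path_end (rep n ds) = (int n * fst (path_end ds), int n * snd (path_end ds))"
  by (induction n) (auto simp: rep_Suc zero_prod_def prod_eq_iff algebra_simps)

lemma wind_East [simp]: "wind p (replicate n East) t = 0"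
  by (induction n arbitrary: p) simp_all

lemma wind_West [simp]: "wind p (replicate n West) t = 0"
  by (induction n arbitrary: p) simp_all

lemma wind_NE [simp]: "wind (i, j) (replicate n NE) t =
    (if j \<le> row t \<and> row t < j + int n \<and> 2 * i \<le> col t then -1 else 0)"
proof (induction n arbitrary: j)
  case (Suc n)
  show ?case using Suc[of "j + 1"] by auto
qed simp

lemma wind_NW [simp]: "wind (i, j) (replicate n NW) t =
    (if j \<le> row t \<and> row t < j + int n \<and> 2 * (i - (row t - j)) - 1 \<le> col t then -1 else 0)"
proof (induction n arbitrary: i j)
  case (Suc n)
  show ?case using Suc[of "i - 1" "j + 1"] by auto
qed simp

lemma wind_SE [simp]: "wind (i, j) (replicate n SE) t =
    (if j - int n \<le> row t \<and> row t < j \<and> 2 * i + 1 + 2 * (j - 1 - row t) \<le> col t then 1 else 0)"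
proof (induction n arbitrary: i j)
  case (Suc n)
  show ?case using Suc[of "i + 1" "j - 1"] by auto
qed simp

lemma wind_zigzag [simp]: "wind (i, j) (rep n [SW, SE]) t =
    (if j - 2 * int n \<le> row t \<and> row t < j \<and> 2 * i + (j - 1 - row t) \<le> col t then 1 else 0)"
proof (induction n arbitrary: i j)
  case (Suc n)
  show ?case using Suc[of "i + 1" "j - 2"] by (auto simp: rep_Suc)
qed simp

lemma wind_zigzag' [simp]: "wind (i, j) (rep n [SE, SW]) t =
    (if j - 2 * int n \<le> row t \<and> row t < j \<and> 2 * i + 1 + (j - 1 - row t) \<le> col t then 1 else 0)"
proof (induction n arbitrary: i j)
  case (Suc n)
  show ?case using Suc[of "i + 1" "j - 2"] by (auto simp: rep_Suc)
qed simp

section \<open>The polygons\<close>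

lemma Q_polygon_cells:
  "polygon (rep n [SW, SE] @ replicate (n + c) East @ replicate (2 * n) NW @ replicate c West) = cell ` trapezoid (2 * n) c"
proof (rule eq_cells)
  fix u k
  show "cell (u, k) \<in> polygon (rep n [SW, SE] @ replicate (n + c) East @ replicate (2 * n) NW @ replicate c West) \<longleftrightarrow> (u, k) \<in> trapezoid (2 * n) c"
    by (simp add: polygon_def winding_eq_wind trapezoid_def) linarith
qed

lemma K_polygon_cells:
  "polygon ((rep n [SW, SE] @ [SW]) @ replicate (Suc n + c) East @ replicate (Suc (2 * n)) NW @ replicate c West) =
    cell ` trapezoid (Suc (2 * n)) c"
proof (rule eq_cells)
  fix u k
  show "cell (u, k) \<in> polygon ((rep n [SW, SE] @ [SW]) @ replicate (Suc n + c) East @ replicate (Suc (2 * n)) NW @ replicate c West) \<longleftrightarrow>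
      (u, k) \<in> trapezoid (Suc (2 * n)) c"
    by (simp add: polygon_def winding_eq_wind trapezoid_def del: replicate_Suc) linarith
qed

lemma P_polygon_cells:
  assumes "a \<le> b"
  shows "P_polygon a b c = cell ` {(u, k). 0 \<le> u \<and> u < int a + int b \<and> 0 \<le> k \<and> u - 2 * int a + 1 \<le> k \<and>
      k \<le> 2 * int c + u \<and> k \<le> 2 * int (b + c) - 1 - u}"
proof (rule eq_cells)
  fix u k
  show "cell (u, k) \<in> P_polygon a b c \<longleftrightarrow> (u, k) \<in> {(u, k). 0 \<le> u \<and> u < int a + int b \<and> 0 \<le> k \<and> u - 2 * int a + 1 \<le> k \<and>
      k \<le> 2 * int c + u \<and> k \<le> 2 * int (b + c) - 1 - u}"
    using assms by (simp add: P_polygon_def polygon_def winding_eq_wind of_nat_diff) linarith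
qed

text \<open>The western boundary turns from (SW,SE) to (SE,SW) at the level of the marked line,
  which moves its position by one.\<close>

lemma H6_polygon_cells:
  assumes "z + even_sum a \<ge> 1"
  shows "H6_polygon x y z a = cell ` {(u, k). 0 \<le> u \<and> u < 2 * int (y + z + odd_sum a + even_sum a) - 1 \<and>
      (if u < 2 * int (y + odd_sum a) then 0 else 1) \<le> k \<and> k \<le> 2 * int (x + even_sum a) + u \<and>
      k \<le> 2 * int (x + y + z + even_sum a + 2 * odd_sum a) - 1 - u}"
proof -
  obtain m where m: "z + even_sum a = Suc m" using assms by (cases "z + even_sum a") auto
  then have e: "y + z + 2 * even_sum a - 1 = y + even_sum a + m" "z + even_sum a - 1 = m"
    "int z = int m + 1 - int (even_sum a)"
    by auto
  show ?thesis
  proof (rule eq_cells)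
    fix u k
    show "cell (u, k) \<in> H6_polygon x y z a \<longleftrightarrow> (u, k) \<in> {(u, k). 0 \<le> u \<and> u < 2 * int (y + z + odd_sum a + even_sum a) - 1 \<and>
      (if u < 2 * int (y + odd_sum a) then 0 else 1) \<le> k \<and> k \<le> 2 * int (x + even_sum a) + u \<and>
      k \<le> 2 * int (x + y + z + even_sum a + 2 * odd_sum a) - 1 - u}"
      using e(3) by (simp add: H6_polygon_def H6_west_def e(1,2) polygon_def winding_eq_wind) linarith
  qed
qed


section \<open>Removed triangles\<close>

text \<open>The up-pointing triangle of side s whose base lies in row u0 and starts at position
  k0.\<close>

definition utri :: "int \<Rightarrow> int \<Rightarrow> nat \<Rightarrow> (int \<times> int) set" where
  "utri u\<^sub>0 k\<^sub>0 s = {(u, k). u \<le> u\<^sub>0 \<and> k\<^sub>0 + (u\<^sub>0 - u) \<le> k \<and> k \<le> k\<^sub>0 + 2 * int s - 2 - (u\<^sub>0 - u)}"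

text \<open>The up-pointing unit triangles along the base of such a triangle.\<close>

definition utri_base :: "int \<Rightarrow> nat \<Rightarrow> int set" where
  "utri_base k\<^sub>0 s = (\<lambda>i. k\<^sub>0 + 2 * int i) ` {..<s}"

lemma up_triangle_cells: "cell (u, k) \<in> up_triangle (i, j) s \<longleftrightarrow> u \<le> -1 - j \<and> 2 * i \<le> u + k \<and> k - u \<le> 2 * (i + j + int s)"
proof (cases "even (u + k)")
  case True
  then obtain m where "u + k = 2 * m" by (rule evenE)
  then have "k = 2 * m - u" by simp
  then show ?thesis by (simp add: up_triangle_def cell_def) linarith
next
  case False
  then obtain m where "u + k = 2 * m + 1" by (rule oddE)
  then have "k = 2 * m + 1 - u" by simp
  then show ?thesis by (simp add: up_triangle_def cell_def) linarith
qed

lemma down_triangle_cells: "cell (u, k) \<in> down_triangle (i, j) s \<longleftrightarrow> - j \<le> u \<and> u + k + 1 \<le> 2 * (i + int s) \<and> 2 * (i + j) + 1 \<le> k - u"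
proof (cases "even (u + k)")
  case True
  then obtain m where "u + k = 2 * m" by (rule evenE)
  then have "k = 2 * m - u" by simp
  then show ?thesis by (simp add: down_triangle_def cell_def) linarith
next
  case False
  then obtain m where "u + k = 2 * m + 1" by (rule oddE)
  then have "k = 2 * m + 1 - u" by simp
  then show ?thesis by (simp add: down_triangle_def cell_def) linarith
qed

lemma above_left_cells: "cell (u, k) \<in> above_left (i, j) \<longleftrightarrow> u \<le> -1 - j \<and> k - u \<le> 2 * (i + j)"
proof (cases "even (u + k)")
  case True
  then obtain m where "u + k = 2 * m" by (rule evenE)
  then have "k = 2 * m - u" by simp
  then show ?thesis by (simp add: above_left_def cell_def) linarith
next
  case False
  then obtain m where "u + k = 2 * m + 1" by (rule oddE)
  then have "k = 2 * m + 1 - u" by simp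
  then show ?thesis by (simp add: above_left_def cell_def) linarith
qed

lemma utri_base_iff: "l \<in> utri_base k s \<longleftrightarrow> k \<le> l \<and> l \<le> k + 2 * int s - 2 \<and> even (l - k)"
proof
  assume l: "k \<le> l \<and> l \<le> k + 2 * int s - 2 \<and> even (l - k)"
  then obtain j where "l - k = 2 * j" unfolding dvd_def by blast
  then have "l = k + 2 * int (nat j)" "nat j < s" using l by auto
  then show "l \<in> utri_base k s" unfolding utri_base_def by blast
qed (auto simp: utri_base_def)

lemma finite_utri_base [simp]: "finite (utri_base k s)"
  by (simp add: utri_base_def)

text \<open>Several forced vertical lozenges side by side.\<close>

lemma bcov_forced_row:
  assumes "finite K" "finite R"
    and "\<And>k. k \<in> K \<Longrightarrow> (u + 1, k) \<in> R \<and> (u, k) \<in> R \<and> even (u + k) \<and> (u + 1, k + 1) \<notin> R \<and> (u + 1, k - 1) \<notin> R"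
  shows "bcov \<theta> R = (if 0 \<in> K then \<theta> else 1) * bcov \<theta> (R - {u, u + 1} \<times> K)"
  using assms
proof (induction K arbitrary: R rule: finite_induct)
  case (insert k K)
  have "bcov \<theta> R = (if k = 0 then \<theta> else 1) * bcov \<theta> (R - vbrick u k)"
    using insert.prems by (intro bcov_forced) auto
  also have "bcov \<theta> (R - vbrick u k) = (if 0 \<in> K then \<theta> else 1) * bcov \<theta> (R - vbrick u k - {u, u + 1} \<times> K)"
    using insert.prems insert.hyps by (intro insert.IH) (auto simp: vbrick_def)
  also have "R - vbrick u k - {u, u + 1} \<times> K = R - {u, u + 1} \<times> insert k K"
    by (auto simp: vbrick_def)
  finally show ?case using insert.hyps by auto
qed simp

text \<open>If only the up-pointing unit triangles along the base are removed, the rest of the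
  triangle is covered by forced vertical lozenges, row by row.\<close>

lemma bcov_utri:
  assumes "finite R" "even (u + k)" "0 \<le> k" "utri u k s \<subseteq> R"
  shows "bcov \<theta> (R - utri u k s) = bcov \<theta> (R - {u} \<times> utri_base k s)"
  using assms
proof (induction s arbitrary: R u k)
  case 0
  then show ?case by (simp add: utri_def utri_base_def) (intro arg_cong[of _ _ "cov _ _"], auto)
next
  case (Suc s)
  let ?D = "{u} \<times> utri_base k (Suc s)" and ?K = "utri_base (k + 1) s"
  let ?R = "R - ?D - {u} \<times> ?K"
  have K: "l \<in> ?K \<longleftrightarrow> k + 1 \<le> l \<and> l \<le> k + 2 * int s - 1 \<and> odd (l - k)" for l
    unfolding utri_base_iff by auto
  have D: "l \<in> utri_base k (Suc s) \<longleftrightarrow> k \<le> l \<and> l \<le> k + 2 * int s \<and> even (l - k)" for l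
    unfolding utri_base_iff by auto
  have un: "utri u k (Suc s) = ?D \<union> {u} \<times> ?K \<union> utri (u - 1) (k + 1) s"
  proof -
    have "(v, l) \<in> utri u k (Suc s) \<longleftrightarrow> (v, l) \<in> ?D \<union> {u} \<times> ?K \<union> utri (u - 1) (k + 1) s" for v l
      by (simp add: D K utri_def) presburger
    then show ?thesis by auto
  qed
  have "bcov \<theta> (R - ?D) = (if 0 \<in> ?K then \<theta> else 1) * bcov \<theta> (R - ?D - {u - 1, u - 1 + 1} \<times> ?K)"
  proof (rule bcov_forced_row)
    fix l assume l: "l \<in> ?K"
    then have "(u, l) \<in> utri u k (Suc s)" using un by blast
    then have "(u, l) \<in> R" using Suc.prems(4) by blast
    moreover have "(u - 1, l) \<in> utri u k (Suc s)" using l unfolding K utri_def by simp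
    then have "(u - 1, l) \<in> R" using Suc.prems(4) by blast
    moreover have "l \<notin> utri_base k (Suc s)" "l + 1 \<in> utri_base k (Suc s)" "l - 1 \<in> utri_base k (Suc s)" "even (u - 1 + l)"
      using l Suc.prems(2) unfolding K D by presburger+
    ultimately show "(u - 1 + 1, l) \<in> R - ?D \<and> (u - 1, l) \<in> R - ?D \<and> even (u - 1 + l) \<and>
        (u - 1 + 1, l + 1) \<notin> R - ?D \<and> (u - 1 + 1, l - 1) \<notin> R - ?D"
      by simp
  qed (use Suc.prems in \<open>auto simp: utri_base_def\<close>)
  also have "0 \<notin> ?K" using Suc.prems(3) by (auto simp: utri_base_def)
  then have "(if 0 \<in> ?K then \<theta> else 1) = 1" by simp
  also have "R - ?D - {u - 1, u - 1 + 1} \<times> ?K = ?R - {u - 1} \<times> ?K"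
    by auto
  also have "bcov \<theta> (?R - {u - 1} \<times> ?K) = bcov \<theta> (?R - utri (u - 1) (k + 1) s)"
  proof (rule Suc.IH[symmetric])
    have "(v, l) \<notin> utri (u - 1) (k + 1) s" if "v = u" for v l using that by (simp add: utri_def)
    then show "utri (u - 1) (k + 1) s \<subseteq> ?R" using Suc.prems(4) un by blast
  qed (use Suc.prems in auto)
  also have "?R - utri (u - 1) (k + 1) s = R - utri u k (Suc s)"
    unfolding un by blast
  finally show ?case by simp
qed

lemma bcov_utris:
  assumes "finite I" "finite R" "\<And>i. i \<in> I \<Longrightarrow> even (u + k i) \<and> 0 \<le> k i \<and> utri u (k i) (s i) \<subseteq> R"
    and "\<And>i j. i \<in> I \<Longrightarrow> j \<in> I \<Longrightarrow> i \<noteq> j \<Longrightarrow> utri u (k i) (s i) \<inter> utri u (k j) (s j) = {}"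
  shows "bcov \<theta> (R - (\<Union>i\<in>I. utri u (k i) (s i))) = bcov \<theta> (R - {u} \<times> (\<Union>i\<in>I. utri_base (k i) (s i)))"
  using assms
proof (induction I arbitrary: R rule: finite_induct)
  case (insert i I)
  have base: "{u} \<times> utri_base (k i) (s i) \<subseteq> utri u (k i) (s i)"
    by (auto simp: utri_base_def utri_def)
  have disj: "utri u (k i) (s i) \<inter> utri u (k j) (s j) = {}" if "j \<in> I" for j
    using insert.prems(3)[of i j] insert.hyps that by auto
  have sub: "utri u (k j) (s j) \<subseteq> R" if "j \<in> insert i I" for j
    using insert.prems(2)[of j] that by auto
  have "bcov \<theta> (R - (\<Union>j\<in>insert i I. utri u (k j) (s j))) = bcov \<theta> ((R - (\<Union>j\<in>I. utri u (k j) (s j))) - utri u (k i) (s i))"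
    by (intro arg_cong[of _ _ "cov _ _"]) auto
  also have "\<dots> = bcov \<theta> ((R - (\<Union>j\<in>I. utri u (k j) (s j))) - {u} \<times> utri_base (k i) (s i))"
    by (rule bcov_utri) (use insert.prems(1,2) disj sub[of i] in \<open>auto 4 3\<close>)
  also have "(R - (\<Union>j\<in>I. utri u (k j) (s j))) - {u} \<times> utri_base (k i) (s i) =
      (R - {u} \<times> utri_base (k i) (s i)) - (\<Union>j\<in>I. utri u (k j) (s j))"
    by blast
  also have "bcov \<theta> \<dots> = bcov \<theta> ((R - {u} \<times> utri_base (k i) (s i)) - {u} \<times> (\<Union>j\<in>I. utri_base (k j) (s j)))"
  proof (rule insert.IH)
    fix j assume j: "j \<in> I"
    have "utri u (k j) (s j) \<subseteq> R - {u} \<times> utri_base (k i) (s i)"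
      using disj[OF j] sub[of j] base j by blast
    then show "even (u + k j) \<and> 0 \<le> k j \<and> utri u (k j) (s j) \<subseteq> R - {u} \<times> utri_base (k i) (s i)"
      using insert.prems(2)[of j] j by simp
  qed (use insert.prems in auto)
  also have "(R - {u} \<times> utri_base (k i) (s i)) - {u} \<times> (\<Union>j\<in>I. utri_base (k j) (s j)) =
      R - {u} \<times> (\<Union>j\<in>insert i I. utri_base (k j) (s j))"
    by auto
  finally show ?case .
qed simp

text \<open>The right half of an up-pointing triangle of side 2a whose base lies in row 2n - 1 and
  is bisected by the zigzag.\<close>

definition htri :: "int \<Rightarrow> nat \<Rightarrow> (int \<times> int) set" where
  "htri n a = {(u, k). u \<le> 2 * n - 1 \<and> 0 \<le> k \<and> k \<le> u - 2 * n + 2 * int a}"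

text \<open>The forced lozenges now include one on the zigzag in every second row, which gives the
  factor for the weight.\<close>

lemma bcov_htri:
  assumes "finite R" "htri n a \<subseteq> R" "\<And>u. (u, -1) \<notin> R"
  shows "bcov \<theta> (R - {2 * n - 1} \<times> utri_base 1 a) = \<theta> ^ a * bcov \<theta> (R - htri n a)"
  using assms
proof (induction a arbitrary: n R)
  case 0
  have "htri n 0 = {}" by (auto simp: htri_def)
  then show ?case by (simp add: utri_base_def)
next
  case (Suc a)
  let ?v = "2 * n - 1"
  let ?D = "{?v} \<times> utri_base 1 (Suc a)" and ?K = "utri_base 0 (Suc a)" and ?L = "utri_base 1 a"
  let ?R1 = "R - ?D - {?v} \<times> ?K"
  let ?R2 = "?R1 - {?v - 1} \<times> ?K - {?v - 1} \<times> ?L"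
  have un: "htri n (Suc a) = ?D \<union> {?v} \<times> ?K \<union> ({?v - 1} \<times> ?K \<union> {?v - 1} \<times> ?L) \<union> htri (n - 1) a"
  proof -
    have "(v, l) \<in> htri n (Suc a) \<longleftrightarrow> (v, l) \<in> ?D \<union> {?v} \<times> ?K \<union> ({?v - 1} \<times> ?K \<union> {?v - 1} \<times> ?L) \<union> htri (n - 1) a" for v l
      by (simp add: utri_base_iff htri_def) presburger
    then show ?thesis by auto
  qed
  have sub: "?D \<union> {?v} \<times> ?K \<union> ({?v - 1} \<times> ?K \<union> {?v - 1} \<times> ?L) \<subseteq> R" "htri (n - 1) a \<subseteq> R"
    using Suc.prems(2) unfolding un by auto
  have inR: "(?v, l) \<in> R" "(?v - 1, l) \<in> R" if "l \<in> ?K" for l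
    using sub(1) that by auto
  have inR': "(?v - 1, l) \<in> R" "(?v - 2, l) \<in> R" if "l \<in> ?L" for l
  proof -
    show "(?v - 1, l) \<in> R" using sub(1) that by auto
    have "(?v - 2, l) \<in> htri (n - 1) a" using that by (simp add: utri_base_iff htri_def)
    then show "(?v - 2, l) \<in> R" using sub(2) by blast
  qed
  have "bcov \<theta> (R - ?D) = (if 0 \<in> ?K then \<theta> else 1) * bcov \<theta> (R - ?D - {?v - 1, ?v - 1 + 1} \<times> ?K)"
  proof (rule bcov_forced_row)
    fix l assume l: "l \<in> ?K"
    have "l \<notin> utri_base 1 (Suc a)" "l + 1 \<in> utri_base 1 (Suc a)" "l - 1 \<in> utri_base 1 (Suc a) \<or> l - 1 = -1" "even (?v - 1 + l)"
      using l unfolding utri_base_iff by presburger+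
    then show "(?v - 1 + 1, l) \<in> R - ?D \<and> (?v - 1, l) \<in> R - ?D \<and> even (?v - 1 + l) \<and>
        (?v - 1 + 1, l + 1) \<notin> R - ?D \<and> (?v - 1 + 1, l - 1) \<notin> R - ?D"
      using inR[OF l] Suc.prems(3) by auto
  qed (use Suc.prems in auto)
  also have "(if 0 \<in> ?K then \<theta> else 1) = \<theta>"
    by (simp add: utri_base_iff)
  also have "R - ?D - {?v - 1, ?v - 1 + 1} \<times> ?K = ?R1 - {?v - 1} \<times> ?K"
    by auto
  also have "bcov \<theta> (?R1 - {?v - 1} \<times> ?K) =
      (if 0 \<in> ?L then \<theta> else 1) * bcov \<theta> (?R1 - {?v - 1} \<times> ?K - {?v - 2, ?v - 2 + 1} \<times> ?L)"
  proof (rule bcov_forced_row)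
    fix l assume l: "l \<in> ?L"
    have "l \<notin> ?K" "l + 1 \<in> ?K" "l - 1 \<in> ?K" "even (?v - 2 + l)"
      using l unfolding utri_base_iff by presburger+
    then show "(?v - 2 + 1, l) \<in> ?R1 - {?v - 1} \<times> ?K \<and> (?v - 2, l) \<in> ?R1 - {?v - 1} \<times> ?K \<and> even (?v - 2 + l) \<and>
        (?v - 2 + 1, l + 1) \<notin> ?R1 - {?v - 1} \<times> ?K \<and> (?v - 2 + 1, l - 1) \<notin> ?R1 - {?v - 1} \<times> ?K"
      using inR'[OF l] by simp
  qed (use Suc.prems in auto)
  also have "(if 0 \<in> ?L then \<theta> else 1) = 1"
    by (simp add: utri_base_iff)
  also have "?R1 - {?v - 1} \<times> ?K - {?v - 2, ?v - 2 + 1} \<times> ?L = ?R2 - {2 * (n - 1) - 1} \<times> ?L"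
    by auto
  also have "bcov \<theta> (?R2 - {2 * (n - 1) - 1} \<times> ?L) = \<theta> ^ a * bcov \<theta> (?R2 - htri (n - 1) a)"
  proof (rule Suc.IH)
    have "v \<noteq> ?v \<and> v \<noteq> ?v - 1" if "(v, l) \<in> htri (n - 1) a" for v l
      using that by (auto simp: htri_def)
    then show "htri (n - 1) a \<subseteq> ?R2" using sub(2) by auto
  qed (use Suc.prems in auto)
  also have "?R2 - htri (n - 1) a = R - htri n (Suc a)"
    unfolding un by blast
  finally show ?case by simp
qed

section \<open>Positions marked by a sequence\<close>

text \<open>The positions (odpos, evpos) in the segments with odd, respectively even, index when
  consecutive segments of lengths t1, t2, ... are marked on a line.\<close>

definition odpos :: "nat list \<Rightarrow> nat set" where
  "odpos t = (\<Union>i\<in>{i \<in> {1..length t}. odd i}. {s_sum (i - 1) t + 1..s_sum i t})"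

definition evpos :: "nat list \<Rightarrow> nat set" where
  "evpos t = (\<Union>i\<in>{i \<in> {1..length t}. even i}. {s_sum (i - 1) t + 1..s_sum i t})"

lemma s_sum_0 [simp]: "s_sum 0 t = 0"
  by (simp add: s_sum_def)

lemma s_sum_Suc: "s_sum (Suc i) t = s_sum i t + entry t (Suc i)"
  by (simp add: s_sum_def)

lemma s_sum_step: "i \<ge> 1 \<Longrightarrow> s_sum i t = s_sum (i - 1) t + entry t i"
  using s_sum_Suc[of "i - 1" t] by simp

lemma s_sum_mono: "i \<le> j \<Longrightarrow> s_sum i t \<le> s_sum j t"
  by (induction j) (auto simp: s_sum_Suc le_Suc_eq)

lemma entry_snoc: "entry (t @ [v]) i = (if i = Suc (length t) then v else entry t i)"
  by (auto simp: entry_def nth_append)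

lemma entry_Cons_Suc: "i \<ge> 1 \<Longrightarrow> entry (v # t) (Suc i) = entry t i"
  by (auto simp: entry_def)

lemma s_sum_snoc: "i \<le> length t \<Longrightarrow> s_sum i (t @ [v]) = s_sum i t"
  by (auto simp: s_sum_def entry_snoc intro!: sum.cong)

lemma s_sum_snoc_all: "s_sum (Suc (length t)) (t @ [v]) = s_sum (length t) t + v"
  by (simp add: s_sum_Suc s_sum_snoc entry_snoc)

lemma s_sum_Cons_0: "s_sum (Suc i) (0 # t) = s_sum i t"
  by (induction i) (simp_all add: s_sum_Suc entry_Cons_Suc, simp add: entry_def)

lemma odd_sum_snoc: "odd_sum (t @ [v]) = odd_sum t + (if even (length t) then v else 0)"
proof -
  have "{i. i \<in> {1..length (t @ [v])} \<and> odd i} =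
      (if even (length t) then insert (Suc (length t)) {i. i \<in> {1..length t} \<and> odd i} else {i. i \<in> {1..length t} \<and> odd i})"
    by (auto simp: le_Suc_eq)
  then show ?thesis
    by (auto simp: odd_sum_def entry_snoc intro!: sum.cong)
qed

lemma even_sum_snoc: "even_sum (t @ [v]) = even_sum t + (if odd (length t) then v else 0)"
proof -
  have "{i. i \<in> {1..length (t @ [v])} \<and> even i} =
      (if odd (length t) then insert (Suc (length t)) {i. i \<in> {1..length t} \<and> even i} else {i. i \<in> {1..length t} \<and> even i})"
    by (auto simp: le_Suc_eq)
  then show ?thesis
    by (auto simp: even_sum_def entry_snoc intro!: sum.cong)
qed

lemma sums_Nil [simp]: "odd_sum [] = 0" "even_sum [] = 0" "odpos [] = {}" "evpos [] = {}"
  by (simp_all add: odd_sum_def even_sum_def odpos_def evpos_def)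

lemma sum_Cons_0: "even_sum (0 # t) = odd_sum t" "odd_sum (0 # t) = even_sum t"
proof (induction t rule: rev_induct)
  case (snoc v t)
  { case 1 show ?case using snoc even_sum_snoc[of "0 # t" v] by (simp add: odd_sum_snoc) }
  { case 2 show ?case using snoc odd_sum_snoc[of "0 # t" v] by (simp add: even_sum_snoc) }
next
  case Nil
  { case 1 show ?case using even_sum_snoc[of "[]" 0] by simp }
  { case 2 show ?case using odd_sum_snoc[of "[]" 0] by simp }
qed

lemma s_sum_length: "s_sum (length t) t = odd_sum t + even_sum t"
  by (induction t rule: rev_induct) (auto simp: s_sum_snoc_all odd_sum_snoc even_sum_snoc)

lemma odpos_snoc: "odpos (t @ [v]) = odpos t \<union>
    (if even (length t) then {s_sum (length t) t + 1..s_sum (length t) t + v} else {})"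
proof -
  have "{i \<in> {1..length (t @ [v])}. odd i} =
      (if even (length t) then insert (Suc (length t)) {i \<in> {1..length t}. odd i} else {i \<in> {1..length t}. odd i})"
    by (auto simp: le_Suc_eq)
  moreover have "(\<Union>i\<in>{i \<in> {1..length t}. odd i}. {s_sum (i - 1) (t @ [v]) + 1..s_sum i (t @ [v])}) = odpos t"
    unfolding odpos_def
  proof (intro SUP_cong refl)
    fix i assume "i \<in> {i \<in> {1..length t}. odd i}"
    then have "i - 1 \<le> length t" "i \<le> length t" by auto
    then show "{s_sum (i - 1) (t @ [v]) + 1..s_sum i (t @ [v])} = {s_sum (i - 1) t + 1..s_sum i t}"
      by (simp only: s_sum_snoc)
  qed
  ultimately show ?thesis
    unfolding odpos_def[of "t @ [v]"] by (auto simp: s_sum_snoc s_sum_snoc_all)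
qed

lemma evpos_snoc: "evpos (t @ [v]) = evpos t \<union>
    (if odd (length t) then {s_sum (length t) t + 1..s_sum (length t) t + v} else {})"
proof -
  have "{i \<in> {1..length (t @ [v])}. even i} =
      (if odd (length t) then insert (Suc (length t)) {i \<in> {1..length t}. even i} else {i \<in> {1..length t}. even i})"
    by (auto simp: le_Suc_eq)
  moreover have "(\<Union>i\<in>{i \<in> {1..length t}. even i}. {s_sum (i - 1) (t @ [v]) + 1..s_sum i (t @ [v])}) = evpos t"
    unfolding evpos_def
  proof (intro SUP_cong refl)
    fix i assume "i \<in> {i \<in> {1..length t}. even i}"
    then have "i - 1 \<le> length t" "i \<le> length t" by auto
    then show "{s_sum (i - 1) (t @ [v]) + 1..s_sum i (t @ [v])} = {s_sum (i - 1) t + 1..s_sum i t}"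
      by (simp only: s_sum_snoc)
  qed
  ultimately show ?thesis
    unfolding evpos_def[of "t @ [v]"] by (auto simp: s_sum_snoc s_sum_snoc_all)
qed

lemma evpos_Cons_0: "evpos (0 # t) = odpos t"
proof (induction t rule: rev_induct)
  case Nil
  show ?case using evpos_snoc[of "[]" 0] by simp
next
  case (snoc v t)
  have "s_sum (length (0 # t)) (0 # t) = s_sum (length t) t" using s_sum_Cons_0 by simp
  then show ?case using snoc evpos_snoc[of "0 # t" v] by (simp add: odpos_snoc)
qed

lemma positions: "odpos t \<union> evpos t = {1..odd_sum t + even_sum t} \<and> odpos t \<inter> evpos t = {} \<and>
    card (odpos t) = odd_sum t \<and> card (evpos t) = even_sum t"
proof (induction t rule: rev_induct)
  case (snoc v t)
  let ?m = "odd_sum t + even_sum t"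
  have m: "s_sum (length t) t = ?m" by (rule s_sum_length)
  have fin: "finite (odpos t)" "finite (evpos t)" using snoc finite_atLeastAtMost by (metis finite_Un)+
  have sub: "odpos t \<subseteq> {1..?m}" "evpos t \<subseteq> {1..?m}" using snoc by blast+
  then have disj: "odpos t \<inter> {?m + 1..?m + v} = {}" "evpos t \<inter> {?m + 1..?m + v} = {}" by auto
  have un: "{1..?m} \<union> {?m + 1..?m + v} = {1..?m + v}" by auto
  show ?case
  proof (cases "even (length t)")
    case True
    have "odpos t \<union> {?m + 1..?m + v} \<union> evpos t = {1..?m + v}" using snoc un by blast
    moreover have "(odpos t \<union> {?m + 1..?m + v}) \<inter> evpos t = {}" using snoc disj by blast
    moreover have "card (odpos t \<union> {?m + 1..?m + v}) = odd_sum t + v"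
      using snoc fin disj by (subst card_Un_disjoint) auto
    ultimately show ?thesis using True snoc
      by (simp add: odpos_snoc evpos_snoc odd_sum_snoc even_sum_snoc m add_ac)
  next
    case False
    have "odpos t \<union> (evpos t \<union> {?m + 1..?m + v}) = {1..?m + v}" using snoc un by blast
    moreover have "odpos t \<inter> (evpos t \<union> {?m + 1..?m + v}) = {}" using snoc disj by blast
    moreover have "card (evpos t \<union> {?m + 1..?m + v}) = even_sum t + v"
      using snoc fin disj by (subst card_Un_disjoint) auto
    ultimately show ?thesis using False snoc
      by (simp add: odpos_snoc evpos_snoc odd_sum_snoc even_sum_snoc m add_ac)
  qed
qed simp

lemma entry_le: "i \<in> {1..length t} \<Longrightarrow> odd i \<Longrightarrow> entry t i \<le> odd_sum t"
  "i \<in> {1..length t} \<Longrightarrow> even i \<Longrightarrow> entry t i \<le> even_sum t"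
  unfolding odd_sum_def even_sum_def by (auto intro!: member_le_sum)


section \<open>Counting dented trapezoids by positions\<close>

text \<open>The number of dents must be that of the vertical lozenges: every two rows add
  one.\<close>

lemma dented_zero:
  assumes "sorted_wrt (<) xs" "length xs \<noteq> Suc (Suc h) div 2"
    and "\<forall>x\<in>set xs. 0 \<le> x \<and> x < 2 * int c + int (Suc h) \<and> even (x + int h)"
  shows "dented \<theta> (Suc h) c (set xs) = 0"
  using assms
proof (induction h arbitrary: xs)
  case 0
  have "trapezoid (Suc 0) c - {0} \<times> set xs = {0} \<times> ({0..<2 * int c + 1} - set xs)"
    by (auto simp: trapezoid_def)
  then have e: "dented \<theta> (Suc 0) c (set xs) = rowcov \<theta> 0 0 (2 * int c + 1) (set xs)"
    by (simp add: dented_def rowcov_def)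
  show ?case
  proof (cases xs)
    case Nil
    then show ?thesis unfolding e by (subst rowcov_no_hole) auto
  next
    case (Cons x xs')
    then have ne: "xs' \<noteq> []" using 0 by auto
    have x: "0 \<le> x" "x < 2 * int c + 1" "even x" and xs': "\<forall>x'\<in>set xs'. x < x' \<and> x' < 2 * int c + 1 \<and> even x'"
      using 0 Cons by auto
    have "{0..<x} \<inter> set xs = {}" using xs' Cons by force
    then have "rowcov \<theta> 0 0 (2 * int c + 1) (set xs) = rowcov \<theta> 0 (x + 1) (2 * int c + 1) (set xs)"
      using x Cons by (subst rowcov_gap[of 0 x]) auto
    also have "\<dots> = 0"
    proof -
      obtain x' xs'' where c2: "xs' = x' # xs''" using ne by (cases xs') auto
      have x': "x < x'" "x' < 2 * int c + 1" "even x'" and xs'': "\<forall>z\<in>set xs''. x' < z" using xs' 0 Cons c2 by auto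
      have "{x + 1..<x'} \<inter> set xs = {}" using Cons c2 xs'' by force
      then show ?thesis using x x' Cons c2 by (subst rowcov_gap[of "x + 1" x']) auto
    qed
    finally show ?thesis unfolding e .
  qed
next
  case (Suc h)
  let ?H = "Suc h"
  let ?r = "2 * int c + int ?H + 1"
  have tr: "dented \<theta> (Suc ?H) c (set xs) =
    (\<Sum>Y\<in>Pow (par (if odd ?H then 0 else 1) ?r).
       rowcov \<theta> (int ?H) 0 ?r (set xs \<union> Y) * ((if 0 \<in> Y then \<theta> else 1) * dented \<theta> ?H c Y))"
    by (rule dented_transfer) (use Suc.prems in auto)
  show ?case
  proof (cases "odd ?H")
    case True
    then have h: "even h" by simp
    have par: "\<forall>x\<in>set xs. 0 \<le> x \<and> odd x" "\<forall>x\<in>set xs. odd (x - 0)"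
      using Suc.prems(3) h by auto
    have "dented \<theta> (Suc ?H) c (set xs) = (\<Sum>ys\<in>interlacing 0 xs. (if 0 \<in> set ys then \<theta> else 1) * dented \<theta> ?H c (set ys))"
      unfolding tr if_P[OF True] by (rule sum_rowcov) (use Suc.prems par h in auto)
    also have "\<dots> = 0"
    proof (rule sum.neutral, rule ballI)
      fix ys assume ys: "ys \<in> interlacing 0 xs"
      have "dented \<theta> ?H c (set ys) = 0"
      proof (rule Suc.IH)
        show "sorted_wrt (<) ys" using interlacing_sorted[OF ys] by simp
        show "length ys \<noteq> Suc (Suc h) div 2"
          using length_interlacing[OF ys] Suc.prems(2) h by simp
        show "\<forall>y\<in>set ys. 0 \<le> y \<and> y < 2 * int c + int (Suc h) \<and> even (y + int h)"
        proof
          fix y assume y: "y \<in> set ys"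
          obtain x where "x \<in> set xs" "y < x" using interlacing_bound[OF ys y] by blast
          moreover have "0 \<le> y" using interlacing_sorted[OF ys] y by simp
          moreover have "even y" using interlacing_parity[OF ys par(2) y] by simp
          ultimately show "0 \<le> y \<and> y < 2 * int c + int (Suc h) \<and> even (y + int h)"
            using Suc.prems(3) h by force
        qed
      qed
      then show "(if 0 \<in> set ys then \<theta> else 1) * dented \<theta> ?H c (set ys) = 0" by simp
    qed
    finally show ?thesis .
  next
    case False
    then have h: "odd h" by simp
    show ?thesis
    proof (cases xs)
      case Nil
      have "rowcov \<theta> (int ?H) 0 ?r (set xs \<union> Y) = 0" if Y: "Y \<in> Pow (par 1 ?r)" for Y
      proof (cases "Y = {}")
        case True
        then show ?thesis using Nil h by (subst rowcov_no_hole) auto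
      next
        case ne: False
        have fin: "finite Y" using Y finite_subset[OF _ finite_par] by blast
        define f where "f = Min Y"
        have f: "f \<in> Y" "\<forall>y\<in>Y. f \<le> y" using fin ne by (auto simp: f_def)
        have "f \<in> par 1 ?r" using f(1) Y by blast
        then have fb: "0 < f" "f < ?r" "odd f" by (auto simp: par_iff)
        have "{0..<f} \<inter> Y = {}" using f(2) by force
        then show ?thesis using fb f Nil by (subst rowcov_gap[of 0 f]) auto
      qed
      then show ?thesis unfolding tr if_not_P[OF False] by (intro sum.neutral) simp
    next
      case (Cons x xs')
      note xs = Cons
      have x0: "0 \<le> x" using Suc.prems(3) xs by simp
      have par: "\<forall>x'\<in>set (x # xs'). even (x' - 0)" "\<forall>x'\<in>set xs'. even (x' - x)" "\<forall>x'\<in>set xs'. odd (x' - (x + 1))"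
        using Suc.prems(3) h by (auto simp: xs)
      have "dented \<theta> (Suc ?H) c (set xs) = (\<Sum>ys\<in>interlacing (x + 1) xs'. (if 0 \<in> set ys then \<theta> else 1) * dented \<theta> ?H c (set ys))"
      proof -
        have sub: "set (x # xs') \<subseteq> {0..<?r}"
          using Suc.prems(3) by (force simp: xs)
        have "dented \<theta> (Suc ?H) c (set xs) = (\<Sum>Y\<in>Pow (par (0 + 1) ?r).
            rowcov \<theta> (int ?H) 0 ?r (set (x # xs') \<union> Y) * ((if 0 \<in> Y then \<theta> else 1) * dented \<theta> ?H c Y))"
          unfolding tr if_not_P[OF False] unfolding xs by simp
        also have "\<dots> = (\<Sum>ys\<in>interlacing (x + 1) xs'. (if 0 \<in> set ys then \<theta> else 1) * dented \<theta> ?H c (set ys))"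
          by (rule sum_rowcov_inner) (use Suc.prems(1) par sub h in \<open>auto simp: xs\<close>)
        finally show ?thesis .
      qed
      also have "\<dots> = 0"
      proof (rule sum.neutral, rule ballI)
        fix ys assume ys: "ys \<in> interlacing (x + 1) xs'"
        have "dented \<theta> ?H c (set ys) = 0"
        proof (rule Suc.IH)
          show "sorted_wrt (<) ys" using interlacing_sorted[OF ys] by simp
          show "length ys \<noteq> Suc (Suc h) div 2"
            using length_interlacing[OF ys] Suc.prems(2) h xs by (auto elim!: oddE)
          show "\<forall>y\<in>set ys. 0 \<le> y \<and> y < 2 * int c + int (Suc h) \<and> even (y + int h)"
          proof
            fix y assume y: "y \<in> set ys"
            obtain x' where x': "x' \<in> set xs'" "y < x'" using interlacing_bound[OF ys y] by blast
            then have "x' < 2 * int c + int (Suc ?H)" using Suc.prems(3) xs by simp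
            moreover have "0 < y" using interlacing_sorted[OF ys] y x0 by force
            moreover have "odd y" using interlacing_parity[OF ys par(3) y] par(1) by auto
            ultimately show "0 \<le> y \<and> y < 2 * int c + int (Suc h) \<and> even (y + int h)"
              using h x' by auto
          qed
        qed
        then show "(if 0 \<in> set ys then \<theta> else 1) * dented \<theta> ?H c (set ys) = 0" by simp
      qed
      finally show ?thesis .
    qed
  qed
qed

text \<open>The p-th up-pointing triangle in the bottom row of a trapezoid with an even number of
  rows, and the same for an odd number of rows.\<close>

definition posQ :: "nat set \<Rightarrow> int set" where
  "posQ X = (\<lambda>p. 2 * int p - 1) ` X"

definition posK :: "nat set \<Rightarrow> int set" where
  "posK X = (\<lambda>p. 2 * int p - 2) ` X"

text \<open>Trapezoids with 2n, respectively 2n - 1, rows and with dents given by their positions,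
  with the weight 1/2 on the zigzag in the first case only. The distance to the axis of the p-th
  position is val p in both cases.\<close>

definition Qd :: "nat \<Rightarrow> nat \<Rightarrow> nat set \<Rightarrow> real" where
  "Qd n c X = dented (1 / 2) (2 * n) c (posQ X)"

definition Kd :: "nat \<Rightarrow> nat \<Rightarrow> nat set \<Rightarrow> real" where
  "Kd n c X = dented 1 (2 * n - 1) c (posK X)"

abbreviation sqd :: "nat set \<Rightarrow> real" where
  "sqd \<equiv> vdm (\<lambda>p. (val p)\<^sup>2)"

lemma posQ_Un: "posQ (X \<union> Y) = posQ X \<union> posQ Y" and posK_Un: "posK (X \<union> Y) = posK X \<union> posK Y"
  by (auto simp: posQ_def posK_def)

lemma posQ_UN: "posQ (\<Union>i\<in>I. X i) = (\<Union>i\<in>I. posQ (X i))" and posK_UN: "posK (\<Union>i\<in>I. X i) = (\<Union>i\<in>I. posK (X i))"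
  by (auto simp: posQ_def posK_def)

lemma utri_base_posQ: "utri_base (2 * int s + 1) a = posQ {s+1..s+a}"
proof -
  have "x \<in> (\<lambda>i. s + 1 + i) ` {..<a}" if "x \<in> {s+1..s+a}" for x
    using that by (intro image_eqI[of _ _ "x - (s + 1)"]) auto
  then have "{s+1..s+a} = (\<lambda>i. s + 1 + i) ` {..<a}" by auto
  then show ?thesis by (auto simp: utri_base_def posQ_def image_image)
qed

lemma utri_base_posK: "utri_base (2 * int s) a = posK {s+1..s+a}"
proof -
  have "x \<in> (\<lambda>i. s + 1 + i) ` {..<a}" if "x \<in> {s+1..s+a}" for x
    using that by (intro image_eqI[of _ _ "x - (s + 1)"]) auto
  then have "{s+1..s+a} = (\<lambda>i. s + 1 + i) ` {..<a}" by auto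
  then show ?thesis by (auto simp: utri_base_def posK_def image_image)
qed

lemma sqdiff_sorted:
  assumes "sorted_wrt (<) ps"
  shows "sqdiff (map val ps) = sqd (set ps)"
proof -
  have dis: "distinct ps" using assms by (simp add: strict_sorted_iff)
  have low: "{q \<in> set ps. q < ps ! i} = (!) ps ` {0..<i}" if "i < length ps" for i
  proof (intro equalityI subsetI)
    fix q assume "q \<in> {q \<in> set ps. q < ps ! i}"
    then obtain j where j: "j < length ps" "q = ps ! j" "ps ! j < ps ! i" by (auto simp: in_set_conv_nth)
    have "j < i"
    proof (rule ccontr)
      assume "\<not> j < i"
      then have "ps ! i \<le> ps ! j" using sorted_wrt_nth_less[OF assms, of i j] j that by (cases "i = j") auto
      then show False using j by simp
    qed
    then show "q \<in> (!) ps ` {0..<i}" using j by auto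
  next
    fix q assume "q \<in> (!) ps ` {0..<i}"
    then show "q \<in> {q \<in> set ps. q < ps ! i}" using that sorted_wrt_nth_less[OF assms] by auto
  qed
  have "sqd (set ps) = (\<Prod>i\<in>{0..<length ps}. \<Prod>q\<in>{q \<in> set ps. q < ps ! i}. (val (ps ! i))\<^sup>2 - (val q)\<^sup>2)"
    unfolding vdm_def
    by (rule prod.reindex_bij_betw[symmetric, OF bij_betw_nth[OF dis]]) auto
  also have "\<dots> = (\<Prod>i\<in>{0..<length ps}. \<Prod>j\<in>{0..<i}. (val (ps ! i))\<^sup>2 - (val (ps ! j))\<^sup>2)"
  proof (rule prod.cong[OF refl])
    fix i assume "i \<in> {0..<length ps}"
    then have i: "i < length ps" by simp
    have "inj_on ((!) ps) {0..<i}" using i dis by (auto simp: inj_on_def nth_eq_iff_index_eq)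
    then show "(\<Prod>q\<in>{q \<in> set ps. q < ps ! i}. (val (ps ! i))\<^sup>2 - (val q)\<^sup>2) = (\<Prod>j\<in>{0..<i}. (val (ps ! i))\<^sup>2 - (val (ps ! j))\<^sup>2)"
      unfolding low[OF i] by (subst prod.reindex) auto
  qed
  also have "\<dots> = sqdiff (map val ps)"
    unfolding sqdiff_def by (intro prod.cong) auto
  finally show ?thesis by simp
qed

lemma Qd_formula:
  assumes "X \<subseteq> {1..n + c}"
  shows "card X = n \<Longrightarrow> Qd n c X = dent_const (2 * n) * (\<Prod>p\<in>X. val p) * sqd X"
    and "n \<ge> 1 \<Longrightarrow> card X \<noteq> n \<Longrightarrow> Qd n c X = 0"
proof -
  have fin: "finite X" using assms finite_subset by auto
  define ps where "ps = sorted_list_of_set X"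
  have ps: "sorted_wrt (<) ps" "set ps = X" "length ps = card X" "distinct ps"
    using fin by (simp_all add: ps_def)
  let ?xs = "map (\<lambda>p. 2 * int p - 1) ps"
  have xs: "sorted_wrt (<) ?xs" "set ?xs = posQ X"
    using ps by (auto simp: sorted_wrt_map posQ_def)
  have sh: "shifted 0 ?xs = map val ps" by (simp add: shifted_def val_def)
  have rng: "\<forall>x\<in>set ?xs. 0 \<le> x \<and> x < 2 * int c + int (2 * n) \<and> odd x"
    using assms ps(2) by auto
  { assume c: "card X = n"
    show "Qd n c X = dent_const (2 * n) * (\<Prod>p\<in>X. val p) * sqd X"
    proof (cases n)
      case 0
      then have "X = {}" using c fin by simp
      moreover have "trapezoid 0 c = {}" by (auto simp: trapezoid_def)
      ultimately show ?thesis using 0 by (simp add: Qd_def dented_def vdm_def posQ_def)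
    next
      case (Suc m)
      have e: "2 * n = Suc (2 * m + 1)" using Suc by simp
      have "Qd n c X = dented (1 / 2) (Suc (2 * m + 1)) c (set ?xs)"
        unfolding Qd_def e xs(2) ..
      also have "\<dots> = dent_const (Suc (2 * m + 1)) * (if odd (2 * m + 1) then prod_list (shifted 0 ?xs) else 1) * sqdiff (shifted 0 ?xs)"
        by (rule dented_product) (use xs rng c ps(3) Suc in auto)
      also have "\<dots> = dent_const (2 * n) * (\<Prod>p\<in>X. val p) * sqd X"
        unfolding sh sqdiff_sorted[OF ps(1)] e[symmetric] ps(2)
        using prod.distinct_set_conv_list[OF ps(4), of val] ps(2) by simp
      finally show ?thesis .
    qed }
  { assume c: "n \<ge> 1" "card X \<noteq> n"
    then obtain m where m: "n = Suc m" by (cases n) auto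
    have e: "2 * n = Suc (2 * m + 1)" using m by simp
    have "Qd n c X = dented (1 / 2) (Suc (2 * m + 1)) c (set ?xs)"
      unfolding Qd_def e xs(2) ..
    also have "\<dots> = 0"
      by (rule dented_zero) (use xs rng c ps(3) m in auto)
    finally show "Qd n c X = 0" . }
qed

lemma Kd_formula:
  assumes "X \<subseteq> {1..n + c}" "n \<ge> 1"
  shows "card X = n \<Longrightarrow> Kd n c X = dent_const (2 * n - 1) * sqd X"
proof -
  have fin: "finite X" using assms finite_subset by auto
  define ps where "ps = sorted_list_of_set X"
  have ps: "sorted_wrt (<) ps" "set ps = X" "length ps = card X" "distinct ps"
    using fin by (simp_all add: ps_def)
  let ?xs = "map (\<lambda>p. 2 * int p - 2) ps"
  have xs: "sorted_wrt (<) ?xs" "set ?xs = posK X"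
    using ps by (auto simp: sorted_wrt_map posK_def)
  have sh: "shifted 1 ?xs = map val ps" by (simp add: shifted_def val_def)
  have rng: "\<forall>x\<in>set ?xs. 0 \<le> x \<and> x < 2 * int c + int (2 * n - 1) \<and> even x"
    using assms ps(2) by (force simp: of_nat_diff)
  assume c: "card X = n"
  obtain m where m: "n = Suc m" using assms by (cases n) auto
  have e: "2 * n - 1 = Suc (2 * m)" using m by simp
  have "Kd n c X = dented 1 (Suc (2 * m)) c (set ?xs)"
    unfolding Kd_def e xs(2) ..
  also have "\<dots> = dent_const (Suc (2 * m)) * (if odd (2 * m) then prod_list (shifted 1 ?xs) else 1) * sqdiff (shifted 1 ?xs)"
    by (rule dented_product) (use xs rng c ps(3) m e in auto)
  also have "\<dots> = dent_const (2 * n - 1) * sqd X"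
    unfolding sh sqdiff_sorted[OF ps(1)] e[symmetric] ps(2) using m by simp
  finally show ?thesis .
qed


section \<open>Weights along the western zigzag\<close>

lemma vert_lozenge_cells: "vert_lozenge i j = cell ` vbrick (-1 - j) (2 * i + j + 1)"
  by (subst cell_vbrick) auto

lemma zigzag_steps: "set (steps_from (i, j) (rep n [SW, SE])) =
  (\<Union>k<n. {((i + int k, j - 2 * int k), (i + int k, j - 2 * int k - 1)),
            ((i + int k, j - 2 * int k - 1), (i + int k + 1, j - 2 * int k - 2))})"
proof (induction n arbitrary: i j)
  case (Suc n)
  let ?F = "\<lambda>i j k. {((i + int k, j - 2 * int k), (i + int k, j - 2 * int k - 1)),
            ((i + int k, j - 2 * int k - 1), (i + int k + 1, j - 2 * int k - 2))}"
  have "set (steps_from (i, j) (rep (Suc n) [SW, SE])) = ?F i j 0 \<union> set (steps_from (i + 1, j - 2) (rep n [SW, SE]))"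
    by (simp add: rep_Suc)
  also have "set (steps_from (i + 1, j - 2) (rep n [SW, SE])) = (\<Union>k<n. ?F (i + 1) (j - 2) k)"
    by (rule Suc)
  also have "\<dots> = (\<Union>k<n. ?F i j (Suc k))"
    by (intro SUP_cong refl) (simp add: algebra_simps)
  also have "?F i j 0 \<union> (\<Union>k<n. ?F i j (Suc k)) = (\<Union>k<Suc n. ?F i j k)"
    unfolding lessThan_Suc_eq_insert_0 by blast
  finally show ?case .
qed simp

lemma west_weight_zigzag:
  "west_weight (rep n [SW, SE]) (cell ` l) = (if \<exists>k<n. l = vbrick (2 * int k) 0 then 1 / 2 else 1)"
proof -
  have "(\<exists>i j. cell ` l = vert_lozenge i j \<and> ((i, j + 1), (i, j)) \<in> set (path_steps (rep n [SW, SE]))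
      \<and> ((i, j), (i + 1, j - 1)) \<in> set (path_steps (rep n [SW, SE]))) \<longleftrightarrow> (\<exists>k<n. l = vbrick (2 * int k) 0)"
    (is "?L \<longleftrightarrow> ?R")
  proof
    assume ?L
    then obtain i j where l: "cell ` l = vert_lozenge i j" and ij: "((i, j + 1), (i, j)) \<in> set (path_steps (rep n [SW, SE]))"
      "((i, j), (i + 1, j - 1)) \<in> set (path_steps (rep n [SW, SE]))" by blast
    obtain k where k: "k < n" "i = int k" "j = - 2 * int k - 1"
      using ij(1) unfolding path_steps_def zigzag_steps by auto
    have "l = vbrick (-1 - j) (2 * i + j + 1)"
      using l inj_cell unfolding vert_lozenge_cells by (simp add: inj_image_eq_iff)
    then show ?R using k by auto
  next
    assume ?R
    then obtain k where k: "k < n" "l = vbrick (2 * int k) 0" by blast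
    have "cell ` l = vert_lozenge (int k) (- 2 * int k - 1)"
      unfolding vert_lozenge_cells k(2) by simp
    moreover have "((int k, - 2 * int k - 1 + 1), (int k, - 2 * int k - 1)) \<in> set (path_steps (rep n [SW, SE]))"
      "((int k, - 2 * int k - 1), (int k + 1, - 2 * int k - 1 - 1)) \<in> set (path_steps (rep n [SW, SE]))"
      unfolding path_steps_def zigzag_steps using k(1) by auto
    ultimately show ?L by blast
  qed
  then show ?thesis unfolding west_weight_def by simp
qed

lemma weighted_tilings_zigzag:
  assumes "\<And>u. (u, 0) \<in> R \<Longrightarrow> 0 \<le> u \<and> u < 2 * int n"
  shows "weighted_tilings (west_weight (rep n [SW, SE])) (cell ` R) = bcov (1 / 2) R"
  unfolding weighted_tilings_cells
proof (rule cov_cong)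
  fix l assume l: "l \<in> bricks" "l \<subseteq> R"
  have "(\<exists>k<n. l = vbrick (2 * int k) 0) \<longleftrightarrow> (\<exists>u. l = vbrick u 0)"
  proof
    assume "\<exists>u. l = vbrick u 0"
    then obtain u where u: "l = vbrick u 0" by blast
    have "even u" using l(1) u by (auto simp: bricks_def)
    then obtain v where v: "u = 2 * v" by (rule evenE)
    have "(u, 0) \<in> R" using l(2) u by (auto simp: vbrick_def)
    then have "0 \<le> u" "u < 2 * int n" using assms by blast+
    then have "u = 2 * int (nat v)" "nat v < n" using v by auto
    then have "nat v < n \<and> l = vbrick (2 * int (nat v)) 0" using u by simp
    then show "\<exists>k<n. l = vbrick (2 * int k) 0" by blast
  qed blast
  then show "west_weight (rep n [SW, SE]) (cell ` l) = axis_weight (1 / 2) l"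
    unfolding west_weight_zigzag axis_weight_def by simp
qed

section \<open>Trapezoids with removed triangles\<close>

lemma up_triangle_utri: "up_triangle (i, j) s = cell ` utri (-1 - j) (2 * i + 1 + j) s"
  by (rule eq_cells) (simp add: up_triangle_cells utri_def, linarith)

lemma utri_range: "(u, l) \<in> utri v k s \<Longrightarrow> u \<le> v \<and> k \<le> l \<and> l \<le> k + 2 * int s - 2"
  by (auto simp: utri_def)

lemma utri_subset_trapezoid:
  assumes "0 \<le> k" "s \<le> h" "k + 2 * int s - 2 \<le> 2 * int c + int h - 1"
  shows "utri (int h - 1) k s \<subseteq> trapezoid h c"
  using assms by (auto simp: utri_def trapezoid_def)

lemma bcov_family:
  fixes \<sigma> \<tau> :: "nat \<Rightarrow> nat"
  assumes "finite I" "finite R" "even (v + b)" "0 \<le> b"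
    and sub: "\<And>i. i \<in> I \<Longrightarrow> utri v (b + 2 * int (\<sigma> i)) (\<tau> i) \<subseteq> R"
    and sep: "\<And>i j. i \<in> I \<Longrightarrow> j \<in> I \<Longrightarrow> i < j \<Longrightarrow> \<sigma> i + \<tau> i \<le> \<sigma> j"
  shows "bcov \<theta> (R - (\<Union>i\<in>I. utri v (b + 2 * int (\<sigma> i)) (\<tau> i))) =
    bcov \<theta> (R - {v} \<times> (\<Union>i\<in>I. utri_base (b + 2 * int (\<sigma> i)) (\<tau> i)))"
proof (rule bcov_utris)
  fix i assume "i \<in> I"
  then show "even (v + (b + 2 * int (\<sigma> i))) \<and> 0 \<le> b + 2 * int (\<sigma> i) \<and> utri v (b + 2 * int (\<sigma> i)) (\<tau> i) \<subseteq> R"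
    using assms(3,4) sub by simp
next
  fix i j assume ij: "i \<in> I" "j \<in> I" "i \<noteq> j"
  have "\<sigma> i + \<tau> i \<le> \<sigma> j \<or> \<sigma> j + \<tau> j \<le> \<sigma> i"
    using sep[of i j] sep[of j i] ij by (cases "i < j") auto
  then have "(u, l) \<notin> utri v (b + 2 * int (\<sigma> j)) (\<tau> j)" if "(u, l) \<in> utri v (b + 2 * int (\<sigma> i)) (\<tau> i)" for u l
    using utri_range[OF that] utri_range[of u l v "b + 2 * int (\<sigma> j)" "\<tau> j"] by auto
  then show "utri v (b + 2 * int (\<sigma> i)) (\<tau> i) \<inter> utri v (b + 2 * int (\<sigma> j)) (\<tau> j) = {}"
    by auto
qed (use assms in auto)

lemma s_sum_sep: "i < j \<Longrightarrow> 1 \<le> i \<Longrightarrow> s_sum (i - 1) t + entry t i \<le> s_sum (j - 1) t"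
  using s_sum_step[of i t] s_sum_mono[of i "j - 1" t] by simp

lemma s_sum_le: "i \<le> length t \<Longrightarrow> s_sum i t \<le> odd_sum t + even_sum t"
  using s_sum_mono[of i "length t" t] by (simp add: s_sum_length)

lemma evpos_alt: "evpos t = (\<Union>i\<in>{i \<in> {1..length t}. even i}. {s_sum (i - 1) t + 1..s_sum (i - 1) t + entry t i})"
  unfolding evpos_def by (intro SUP_cong refl) (use s_sum_step in auto)

lemma odpos_alt: "odpos t = (\<Union>i\<in>{i \<in> {1..length t}. odd i}. {s_sum (i - 1) t + 1..s_sum (i - 1) t + entry t i})"
  unfolding odpos_def by (intro SUP_cong refl) (use s_sum_step in auto)

lemma bottom_triangles_cells: "bottom_triangles (i, j) t =
  cell ` (\<Union>l\<in>{l \<in> {1..length t}. even l}. utri (-1 - j) ((2 * i + 1 + j) + 2 * int (s_sum (l - 1) t)) (entry t l))"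
  unfolding bottom_triangles_def image_UN
  by (intro SUP_cong refl) (auto simp: up_triangle_utri algebra_simps)

theorem Q'_num_positions: "Q'_num t = Qd (even_sum t) (odd_sum t) (evpos t)"
proof -
  let ?n = "even_sum t" and ?c = "odd_sum t"
  let ?I = "{l \<in> {1..length t}. even l}"
  let ?U = "\<Union>l\<in>?I. utri (2 * int ?n - 1) (1 + 2 * int (s_sum (l - 1) t)) (entry t l)"
  have pe: "path_end (rep ?n [SW, SE]) = (int ?n, - (2 * int ?n))"
    by simp
  have reg: "polygon (rep ?n [SW, SE] @ replicate (?n + ?c) East @ replicate (2 * ?n) NW @ replicate ?c West) -
      bottom_triangles (path_end (rep ?n [SW, SE])) t = cell ` (trapezoid (2 * ?n) ?c - ?U)"
    unfolding Q_polygon_cells pe bottom_triangles_cells cell_diff by (simp add: algebra_simps)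
  have "Q'_num t = weighted_tilings (west_weight (rep ?n [SW, SE])) (cell ` (trapezoid (2 * ?n) ?c - ?U))"
    unfolding Q'_num_def Let_def reg ..
  also have "\<dots> = bcov (1 / 2) (trapezoid (2 * ?n) ?c - ?U)"
    by (rule weighted_tilings_zigzag) (auto simp: trapezoid_def)
  also have "\<dots> = bcov (1 / 2) (trapezoid (2 * ?n) ?c - {2 * int ?n - 1} \<times> (\<Union>l\<in>?I. utri_base (1 + 2 * int (s_sum (l - 1) t)) (entry t l)))"
  proof (rule bcov_family)
    fix l assume l: "l \<in> ?I"
    have "s_sum (l - 1) t + entry t l \<le> ?c + ?n"
      using s_sum_step[of l t] s_sum_le[of l t] l by auto
    then have "utri (int (2 * ?n) - 1) (1 + 2 * int (s_sum (l - 1) t)) (entry t l) \<subseteq> trapezoid (2 * ?n) ?c"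
      using entry_le(2)[of l t] l by (intro utri_subset_trapezoid) auto
    then show "utri (2 * int ?n - 1) (1 + 2 * int (s_sum (l - 1) t)) (entry t l) \<subseteq> trapezoid (2 * ?n) ?c"
      by simp
  qed (use s_sum_sep in auto)
  also have "(\<Union>l\<in>?I. utri_base (1 + 2 * int (s_sum (l - 1) t)) (entry t l)) = posQ (evpos t)"
    unfolding evpos_alt posQ_UN utri_base_posQ[symmetric] by (simp add: add.commute)
  finally show ?thesis by (simp add: Qd_def dented_def)
qed

theorem K_num_positions:
  assumes "even_sum t \<ge> 1"
  shows "K_num t = Kd (even_sum t) (odd_sum t) (evpos t)"
proof -
  obtain m where m: "even_sum t = Suc m" using assms by (cases "even_sum t") auto
  let ?c = "odd_sum t"
  let ?h = "Suc (2 * m)"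
  let ?I = "{l \<in> {1..length t}. even l}"
  let ?U = "\<Union>l\<in>?I. utri (2 * int m) (0 + 2 * int (s_sum (l - 1) t)) (entry t l)"
  have pe: "path_end (rep m [SW, SE] @ [SW]) = (int m, - (2 * int m) - 1)"
    by (simp add: zero_prod_def)
  have e: "2 * Suc m - 1 = ?h" by simp
  have reg: "polygon ((rep m [SW, SE] @ [SW]) @ replicate (Suc m + ?c) East @ replicate ?h NW @ replicate ?c West) -
      bottom_triangles (path_end (rep m [SW, SE] @ [SW])) t = cell ` (trapezoid ?h ?c - ?U)"
    unfolding K_polygon_cells pe bottom_triangles_cells cell_diff by (simp add: algebra_simps)
  have "K_num t = num_tilings (cell ` (trapezoid ?h ?c - ?U))"
    unfolding K_num_def Let_def m diff_Suc_1 e reg ..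
  also have "\<dots> = bcov 1 (trapezoid ?h ?c - ?U)"
    by (rule num_tilings_cells)
  also have "\<dots> = bcov 1 (trapezoid ?h ?c - {2 * int m} \<times> (\<Union>l\<in>?I. utri_base (0 + 2 * int (s_sum (l - 1) t)) (entry t l)))"
  proof (rule bcov_family)
    fix l assume l: "l \<in> ?I"
    have "s_sum (l - 1) t + entry t l \<le> ?c + Suc m"
      using s_sum_step[of l t] s_sum_le[of l t] l m by auto
    then have "utri (int ?h - 1) (0 + 2 * int (s_sum (l - 1) t)) (entry t l) \<subseteq> trapezoid ?h ?c"
      using entry_le(2)[of l t] l m by (intro utri_subset_trapezoid) auto
    then show "utri (2 * int m) (0 + 2 * int (s_sum (l - 1) t)) (entry t l) \<subseteq> trapezoid ?h ?c"
      by simp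
  qed (use s_sum_sep in auto)
  also have "(\<Union>l\<in>?I. utri_base (0 + 2 * int (s_sum (l - 1) t)) (entry t l)) = posK (evpos t)"
    unfolding evpos_alt posK_UN utri_base_posK[symmetric] by simp
  finally show ?thesis by (simp add: Kd_def dented_def m)
qed

text \<open>The polygon is a trapezoid without the right half of a triangle of side 2a, along the
  zigzag, and without an up-pointing triangle of side y in the lower right corner.\<close>

theorem P'_num_positions: "P'_num y (y + 2 * a) b = 2 ^ a * Qd (y + a) b ({1..a} \<union> {a+b+1..a+b+y})"
proof -
  let ?n = "y + a"
  let ?v = "2 * int ?n - 1"
  let ?C = "utri ?v (1 + 2 * int (a + b)) y"
  let ?R = "trapezoid (2 * ?n) b"
  have reg: "P_polygon y (y + 2 * a) b = cell ` (?R - htri (int ?n) a - ?C)"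
  proof -
    have "{(u, k). 0 \<le> u \<and> u < int y + int (y + 2 * a) \<and> 0 \<le> k \<and> u - 2 * int y + 1 \<le> k \<and>
      k \<le> 2 * int b + u \<and> k \<le> 2 * int (y + 2 * a + b) - 1 - u} = ?R - htri (int ?n) a - ?C"
      by (auto simp: trapezoid_def htri_def utri_def)
    then show ?thesis by (subst P_polygon_cells) simp_all
  qed
  have C: "?C \<subseteq> ?R"
    using utri_subset_trapezoid[of "1 + 2 * int (a + b)" y "2 * ?n" b] by simp
  have H: "htri (int ?n) a \<subseteq> ?R" by (auto simp: htri_def trapezoid_def)
  have HC: "htri (int ?n) a \<inter> ?C = {}" by (auto simp: htri_def utri_def)
  have "P'_num y (y + 2 * a) b = bcov (1 / 2) (?R - htri (int ?n) a - ?C)"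
    unfolding P'_num_def reg by (rule weighted_tilings_zigzag) (auto simp: trapezoid_def htri_def)
  also have "\<dots> = bcov (1 / 2) (?R - htri (int ?n) a - {?v} \<times> utri_base (1 + 2 * int (a + b)) y)"
    using C HC by (intro bcov_utri) auto
  also have "?R - htri (int ?n) a - {?v} \<times> utri_base (1 + 2 * int (a + b)) y =
      (?R - {?v} \<times> utri_base (1 + 2 * int (a + b)) y) - htri (int ?n) a"
    by blast
  also have "bcov (1 / 2) \<dots> = 2 ^ a * ((1 / 2) ^ a * bcov (1 / 2) ((?R - {?v} \<times> utri_base (1 + 2 * int (a + b)) y) - htri (int ?n) a))"
    by (simp add: power_one_over)
  also have "(1 / 2) ^ a * bcov (1 / 2) ((?R - {?v} \<times> utri_base (1 + 2 * int (a + b)) y) - htri (int ?n) a) =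
      bcov (1 / 2) ((?R - {?v} \<times> utri_base (1 + 2 * int (a + b)) y) - {?v} \<times> utri_base 1 a)"
  proof (rule bcov_htri[symmetric])
    have "{?v} \<times> utri_base (1 + 2 * int (a + b)) y \<inter> htri (int ?n) a = {}" by (auto simp: htri_def utri_base_iff)
    then show "htri (int ?n) a \<subseteq> ?R - {?v} \<times> utri_base (1 + 2 * int (a + b)) y" using H by blast
    show "finite (?R - {?v} \<times> utri_base (1 + 2 * int (a + b)) y)" by simp
  qed (auto simp: trapezoid_def)
  also have "(?R - {?v} \<times> utri_base (1 + 2 * int (a + b)) y) - {?v} \<times> utri_base 1 a =
      ?R - {?v} \<times> (utri_base 1 a \<union> utri_base (1 + 2 * int (a + b)) y)"
    by blast
  also have "utri_base 1 a \<union> utri_base (1 + 2 * int (a + b)) y = posQ ({1..a} \<union> {a+b+1..a+b+y})"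
    using utri_base_posQ[of 0 a] utri_base_posQ[of "a + b" y] by (simp add: posQ_Un add.commute)
  finally show ?thesis by (simp add: Qd_def dented_def)
qed


lemma vdm_singleton [simp]: "vdm t {p} = 1"
  unfolding vdm_def by (intro prod.neutral ballI) auto

text \<open>The n numbers x, x + 2, ...\<close>

fun stepping :: "int \<Rightarrow> nat \<Rightarrow> int list" where
  "stepping x 0 = []"
| "stepping x (Suc n) = x # stepping (x + 2) n"

lemma set_stepping: "set (stepping x n) = utri_base x n"
proof (induction n arbitrary: x)
  case (Suc n)
  have "utri_base x (Suc n) = insert x (utri_base (x + 2) n)"
    unfolding utri_base_def lessThan_Suc_eq_insert_0 by (auto simp: image_image algebra_simps)
  then show ?case using Suc by simp
qed (simp add: utri_base_def)

lemma stepping_sorted: "sorted_wrt (<) (stepping x n)"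
  by (induction n arbitrary: x) (auto simp: set_stepping utri_base_iff)

lemma interlacing_stepping: "interlacing (x + 1) (stepping (x + 2) n) = {stepping (x + 1) n}"
proof (induction n arbitrary: x)
  case (Suc n)
  have "par (x + 1) (x + 2) = {x + 1}" by (auto simp: par_iff)
  moreover have "interlacing (x + 2 + 1) (stepping (x + 2 + 2) n) = {stepping (x + 2 + 1) n}"
    by (rule Suc)
  moreover have "x + 2 + 1 = x + 1 + 2" by simp
  ultimately show ?case
    unfolding stepping.simps interlacing_Cons_image by simp
qed simp

text \<open>The last row of the dented trapezoid is forced: a block of n + 1 consecutive positions
  is strictly interlaced only by a block of n.\<close>

theorem P_num_positions: "P_num n n a = Kd (n + 1) a {a+1..a+n+1}"
proof -
  let ?R = "trapezoid (2 * n) a"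
  have reg: "P_polygon n n a = cell ` (?R - utri (2 * int n - 1) (1 + 2 * int a) n)"
  proof -
    have "{(u, k). 0 \<le> u \<and> u < int n + int n \<and> 0 \<le> k \<and> u - 2 * int n + 1 \<le> k \<and>
      k \<le> 2 * int a + u \<and> k \<le> 2 * int (n + a) - 1 - u} = ?R - utri (2 * int n - 1) (1 + 2 * int a) n"
      by (auto simp: trapezoid_def utri_def)
    then show ?thesis by (subst P_polygon_cells) simp_all
  qed
  have "P_num n n a = bcov 1 (?R - utri (2 * int n - 1) (1 + 2 * int a) n)"
    unfolding P_num_def reg by (rule num_tilings_cells)
  also have "\<dots> = bcov 1 (?R - {2 * int n - 1} \<times> utri_base (1 + 2 * int a) n)"
    using utri_subset_trapezoid[of "1 + 2 * int a" n "2 * n" a] by (intro bcov_utri) auto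
  finally have P: "P_num n n a = dented 1 (2 * n) a (utri_base (1 + 2 * int a) n)"
    by (simp add: dented_def)
  have K: "Kd (n + 1) a {a+1..a+n+1} = dented 1 (Suc (2 * n)) a (utri_base (2 * int a) (Suc n))"
    unfolding Kd_def using utri_base_posK[of a "Suc n"] by simp
  show ?thesis
  proof (cases "n = 0")
    case True
    have "trapezoid 0 a = {}" by (auto simp: trapezoid_def)
    then have "P_num n n a = 1" using P True by (simp add: dented_def)
    moreover have "Kd (n + 1) a {a+1..a+n+1} = 1"
      using Kd_formula[of "{a + 1}" 1 a] True by simp
    ultimately show ?thesis by simp
  next
    case False
    let ?r = "2 * int a + int (2 * n) + 1"
    let ?xs = "stepping (2 * int a + 2) n"
    have xs: "utri_base (2 * int a) (Suc n) = set (2 * int a # ?xs)"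
      using set_stepping[of "2 * int a" "Suc n"] by simp
    have mem: "2 * int a \<le> x \<and> x \<le> 2 * int a + 2 * int n \<and> even x" if "x \<in> set (2 * int a # ?xs)" for x
    proof -
      have "x \<in> utri_base (2 * int a) (Suc n)" unfolding xs by (rule that)
      then show ?thesis unfolding utri_base_iff by auto
    qed
    have "dented 1 (Suc (2 * n)) a (utri_base (2 * int a) (Suc n)) =
        (\<Sum>Y\<in>Pow (par (0 + 1) ?r). rowcov 1 (int (2 * n)) 0 ?r (set (2 * int a # ?xs) \<union> Y) * dented 1 (2 * n) a Y)"
      unfolding xs by (subst dented_transfer) (use False mem in auto)
    also have "\<dots> = (\<Sum>ys\<in>interlacing (2 * int a + 1) ?xs. dented 1 (2 * n) a (set ys))"
    proof (rule sum_rowcov_inner)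
      show "sorted_wrt (<) (2 * int a # ?xs)" using stepping_sorted[of "2 * int a" "Suc n"] by simp
      show "set (2 * int a # ?xs) \<subseteq> {0..<?r}" using mem by force
      show "\<forall>x'\<in>set (2 * int a # ?xs). even (x' - 0)" using mem by auto
    qed simp
    also have "\<dots> = dented 1 (2 * n) a (utri_base (1 + 2 * int a) n)"
      unfolding interlacing_stepping by (simp add: set_stepping add.commute)
    finally show ?thesis using P K by simp
  qed
qed

section \<open>Reflection in a horizontal line\<close>

text \<open>The reflection moves every cell off the axis, so that all weights become 1.\<close>

lemma bcov_reflect:
  assumes "odd H" "\<And>r k. (r, k) \<in> R \<Longrightarrow> 0 \<le> k"
  shows "bcov \<theta> ((\<lambda>(r, k). (H - 1 - r, k + 1)) ` R) = bcov 1 R"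
proof -
  let ?g = "\<lambda>(r, k). (H - 1 - r, k + 1) :: int \<times> int"
  have inj: "inj ?g" by (auto simp: inj_def)
  have h: "?g ` hbrick r k = hbrick (H - 1 - r) (k + 1)" for r k
    by (auto simp: hbrick_def)
  have v: "?g ` vbrick r k = vbrick (H - 2 - r) (k + 1)" for r k
    by (auto simp: vbrick_def)
  have rng: "range ?g = UNIV"
  proof -
    have "(u, k) = ?g (H - 1 - u, k - 1)" for u k by simp
    then show ?thesis by (metis UNIV_eq_I rangeI surj_pair)
  qed
  have "(`) ?g ` bricks = bricks"
  proof (intro equalityI subsetI)
    fix l assume "l \<in> (`) ?g ` bricks"
    then consider (h) r k where "l = ?g ` hbrick r k" | (v) r k where "l = ?g ` vbrick r k" "even (r + k)"
      by (auto simp: bricks_def)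
    then show "l \<in> bricks"
    proof cases
      case h' : h
      then show ?thesis unfolding h by (auto simp: bricks_def)
    next
      case v' : v
      have "even (H - 2 - r + (k + 1))" using assms(1) v'(2) by presburger
      then show ?thesis unfolding v'(1) v unfolding bricks_def by blast
    qed
  next
    fix l assume "l \<in> bricks"
    then consider (h) u k where "l = hbrick u k" | (v) u k where "l = vbrick u k" "even (u + k)"
      by (auto simp: bricks_def)
    then show "l \<in> (`) ?g ` bricks"
    proof cases
      case h': h
      have "l = ?g ` hbrick (H - 1 - u) (k - 1)" unfolding h h' by simp
      moreover have "hbrick (H - 1 - u) (k - 1) \<in> bricks" by (auto simp: bricks_def)
      ultimately show ?thesis by blast
    next
      case v': v
      have "l = ?g ` vbrick (H - 2 - u) (k - 1)" unfolding v v'(1) by simp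
      moreover have "even (H - 2 - u + (k - 1))" using assms(1) v'(2) by presburger
      then have "vbrick (H - 2 - u) (k - 1) \<in> bricks" unfolding bricks_def by blast
      ultimately show ?thesis by blast
    qed
  qed
  then have "bcov \<theta> (?g ` R) = cov bricks (\<lambda>l. axis_weight \<theta> (?g ` l)) R"
    by (intro cov_image inj) (simp only: rng subset_UNIV simp_thms Collect_mem_eq)
  also have "\<dots> = bcov 1 R"
  proof (rule cov_cong)
    fix l assume l: "l \<in> bricks" "l \<subseteq> R"
    then consider (h) r k where "l = hbrick r k" | (v) r k where "l = vbrick r k"
      by (auto simp: bricks_def)
    then show "axis_weight \<theta> (?g ` l) = axis_weight 1 l"
    proof cases
      case h': h
      show ?thesis unfolding h' h by simp
    next
      case v': v
      have "(r, k) \<in> R" using l(2) v' by (auto simp: vbrick_def)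
      then have "0 \<le> k" by (rule assms(2))
      then show ?thesis unfolding v' v by simp
    qed
  qed
  finally show ?thesis .
qed

section \<open>The region with a fern removed\<close>

text \<open>The down-pointing triangle of side a hanging from the marked line at distance s from the
  zigzag, below 2n rows.\<close>

definition dtri :: "int \<Rightarrow> int \<Rightarrow> nat \<Rightarrow> (int \<times> int) set" where
  "dtri n s a = {(u, k). 2 * n \<le> u \<and> u + k + 1 \<le> 2 * (n + s + int a) \<and> 2 * (s - n) + 1 \<le> k - u}"

lemma down_triangle_dtri: "down_triangle (n + s, - (2 * n)) a = cell ` dtri n s a"
  by (rule eq_cells) (auto simp: down_triangle_cells dtri_def)

text \<open>The part of the region above the marked line. Besides the triangles of the fern, it
  lacks a triangle of side y - z in its lower right corner if y > z.\<close>

definition H6_up :: "nat \<Rightarrow> nat \<Rightarrow> nat \<Rightarrow> nat list \<Rightarrow> (int \<times> int) set" where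
  "H6_up x y z a = (let n = y + odd_sum a; m = odd_sum a + even_sum a in
     trapezoid (2 * n) (x + even_sum a) - htri (int n) (entry a 1)
     - (\<Union>i\<in>{i \<in> {1..length a}. odd i \<and> i \<noteq> 1}. utri (2 * int n - 1) (1 + 2 * int (s_sum (i - 1) a)) (entry a i))
     - utri (2 * int n - 1) (1 + 2 * int (m + x + z)) (y - z))"

text \<open>The reflection of the part below the marked line, with the triangles of the fern
  pointing upwards; it lacks a triangle of side z - y in its lower right corner if z > y.\<close>

definition H6_low :: "nat \<Rightarrow> nat \<Rightarrow> nat \<Rightarrow> nat list \<Rightarrow> (int \<times> int) set" where
  "H6_low x y z a = (let h = 2 * (z + even_sum a) - 1; m = odd_sum a + even_sum a in
     trapezoid h (x + odd_sum a)
     - (\<Union>i\<in>{i \<in> {1..length a}. even i}. utri (int h - 1) (0 + 2 * int (s_sum (i - 1) a)) (entry a i))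
     - utri (int h - 1) (0 + 2 * int (m + x + y)) (z - y))"

text \<open>The reflection that reverses the order of all H rows. Positions move by one, as
  the reflected zigzag below the marked line does.\<close>

abbreviation flip :: "int \<Rightarrow> int \<times> int \<Rightarrow> int \<times> int" where
  "flip H \<equiv> \<lambda>(r, k). (H - 1 - r, k + 1)"

lemma flip_mem: "(u, k) \<in> flip H ` R \<longleftrightarrow> (H - 1 - u, k - 1) \<in> R"
proof
  assume "(H - 1 - u, k - 1) \<in> R"
  then have "flip H (H - 1 - u, k - 1) \<in> flip H ` R" by (rule imageI)
  then show "(u, k) \<in> flip H ` R" by simp
qed auto


lemma H6_region_cells:
  assumes "z + even_sum a \<ge> 1" "length a \<ge> 1"
  shows "H6_region x y z a = cell ` (H6_up x y z a \<union> flip (2 * int (y + z + odd_sum a + even_sum a) - 1) ` H6_low x y z a)"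
proof (rule eq_cells)
  fix u k
  let ?n = "y + odd_sum a" and ?m = "odd_sum a + even_sum a" and ?H = "2 * int (y + z + odd_sum a + even_sum a) - 1"
  let ?I = "{i \<in> {1..length a}. odd i \<and> i \<noteq> 1}" and ?J = "{i \<in> {1..length a}. even i}"
  let ?ut = "\<lambda>i. utri (2 * int ?n - 1) (1 + 2 * int (s_sum (i - 1) a)) (entry a i)"
  let ?dt = "\<lambda>i. dtri (int ?n) (int (s_sum (i - 1) a)) (entry a i)"
  have W0: "path_end (H6_west y a) = (int ?n, - (2 * int ?n))"
    by (simp add: H6_west_def)
  have ut: "up_triangle ((int ?n, - (2 * int ?n)) + (int (s_sum (i - 1) a), 0)) (entry a i) = cell ` ?ut i" for i
    by (simp add: up_triangle_utri algebra_simps)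
  have dt: "down_triangle ((int ?n, - (2 * int ?n)) + (int (s_sum (i - 1) a), 0)) (entry a i) = cell ` ?dt i" for i
    using down_triangle_dtri[of "int ?n" "int (s_sum (i - 1) a)" "entry a i"] by simp
  have al: "cell (u, k) \<in> above_left ((int ?n, - (2 * int ?n)) + (int (entry a 1), 0)) \<longleftrightarrow>
      u \<le> 2 * int ?n - 1 \<and> k - u \<le> 2 * (int (entry a 1) - int ?n)"
    by (simp add: above_left_cells) linarith
  have "i \<in> {1..length a} \<longleftrightarrow> i \<in> {1} \<union> ?I \<union> ?J" for i
    using assms(2) by (cases "i = 1"; cases "even i") auto
  then have idx: "{1..length a} = {1} \<union> ?I \<union> ?J" by (rule Set.set_eqI)
  have rem: "cell (u, k) \<in> H6_removed y a \<longleftrightarrow> (u \<le> 2 * int ?n - 1 \<and> k - u \<le> 2 * (int (entry a 1) - int ?n)) \<or>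
      (\<exists>i\<in>?I. (u, k) \<in> ?ut i) \<or> (\<exists>i\<in>?J. (u, k) \<in> ?dt i)"
  proof -
    have "cell (u, k) \<in> H6_removed y a \<longleftrightarrow> (\<exists>i\<in>{1..length a}. cell (u, k) \<in>
      (if i = 1 then above_left ((int ?n, - (2 * int ?n)) + (int (entry a 1), 0))
           else if odd i then cell ` ?ut i else cell ` ?dt i))"
      unfolding H6_removed_def Let_def W0 ut dt by (rule UN_iff)
    also have "\<dots> \<longleftrightarrow> cell (u, k) \<in> above_left ((int ?n, - (2 * int ?n)) + (int (entry a 1), 0)) \<or>
        (\<exists>i\<in>?I. cell (u, k) \<in> cell ` ?ut i) \<or> (\<exists>i\<in>?J. cell (u, k) \<in> cell ` ?dt i)"
    proof -
      have I: "(\<exists>i\<in>?I. t \<in> (if i = 1 then X else if odd i then Y i else Z i)) \<longleftrightarrow> (\<exists>i\<in>?I. t \<in> Y i)"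
        for t :: tri and X and Y Z :: "nat \<Rightarrow> tri set"
        by (rule bex_cong[OF refl]) simp
      have J: "(\<exists>i\<in>?J. t \<in> (if i = 1 then X else if odd i then Y i else Z i)) \<longleftrightarrow> (\<exists>i\<in>?J. t \<in> Z i)"
        for t :: tri and X and Y Z :: "nat \<Rightarrow> tri set"
        by (rule bex_cong[OF refl]) auto
      have 1: "(\<exists>i\<in>{1::nat}. t \<in> (if i = 1 then X else if odd i then Y i else Z i)) \<longleftrightarrow> t \<in> X"
        for t :: tri and X and Y Z :: "nat \<Rightarrow> tri set"
        by simp
      have sp: "(\<exists>i\<in>{1..length a}. Q i) \<longleftrightarrow> (\<exists>i\<in>{1}. Q i) \<or> (\<exists>i\<in>?I. Q i) \<or> (\<exists>i\<in>?J. Q i)" for Q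
        unfolding bex_cong[OF idx refl] bex_Un disj_assoc ..
      show ?thesis unfolding sp I J 1 ..
    qed
    finally show ?thesis unfolding al cell_image_iff .
  qed
  have pol: "cell (u, k) \<in> H6_polygon x y z a \<longleftrightarrow> 0 \<le> u \<and> u < ?H \<and>
      (if u < 2 * int ?n then 0 else 1) \<le> k \<and> k \<le> 2 * int (x + even_sum a) + u \<and>
      k \<le> 2 * int (x + y + z + even_sum a + 2 * odd_sum a) - 1 - u"
    unfolding H6_polygon_cells[OF assms(1)] cell_image_iff by simp
  have ut_high: "u < 2 * int ?n" if "(u, k) \<in> ?ut i" for i using that by (auto simp: utri_def)
  have dt_low: "2 * int ?n \<le> u" if "(u, k) \<in> ?dt i" for i using that by (auto simp: dtri_def)
  show "cell (u, k) \<in> H6_region x y z a \<longleftrightarrow> (u, k) \<in> H6_up x y z a \<union> flip ?H ` H6_low x y z a"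
  proof (cases "u < 2 * int ?n")
    case True
    have "(u, k) \<notin> flip ?H ` H6_low x y z a"
      unfolding flip_mem using True assms(1) by (auto simp: H6_low_def trapezoid_def Let_def of_nat_diff)
    moreover have "cell (u, k) \<in> H6_region x y z a \<longleftrightarrow> (0 \<le> u \<and> 0 \<le> k \<and> k \<le> 2 * int (x + even_sum a) + u \<and>
      k \<le> 2 * int (x + y + z + even_sum a + 2 * odd_sum a) - 1 - u) \<and> \<not> (k - u \<le> 2 * (int (entry a 1) - int ?n)) \<and> \<not> (\<exists>i\<in>?I. (u, k) \<in> ?ut i)"
      unfolding H6_region_def Diff_iff rem pol using True dt_low assms(1) by fastforce
    moreover have "(u, k) \<in> H6_up x y z a \<longleftrightarrow> (0 \<le> u \<and> 0 \<le> k \<and> k \<le> 2 * int (x + even_sum a) + u \<and>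
      k \<le> 2 * int (x + y + z + even_sum a + 2 * odd_sum a) - 1 - u) \<and> \<not> (k - u \<le> 2 * (int (entry a 1) - int ?n)) \<and> \<not> (\<exists>i\<in>?I. (u, k) \<in> ?ut i)"
    proof -
      have *: "(u, k) \<in> utri (2 * int ?n - 1) (1 + 2 * int (?m + x + z)) (y - z) \<longleftrightarrow>
          \<not> k \<le> 2 * int (x + y + z + even_sum a + 2 * odd_sum a) - 1 - u"
        if "0 \<le> u" "k \<le> 2 * int (x + even_sum a) + u"
        using that True by (simp add: utri_def) linarith
      show ?thesis
        unfolding H6_up_def Let_def Diff_iff UN_iff using True * by (auto simp: trapezoid_def htri_def)
    qed
    ultimately show ?thesis by blast
  next
    case False
    have "(u, k) \<notin> H6_up x y z a"
      using False by (auto simp: H6_up_def trapezoid_def Let_def)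
    moreover have "cell (u, k) \<in> H6_region x y z a \<longleftrightarrow> (u < ?H \<and> 1 \<le> k \<and> k \<le> 2 * int (x + even_sum a) + u \<and>
      k \<le> 2 * int (x + y + z + even_sum a + 2 * odd_sum a) - 1 - u) \<and> \<not> (\<exists>i\<in>?J. (u, k) \<in> ?dt i)"
      unfolding H6_region_def Diff_iff rem pol using False ut_high by fastforce
    moreover have "(H - 1 - u, k - 1) \<in> H6_low x y z a \<longleftrightarrow> (u < ?H \<and> 1 \<le> k \<and> k \<le> 2 * int (x + even_sum a) + u \<and>
      k \<le> 2 * int (x + y + z + even_sum a + 2 * odd_sum a) - 1 - u) \<and> \<not> (\<exists>i\<in>?J. (u, k) \<in> ?dt i)" if "H = ?H" for H
    proof -
      have h: "int (2 * (z + even_sum a) - 1) = 2 * int (z + even_sum a) - 1"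
        using assms(1) by (simp add: of_nat_diff)
      have *: "(H - 1 - u, k - 1) \<in> utri (int (2 * (z + even_sum a) - 1) - 1) (0 + 2 * int (?m + x + y)) (z - y) \<longleftrightarrow>
          \<not> k \<le> 2 * int (x + even_sum a) + u" if "u < ?H" "k \<le> 2 * int (x + y + z + even_sum a + 2 * odd_sum a) - 1 - u"
        unfolding h using that False \<open>H = ?H\<close> by (simp add: utri_def) linarith
      have **: "(H - 1 - u, k - 1) \<in> utri (int (2 * (z + even_sum a) - 1) - 1) (0 + 2 * int (s_sum (i - 1) a)) (entry a i) \<longleftrightarrow>
          (u, k) \<in> ?dt i" for i
        unfolding h using False \<open>H = ?H\<close> by (simp add: utri_def dtri_def) linarith
      have t: "(H - 1 - u, k - 1) \<in> trapezoid (2 * (z + even_sum a) - 1) (x + odd_sum a) \<longleftrightarrow>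
          u < ?H \<and> 1 \<le> k \<and> k \<le> 2 * int (x + y + z + even_sum a + 2 * odd_sum a) - 1 - u"
        unfolding trapezoid_def mem_Collect_eq prod.case h using False \<open>H = ?H\<close> by (simp; linarith)
      show ?thesis
        unfolding H6_low_def Let_def Diff_iff UN_iff ** t using * by blast
    qed
    ultimately show ?thesis unfolding Un_iff flip_mem by blast
  qed
qed


lemma odpos_first:
  assumes "length a \<ge> 1"
  shows "odpos a = {1..entry a 1} \<union> (\<Union>i\<in>{i \<in> {1..length a}. odd i \<and> i \<noteq> 1}. {s_sum (i - 1) a + 1..s_sum (i - 1) a + entry a i})"
proof -
  have "{i \<in> {1..length a}. odd i} = insert 1 {i \<in> {1..length a}. odd i \<and> i \<noteq> 1}" using assms by auto
  then show ?thesis unfolding odpos_alt by simp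
qed

lemma utri_bottom: "(v, l) \<in> utri v k s \<longleftrightarrow> k \<le> l \<and> l \<le> k + 2 * int s - 2"
  by (auto simp: utri_def)

text \<open>The positions on the marked line where the upper part has a triangle to be joined with
  one below.\<close>

lemma H6_up_bottom:
  assumes "length a \<ge> 1" "p \<ge> 1"
  shows "(2 * int (y + odd_sum a) - 1, 2 * int p - 1) \<in> H6_up x y z a \<longleftrightarrow>
    y + odd_sum a \<ge> 1 \<and> p \<le> odd_sum a + even_sum a + x + y \<and> p \<notin> odpos a \<and>
    p \<notin> {odd_sum a + even_sum a + x + z + 1..odd_sum a + even_sum a + x + y}"
proof -
  let ?n = "y + odd_sum a" and ?m = "odd_sum a + even_sum a"
  have 1: "(2 * int ?n - 1, 2 * int p - 1) \<in> trapezoid (2 * ?n) (x + even_sum a) \<longleftrightarrow> ?n \<ge> 1 \<and> p \<le> ?m + x + y"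
    using assms(2) by (simp add: trapezoid_def) linarith
  have 2: "(2 * int ?n - 1, 2 * int p - 1) \<in> htri (int ?n) (entry a 1) \<longleftrightarrow> p \<in> {1..entry a 1}"
    using assms(2) by (auto simp: htri_def)
  have 3: "(2 * int ?n - 1, 2 * int p - 1) \<in> utri (2 * int ?n - 1) (1 + 2 * int s) t \<longleftrightarrow> p \<in> {s+1..s+t}" for s t
    unfolding utri_bottom by auto
  have 4: "p \<in> {?m + x + z + 1..?m + x + z + (y - z)} \<longleftrightarrow> p \<in> {?m + x + z + 1..?m + x + y}"
    by auto
  show ?thesis
    unfolding H6_up_def Let_def Diff_iff UN_iff 1 2 3 4 odpos_first[OF assms(1)] Un_iff by blast
qed

lemma H6_low_bottom:
  assumes "z + even_sum a \<ge> 1" "p \<ge> 1"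
  shows "(int (2 * (z + even_sum a) - 1) - 1, 2 * int p - 2) \<in> H6_low x y z a \<longleftrightarrow>
    p \<le> odd_sum a + even_sum a + x + z \<and> p \<notin> evpos a \<and>
    p \<notin> {odd_sum a + even_sum a + x + y + 1..odd_sum a + even_sum a + x + z}"
proof -
  let ?h = "2 * (z + even_sum a) - 1" and ?m = "odd_sum a + even_sum a"
  have 1: "(int ?h - 1, 2 * int p - 2) \<in> trapezoid ?h (x + odd_sum a) \<longleftrightarrow> p \<le> ?m + x + z"
    using assms by (simp add: trapezoid_def of_nat_diff) linarith
  have 3: "(int ?h - 1, 2 * int p - 2) \<in> utri (int ?h - 1) (0 + 2 * int s) t \<longleftrightarrow> p \<in> {s+1..s+t}" for s t
    unfolding utri_bottom by auto
  have 4: "p \<in> {?m + x + y + 1..?m + x + y + (z - y)} \<longleftrightarrow> p \<in> {?m + x + y + 1..?m + x + z}"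
    by auto
  show ?thesis
    unfolding H6_low_def Let_def Diff_iff UN_iff 1 3 4 evpos_alt by blast
qed

lemma H6_up_count:
  assumes len: "length a \<ge> 1" and S: "S \<subseteq> {odd_sum a + even_sum a + 1..odd_sum a + even_sum a + x + min y z}"
  shows "bcov (1 / 2) (H6_up x y z a - {2 * int (y + odd_sum a) - 1} \<times> posQ S) =
    2 ^ entry a 1 * Qd (y + odd_sum a) (x + even_sum a)
      (odpos a \<union> S \<union> {odd_sum a + even_sum a + x + z + 1..odd_sum a + even_sum a + x + y})"
proof -
  let ?n = "y + odd_sum a" and ?m = "odd_sum a + even_sum a" and ?l = "Suc (length a)" and ?e = "entry a 1"
  let ?v = "2 * int ?n - 1"
  let ?I = "{i \<in> {1..length a}. odd i \<and> i \<noteq> 1}"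
  let ?J = "insert ?l ?I"
  define \<sigma> where "\<sigma> i = (if i = ?l then ?m + x + z else s_sum (i - 1) a)" for i
  define \<tau> where "\<tau> i = (if i = ?l then y - z else entry a i)" for i
  let ?T = "trapezoid (2 * ?n) (x + even_sum a)"
  let ?R = "?T - {?v} \<times> posQ S"
  let ?H = "htri (int ?n) ?e"
  let ?B = "\<Union>i\<in>?J. utri_base (1 + 2 * int (\<sigma> i)) (\<tau> i)"
  have eI: "s_sum (i - 1) a + entry a i \<le> ?m" if "i \<in> ?I" for i
    using s_sum_step[of i a] s_sum_le[of i a] that by auto
  have first: "?e \<le> \<sigma> i" if "i \<in> ?J" for i
  proof -
    have e1: "?e = s_sum 1 a" using s_sum_step[of 1 a] by simp
    show ?thesis
    proof (cases "i = ?l")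
      case True
      then show ?thesis using e1 s_sum_le[of 1 a] len by (simp add: \<sigma>_def)
    next
      case False
      then have "1 \<le> i - 1" using that by auto
      then show ?thesis using e1 s_sum_mono[of 1 "i - 1" a] False by (simp add: \<sigma>_def)
    qed
  qed
  have posQS: "2 * int ?m + 1 \<le> l \<and> l \<le> 2 * int (?m + x + min y z) - 1" if "l \<in> posQ S" for l
    using that S by (force simp: posQ_def)
  have sub: "utri ?v (1 + 2 * int (\<sigma> i)) (\<tau> i) \<subseteq> ?R - ?H" if i: "i \<in> ?J" for i
  proof -
    have "utri ?v (1 + 2 * int (\<sigma> i)) (\<tau> i) \<subseteq> ?T"
    proof (cases "\<tau> i = 0")
      case True
      then show ?thesis by (auto simp: utri_def)
    next
      case False
      have "utri (int (2 * ?n) - 1) (1 + 2 * int (\<sigma> i)) (\<tau> i) \<subseteq> ?T"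
      proof (rule utri_subset_trapezoid)
        show "\<tau> i \<le> 2 * ?n" using i entry_le(1)[of i a] by (auto simp: \<tau>_def)
        show "1 + 2 * int (\<sigma> i) + 2 * int (\<tau> i) - 2 \<le> 2 * int (x + even_sum a) + int (2 * ?n) - 1"
          using eI[of i] i False by (auto simp: \<sigma>_def \<tau>_def of_nat_diff split: if_splits)
      qed simp
      then show ?thesis by simp
    qed
    moreover have "l \<notin> posQ S" if "(?v, l) \<in> utri ?v (1 + 2 * int (\<sigma> i)) (\<tau> i)" for l
    proof
      assume "l \<in> posQ S"
      note b = posQS[OF this] utri_range[OF that]
      show False
      proof (cases "i = ?l")
        case True
        then show False using b by (simp add: \<sigma>_def min_def split: if_splits)
      next
        case False
        then show False using b eI[of i] i by (simp add: \<sigma>_def \<tau>_def)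
      qed
    qed
    moreover have "(u, l) \<notin> ?H" if "(u, l) \<in> utri ?v (1 + 2 * int (\<sigma> i)) (\<tau> i)" for u l
      using utri_range[OF that] first[OF i] by (auto simp: htri_def)
    ultimately show ?thesis by auto
  qed
  have "H6_up x y z a - {?v} \<times> posQ S = ?R - ?H - (\<Union>i\<in>?J. utri ?v (1 + 2 * int (\<sigma> i)) (\<tau> i))"
  proof -
    have "(\<Union>i\<in>?I. utri ?v (1 + 2 * int (s_sum (i - 1) a)) (entry a i)) = (\<Union>i\<in>?I. utri ?v (1 + 2 * int (\<sigma> i)) (\<tau> i))"
      by (intro SUP_cong refl) (auto simp: \<sigma>_def \<tau>_def)
    moreover have "utri ?v (1 + 2 * int (?m + x + z)) (y - z) = utri ?v (1 + 2 * int (\<sigma> ?l)) (\<tau> ?l)"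
      by (simp add: \<sigma>_def \<tau>_def)
    ultimately show ?thesis
      unfolding H6_up_def Let_def UN_insert by blast
  qed
  then have "bcov (1 / 2) (H6_up x y z a - {?v} \<times> posQ S) = bcov (1 / 2) (?R - ?H - (\<Union>i\<in>?J. utri ?v (1 + 2 * int (\<sigma> i)) (\<tau> i)))"
    by simp
  also have "\<dots> = bcov (1 / 2) (?R - ?H - {?v} \<times> ?B)"
  proof (rule bcov_family)
    fix i j assume ij: "i \<in> ?J" "j \<in> ?J" "i < j"
    then have i: "i \<in> ?I" by auto
    show "\<sigma> i + \<tau> i \<le> \<sigma> j"
    proof (cases "j = ?l")
      case True
      then show ?thesis using eI[OF i] ij by (simp add: \<sigma>_def \<tau>_def)
    next
      case False
      then show ?thesis using s_sum_sep[of i j a] ij i by (auto simp: \<sigma>_def \<tau>_def)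
    qed
  qed (use sub in auto)
  also have "?R - ?H - {?v} \<times> ?B = (?R - {?v} \<times> ?B) - ?H"
    by blast
  also have "bcov (1 / 2) \<dots> = 2 ^ ?e * ((1 / 2) ^ ?e * bcov (1 / 2) ((?R - {?v} \<times> ?B) - ?H))"
    by (simp add: power_one_over)
  also have "(1 / 2) ^ ?e * bcov (1 / 2) ((?R - {?v} \<times> ?B) - ?H) = bcov (1 / 2) ((?R - {?v} \<times> ?B) - {?v} \<times> utri_base 1 ?e)"
  proof (rule bcov_htri[symmetric])
    have "?e \<le> odd_sum a" using entry_le(1)[of 1 a] len by simp
    then have "?H \<subseteq> ?T" by (auto simp: htri_def trapezoid_def)
    moreover have "l \<notin> posQ S \<and> l \<notin> ?B" if "(u, l) \<in> ?H" for u l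
    proof -
      have l: "l \<le> 2 * int ?e - 1" using that by (auto simp: htri_def)
      have "l \<notin> posQ S"
      proof
        assume "l \<in> posQ S"
        then have "2 * int ?m + 1 \<le> l" using posQS by blast
        then show False using l \<open>?e \<le> odd_sum a\<close> by simp
      qed
      moreover have "l \<notin> ?B"
      proof
        assume "l \<in> ?B"
        then obtain i where i: "i \<in> ?J" "l \<in> utri_base (1 + 2 * int (\<sigma> i)) (\<tau> i)" by blast
        then have "1 + 2 * int (\<sigma> i) \<le> l" by (simp add: utri_base_iff)
        then show False using l first[OF i(1)] by simp
      qed
      ultimately show ?thesis ..
    qed
    ultimately show "?H \<subseteq> ?R - {?v} \<times> ?B" by auto
    show "finite (?R - {?v} \<times> ?B)" by simp
  qed (auto simp: trapezoid_def)
  also have "(?R - {?v} \<times> ?B) - {?v} \<times> utri_base 1 ?e = ?T - {?v} \<times> (utri_base 1 ?e \<union> ?B \<union> posQ S)"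
    by blast
  also have "utri_base 1 ?e \<union> ?B \<union> posQ S = posQ (odpos a \<union> S \<union> {?m + x + z + 1..?m + x + y})"
  proof -
    have "?B = (\<Union>i\<in>?J. posQ {\<sigma> i + 1..\<sigma> i + \<tau> i})"
      unfolding utri_base_posQ[symmetric] by (simp add: add.commute)
    also have "\<dots> = posQ {?m + x + z + 1..?m + x + z + (y - z)} \<union> (\<Union>i\<in>?I. posQ {s_sum (i - 1) a + 1..s_sum (i - 1) a + entry a i})"
      unfolding UN_insert by (intro arg_cong2[of _ _ _ _ "(\<union>)"] SUP_cong refl) (auto simp: \<sigma>_def \<tau>_def)
    also have "{?m + x + z + 1..?m + x + z + (y - z)} = {?m + x + z + 1..?m + x + y}"
      by auto
    finally show ?thesis
      unfolding odpos_first[OF len] posQ_Un posQ_UN using utri_base_posQ[of 0 ?e] by auto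
  qed
  finally show ?thesis by (simp add: Qd_def dented_def)
qed

lemma H6_low_count:
  assumes E: "z + even_sum a \<ge> 1" and S: "S \<subseteq> {odd_sum a + even_sum a + 1..odd_sum a + even_sum a + x + min y z}"
  shows "bcov 1 (H6_low x y z a - {int (2 * (z + even_sum a) - 1) - 1} \<times> posK S) =
    Kd (z + even_sum a) (x + odd_sum a)
      (evpos a \<union> S \<union> {odd_sum a + even_sum a + x + y + 1..odd_sum a + even_sum a + x + z})"
proof -
  let ?h = "2 * (z + even_sum a) - 1" and ?m = "odd_sum a + even_sum a" and ?l = "Suc (length a)"
  let ?v = "int ?h - 1"
  let ?I = "{i \<in> {1..length a}. even i}"
  let ?J = "insert ?l ?I"
  define \<sigma> where "\<sigma> i = (if i = ?l then ?m + x + y else s_sum (i - 1) a)" for i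
  define \<tau> where "\<tau> i = (if i = ?l then z - y else entry a i)" for i
  let ?T = "trapezoid ?h (x + odd_sum a)"
  let ?R = "?T - {?v} \<times> posK S"
  let ?B = "\<Union>i\<in>?J. utri_base (0 + 2 * int (\<sigma> i)) (\<tau> i)"
  have h: "int ?h = 2 * int (z + even_sum a) - 1" using E by (simp add: of_nat_diff)
  have eI: "s_sum (i - 1) a + entry a i \<le> ?m" if "i \<in> ?I" for i
    using s_sum_step[of i a] s_sum_le[of i a] that by auto
  have posKS: "2 * int ?m \<le> l \<and> l \<le> 2 * int (?m + x + min y z) - 2" if "l \<in> posK S" for l
    using that S by (force simp: posK_def)
  have sub: "utri ?v (0 + 2 * int (\<sigma> i)) (\<tau> i) \<subseteq> ?R" if i: "i \<in> ?J" for i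
  proof -
    have "utri ?v (0 + 2 * int (\<sigma> i)) (\<tau> i) \<subseteq> ?T"
    proof (cases "\<tau> i = 0")
      case True
      then show ?thesis by (auto simp: utri_def)
    next
      case False
      show ?thesis
      proof (rule utri_subset_trapezoid)
        show "\<tau> i \<le> ?h" using i entry_le(2)[of i a] E by (auto simp: \<tau>_def)
        show "0 + 2 * int (\<sigma> i) + 2 * int (\<tau> i) - 2 \<le> 2 * int (x + odd_sum a) + int ?h - 1"
          unfolding h using eI[of i] i False by (auto simp: \<sigma>_def \<tau>_def of_nat_diff split: if_splits)
      qed simp
    qed
    moreover have "l \<notin> posK S" if "(?v, l) \<in> utri ?v (0 + 2 * int (\<sigma> i)) (\<tau> i)" for l
    proof
      assume "l \<in> posK S"
      note b = posKS[OF this] utri_range[OF that]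
      show False
      proof (cases "i = ?l")
        case True
        then show False using b by (simp add: \<sigma>_def min_def split: if_splits)
      next
        case False
        then show False using b eI[of i] i by (simp add: \<sigma>_def \<tau>_def)
      qed
    qed
    ultimately show ?thesis by auto
  qed
  have "H6_low x y z a - {?v} \<times> posK S = ?R - (\<Union>i\<in>?J. utri ?v (0 + 2 * int (\<sigma> i)) (\<tau> i))"
  proof -
    have "(\<Union>i\<in>?I. utri ?v (0 + 2 * int (s_sum (i - 1) a)) (entry a i)) = (\<Union>i\<in>?I. utri ?v (0 + 2 * int (\<sigma> i)) (\<tau> i))"
      by (intro SUP_cong refl) (auto simp: \<sigma>_def \<tau>_def)
    moreover have "utri ?v (0 + 2 * int (?m + x + y)) (z - y) = utri ?v (0 + 2 * int (\<sigma> ?l)) (\<tau> ?l)"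
      by (simp add: \<sigma>_def \<tau>_def)
    ultimately show ?thesis
      unfolding H6_low_def Let_def UN_insert by blast
  qed
  then have "bcov 1 (H6_low x y z a - {?v} \<times> posK S) = bcov 1 (?R - (\<Union>i\<in>?J. utri ?v (0 + 2 * int (\<sigma> i)) (\<tau> i)))"
    by simp
  also have "\<dots> = bcov 1 (?R - {?v} \<times> ?B)"
  proof (rule bcov_family)
    show "even (?v + 0)" unfolding h by simp
    fix i j assume ij: "i \<in> ?J" "j \<in> ?J" "i < j"
    then have i: "i \<in> ?I" by auto
    show "\<sigma> i + \<tau> i \<le> \<sigma> j"
    proof (cases "j = ?l")
      case True
      then show ?thesis using eI[OF i] ij by (simp add: \<sigma>_def \<tau>_def)
    next
      case False
      then show ?thesis using s_sum_sep[of i j a] ij i by (auto simp: \<sigma>_def \<tau>_def)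
    qed
  qed (use sub in auto)
  also have "?R - {?v} \<times> ?B = ?T - {?v} \<times> (?B \<union> posK S)"
    by blast
  also have "?B \<union> posK S = posK (evpos a \<union> S \<union> {?m + x + y + 1..?m + x + z})"
  proof -
    have "?B = (\<Union>i\<in>?J. posK {\<sigma> i + 1..\<sigma> i + \<tau> i})"
      unfolding utri_base_posK[symmetric] by simp
    also have "\<dots> = posK {?m + x + y + 1..?m + x + y + (z - y)} \<union> (\<Union>i\<in>?I. posK {s_sum (i - 1) a + 1..s_sum (i - 1) a + entry a i})"
      unfolding UN_insert by (intro arg_cong2[of _ _ _ _ "(\<union>)"] SUP_cong refl) (auto simp: \<sigma>_def \<tau>_def)
    also have "{?m + x + y + 1..?m + x + y + (z - y)} = {?m + x + y + 1..?m + x + z}"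
      by auto
    finally show ?thesis
      unfolding evpos_alt posK_Un posK_UN by auto
  qed
  finally show ?thesis by (simp add: Kd_def dented_def)
qed


lemma pair_set_eqI: "(\<And>u k. (u, k) \<in> A \<longleftrightarrow> (u, k) \<in> B) \<Longrightarrow> A = B"
  by auto

lemma inj_posQ: "inj posQ"
proof -
  have "inj (\<lambda>p. 2 * int p - 1)" by (auto simp: inj_def)
  then show ?thesis
    unfolding posQ_def by (intro injI) (simp add: inj_image_eq_iff)
qed

text \<open>Cutting the region along the marked line. A tiling determines the set S of positions to
  the right of the fern where a vertical lozenge crosses the line; by the number of dents, only sets
  of size min y z contribute.\<close>

theorem M_H6_sum:
  fixes x y z :: nat
  defines "m \<equiv> \<lambda>a. odd_sum a + even_sum a"
  assumes E: "z + even_sum a \<ge> 1" and len: "length a \<ge> 1"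
  shows "M_H6 x y z a = 2 ^ entry a 1 * (\<Sum>S\<in>{S \<in> Pow {m a + 1..m a + (x + min y z)}. card S = min y z}.
    Qd (y + odd_sum a) (x + even_sum a) (odpos a \<union> S \<union> {m a + x + z + 1..m a + x + y}) *
    Kd (z + even_sum a) (x + odd_sum a) (evpos a \<union> S \<union> {m a + x + y + 1..m a + x + z}))"
proof -
  let ?n = "y + odd_sum a" and ?m = "odd_sum a + even_sum a"
  let ?H = "2 * int (y + z + odd_sum a + even_sum a) - 1"
  let ?h = "2 * (z + even_sum a) - 1"
  let ?U = "H6_up x y z a" and ?W = "H6_low x y z a"
  let ?v = "2 * int ?n - 1"
  let ?f = "vbrick ?v"
  \<comment> \<open>Without rows above the line no lozenge can cross it.\<close>
  let ?C = "if ?n = 0 then {} else {?m + 1..?m + (x + min y z)}"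
  let ?Q = "\<lambda>S. Qd ?n (x + even_sum a) (odpos a \<union> S \<union> {?m + x + z + 1..?m + x + y})"
  let ?K = "\<lambda>S. Kd (z + even_sum a) (x + odd_sum a) (evpos a \<union> S \<union> {?m + x + y + 1..?m + x + z})"
  define L where "L = flip ?H ` ?W"
  have L_mem: "(u, k) \<in> L \<longleftrightarrow> (?H - 1 - u, k - 1) \<in> ?W" for u k
    unfolding L_def by (rule flip_mem)
  have h: "int ?h = 2 * int (z + even_sum a) - 1" using E by (simp add: of_nat_diff)
  have Hv: "?H - 1 - (?v + 1) = int ?h - 1" unfolding h by simp
  have upU: "0 \<le> u \<and> u \<le> ?v \<and> 0 \<le> k" if "(u, k) \<in> ?U" for u k
  proof -
    have "(u, k) \<in> trapezoid (2 * ?n) (x + even_sum a)"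
      using that unfolding H6_up_def Let_def by blast
    then show ?thesis by (simp add: trapezoid_def)
  qed
  have lowW: "0 \<le> r \<and> r \<le> int ?h - 1 \<and> 0 \<le> k" if "(r, k) \<in> ?W" for r k
  proof -
    have "(r, k) \<in> trapezoid ?h (x + odd_sum a)"
      using that unfolding H6_low_def Let_def by blast
    then show ?thesis by (simp add: trapezoid_def)
  qed
  have lowL: "?v + 1 \<le> u \<and> 1 \<le> k" if "(u, k) \<in> L" for u k
  proof -
    have "(?H - 1 - u, k - 1) \<in> ?W" using that unfolding L_mem .
    then have "?H - 1 - u \<le> int ?h - 1" "0 \<le> k - 1" using lowW by blast+
    then show ?thesis unfolding h by auto
  qed
  have finU: "finite ?U"
    unfolding H6_up_def Let_def by (intro finite_Diff finite_trapezoid)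
  have finW: "finite ?W"
    unfolding H6_low_def Let_def by (intro finite_Diff finite_trapezoid)
  have finL: "finite L" unfolding L_def using finW by (rule finite_imageI)
  have UL: "?U \<inter> L = {}"
  proof -
    have "(u, k) \<notin> L" if "(u, k) \<in> ?U" for u k using upU[OF that] lowL[of u k] by auto
    then show ?thesis by auto
  qed
  have start: "M_H6 x y z a = bcov (1 / 2) (?U \<union> L)"
    unfolding M_H6_def H6_region_cells[OF E len] H6_west_def L_def[symmetric]
  proof (rule weighted_tilings_zigzag)
    fix u assume "(u, 0) \<in> ?U \<union> L"
    then have "(u, 0) \<in> ?U" using lowL[of u 0] by auto
    then show "0 \<le> u \<and> u < 2 * int ?n" using upU[of u 0] by auto
  qed
  \<comment> \<open>A vertical lozenge can cross the line exactly at the positions between the fern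
    and the missing corner.\<close>
  have cand: "(?v, 2 * int p - 1) \<in> ?U \<and> (?v + 1, 2 * int p - 1) \<in> L \<longleftrightarrow> p \<in> ?C" if p: "p \<ge> 1" for p
  proof -
    have Lp: "(?v + 1, 2 * int p - 1) \<in> L \<longleftrightarrow> (int ?h - 1, 2 * int p - 2) \<in> ?W"
      unfolding L_mem Hv by simp
    have "p \<notin> odpos a \<and> p \<notin> evpos a \<longleftrightarrow> ?m < p"
    proof -
      have "p \<notin> odpos a \<and> p \<notin> evpos a \<longleftrightarrow> p \<notin> {1..?m}" using positions[of a] by blast
      then show ?thesis using p by auto
    qed
    then show ?thesis
      unfolding Lp H6_up_bottom[OF len p] H6_low_bottom[OF E p] by auto
  qed
  have cross: "l \<in> bricks \<and> (l \<subseteq> ?U \<union> L \<and> l \<inter> ?U \<noteq> {} \<and> l \<inter> L \<noteq> {}) \<longleftrightarrow> l \<in> ?f ` posQ ?C" for l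
  proof
    assume l: "l \<in> bricks \<and> (l \<subseteq> ?U \<union> L \<and> l \<inter> ?U \<noteq> {} \<and> l \<inter> L \<noteq> {})"
    then obtain u k u' k' where uk: "(u, k) \<in> l" "(u, k) \<in> ?U" "(u', k') \<in> l" "(u', k') \<in> L" by auto
    have rows: "u \<le> ?v" "?v + 1 \<le> u'" "1 \<le> k'" using upU[OF uk(2)] lowL[OF uk(4)] by auto
    consider (h) w j where "l = hbrick w j" | (v) w j where "l = vbrick w j" "even (w + j)"
      using l by (auto simp: bricks_def)
    then show "l \<in> ?f ` posQ ?C"
    proof cases
      case h
      then have "u = u'" using uk by (auto simp: hbrick_def)
      then show ?thesis using rows by simp
    next
      case v
      then have e: "u = ?v" "u' = ?v + 1" "k = j" "k' = j" "w = ?v" using uk rows by (auto simp: vbrick_def)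
      then have "odd j" using v(2) by auto
      then obtain i where "j = 2 * i + 1" by (rule oddE)
      moreover have "1 \<le> j" using e rows by simp
      ultimately have j: "j = 2 * int (nat (i + 1)) - 1" "nat (i + 1) \<ge> 1" by auto
      then have "nat (i + 1) \<in> ?C" using cand[OF j(2)] uk e by simp
      then have "j \<in> posQ ?C" using j(1) unfolding posQ_def by blast
      then show ?thesis using v(1) e by blast
    qed
  next
    assume "l \<in> ?f ` posQ ?C"
    then obtain p where p: "p \<in> ?C" "l = ?f (2 * int p - 1)" by (auto simp: posQ_def)
    have "p \<ge> 1" using p(1) by (auto split: if_splits)
    then have "(?v, 2 * int p - 1) \<in> ?U" "(?v + 1, 2 * int p - 1) \<in> L" using cand p(1) by blast+
    then show "l \<in> bricks \<and> (l \<subseteq> ?U \<union> L \<and> l \<inter> ?U \<noteq> {} \<and> l \<inter> L \<noteq> {})"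
      unfolding p(2) by (auto simp: vbrick_def[of ?v] bricks_def) (auto simp: vbrick_def)
  qed
  have gen: "C \<subseteq> B \<and> disjoint C \<and> (\<forall>l\<in>C. Q l) \<longleftrightarrow> disjoint C \<and> (\<forall>l\<in>C. l \<in> B \<and> Q l)"
    for C B :: "(int \<times> int) set set" and Q
    by blast
  have dis: "disjoint (?f ` Y)" for Y
    by (auto simp: disjoint_def vbrick_def)
  let ?Cs = "{C. C \<subseteq> bricks \<and> disjoint C \<and> (\<forall>l\<in>C. l \<subseteq> ?U \<union> L \<and> l \<inter> ?U \<noteq> {} \<and> l \<inter> L \<noteq> {})}"
  have mem: "C \<in> ?Cs \<longleftrightarrow> disjoint C \<and> C \<subseteq> ?f ` posQ ?C" for C
    unfolding mem_Collect_eq gen cross by (simp only: subset_eq)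
  have "C \<in> (\<lambda>S. ?f ` posQ S) ` Pow ?C \<longleftrightarrow> disjoint C \<and> C \<subseteq> ?f ` posQ ?C" for C
  proof
    assume "C \<in> (\<lambda>S. ?f ` posQ S) ` Pow ?C"
    then obtain S where S: "S \<subseteq> ?C" "C = ?f ` posQ S" by blast
    have "posQ S \<subseteq> posQ ?C" unfolding posQ_def by (rule image_mono[OF S(1)])
    then show "disjoint C \<and> C \<subseteq> ?f ` posQ ?C" using dis S(2) by blast
  next
    assume "disjoint C \<and> C \<subseteq> ?f ` posQ ?C"
    then obtain Y where Y: "Y \<subseteq> posQ ?C" "C = ?f ` Y" by (blast elim: subset_imageE)
    obtain S where "S \<subseteq> ?C" "Y = posQ S" using Y(1) unfolding posQ_def by (rule subset_imageE)
    then show "C \<in> (\<lambda>S. ?f ` posQ S) ` Pow ?C" using Y(2) by blast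
  qed
  then have Cs: "?Cs = (\<lambda>S. ?f ` posQ S) ` Pow ?C"
    using mem by (intro Set.set_eqI) (simp only:)
  have inj: "inj_on (\<lambda>S. ?f ` posQ S) (Pow ?C)"
  proof (rule inj_onI)
    fix S S' assume "?f ` posQ S = ?f ` posQ S'"
    moreover have "inj ?f" by (auto simp: inj_def)
    ultimately have "posQ S = posQ S'" by (simp add: inj_image_eq_iff)
    then show "S = S'" using inj_posQ by (simp add: inj_eq)
  qed
  have "bcov (1 / 2) (?U \<union> L) = (\<Sum>C\<in>?Cs. (\<Prod>l\<in>C. axis_weight (1 / 2) l) * bcov (1 / 2) (?U - \<Union>C) * bcov (1 / 2) (L - \<Union>C))"
    by (rule cov_split[OF finU finL UL])
  also have "\<dots> = (\<Sum>S\<in>Pow ?C. (\<Prod>l\<in>?f ` posQ S. axis_weight (1 / 2) l) * bcov (1 / 2) (?U - \<Union>(?f ` posQ S)) * bcov (1 / 2) (L - \<Union>(?f ` posQ S)))"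
    unfolding Cs by (subst sum.reindex[OF inj]) (simp only: comp_def)
  also have "\<dots> = (\<Sum>S\<in>Pow ?C. 2 ^ entry a 1 * (?Q S * ?K S))"
  proof (rule sum.cong[OF refl])
    fix S assume S: "S \<in> Pow ?C"
    have S': "S \<subseteq> {?m + 1..?m + x + min y z}" using S by (auto split: if_splits)
    have in_blocks: "(u, k) \<in> \<Union>(?f ` posQ S) \<longleftrightarrow> k \<in> posQ S \<and> (u = ?v \<or> u = ?v + 1)" for u k
      by (auto simp: vbrick_def)
    have "(\<Prod>l\<in>?f ` posQ S. axis_weight (1 / 2) l) = 1"
    proof (rule prod.neutral, rule ballI)
      fix l assume "l \<in> ?f ` posQ S"
      then obtain p where "l = ?f (2 * int p - 1)" by (auto simp: posQ_def)
      moreover have "2 * int p - 1 \<noteq> 0" by presburger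
      ultimately show "axis_weight (1 / 2) l = 1" by simp
    qed
    moreover have "?U - \<Union>(?f ` posQ S) = ?U - {?v} \<times> posQ S"
    proof (rule pair_set_eqI)
      fix u k
      show "(u, k) \<in> ?U - \<Union>(?f ` posQ S) \<longleftrightarrow> (u, k) \<in> ?U - {?v} \<times> posQ S"
        unfolding Diff_iff in_blocks using upU[of u k] by (cases "(u, k) \<in> ?U") auto
    qed
    moreover have "L - \<Union>(?f ` posQ S) = flip ?H ` (?W - {int ?h - 1} \<times> posK S)"
    proof (rule pair_set_eqI)
      fix u k
      have kk: "k - 1 \<in> posK S \<longleftrightarrow> k \<in> posQ S"
      proof -
        have "k - 1 = 2 * int p - 2 \<longleftrightarrow> k = 2 * int p - 1" for p by auto
        then show ?thesis by (simp add: posK_def posQ_def image_iff)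
      qed
      have uu: "?H - 1 - u = int ?h - 1 \<longleftrightarrow> u = ?v + 1" unfolding h by auto
      have "(u, k) \<in> L - \<Union>(?f ` posQ S) \<longleftrightarrow> (u, k) \<in> L \<and> \<not> (u = ?v + 1 \<and> k \<in> posQ S)"
        unfolding Diff_iff in_blocks using lowL[of u k] by (cases "(u, k) \<in> L") auto
      also have "\<dots> \<longleftrightarrow> (u, k) \<in> flip ?H ` (?W - {int ?h - 1} \<times> posK S)"
        unfolding flip_mem L_mem Diff_iff mem_Sigma_iff singleton_iff kk uu ..
      finally show "(u, k) \<in> L - \<Union>(?f ` posQ S) \<longleftrightarrow> (u, k) \<in> flip ?H ` (?W - {int ?h - 1} \<times> posK S)" .
    qed
    moreover have "bcov (1 / 2) (flip ?H ` (?W - {int ?h - 1} \<times> posK S)) = bcov 1 (?W - {int ?h - 1} \<times> posK S)"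
    proof (rule bcov_reflect)
      fix r k assume "(r, k) \<in> ?W - {int ?h - 1} \<times> posK S"
      then have "(r, k) \<in> ?W" by (rule DiffD1)
      then show "0 \<le> k" using lowW by blast
    qed simp
    ultimately show "(\<Prod>l\<in>?f ` posQ S. axis_weight (1 / 2) l) * bcov (1 / 2) (?U - \<Union>(?f ` posQ S)) * bcov (1 / 2) (L - \<Union>(?f ` posQ S)) =
        2 ^ entry a 1 * (?Q S * ?K S)"
      using H6_up_count[OF len S'] H6_low_count[OF E S'] by simp
  qed
  also have "\<dots> = 2 ^ entry a 1 * (\<Sum>S\<in>Pow ?C. ?Q S * ?K S)"
    by (simp only: sum_distrib_left)
  \<comment> \<open>A set of the wrong size gives the wrong number of dents in the upper
    trapezoid.\<close>
  also have "(\<Sum>S\<in>Pow ?C. ?Q S * ?K S) = (\<Sum>S\<in>{S \<in> Pow {?m + 1..?m + (x + min y z)}. card S = min y z}. ?Q S * ?K S)"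
  proof (cases "?n = 0")
    case True
    then have "{S \<in> Pow {?m + 1..?m + (x + min y z)}. card S = min y z} = {{}}"
    proof -
      have "S = {}" if "S \<subseteq> {?m + 1..?m + (x + min y z)}" "card S = min y z" for S
      proof -
        have "finite S" using that(1) by (rule finite_subset) simp
        then show ?thesis using that(2) True by simp
      qed
      then show ?thesis using True by auto
    qed
    then show ?thesis using True by simp
  next
    case False
    show ?thesis
    proof (rule sum.mono_neutral_right)
      show "finite (Pow ?C)" by simp
      show "{S \<in> Pow {?m + 1..?m + (x + min y z)}. card S = min y z} \<subseteq> Pow ?C" using False by auto
      show "\<forall>S\<in>Pow ?C - {S \<in> Pow {?m + 1..?m + (x + min y z)}. card S = min y z}. ?Q S * ?K S = 0"
      proof
        fix S assume "S \<in> Pow ?C - {S \<in> Pow {?m + 1..?m + (x + min y z)}. card S = min y z}"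
        then have S: "S \<subseteq> {?m + 1..?m + (x + min y z)}" "card S \<noteq> min y z" using False by auto
        let ?E = "{?m + x + z + 1..?m + x + y}"
        have od: "odpos a \<subseteq> {1..?m}" "card (odpos a) = odd_sum a" using positions[of a] by blast+
        have fin: "finite (odpos a)" "finite S" using od S(1) finite_subset by blast+
        have d1: "odpos a \<inter> S = {}" using od(1) S(1) by fastforce
        have "p \<notin> ?E" if "p \<in> odpos a \<union> S" for p using that od(1) S(1) by fastforce
        then have d2: "(odpos a \<union> S) \<inter> ?E = {}" by blast
        have "card (odpos a \<union> S \<union> ?E) = odd_sum a + card S + (y - z)"
          using card_Un_disjoint[of "odpos a \<union> S" ?E] card_Un_disjoint[of "odpos a" S] fin d1 d2 od(2) by simp
        then have "card (odpos a \<union> S \<union> ?E) \<noteq> ?n" using S(2) by auto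
        moreover have "odpos a \<union> S \<union> ?E \<subseteq> {1..?n + (x + even_sum a)}" using od(1) S(1) by fastforce
        ultimately have "?Q S = 0" using False by (intro Qd_formula(2)) auto
        then show "?Q S * ?K S = 0" by simp
      qed
    qed
  qed
  finally show ?thesis unfolding start m_def .
qed


section \<open>The fern enters only through two products\<close>

text \<open>The part of the Vandermonde product in the squares of the distances that involves a
  point of X and one of Y.\<close>

definition cr :: "nat set \<Rightarrow> nat set \<Rightarrow> real" where
  "cr X Y = (\<Prod>q\<in>Y. \<Prod>p\<in>X. (val q)\<^sup>2 - (val p)\<^sup>2)"

lemma cr_Un_left: "finite X \<Longrightarrow> finite X' \<Longrightarrow> X \<inter> X' = {} \<Longrightarrow> cr (X \<union> X') Y = cr X Y * cr X' Y"
  unfolding cr_def by (simp add: prod.union_disjoint prod.distrib)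

lemma cr_Un_right: "finite Y \<Longrightarrow> finite Y' \<Longrightarrow> Y \<inter> Y' = {} \<Longrightarrow> cr X (Y \<union> Y') = cr X Y * cr X Y'"
  unfolding cr_def by (simp add: prod.union_disjoint)

lemma cr_empty [simp]: "cr X {} = 1" "cr {} Y = 1"
  by (simp_all add: cr_def)

lemma val_less: "1 \<le> p \<Longrightarrow> p < q \<Longrightarrow> (val p)\<^sup>2 < (val q)\<^sup>2"
  by (intro power_strict_mono) (auto simp: val_def)

lemma val_pos: "1 \<le> p \<Longrightarrow> 0 < val p"
  by (simp add: val_def)

lemma cr_pos: "(\<And>p q. p \<in> X \<Longrightarrow> q \<in> Y \<Longrightarrow> 1 \<le> p \<and> p < q) \<Longrightarrow> cr X Y > 0"
  unfolding cr_def by (intro prod_pos) (simp add: val_less)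

lemma sqd_pos: "(\<And>p. p \<in> X \<Longrightarrow> 1 \<le> p) \<Longrightarrow> sqd X > 0"
  unfolding vdm_def by (intro prod_pos) (auto simp: val_less)

lemma sqd_empty [simp]: "vdm t {} = 1"
  by (simp add: vdm_def)

lemma sqd_Un:
  assumes "finite X" "finite Y" "\<And>p q. p \<in> X \<Longrightarrow> q \<in> Y \<Longrightarrow> p < q"
  shows "sqd (X \<union> Y) = sqd X * sqd Y * cr X Y"
proof -
  let ?g = "\<lambda>q p. (val q)\<^sup>2 - (val p)\<^sup>2"
  have disj: "X \<inter> Y = {}" using assms(3) by blast
  have "sqd (X \<union> Y) = (\<Prod>q\<in>X. \<Prod>p\<in>{p \<in> X \<union> Y. p < q}. ?g q p) * (\<Prod>q\<in>Y. \<Prod>p\<in>{p \<in> X \<union> Y. p < q}. ?g q p)"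
    unfolding vdm_def by (rule prod.union_disjoint[OF assms(1,2) disj])
  also have "(\<Prod>q\<in>X. \<Prod>p\<in>{p \<in> X \<union> Y. p < q}. ?g q p) = sqd X"
    unfolding vdm_def
  proof (intro prod.cong refl)
    fix q assume "q \<in> X"
    then show "{p \<in> X \<union> Y. p < q} = {p \<in> X. p < q}" using assms(3) by force
  qed
  also have "(\<Prod>q\<in>Y. \<Prod>p\<in>{p \<in> X \<union> Y. p < q}. ?g q p) = (\<Prod>q\<in>Y. (\<Prod>p\<in>X. ?g q p) * (\<Prod>p\<in>{p \<in> Y. p < q}. ?g q p))"
  proof (intro prod.cong refl)
    fix q assume q: "q \<in> Y"
    have e: "{p \<in> X \<union> Y. p < q} = X \<union> {p \<in> Y. p < q}" using assms(3) q by blast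
    have d: "X \<inter> {p \<in> Y. p < q} = {}" using disj by blast
    show "(\<Prod>p\<in>{p \<in> X \<union> Y. p < q}. ?g q p) = (\<Prod>p\<in>X. ?g q p) * (\<Prod>p\<in>{p \<in> Y. p < q}. ?g q p)"
      unfolding e by (rule prod.union_disjoint[OF _ _ d]) (use assms in simp_all)
  qed
  also have "\<dots> = cr X Y * sqd Y"
    by (simp add: prod.distrib cr_def vdm_def)
  finally show ?thesis by simp
qed

lemma sqd_Un3:
  assumes "finite X" "finite Y" "finite Z" "\<And>p q. p \<in> X \<Longrightarrow> q \<in> Y \<union> Z \<Longrightarrow> p < q" "\<And>p q. p \<in> Y \<Longrightarrow> q \<in> Z \<Longrightarrow> p < q"
  shows "sqd (X \<union> Y \<union> Z) = sqd X * sqd Y * sqd Z * cr X Y * cr X Z * cr Y Z"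
proof -
  have d: "Y \<inter> Z = {}" using assms(5) by blast
  have "sqd (X \<union> (Y \<union> Z)) = sqd X * sqd (Y \<union> Z) * cr X (Y \<union> Z)"
    by (rule sqd_Un) (use assms in auto)
  also have "sqd (Y \<union> Z) = sqd Y * sqd Z * cr Y Z"
    by (rule sqd_Un) (use assms in auto)
  also have "cr X (Y \<union> Z) = cr X Y * cr X Z"
    by (rule cr_Un_right) (use assms d in auto)
  finally show ?thesis by (simp add: Un_assoc mult_ac)
qed

text \<open>The positions that are missing on the right of the marked line above it, if y > z; with
  y and z exchanged, those that are missing below it.\<close>

definition ext_up :: "nat \<Rightarrow> nat \<Rightarrow> nat \<Rightarrow> nat \<Rightarrow> nat set" where
  "ext_up m x y z = {m + x + z + 1..m + x + y}"

lemma finite_ext_up [simp]: "finite (ext_up m x y z)"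
  by (simp add: ext_up_def)

lemma ext_up_Un: "ext_up m x y z \<union> ext_up m x z y = {m + (x + min y z) + 1..m + (x + min y z) + (max y z - min y z)}"
  "ext_up m x y z \<inter> ext_up m x z y = {}"
  by (auto simp: ext_up_def)

text \<open>Every one of the m positions of the fern is a dent of exactly one of the two trapezoids,
  so the dependence of the summands on S does not depend on the order of the segments of the fern,
  and the sum can be taken out.\<close>

theorem M_H6_formula:
  fixes x y z :: nat
  defines "m \<equiv> \<lambda>a. odd_sum a + even_sum a"
  assumes E: "z + even_sum a \<ge> 1" and len: "length a \<ge> 1"
  shows "M_H6 x y z a = 2 ^ entry a 1 * (dent_const (2 * (y + odd_sum a)) * dent_const (2 * (z + even_sum a) - 1)) *
    ((\<Prod>p\<in>odpos a. val p) * sqd (odpos a) * sqd (evpos a) * (cr (odpos a) (ext_up (m a) x y z) * cr (evpos a) (ext_up (m a) x z y))) *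
    ((\<Prod>p\<in>ext_up (m a) x y z. val p) * sqd (ext_up (m a) x y z) * sqd (ext_up (m a) x z y) *
      Zsum (m a) (min y z) (x + min y z) (max y z - min y z))"
proof -
  let ?m = "m a" and ?A = "odpos a" and ?B = "evpos a" and ?E1 = "ext_up (m a) x y z" and ?E2 = "ext_up (m a) x z y"
  let ?n = "min y z" and ?N = "x + min y z" and ?d = "max y z - min y z"
  let ?n1 = "y + odd_sum a" and ?n2 = "z + even_sum a"
  let ?c = "dent_const (2 * ?n1) * dent_const (2 * ?n2 - 1)"
  let ?P = "(\<Prod>p\<in>?A. val p) * sqd ?A * sqd ?B * (cr ?A ?E1 * cr ?B ?E2)"
  let ?X = "(\<Prod>p\<in>?E1. val p) * sqd ?E1 * sqd ?E2"
  have pos: "?A \<union> ?B = {1..?m}" "?A \<inter> ?B = {}" "card ?A = odd_sum a" "card ?B = even_sum a"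
    using positions[of a] unfolding m_def by blast+
  have sub: "?A \<subseteq> {1..?m}" "?B \<subseteq> {1..?m}" using pos(1) by blast+
  have fin: "finite ?A" "finite ?B" using sub finite_subset by blast+
  have inA: "1 \<le> p \<and> p \<le> ?m" if "p \<in> ?A" for p using sub(1) that by auto
  have inB: "1 \<le> p \<and> p \<le> ?m" if "p \<in> ?B" for p using sub(2) that by auto
  have inE1: "?m + ?N < p \<and> p \<le> ?m + x + y" if "p \<in> ?E1" for p using that by (auto simp: ext_up_def)
  have inE2: "?m + ?N < p \<and> p \<le> ?m + x + z" if "p \<in> ?E2" for p using that by (auto simp: ext_up_def)
  have cE: "card ?E1 = y - z" "card ?E2 = z - y" by (auto simp: ext_up_def)
  have summand: "Qd ?n1 (x + even_sum a) (?A \<union> S \<union> ?E1) * Kd ?n2 (x + odd_sum a) (?B \<union> S \<union> ?E2) =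
      ?c * ?P * ?X * ((sqd S)\<^sup>2 * (\<Prod>p\<in>S. wt ?m ?N ?d p))"
    if S: "S \<in> {S \<in> Pow {?m + 1..?m + ?N}. card S = ?n}" for S
  proof -
    have finS: "finite S" using S finite_subset by auto
    have inS: "?m < p \<and> p \<le> ?m + ?N" if "p \<in> S" for p using S that by auto
    have dis: "?A \<inter> S = {}" "?B \<inter> S = {}" "(?A \<union> S) \<inter> ?E1 = {}" "(?B \<union> S) \<inter> ?E2 = {}"
      using inA inB inS inE1 inE2 by fastforce+
    have cards: "card (?A \<union> S \<union> ?E1) = ?n1" "card (?B \<union> S \<union> ?E2) = ?n2"
      using card_Un_disjoint[OF _ _ dis(3)] card_Un_disjoint[OF _ _ dis(4)] card_Un_disjoint[OF _ _ dis(1)] card_Un_disjoint[OF _ _ dis(2)]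
        fin finS cE pos S by auto
    have s1: "?A \<union> S \<union> ?E1 \<subseteq> {1..?n1 + (x + even_sum a)}"
      using inA inS inE1 by (fastforce simp: m_def)
    have s2: "?B \<union> S \<union> ?E2 \<subseteq> {1..?n2 + (x + odd_sum a)}"
      using inB inS inE2 by (fastforce simp: m_def)
    have q: "Qd ?n1 (x + even_sum a) (?A \<union> S \<union> ?E1) = dent_const (2 * ?n1) * (\<Prod>p\<in>?A \<union> S \<union> ?E1. val p) * sqd (?A \<union> S \<union> ?E1)"
      by (rule Qd_formula(1)[OF s1 cards(1)])
    have k: "Kd ?n2 (x + odd_sum a) (?B \<union> S \<union> ?E2) = dent_const (2 * ?n2 - 1) * sqd (?B \<union> S \<union> ?E2)"
      by (rule Kd_formula[OF s2 E cards(2)])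
    have v: "(\<Prod>p\<in>?A \<union> S \<union> ?E1. val p) = (\<Prod>p\<in>?A. val p) * (\<Prod>p\<in>S. val p) * (\<Prod>p\<in>?E1. val p)"
      using fin finS dis by (subst prod.union_disjoint; (subst prod.union_disjoint)?; simp)
    have u1: "sqd (?A \<union> S \<union> ?E1) = sqd ?A * sqd S * sqd ?E1 * cr ?A S * cr ?A ?E1 * cr S ?E1"
    proof (rule sqd_Un3[OF fin(1) finS finite_ext_up])
      show "p < q" if "p \<in> ?A" "q \<in> S \<union> ?E1" for p q using inA[OF that(1)] inS[of q] inE1[of q] that(2) by fastforce
      show "p < q" if "p \<in> S" "q \<in> ?E1" for p q using inS[OF that(1)] inE1[OF that(2)] by linarith
    qed
    have u2: "sqd (?B \<union> S \<union> ?E2) = sqd ?B * sqd S * sqd ?E2 * cr ?B S * cr ?B ?E2 * cr S ?E2"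
    proof (rule sqd_Un3[OF fin(2) finS finite_ext_up])
      show "p < q" if "p \<in> ?B" "q \<in> S \<union> ?E2" for p q using inB[OF that(1)] inS[of q] inE2[of q] that(2) by fastforce
      show "p < q" if "p \<in> S" "q \<in> ?E2" for p q using inS[OF that(1)] inE2[OF that(2)] by linarith
    qed
    have "cr ?A S * cr ?B S = (\<Prod>p\<in>S. \<Prod>q\<in>{1..?m}. (val p)\<^sup>2 - (val q)\<^sup>2)"
      using cr_Un_left[OF fin pos(2), of S] unfolding pos(1) cr_def by simp
    moreover have "cr S ?E1 * cr S ?E2 = (\<Prod>p\<in>S. \<Prod>q\<in>{?m + ?N + 1..?m + ?N + ?d}. (val q)\<^sup>2 - (val p)\<^sup>2)"
    proof -
      have "cr S ?E1 * cr S ?E2 = cr S {?m + ?N + 1..?m + ?N + ?d}"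
        using cr_Un_right[OF _ _ ext_up_Un(2), of ?m x y z S] unfolding ext_up_Un(1) by simp
      also have "\<dots> = (\<Prod>p\<in>S. \<Prod>q\<in>{?m + ?N + 1..?m + ?N + ?d}. (val q)\<^sup>2 - (val p)\<^sup>2)"
        unfolding cr_def by (rule prod.swap)
      finally show ?thesis .
    qed
    ultimately have "(\<Prod>p\<in>S. val p) * (cr ?A S * cr ?B S) * (cr S ?E1 * cr S ?E2) = (\<Prod>p\<in>S. wt ?m ?N ?d p)"
      unfolding wt_def by (simp only: prod.distrib)
    moreover have "Qd ?n1 (x + even_sum a) (?A \<union> S \<union> ?E1) * Kd ?n2 (x + odd_sum a) (?B \<union> S \<union> ?E2) =
      ?c * ?P * ?X * ((sqd S)\<^sup>2 * ((\<Prod>p\<in>S. val p) * (cr ?A S * cr ?B S) * (cr S ?E1 * cr S ?E2)))"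
      unfolding q k v u1 u2 power2_eq_square[of "sqd S"] by (simp only: mult_ac)
    ultimately show ?thesis by (simp only:)
  qed
  have "M_H6 x y z a = 2 ^ entry a 1 * (\<Sum>S\<in>{S \<in> Pow {?m + 1..?m + ?N}. card S = ?n}.
      Qd ?n1 (x + even_sum a) (?A \<union> S \<union> ?E1) * Kd ?n2 (x + odd_sum a) (?B \<union> S \<union> ?E2))"
    using M_H6_sum[OF E len, of x y] unfolding ext_up_def m_def .
  also have "\<dots> = 2 ^ entry a 1 * (\<Sum>S\<in>{S \<in> Pow {?m + 1..?m + ?N}. card S = ?n}. ?c * ?P * ?X * ((sqd S)\<^sup>2 * (\<Prod>p\<in>S. wt ?m ?N ?d p)))"
    by (intro arg_cong2[of _ _ _ _ "(*)"] sum.cong refl summand)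
  also have "\<dots> = 2 ^ entry a 1 * (?c * ?P * ?X * Zsum ?m ?n ?N ?d)"
    unfolding Zsum_def by (simp only: sum_distrib_left)
  finally show ?thesis by (simp only: mult.assoc)
qed


section \<open>Telescoping of products over a fern\<close>

lemma cr_swap: "cr X Y = (\<Prod>p\<in>X. \<Prod>q\<in>Y. (val q)\<^sup>2 - (val p)\<^sup>2)"
  unfolding cr_def by (rule prod.swap)

lemma val_diff: "(val q)\<^sup>2 - (val p)\<^sup>2 = 4 * (real q - real p) * (real q + real p - 1)"
  by (simp add: val_def power2_eq_square algebra_simps)

text \<open>Two blocks of consecutive positions, of lengths t and u, with e positions between
  them.\<close>

lemma cr_blocks:
  "cr {s+1..s+t} {s+t+e+1..s+t+e+u} = 4 ^ (t * u) * (\<Prod>l<t. pochhammer (real (e+1+l)) u * pochhammer (real (2*s+t+e+1+l)) u)"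
proof -
  have one: "(\<Prod>q\<in>{s+t+e+1..s+t+e+u}. (val q)\<^sup>2 - (val p)\<^sup>2) =
      4 ^ u * (pochhammer (real (s+t+e+1) - real p) u * pochhammer (real (s+t+e) + real p) u)" for p
  proof -
    have "(\<Prod>q\<in>{s+t+e+1..s+t+e+u}. (val q)\<^sup>2 - (val p)\<^sup>2) =
        (\<Prod>i=0..<u. 4 * ((real (s+t+e+1) - real p + real i) * (real (s+t+e) + real p + real i)))"
      by (rule prod.reindex_bij_witness[where i = "\<lambda>i. s+t+e+1+i" and j = "\<lambda>q. q - (s+t+e+1)"])
        (auto simp: val_diff of_nat_diff algebra_simps)
    then show ?thesis
      by (simp add: prod.distrib pochhammer_prod)
  qed
  have "cr {s+1..s+t} {s+t+e+1..s+t+e+u} =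
      (\<Prod>p\<in>{s+1..s+t}. 4 ^ u * (pochhammer (real (s+t+e+1) - real p) u * pochhammer (real (s+t+e) + real p) u))"
    unfolding cr_swap one ..
  also have "\<dots> = (4 ^ u) ^ t * ((\<Prod>p\<in>{s+1..s+t}. pochhammer (real (s+t+e+1) - real p) u) *
      (\<Prod>p\<in>{s+1..s+t}. pochhammer (real (s+t+e) + real p) u))"
    by (simp add: prod.distrib)
  also have "(\<Prod>p\<in>{s+1..s+t}. pochhammer (real (s+t+e+1) - real p) u) = (\<Prod>l<t. pochhammer (real (e+1+l)) u)"
    by (rule prod.reindex_bij_witness[where i = "\<lambda>l. s+t-l" and j = "\<lambda>p. s+t-p"]) (auto simp: of_nat_diff algebra_simps)
  also have "(\<Prod>p\<in>{s+1..s+t}. pochhammer (real (s+t+e) + real p) u) = (\<Prod>l<t. pochhammer (real (2*s+t+e+1+l)) u)"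
    by (rule prod.reindex_bij_witness[where i = "\<lambda>l. s+1+l" and j = "\<lambda>p. p-(s+1)"]) (auto simp: of_nat_diff algebra_simps)
  finally show ?thesis by (simp add: prod.distrib power_mult[symmetric] mult.commute)
qed

text \<open>Both sides are the rising factorial of length u + c.\<close>

lemma pochhammer_exchange:
  "pochhammer (v::real) u * pochhammer (v + real u) c = pochhammer v c * pochhammer (v + real c) u"
  by (simp only: pochhammer_product'[symmetric] add.commute)

text \<open>The product T(v, c + t - 1, t), rewritten so that no negative exponents occur.\<close>

definition tprod :: "nat \<Rightarrow> nat \<Rightarrow> nat \<Rightarrow> real" where
  "tprod v c t = (\<Prod>l<t. pochhammer (real (v + l)) c)"

lemma tprod_pos: "v \<ge> 1 \<Longrightarrow> tprod v c t > 0"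
  unfolding tprod_def by (intro prod_pos pochhammer_pos) auto

lemma tprod_exchange: "tprod v u t * tprod (v + u) c t = tprod v c t * tprod (v + c) u t"
  unfolding tprod_def prod.distrib[symmetric]
proof (intro prod.cong refl)
  fix l
  show "pochhammer (real (v + l)) u * pochhammer (real (v + u + l)) c =
      pochhammer (real (v + l)) c * pochhammer (real (v + c + l)) u"
    using pochhammer_exchange[of "real (v + l)" u c] by (simp add: algebra_simps)
qed

lemma pochhammer_fact_quotient: "pochhammer (real (Suc p)) k = fact (p + k) / fact p"
  using pochhammer_product'[of "1 :: real" p k] by (simp add: pochhammer_fact[symmetric] field_simps)

lemma rising_fact: "rising (real (Suc p)) (int q - int p) = fact q / fact p"
proof (cases "p \<le> q")
  case True
  then have "nat (int q - int p) = q - p" by simp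
  then show ?thesis using True pochhammer_fact_quotient[of p "q - p"] by (simp add: rising_def)
next
  case False
  define k where "k = p - q"
  have p: "p = q + k" using False by (simp add: k_def)
  have "(\<Prod>i=1..k. real (Suc p) - real i) = pochhammer (real (Suc q)) k"
    unfolding pochhammer_prod
    by (rule prod.reindex_bij_witness[where i = "\<lambda>i. k - i" and j = "\<lambda>i. k - i"]) (auto simp: p of_nat_diff)
  then have "(\<Prod>i=1..k. real (Suc p) - real i) = fact p / fact q"
    unfolding pochhammer_fact_quotient by (simp add: p)
  moreover have "nat (- (int q - int p)) = k" "\<not> 0 \<le> int q - int p" using False by (simp_all add: k_def)
  ultimately show ?thesis by (simp add: rising_def)
qed

text \<open>Written with factorials, both products have the same numerators and denominators, in
  different order.\<close>

lemma T_prod_tprod: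
  assumes "v \<ge> 1"
  shows "T_prod (real v) (int c + int t - 1) t = tprod v c t"
proof -
  obtain p where v: "v = Suc p" using assms by (cases v) auto
  have "T_prod (real v) (int c + int t - 1) t = (\<Prod>l<t. fact (p + c + (t - Suc l)) / fact (p + l))"
    unfolding T_prod_def
  proof (intro prod.cong refl)
    fix l assume "l \<in> {..<t}"
    then have e: "int c + int t - 1 - 2 * int l = int (p + c + (t - Suc l)) - int (p + l)" by auto
    have "real v + real l = real (Suc (p + l))" by (simp add: v)
    then show "rising (real v + real l) (int c + int t - 1 - 2 * int l) = fact (p + c + (t - Suc l)) / fact (p + l)"
      unfolding e by (simp only: rising_fact)
  qed
  also have "\<dots> = (\<Prod>l<t. fact (p + c + l)) / (\<Prod>l<t. fact (p + l))"
    unfolding prod_dividef using prod.nat_diff_reindex[of "\<lambda>l. fact (p + c + l) :: real" t] by simp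
  also have "\<dots> = tprod v c t"
    unfolding tprod_def v prod_dividef[symmetric]
  proof (intro prod.cong refl)
    fix l
    show "fact (p + c + l) / fact (p + l) = pochhammer (real (Suc p + l)) c"
      using pochhammer_fact_quotient[of "p + l" c] by (simp add: add_ac)
  qed
  finally show ?thesis .
qed


lemma cr_blocks_tprod:
  "cr {s+1..s+t} {s+t+e+1..s+t+e+u} = 4 ^ (t * u) * (tprod (e + 1) u t * tprod (2 * s + t + e + 1) u t)"
  unfolding cr_blocks tprod_def by (simp add: prod.distrib add_ac)

text \<open>Moving a block of length t to the right by c positions, towards a block starting e
  positions further.\<close>

lemma block_shift:
  defines "v \<equiv> \<lambda>s c t e. 2 * s + c + t + e + 1"
  shows "cr {s+c+1..s+c+t} {s+c+t+e+1..s+c+t+e+u} / cr {s+1..s+t} {s+c+t+e+1..s+c+t+e+u} =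
    tprod (e + 1) c t / tprod (v s c t e) c t * (tprod (v s c t e + u) c t / tprod (e + 1 + u) c t)"
proof -
  let ?v = "v s c t e"
  have "cr {s+c+1..s+c+t} {s+c+t+e+1..s+c+t+e+u} = 4 ^ (t * u) * (tprod (e + 1) u t * tprod (?v + c) u t)"
    using cr_blocks_tprod[of "s + c" t e u] by (simp add: v_def add_ac)
  moreover have "cr {s+1..s+t} {s+c+t+e+1..s+c+t+e+u} = 4 ^ (t * u) * (tprod (e + 1 + c) u t * tprod ?v u t)"
    using cr_blocks_tprod[of s t "e + c" u] by (simp add: v_def add_ac)
  moreover have "tprod (e + 1) u t = tprod (e + 1) c t * tprod (e + 1 + c) u t / tprod (e + 1 + u) c t"
    using tprod_exchange[of "e + 1" u t c] tprod_pos[of "e + 1 + u" c t] by (simp add: field_simps)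
  moreover have "tprod (?v + c) u t = tprod ?v u t * tprod (?v + u) c t / tprod ?v c t"
    using tprod_exchange[of ?v u t c] tprod_pos[of ?v c t] by (simp add: v_def field_simps)
  moreover have "tprod (e + 1 + c) u t > 0" "tprod ?v u t > 0" by (simp_all add: tprod_pos v_def)
  ultimately show ?thesis by (simp add: field_simps)
qed

lemma cr_block_append: "cr {s+1..s+(t+t')} Y = cr {s+1..s+t} Y * cr {s+t+1..s+t+t'} Y"
proof -
  have "{s+1..s+(t+t')} = {s+1..s+t} \<union> {s+t+1..s+t+t'}" by auto
  then show ?thesis using cr_Un_left[of "{s+1..s+t}" "{s+t+1..s+t+t'}" Y] by auto
qed

lemma o_sum_step:
  assumes "length a = 2 * k" "1 \<le> i" "i \<le> k"
  shows "o_sum i a = entry a (2 * i - 1) + o_sum (i + 1) a"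
    and "e_sum i a = entry a (2 * i) + e_sum (i + 1) a"
proof -
  have "{j. i \<le> j \<and> 1 \<le> j \<and> 2 * j - 1 \<le> length a} = insert i {j. i + 1 \<le> j \<and> 1 \<le> j \<and> 2 * j - 1 \<le> length a}"
    "{j. i \<le> j \<and> 1 \<le> j \<and> 2 * j \<le> length a} = insert i {j. i + 1 \<le> j \<and> 1 \<le> j \<and> 2 * j \<le> length a}"
    using assms by auto
  moreover have "finite {j. i + 1 \<le> j \<and> 1 \<le> j \<and> 2 * j - 1 \<le> length a}" "finite {j. i + 1 \<le> j \<and> 1 \<le> j \<and> 2 * j \<le> length a}"
    by (rule finite_subset[of _ "{..length a}"]; auto)+
  ultimately show "o_sum i a = entry a (2 * i - 1) + o_sum (i + 1) a"
    "e_sum i a = entry a (2 * i) + e_sum (i + 1) a"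
    unfolding o_sum_def e_sum_def by simp_all
qed

lemma o_sum_beyond:
  assumes "length a = 2 * k"
  shows "o_sum (k + 1) a = 0" "e_sum (k + 1) a = 0"
proof -
  have "{j. k + 1 \<le> j \<and> 1 \<le> j \<and> 2 * j - 1 \<le> length a} = {}" "{j. k + 1 \<le> j \<and> 1 \<le> j \<and> 2 * j \<le> length a} = {}"
    using assms by auto
  then show "o_sum (k + 1) a = 0" "e_sum (k + 1) a = 0" unfolding o_sum_def e_sum_def by (simp_all only: sum.empty)
qed

text \<open>The first 2i segments and the remaining ones of odd and even index make up the whole
  fern.\<close>

lemma s_sum_remaining:
  assumes "length a = 2 * k" "i \<le> k"
  shows "s_sum (2 * i) a + o_sum (i + 1) a + e_sum (i + 1) a = odd_sum a + even_sum a"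
  using assms(2)
proof (induction "k - i" arbitrary: i)
  case 0
  then have "i = k" by simp
  then show ?case using o_sum_beyond[OF assms(1)] s_sum_length[of a] by (simp add: assms(1))
next
  case (Suc d)
  then have i: "i < k" by simp
  have "s_sum (2 * (i + 1)) a + o_sum (i + 2) a + e_sum (i + 2) a = odd_sum a + even_sum a"
    using Suc(1)[of "i + 1"] Suc(2) i by simp
  moreover have "s_sum (2 * (i + 1)) a = s_sum (2 * i) a + entry a (2 * (i + 1) - 1) + entry a (2 * (i + 1))"
    using s_sum_Suc[of "2 * i" a] s_sum_Suc[of "Suc (2 * i)" a] by simp
  ultimately show ?case
    using o_sum_step[OF assms(1), of "i + 1"] i by simp
qed

lemma o_sum_1: "length a = 2 * k \<Longrightarrow> o_sum 1 a = odd_sum a"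
  unfolding o_sum_def odd_sum_def
  by (rule sum.reindex_bij_witness[where i = "\<lambda>j. (j + 1) div 2" and j = "\<lambda>i. 2 * i - 1"])
    (auto elim!: oddE)

lemma odpos_pairs: "length a = 2 * k \<Longrightarrow> odpos a = (\<Union>j\<in>{1..k}. {s_sum (2*j-2) a + 1..s_sum (2*j-2) a + entry a (2*j-1)})"
proof -
  assume len: "length a = 2 * k"
  have "{i \<in> {1..length a}. odd i} = (\<lambda>j. 2 * j - 1) ` {1..k}"
  proof (intro equalityI subsetI)
    fix i assume "i \<in> {i \<in> {1..length a}. odd i}"
    then have "i = 2 * ((i + 1) div 2) - 1" "(i + 1) div 2 \<in> {1..k}" using len by (auto elim!: oddE)
    then show "i \<in> (\<lambda>j. 2 * j - 1) ` {1..k}" by blast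
  next
    fix i assume "i \<in> (\<lambda>j. 2 * j - 1) ` {1..k}"
    then show "i \<in> {i \<in> {1..length a}. odd i}" using len by auto
  qed
  then show ?thesis unfolding odpos_alt by (simp add: numeral_2_eq_2)
qed

lemma cr_odpos:
  assumes len: "length a = 2 * k"
  shows "cr (odpos a) Y = (\<Prod>j\<in>{1..k}. cr {s_sum (2*j-2) a + 1..s_sum (2*j-2) a + entry a (2*j-1)} Y)"
  unfolding odpos_pairs[OF len] cr_swap
proof (rule prod.UNION_disjoint)
  show "\<forall>i\<in>{1..k}. \<forall>j\<in>{1..k}. i \<noteq> j \<longrightarrow> {s_sum (2*i-2) a + 1..s_sum (2*i-2) a + entry a (2*i-1)} \<inter>
      {s_sum (2*j-2) a + 1..s_sum (2*j-2) a + entry a (2*j-1)} = {}"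
  proof (intro ballI impI)
    have sep: "{s_sum (2*i-2) a + 1..s_sum (2*i-2) a + entry a (2*i-1)} \<inter>
      {s_sum (2*j-2) a + 1..s_sum (2*j-2) a + entry a (2*j-1)} = {}" if "1 \<le> i" "i < j" for i j
    proof -
      have "s_sum (2*i-1 - 1) a + entry a (2*i-1) \<le> s_sum (2*j-1 - 1) a"
        by (rule s_sum_sep) (use that in auto)
      then have "s_sum (2*i-2) a + entry a (2*i-1) \<le> s_sum (2*j-2) a" by (simp add: numeral_2_eq_2)
      then show ?thesis by auto
    qed
    fix i j assume ij: "i \<in> {1..k}" "j \<in> {1..k}" "i \<noteq> j"
    then show "{s_sum (2*i-2) a + 1..s_sum (2*i-2) a + entry a (2*i-1)} \<inter>
      {s_sum (2*j-2) a + 1..s_sum (2*j-2) a + entry a (2*j-1)} = {}"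
    proof (cases "i < j")
      case True
      then show ?thesis by (intro sep) (use ij in auto)
    next
      case False
      then show ?thesis by (subst Int_commute, intro sep) (use ij in auto)
    qed
  qed
qed auto

text \<open>The odd segments of a fern arise from a single segment of the same total length at the
  left end: at step i, all that belongs to odd segments of index at least 2i - 1 is moved to the
  right past the segment 2i - 2.\<close>

lemma cr_odpos_ratio:
  assumes len: "length a = 2 * k" and k: "k \<ge> 1"
  shows "cr (odpos a) Y * (\<Prod>i=2..k. cr {s_sum (2*i-3) a + 1..s_sum (2*i-3) a + o_sum i a} Y) =
    cr {1..odd_sum a} Y * (\<Prod>i=2..k. cr {s_sum (2*i-2) a + 1..s_sum (2*i-2) a + o_sum i a} Y)"
proof -
  let ?blk = "\<lambda>s t. cr {s+1..s+t} Y" and ?s = "\<lambda>i. s_sum i a" and ?o = "\<lambda>i. o_sum i a"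
  have blk: "?blk (?s (2*i-2)) (?o i) = ?blk (?s (2*i-2)) (entry a (2*i-1)) * ?blk (?s (2*i-1)) (?o (i+1))"
    if "1 \<le> i" "i \<le> k" for i
  proof -
    have "?s (2*i-1) = ?s (2*i-2) + entry a (2*i-1)"
      using s_sum_step[of "2*i-1" a] that by (simp add: numeral_2_eq_2)
    then show ?thesis using cr_block_append[of "?s (2*i-2)" "entry a (2*i-1)" "?o (i+1)" Y] o_sum_step(1)[OF len that] by simp
  qed
  have "?blk 0 (odd_sum a) * (\<Prod>i=2..n. ?blk (?s (2*i-2)) (?o i)) =
      (\<Prod>i=2..n. ?blk (?s (2*i-3)) (?o i)) * (\<Prod>j\<in>{1..<n}. ?blk (?s (2*j-2)) (entry a (2*j-1))) * ?blk (?s (2*n-2)) (?o n)"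
    if "1 \<le> n" "n \<le> k" for n
    using that
  proof (induction n rule: nat_induct_at_least)
    case base
    show ?case using o_sum_1[OF len] by simp
  next
    case (Suc n)
    have f: "(\<Prod>i=2..Suc n. f i) = (\<Prod>i=2..n. f i) * f (Suc n)" for f :: "nat \<Rightarrow> real"
      using Suc(1) by (simp add: prod.nat_ivl_Suc')
    have g: "(\<Prod>i\<in>{1..<Suc n}. f i) = (\<Prod>i\<in>{1..<n}. f i) * f n" for f :: "nat \<Rightarrow> real"
      using Suc(1) by (simp add: prod.atLeastLessThan_Suc)
    have e: "2 * Suc n - 3 = 2 * n - 1" by simp
    have IH: "?blk 0 (odd_sum a) * (\<Prod>i=2..n. ?blk (?s (2*i-2)) (?o i)) =
      (\<Prod>i=2..n. ?blk (?s (2*i-3)) (?o i)) * (\<Prod>j\<in>{1..<n}. ?blk (?s (2*j-2)) (entry a (2*j-1))) * ?blk (?s (2*n-2)) (?o n)"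
      using Suc by simp
    show ?case
      unfolding f g e using IH blk[of n] Suc(1,3) by (simp only: Suc_eq_plus1) (simp add: mult_ac)
  qed
  from this[of k] k have
    "?blk 0 (odd_sum a) * (\<Prod>i=2..k. ?blk (?s (2*i-2)) (?o i)) =
      (\<Prod>i=2..k. ?blk (?s (2*i-3)) (?o i)) * ((\<Prod>j\<in>{1..<k}. ?blk (?s (2*j-2)) (entry a (2*j-1))) * ?blk (?s (2*k-2)) (?o k))"
    by (simp only: mult.assoc order_refl simp_thms)
  also have "?o k = entry a (2*k-1)"
    using o_sum_step(1)[OF len, of k] o_sum_beyond(1)[OF len] k by simp
  also have "(\<Prod>j\<in>{1..<k}. ?blk (?s (2*j-2)) (entry a (2*j-1))) * ?blk (?s (2*k-2)) (entry a (2*k-1)) = cr (odpos a) Y"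
    unfolding cr_odpos[OF len] using k by (cases k) (simp_all add: atLeastLessThanSuc_atLeastAtMost)
  finally show ?thesis by (simp add: mult_ac)
qed


text \<open>The first u positions after the first m ones.\<close>

abbreviation following :: "nat \<Rightarrow> nat \<Rightarrow> nat set" where
  "following m u \<equiv> {m+1..m+u}"

lemma fern_ratio:
  assumes len: "length a = 2 * k" and k: "k \<ge> 1"
  defines "m \<equiv> odd_sum a + even_sum a"
  shows "cr (odpos a) (following m u) / cr {1..odd_sum a} (following m u) =
    (\<Prod>i=2..k. T_seq a i (e_sum i a + 1) / T_seq a i (sigma a i + 1) *
      (T_seq a i (u + sigma a i + 1) / T_seq a i (u + e_sum i a + 1)))"
proof -
  let ?I = "following m u" and ?s = "\<lambda>i. s_sum i a" and ?o = "\<lambda>i. o_sum i a"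
  have blk: "?s (2*i-2) = ?s (2*i-3) + entry a (2*i-2)" "m = ?s (2*i-2) + ?o i + e_sum i a"
    "sigma a i = ?s (2*i-3) + m" if "2 \<le> i" "i \<le> k" for i
  proof -
    have "2*i-2 - 1 = 2*i-3" by simp
    then show "?s (2*i-2) = ?s (2*i-3) + entry a (2*i-2)" using s_sum_step[of "2*i-2" a] that by simp
    show "m = ?s (2*i-2) + ?o i + e_sum i a"
      using s_sum_remaining[OF len, of "i-1"] that by (simp add: m_def right_diff_distrib')
    show "sigma a i = ?s (2*i-3) + m"
      using s_sum_length[of a] by (simp add: sigma_def m_def)
  qed
  have pos: "cr {?s (2*i-3) + 1..?s (2*i-3) + ?o i} ?I > 0" if "2 \<le> i" "i \<le> k" for i
    by (rule cr_pos) (use blk(1,2)[OF that] in auto)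
  have posA0: "cr {1..odd_sum a} ?I > 0"
    by (rule cr_pos) (auto simp: m_def)
  have T: "T_seq a i u = tprod u (entry a (2*i-2)) (?o i)" if "u \<ge> 1" for i u
    unfolding T_seq_def using T_prod_tprod[OF that] by simp
  have one: "cr {?s (2*i-2) + 1..?s (2*i-2) + ?o i} ?I / cr {?s (2*i-3) + 1..?s (2*i-3) + ?o i} ?I =
      T_seq a i (e_sum i a + 1) / T_seq a i (sigma a i + 1) *
      (T_seq a i (u + sigma a i + 1) / T_seq a i (u + e_sum i a + 1))" if "2 \<le> i" "i \<le> k" for i
  proof -
    have v: "2 * ?s (2*i-3) + entry a (2*i-2) + ?o i + e_sum i a + 1 = sigma a i + 1"
      "?s (2*i-3) + entry a (2*i-2) = ?s (2*i-2)" "?s (2*i-2) + ?o i + e_sum i a = m"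
      "sigma a i + 1 + u = u + sigma a i + 1" "e_sum i a + 1 + u = u + e_sum i a + 1"
      using blk[OF that] by simp_all
    show ?thesis
      using block_shift[of "?s (2*i-3)" "entry a (2*i-2)" "?o i" "e_sum i a" u] unfolding v by (simp only: T le_add2)
  qed
  have "cr (odpos a) ?I / cr {1..odd_sum a} ?I =
      (\<Prod>i=2..k. cr {?s (2*i-2) + 1..?s (2*i-2) + ?o i} ?I) / (\<Prod>i=2..k. cr {?s (2*i-3) + 1..?s (2*i-3) + ?o i} ?I)"
  proof -
    have "(\<Prod>i=2..k. cr {?s (2*i-3) + 1..?s (2*i-3) + ?o i} ?I) > 0"
      by (intro prod_pos) (use pos in auto)
    moreover have "X / Y = R / Q" if "X * Q = Y * R" "Q > 0" "Y > 0" for X Y R Q :: real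
      using that by (simp add: field_simps)
    ultimately show ?thesis using cr_odpos_ratio[OF len k, of ?I] posA0 by blast
  qed
  also have "\<dots> = (\<Prod>i=2..k. cr {?s (2*i-2) + 1..?s (2*i-2) + ?o i} ?I / cr {?s (2*i-3) + 1..?s (2*i-3) + ?o i} ?I)"
    by (rule prod_dividef[symmetric])
  also have "\<dots> = (\<Prod>i=2..k. T_seq a i (e_sum i a + 1) / T_seq a i (sigma a i + 1) *
      (T_seq a i (u + sigma a i + 1) / T_seq a i (u + e_sum i a + 1)))"
    by (intro prod.cong refl one) auto
  finally show ?thesis .
qed

lemma T_seq_pos: "u \<ge> 1 \<Longrightarrow> T_seq a i u > 0"
  unfolding T_seq_def using T_prod_tprod[of u "entry a (2*i-2)" "o_sum i a"] tprod_pos by simp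

lemma fern_ratio_product:
  assumes len: "length a = 2 * k" and k: "k \<ge> 1"
  defines "m \<equiv> odd_sum a + even_sum a"
  defines "r \<equiv> \<lambda>u. cr (odpos a) (following m u) / cr {1..odd_sum a} (following m u)"
  shows "(\<Prod>i=2..k.
     (T_seq a i (x + z + e_sum i a + 1) * T_seq a i (y + e_sum i a + 1))
     / (T_seq a i (x + y + e_sum i a + 1) * T_seq a i (z + e_sum i a + 1))
     * ((T_seq a i (x + y + sigma a i + 1) * T_seq a i (z + sigma a i + 1))
        / (T_seq a i (x + z + sigma a i + 1) * T_seq a i (y + sigma a i + 1)))) =
    r (x + y) / r (x + z) * (r z / r y)"
proof -
  let ?T = "T_seq a" and ?e = "\<lambda>i. e_sum i a" and ?\<sigma> = "sigma a"
  have "r (x + y) / r (x + z) * (r z / r y) = (\<Prod>i=2..k.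
    (?T i (?e i + 1) / ?T i (?\<sigma> i + 1) * (?T i (x + y + ?\<sigma> i + 1) / ?T i (x + y + ?e i + 1))) /
    (?T i (?e i + 1) / ?T i (?\<sigma> i + 1) * (?T i (x + z + ?\<sigma> i + 1) / ?T i (x + z + ?e i + 1))) *
    ((?T i (?e i + 1) / ?T i (?\<sigma> i + 1) * (?T i (z + ?\<sigma> i + 1) / ?T i (z + ?e i + 1))) /
    (?T i (?e i + 1) / ?T i (?\<sigma> i + 1) * (?T i (y + ?\<sigma> i + 1) / ?T i (y + ?e i + 1)))))"
    unfolding r_def m_def fern_ratio[OF len k] by (simp only: prod.distrib prod_dividef)
  also have "\<dots> = (\<Prod>i=2..k.
     (?T i (x + z + ?e i + 1) * ?T i (y + ?e i + 1)) / (?T i (x + y + ?e i + 1) * ?T i (z + ?e i + 1))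
     * ((?T i (x + y + ?\<sigma> i + 1) * ?T i (z + ?\<sigma> i + 1)) / (?T i (x + z + ?\<sigma> i + 1) * ?T i (y + ?\<sigma> i + 1))))"
  proof (intro prod.cong refl)
    fix i
    have "?T i (u + 1) > 0" for u by (simp add: T_seq_pos)
    note this[of "?e i"] this[of "?\<sigma> i"] this[of "u + ?e i" for u] this[of "u + ?\<sigma> i" for u]
    have alg: "(c / c' * (p1 / q1)) / (c / c' * (p2 / q2)) * ((c / c' * (p3 / q3)) / (c / c' * (p4 / q4))) =
      (q2 * q4) / (q1 * q3) * ((p1 * p3) / (p2 * p4))"
      if "c > 0" "c' > 0" "p2 > 0" "p4 > 0" "q1 > 0" "q2 > 0" "q3 > 0" "q4 > 0" for c c' p1 p2 p3 p4 q1 q2 q3 q4 :: real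
      using that by (simp add: field_simps)
    show "(?T i (?e i + 1) / ?T i (?\<sigma> i + 1) * (?T i (x + y + ?\<sigma> i + 1) / ?T i (x + y + ?e i + 1))) /
    (?T i (?e i + 1) / ?T i (?\<sigma> i + 1) * (?T i (x + z + ?\<sigma> i + 1) / ?T i (x + z + ?e i + 1))) *
    ((?T i (?e i + 1) / ?T i (?\<sigma> i + 1) * (?T i (z + ?\<sigma> i + 1) / ?T i (z + ?e i + 1))) /
    (?T i (?e i + 1) / ?T i (?\<sigma> i + 1) * (?T i (y + ?\<sigma> i + 1) / ?T i (y + ?e i + 1)))) =
    (?T i (x + z + ?e i + 1) * ?T i (y + ?e i + 1)) / (?T i (x + y + ?e i + 1) * ?T i (z + ?e i + 1))
     * ((?T i (x + y + ?\<sigma> i + 1) * ?T i (z + ?\<sigma> i + 1)) / (?T i (x + z + ?\<sigma> i + 1) * ?T i (y + ?\<sigma> i + 1)))"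
      by (rule alg) (simp_all add: T_seq_pos)
  qed
  finally show ?thesis by (rule sym)
qed

lemma cr_complement:
  assumes "A \<union> B = {1..m}" "A \<inter> B = {}"
  shows "cr A Y * cr B Y = cr {1..m} Y"
proof -
  have "finite A" "finite B" using assms(1) by (metis finite_Un finite_atLeastAtMost)+
  then show ?thesis using cr_Un_left[of A B Y] assms by simp
qed

lemma cr_split:
  assumes "v \<le> u"
  shows "cr X (following m u) = cr X (following m v) * cr X {m+v+1..m+u}"
proof -
  have "following m u = following m v \<union> {m+v+1..m+u}" using assms by auto
  then show ?thesis using cr_Un_right[of "following m v" "{m+v+1..m+u}" X] by auto
qed

text \<open>For two ferns occupying the same m positions, the missing positions on the right enter
  through the ratio r alone, whichever of y and z is larger, since cr A times cr B is the same for
  both ferns.\<close>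

lemma cr_ext_up:
  assumes AB: "A \<union> B = {1..m}" "A \<inter> B = {}" and AB0: "A0 \<union> B0 = {1..m}" "A0 \<inter> B0 = {}"
  defines "r \<equiv> \<lambda>u. cr A (following m u) / cr A0 (following m u)"
  shows "cr A (ext_up m x y z) * cr B (ext_up m x z y) =
      cr A0 (ext_up m x y z) * cr B0 (ext_up m x z y) * (r (x + y) / r (x + z))"
    and "cr B (following m u) / cr B0 (following m u) = 1 / r u"
    and "r u > 0"
proof -
  let ?I = "following m"
  have pos: "cr X (?I u) > 0" if "X \<subseteq> {1..m}" for X u
    by (rule cr_pos) (use that in fastforce)
  have sub: "A \<subseteq> {1..m}" "B \<subseteq> {1..m}" "A0 \<subseteq> {1..m}" "B0 \<subseteq> {1..m}" using AB(1) AB0(1) by blast+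
  note p = pos[OF sub(1)] pos[OF sub(2)] pos[OF sub(3)] pos[OF sub(4)]
  have c: "cr A Y * cr B Y = cr A0 Y * cr B0 Y" for Y
    using cr_complement[OF AB] cr_complement[OF AB0] by simp
  show r_pos: "r u > 0" for u unfolding r_def using p by simp
  show "cr B (?I u) / cr B0 (?I u) = 1 / r u"
    using c[of "?I u"] p[of u] by (simp add: r_def field_simps)
  show "cr A (ext_up m x y z) * cr B (ext_up m x z y) =
      cr A0 (ext_up m x y z) * cr B0 (ext_up m x z y) * (r (x + y) / r (x + z))"
  proof (cases "z \<le> y")
    case True
    then have E: "ext_up m x z y = {}" by (auto simp: ext_up_def)
    have s: "cr X (?I (x + y)) = cr X (?I (x + z)) * cr X (ext_up m x y z)" for X
      using cr_split[of "x + z" "x + y" X m] True by (simp add: ext_up_def add_ac)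
    have "cr A0 (ext_up m x y z) > 0" using s[of A0] p(3)[of "x + y"] p(3)[of "x + z"] by (simp add: zero_less_mult_iff)
    then show ?thesis
      unfolding E r_def s using p[of "x + z"] by simp
  next
    case False
    then have E: "ext_up m x y z = {}" by (auto simp: ext_up_def)
    let ?E = "ext_up m x z y"
    have s: "cr X (?I (x + z)) = cr X (?I (x + y)) * cr X ?E" for X
      using cr_split[of "x + y" "x + z" X m] False by (simp add: ext_up_def add_ac)
    have q: "cr X ?E > 0" if "X \<subseteq> {1..m}" for X
      by (rule cr_pos) (use that in \<open>fastforce simp: ext_up_def\<close>)
    show ?thesis
      unfolding E r_def s using p[of "x + y"] c[of ?E] q[OF sub(1)] q[OF sub(2)] q[OF sub(3)] q[OF sub(4)]
      by (simp add: field_simps)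
  qed
qed


lemma two_blocks: "odd_sum [p, q] = p" "even_sum [p, q] = q" "odpos [p, q] = {1..p}" "evpos [p, q] = {p+1..p+q}" "entry [p, q] 1 = p"
proof -
  have e: "[p, q] = ([] @ [p]) @ [q]" by simp
  have l: "s_sum (Suc 0) [p] = p" "s_sum 0 [p] = 0" by (simp_all add: s_sum_def entry_def)
  show "odd_sum [p, q] = p" "even_sum [p, q] = q" "odpos [p, q] = {1..p}" "evpos [p, q] = {p+1..p+q}"
    unfolding e odd_sum_snoc even_sum_snoc odpos_snoc evpos_snoc by (simp_all add: l)
  show "entry [p, q] 1 = p" by (simp add: entry_def)
qed

lemma Q'_fern:
  assumes "even (length a)"
  shows "Q'_num (0 # a @ [y]) = Qd (odd_sum a + y) (even_sum a) (odpos a \<union> following (odd_sum a + even_sum a) y)"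
  using assms unfolding Q'_num_positions sum_Cons_0 evpos_Cons_0 odd_sum_snoc even_sum_snoc odpos_snoc
  by (simp add: s_sum_length)

lemma K_fern:
  assumes "even (length a)" "a \<noteq> []" "z + even_sum a \<ge> 1"
  shows "K_num (butlast a @ [last a + z]) = Kd (even_sum a + z) (odd_sum a) (evpos a \<union> following (odd_sum a + even_sum a) z)"
proof -
  obtain b l where a: "a = b @ [l]" using assms(2) by (metis append_butlast_last_id)
  have odd: "odd (length b)" using assms(1) a by simp
  let ?s = "s_sum (length b) b"
  have e: "even_sum (b @ [l + z]) = even_sum a + z" "odd_sum (b @ [l + z]) = odd_sum a"
    using odd unfolding a even_sum_snoc odd_sum_snoc by simp_all
  have s: "odd_sum a + even_sum a = ?s + l"
    using odd s_sum_length[of b] unfolding a even_sum_snoc odd_sum_snoc by simp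
  have u: "{?s+1..?s+(l+z)} = {?s+1..?s+l} \<union> {?s+l+1..?s+l+z}" by auto
  have "evpos (b @ [l + z]) = evpos a \<union> following (odd_sum a + even_sum a) z"
    using odd unfolding s unfolding a evpos_snoc u by (simp only: Un_assoc if_True simp_thms)
  then show ?thesis
    using K_num_positions[of "b @ [l + z]"] assms(3) by (simp add: e a)
qed

text \<open>The constants and Zsum cancel, and what is left is the product of the ratios r.\<close>

theorem many_blocks:
  assumes len: "length a = 2 * k" and k: "k \<ge> 1" and E: "z + even_sum a \<ge> 1"
  shows "M_H6 x y z a =
          2 ^ entry a 1 * M_H6 x y z [odd_sum a, even_sum a]
          * (Q'_num (0 # a @ [y]) * K_num (butlast a @ [last a + z])
             / (P'_num y (y + 2 * odd_sum a) (even_sum a)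
                * P_num (z + even_sum a - 1) (z + even_sum a - 1) (odd_sum a)))
          * (\<Prod>i=2..k.
               (T_seq a i (x + z + e_sum i a + 1) * T_seq a i (y + e_sum i a + 1))
               / (T_seq a i (x + y + e_sum i a + 1) * T_seq a i (z + e_sum i a + 1))
               * ((T_seq a i (x + y + sigma a i + 1) * T_seq a i (z + sigma a i + 1))
                  / (T_seq a i (x + z + sigma a i + 1) * T_seq a i (y + sigma a i + 1))))"
proof -
  define o' where "o' = odd_sum a"
  define e where "e = even_sum a"
  define m where "m = o' + e"
  define A where "A = odpos a"
  define B where "B = evpos a"
  define r where "r u = cr A (following m u) / cr {1..o'} (following m u)" for u
  have AB: "A \<union> B = {1..m}" "A \<inter> B = {}" "card A = o'" "card B = e"
    using positions[of a] unfolding A_def B_def m_def o'_def e_def by blast+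
  have AB0: "{1..o'} \<union> {o'+1..o'+e} = {1..m}" "{1..o'} \<inter> {o'+1..o'+e} = {}" by (auto simp: m_def)
  have E': "z + e \<ge> 1" using E by (simp add: e_def)
  have Q: "Qd (o' + y) e (X \<union> following m y) = dent_const (2 * (o' + y)) * ((\<Prod>p\<in>X. val p) * (\<Prod>p\<in>following m y. val p)) *
      (sqd X * sqd (following m y) * cr X (following m y))" if X: "X \<subseteq> {1..m}" "card X = o'" for X
  proof -
    have d: "X \<inter> following m y = {}" using X(1) by fastforce
    have f: "finite X" using X(1) finite_subset by blast
    have "card (X \<union> following m y) = o' + y" using card_Un_disjoint[OF f _ d] X(2) by simp
    moreover have "X \<union> following m y \<subseteq> {1..o' + y + e}" using X(1) by (fastforce simp: m_def)
    moreover have "sqd (X \<union> following m y) = sqd X * sqd (following m y) * cr X (following m y)"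
      by (rule sqd_Un) (use X(1) f in fastforce)+
    ultimately show ?thesis using Qd_formula(1)[of "X \<union> following m y" "o' + y" e] prod.union_disjoint[OF f _ d, of val] by simp
  qed
  have K: "Kd (e + z) o' (X \<union> following m z) = dent_const (2 * (e + z) - 1) * (sqd X * sqd (following m z) * cr X (following m z))"
    if X: "X \<subseteq> {1..m}" "card X = e" for X
  proof -
    have d: "X \<inter> following m z = {}" using X(1) by fastforce
    have f: "finite X" using X(1) finite_subset by blast
    have "card (X \<union> following m z) = e + z" using card_Un_disjoint[OF f _ d] X(2) by simp
    moreover have "X \<union> following m z \<subseteq> {1..e + z + o'}" using X(1) by (fastforce simp: m_def)
    moreover have "sqd (X \<union> following m z) = sqd X * sqd (following m z) * cr X (following m z)"
      by (rule sqd_Un) (use X(1) f in fastforce)+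
    moreover have "e + z \<ge> 1" using E' by simp
    ultimately show ?thesis using Kd_formula[of "X \<union> following m z" "e + z" o'] by simp
  qed
  have sub: "A \<subseteq> {1..m}" "B \<subseteq> {1..m}" "{1..o'} \<subseteq> {1..m}" "{o'+1..o'+e} \<subseteq> {1..m}" using AB(1) AB0(1) by blast+
  have q1: "Q'_num (0 # a @ [y]) = dent_const (2 * (o' + y)) * ((\<Prod>p\<in>A. val p) * (\<Prod>p\<in>following m y. val p)) *
      (sqd A * sqd (following m y) * cr A (following m y))"
    using Q'_fern[of a y] len Q[OF sub(1) AB(3)] unfolding A_def[symmetric] o'_def[symmetric] e_def[symmetric] m_def[symmetric] by simp
  have ne: "a \<noteq> []" using len k by auto
  have k1: "K_num (butlast a @ [last a + z]) = dent_const (2 * (e + z) - 1) * (sqd B * sqd (following m z) * cr B (following m z))"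
    using K_fern[OF _ ne E] len K[OF sub(2) AB(4)] unfolding B_def[symmetric] o'_def[symmetric] e_def[symmetric] m_def[symmetric] by simp
  have q0: "P'_num y (y + 2 * o') e = 2 ^ o' * (dent_const (2 * (o' + y)) * ((\<Prod>p\<in>{1..o'}. val p) * (\<Prod>p\<in>following m y. val p)) *
      (sqd {1..o'} * sqd (following m y) * cr {1..o'} (following m y)))"
    using P'_num_positions[of y o' e] Q[OF sub(3)] by (simp add: m_def add.commute)
  have k0: "P_num (z + e - 1) (z + e - 1) o' = dent_const (2 * (e + z) - 1) *
      (sqd {o'+1..o'+e} * sqd (following m z) * cr {o'+1..o'+e} (following m z))"
  proof -
    have u: "{o'+1..o'+(e+z)} = {o'+1..o'+e} \<union> following m z" by (auto simp: m_def)
    have "z + e - 1 + 1 = e + z" "o' + (z + e - 1) + 1 = o' + (e + z)" using E' by simp_all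
    then have "P_num (z + e - 1) (z + e - 1) o' = Kd (e + z) o' {o'+1..o'+(e+z)}"
      using P_num_positions[of "z + e - 1" o'] by simp
    also have "\<dots> = Kd (e + z) o' ({o'+1..o'+e} \<union> following m z)" unfolding u ..
    finally show ?thesis using K[OF sub(4)] by simp
  qed
  let ?W = "((\<Prod>p\<in>ext_up m x y z. val p) * sqd (ext_up m x y z) * sqd (ext_up m x z y) *
      Zsum m (min y z) (x + min y z) (max y z - min y z))"
  let ?D = "dent_const (2 * (y + o')) * dent_const (2 * (z + e) - 1)"
  have M1: "M_H6 x y z a = 2 ^ entry a 1 * ?D * ((\<Prod>p\<in>A. val p) * sqd A * sqd B *
      (cr A (ext_up m x y z) * cr B (ext_up m x z y))) * ?W"
    using M_H6_formula[OF E, of x y] ne unfolding A_def B_def m_def o'_def e_def by (simp add: Suc_le_eq)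
  have M0: "M_H6 x y z [o', e] = 2 ^ o' * ?D * ((\<Prod>p\<in>{1..o'}. val p) * sqd {1..o'} * sqd {o'+1..o'+e} *
      (cr {1..o'} (ext_up m x y z) * cr {o'+1..o'+e} (ext_up m x z y))) * ?W"
    using M_H6_formula[of z "[o', e]" x y] E' unfolding two_blocks m_def by simp
  note c = cr_ext_up[OF AB(1,2) AB0, folded r_def]
  have prod: "(\<Prod>i=2..k.
     (T_seq a i (x + z + e_sum i a + 1) * T_seq a i (y + e_sum i a + 1))
     / (T_seq a i (x + y + e_sum i a + 1) * T_seq a i (z + e_sum i a + 1))
     * ((T_seq a i (x + y + sigma a i + 1) * T_seq a i (z + sigma a i + 1))
        / (T_seq a i (x + z + sigma a i + 1) * T_seq a i (y + sigma a i + 1)))) =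
    r (x + y) / r (x + z) * (r z / r y)"
    using fern_ratio_product[OF len k, of x z y] unfolding r_def A_def m_def o'_def e_def .
  have p: "sqd X > 0 \<and> (\<Prod>p\<in>X. val p) > 0" if "X \<subseteq> {1..n}" for X n
  proof
    have one: "p \<ge> 1" if "p \<in> X" for p using \<open>X \<subseteq> {1..n}\<close> that by auto
    show "sqd X > 0" using one by (rule sqd_pos)
    show "(\<Prod>p\<in>X. val p) > 0" using one by (intro prod_pos val_pos)
  qed
  have cp: "cr X (following m u) > 0" if "X \<subseteq> {1..m}" for X u
    by (rule cr_pos) (use that in fastforce)
  have fy: "following m u \<subseteq> {1..m+u}" for u by auto
  have ca: "cr A (following m y) = r y * cr {1..o'} (following m y)"
    using cp[OF sub(3), of y] by (simp add: r_def)
  have cb: "cr B (following m z) = cr {o'+1..o'+e} (following m z) / r z"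
    using c(2)[of z] cp[OF sub(4), of z] by (simp add: field_simps)
  have alg: "t * d * (va * sa * sb * (c0 * (rxy / rxz))) * w =
     t * (t0 * d * (va0 * sa0 * sb0 * c0) * w) *
      (d1 * (va * vy) * (sa * sy * (ry * cy)) * (d2 * (sb * sz * (cz / rz))) /
       (t0 * (d1 * (va0 * vy) * (sa0 * sy * cy)) * (d2 * (sb0 * sz * cz)))) *
      (rxy / rxz * (rz / ry))"
    if "t0 > 0" "d1 > 0" "va0 > 0" "vy > 0" "sa0 > 0" "sy > 0" "cy > 0" "d2 > 0" "sb0 > 0" "sz > 0" "cz > 0"
      "ry > 0" "rz > 0" "rxz > 0"
    for t d va sa sb c0 rxy rxz w t0 va0 sa0 sb0 d1 vy sy ry cy d2 sz cz rz :: real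
  proof -
    define g where "g = d1 * vy * sy * cy * d2 * sz * cz"
    define h where "h = t0 * va0 * sa0 * sb0"
    define f where "f = va * sa * sb"
    have pos: "g > 0" "h > 0" using that by (simp_all add: g_def h_def)
    have "d1 * (va * vy) * (sa * sy * (ry * cy)) * (d2 * (sb * sz * (cz / rz))) = g * (f * (ry / rz))"
      by (simp add: g_def f_def)
    moreover have "t0 * (d1 * (va0 * vy) * (sa0 * sy * cy)) * (d2 * (sb0 * sz * cz)) = g * h"
      by (simp add: g_def h_def)
    moreover have "t * (t0 * d * (va0 * sa0 * sb0 * c0) * w) = t * d * c0 * w * h" by (simp add: h_def)
    moreover have "t * d * (va * sa * sb * (c0 * (rxy / rxz))) * w = t * d * c0 * w * (f * (rxy / rxz))" by (simp add: f_def)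
    moreover have "t * d * c0 * w * (f * (rxy / rxz)) = t * d * c0 * w * h * (g * (f * (ry / rz)) / (g * h)) * (rxy / rxz * (rz / ry))"
      using pos that by simp
    ultimately show ?thesis by (simp only:)
  qed
  have pos: "2 ^ o' > (0 :: real)" "dent_const (2 * (o' + y)) > 0" "(\<Prod>p\<in>{1..o'}. val p) > 0" "(\<Prod>p\<in>following m y. val p) > 0"
    "sqd {1..o'} > 0" "sqd (following m y) > 0" "cr {1..o'} (following m y) > 0" "dent_const (2 * (e + z) - 1) > 0"
    "sqd {o'+1..o'+e} > 0" "sqd (following m z) > 0" "cr {o'+1..o'+e} (following m z) > 0" "r y > 0" "r z > 0" "r (x + z) > 0"
    using p[OF sub(3)] p[OF sub(4)] p[OF fy[of y]] p[OF fy[of z]] cp[OF sub(3)] cp[OF sub(4)] c(3)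
    by (simp_all only: dent_const_pos zero_less_power zero_less_numeral)
  have "M_H6 x y z a = 2 ^ entry a 1 * M_H6 x y z [o', e]
          * (Q'_num (0 # a @ [y]) * K_num (butlast a @ [last a + z])
             / (P'_num y (y + 2 * o') e * P_num (z + e - 1) (z + e - 1) o'))
          * (r (x + y) / r (x + z) * (r z / r y))"
    unfolding M1 M0 q1 k1 q0 k0 c(1) ca cb by (rule alg[OF pos])
  then show ?thesis unfolding prod o'_def e_def .
qed


section \<open>The region with two removed triangles: dependence on the width\<close>

abbreviation fct :: "nat \<Rightarrow> real" where "fct \<equiv> fact"

lemma prod_telescope: "(\<And>i. g i \<noteq> (0::real)) \<Longrightarrow> (\<Prod>i<n. g (Suc i) / g i) = g n / g 0"
  by (induction n) auto

lemma tprod_shift: "tprod (p + 2) c t / tprod (p + 1) c t = fct (p + c + t) * fct p / (fct (p + c) * fct (p + t))"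
proof -
  have q: "tprod (p + 1) c t = (\<Prod>l<t. fct (p + c + l) / fct (p + l))" for p
    unfolding tprod_def by (intro prod.cong refl) (use pochhammer_fact_quotient[of "p + l" c for l] in \<open>simp add: add_ac\<close>)
  have "tprod (p + 2) c t / tprod (p + 1) c t =
      (\<Prod>l<t. fct (p + c + Suc l) / fct (p + Suc l)) / (\<Prod>l<t. fct (p + c + l) / fct (p + l))"
    using q[of "p + 1"] q[of p] by simp
  also have "\<dots> = (\<Prod>l<t. fct (p + c + Suc l) / fct (p + c + l)) / (\<Prod>l<t. fct (p + Suc l) / fct (p + l))"
    by (simp only: prod_dividef) (simp add: divide_divide_eq_left divide_divide_eq_right mult.commute)
  also have "\<dots> = (fct (p + c + t) / fct (p + c)) / (fct (p + t) / fct p)"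
    using prod_telescope[of "\<lambda>l. fct (p + c + l)" t] prod_telescope[of "\<lambda>l. fct (p + l)" t] by simp
  finally show ?thesis by simp
qed

text \<open>Moving the right block, of length u, by one position.\<close>

lemma cr_shift:
  "cr {s+1..s+t} {s+t+e+2..s+t+e+1+u} / cr {s+1..s+t} {s+t+e+1..s+t+e+u} =
    fct (e+u+t) * fct e / (fct (e+u) * fct (e+t)) *
    (fct (2*s+2*t+e+u) * fct (2*s+t+e) / (fct (2*s+t+e+u) * fct (2*s+2*t+e)))"
proof -
  have "cr {s+1..s+t} {s+t+e+2..s+t+e+1+u} = 4 ^ (t * u) * (tprod (e + 2) u t * tprod (2 * s + t + e + 2) u t)"
    using cr_blocks_tprod[of s t "e + 1" u] by simp
  moreover have "cr {s+1..s+t} {s+t+e+1..s+t+e+u} = 4 ^ (t * u) * (tprod (e + 1) u t * tprod (2 * s + t + e + 1) u t)"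
    by (rule cr_blocks_tprod)
  ultimately have "cr {s+1..s+t} {s+t+e+2..s+t+e+1+u} / cr {s+1..s+t} {s+t+e+1..s+t+e+u} =
      (tprod (e + 2) u t / tprod (e + 1) u t) * (tprod (2 * s + t + e + 2) u t / tprod (2 * s + t + e + 1) u t)"
    by (simp add: times_divide_times_eq)
  moreover have "2 * s + t + e + u + t = 2*s+2*t+e+u" "2 * s + t + e + t = 2*s+2*t+e" by simp_all
  ultimately show ?thesis
    using tprod_shift[of e u t] tprod_shift[of "2 * s + t + e" u t] by (simp only:)
qed

lemma sqd_shift:
  "sqd {c+2..c+1+l} / sqd {c+1..c+l} = fct (2*c+2*l) * fct (2*c+1) / (fct (2*c+l) * fct (2*c+1+l))"
proof -
  let ?a = "{c+1..c+1}" and ?F = "{c+2..c+1+l}" and ?G = "{c+1..c+l}" and ?z = "{c+l+1..c+l+1}"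
  have e: "?a \<union> ?F = ?G \<union> ?z"
    unfolding set_eq_iff Un_iff atLeastAtMost_iff by presburger
  have one: "sqd ?a = 1" "sqd ?z = 1" by (simp_all add: vdm_singleton)
  have l: "sqd (?a \<union> ?F) = sqd ?a * sqd ?F * cr ?a ?F"
    by (rule sqd_Un) auto
  have r: "sqd (?G \<union> ?z) = sqd ?G * sqd ?z * cr ?G ?z"
    by (rule sqd_Un) auto
  have eq: "sqd ?F * cr ?a ?F = sqd ?G * cr ?G ?z"
    using l r unfolding e one by (simp only: mult_1)
  have pos: "sqd ?G > 0" "cr ?a ?F > 0" by (rule sqd_pos; auto) (rule cr_pos; auto)
  have "p / p' = q / q'" if "p * q' = p' * q" "p' > 0" "q' > 0" for p p' q q' :: real
    using that by (simp add: field_simps)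
  note this[OF eq pos]
  also have "cr {c+1..c+l} {c+l+1..c+l+1} = 4 ^ l * (tprod 1 1 l * tprod (2 * c + l + 1) 1 l)"
    using cr_blocks_tprod[of c l 0 1] by simp
  also have "cr {c+1..c+1} {c+2..c+1+l} = 4 ^ l * (tprod 1 l 1 * tprod (2 * c + 2) l 1)"
    using cr_blocks_tprod[of c 1 0 l] by simp
  also have "tprod 1 1 l = fct l"
    by (simp add: tprod_def fact_prod_Suc lessThan_atLeast0)
  also have "tprod 1 l 1 = fct l"
    by (simp add: tprod_def pochhammer_fact)
  also have "tprod (2 * c + l + 1) 1 l = pochhammer (real (Suc (2 * c + l))) l"
    by (simp add: tprod_def pochhammer_prod lessThan_atLeast0 add_ac)
  also have "tprod (2 * c + 2) l 1 = pochhammer (real (Suc (2 * c + 1))) l"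
    by (simp add: tprod_def)
  finally have "sqd ?F / sqd ?G = 4 ^ l * (fct l * (fct (2*c+l+l) / fct (2*c+l))) / (4 ^ l * (fct l * (fct (2*c+1+l) / fct (2*c+1))))"
    unfolding pochhammer_fact_quotient .
  moreover have "p * (q * (a / b)) / (p * (q * (e / f))) = a * f / (b * e)" if "p \<noteq> 0" "q \<noteq> 0" for p q a b e f :: real
    using that by simp
  moreover have "2*c+l+l = 2*c+2*l" by simp
  ultimately show ?thesis by (simp only: fact_nonzero power_eq_0_iff) simp
qed

lemma val_shift: "(\<Prod>p\<in>{c+2..c+1+u}. val p) / (\<Prod>p\<in>{c+1..c+u}. val p) = (2 * real c + 2 * real u + 1) / (2 * real c + 1)"
proof -
  have "(\<Prod>p\<in>{c+1..c+u}. val p) = (\<Prod>i<u. val (c+1+i))" for c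
    by (rule prod.reindex_bij_witness[where i = "\<lambda>i. c+1+i" and j = "\<lambda>p. p-(c+1)"]) auto
  from this[of c] this[of "c+1"]
  have p: "(\<Prod>p\<in>{c+1..c+u}. val p) = (\<Prod>i<u. val (c+1+i))" "(\<Prod>p\<in>{c+2..c+1+u}. val p) = (\<Prod>i<u. val (c+1+Suc i))"
    by (simp_all del: prod.cl_ivl_Suc)
  have "(\<Prod>p\<in>{c+2..c+1+u}. val p) / (\<Prod>p\<in>{c+1..c+u}. val p) = (\<Prod>i<u. val (c+1+Suc i) / val (c+1+i))"
    unfolding p by (rule prod_dividef[symmetric])
  also have "\<dots> = val (c+1+u) / val (c+1)"
    using prod_telescope[of "\<lambda>i. val (c+1+i)" u] by (simp add: val_def)
  also have "\<dots> = (2 * real c + 2 * real u + 1) / (2 * real c + 1)" by (simp add: val_def algebra_simps)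
  finally show ?thesis .
qed

lemma pochhammer_shift: "v > 0 \<Longrightarrow> pochhammer (v + 1) q / pochhammer v q = (v + real q) / (v::real)"
proof -
  assume v: "v > 0"
  have "v * pochhammer (v + 1) q = pochhammer v q * (v + real q)"
    using pochhammer_rec[of v q] pochhammer_Suc[of v q] by simp
  then show ?thesis using v pochhammer_pos[OF v, of q] by (simp add: frac_eq_eq field_simps)
qed

lemma Zprod_shift:
  "Zprod m n (x + 1 + n) d / Zprod m n (x + n) d =
    fct (x+2*n+d+m) * fct x / (fct (x+n+d+m) * fct (x+n)) *
    (fct (x+2*n+d+2*m) * fct (x+m) / (fct (x+n+d+2*m) * fct (x+n+m)))"
proof -
  let ?q = "\<lambda>i. m + d + 1 + 2 * i"
  have down: "(\<Prod>i<n. fct (w + n - i) / fct (w + n - Suc i)) = fct (w + n) / fct w" for w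
  proof -
    have "(\<Prod>i<n. fct (w + n - i) / fct (w + n - Suc i)) = (\<Prod>i<n. fct (w + Suc i) / fct (w + i))"
      by (rule prod.reindex_bij_witness[where i = "\<lambda>i. n - Suc i" and j = "\<lambda>i. n - Suc i"])
        (auto simp: Suc_diff_Suc less_imp_le)
    then show ?thesis using prod_telescope[of "\<lambda>i. fct (w + i)" n] by simp
  qed
  have "Zprod m n (x + 1 + n) d / Zprod m n (x + n) d =
      (\<Prod>i<n. (fct (x+n+d+m + Suc i) / fct (x+n+d+m+i)) * (fct (x+n+d+2*m + Suc i) / fct (x+n+d+2*m+i)) /
        ((fct (x + n - i) / fct (x + n - Suc i)) * (fct (x + n + m - i) / fct (x + n + m - Suc i))))"
    unfolding Zprod_def prod_dividef[symmetric] lessThan_atLeast0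
  proof (intro prod.cong refl)
    fix i assume "i \<in> {0..<n}"
    then have i: "i < n" by simp
    define v where "v = x + n - Suc i"
    have v: "real (x + n) - real i = real (Suc v)" "real (x + n + m) - real i = real (Suc (v + m))"
      "real (x + 1 + n) - real i = real (Suc v) + 1" "real (x + 1 + n + m) - real i = real (Suc (v + m)) + 1"
      using i by (simp_all add: v_def)
    have f: "fct (Suc w) / fct w = real (Suc w)" for w by simp
    have "real (Suc v) + real (?q i) = real (Suc (x+n+d+m+i))" "real (Suc (v + m)) + real (?q i) = real (Suc (x+n+d+2*m+i))"
      using i by (simp_all add: v_def)
    then have "pochhammer (real (Suc v) + 1) (?q i) / pochhammer (real (Suc v)) (?q i) = real (Suc (x+n+d+m+i)) / real (Suc v)"
       "pochhammer (real (Suc (v+m)) + 1) (?q i) / pochhammer (real (Suc (v+m))) (?q i) = real (Suc (x+n+d+2*m+i)) / real (Suc (v+m))"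
      using pochhammer_shift[of "real (Suc v)" "?q i"] pochhammer_shift[of "real (Suc (v+m))" "?q i"] by simp_all
    moreover have "fct (x + n - i) / fct (x + n - Suc i) = real (Suc v)"
      "fct (x + n + m - i) / fct (x + n + m - Suc i) = real (Suc (v + m))"
    proof -
      have "x + n - i = Suc v" "x + n + m - i = Suc (v + m)" "x + n + m - Suc i = v + m" using i by (simp_all add: v_def)
      then show "fct (x + n - i) / fct (x + n - Suc i) = real (Suc v)"
        "fct (x + n + m - i) / fct (x + n + m - Suc i) = real (Suc (v + m))" using f by (simp_all add: v_def[symmetric])
    qed
    moreover have "fct (x+n+d+m + Suc i) / fct (x+n+d+m+i) = real (Suc (x+n+d+m+i))"
      "fct (x+n+d+2*m + Suc i) / fct (x+n+d+2*m+i) = real (Suc (x+n+d+2*m+i))" by (simp_all only: add_Suc_right f)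
    ultimately show "pochhammer (real (x + 1 + n) - real i) (?q i) * pochhammer (real (x + 1 + n + m) - real i) (?q i) /
        (pochhammer (real (x + n) - real i) (?q i) * pochhammer (real (x + n + m) - real i) (?q i)) =
      (fct (x+n+d+m + Suc i) / fct (x+n+d+m+i)) * (fct (x+n+d+2*m + Suc i) / fct (x+n+d+2*m+i)) /
        ((fct (x + n - i) / fct (x + n - Suc i)) * (fct (x + n + m - i) / fct (x + n + m - Suc i)))"
      unfolding v by (simp only: times_divide_times_eq[symmetric])
  qed
  also have "\<dots> = (\<Prod>i<n. fct (x+n+d+m + Suc i) / fct (x+n+d+m+i)) * (\<Prod>i<n. fct (x+n+d+2*m + Suc i) / fct (x+n+d+2*m+i)) /
      ((\<Prod>i<n. fct (x + n - i) / fct (x + n - Suc i)) * (\<Prod>i<n. fct (x + n + m - i) / fct (x + n + m - Suc i)))"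
    by (simp only: prod.distrib prod_dividef)
  also have "(\<Prod>i<n. fct (x+n+d+m + Suc i) / fct (x+n+d+m+i)) = fct (x+n+d+m+n) / fct (x+n+d+m)"
    using prod_telescope[of "\<lambda>i. fct (x+n+d+m+i)" n] by simp
  also have "(\<Prod>i<n. fct (x+n+d+2*m + Suc i) / fct (x+n+d+2*m+i)) = fct (x+n+d+2*m+n) / fct (x+n+d+2*m)"
    using prod_telescope[of "\<lambda>i. fct (x+n+d+2*m+i)" n] by simp
  also have "(\<Prod>i<n. fct (x + n - i) / fct (x + n - Suc i)) = fct (x + n) / fct x"
    by (rule down)
  also have "(\<Prod>i<n. fct (x + n + m - i) / fct (x + n + m - Suc i)) = fct (x + n + m) / fct (x + m)"
    using down[of "x + m"] by (simp add: add_ac)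
  also have "fct (x+n+d+m+n) / fct (x+n+d+m) * (fct (x+n+d+2*m+n) / fct (x+n+d+2*m)) /
      (fct (x + n) / fct x * (fct (x + n + m) / fct (x + m))) =
    fct (x+2*n+d+m) * fct x / (fct (x+n+d+m) * fct (x+n)) *
    (fct (x+2*n+d+2*m) * fct (x+m) / (fct (x+n+d+2*m) * fct (x+n+m)))"
  proof -
    have e: "x+n+d+m+n = x+2*n+d+m" "x+n+d+2*m+n = x+2*n+d+2*m" by simp_all
    have "a / b * (c / d') / (e / f * (g / h)) = a * f / (b * e) * (c * h / (d' * g))" for a b c d' e f g h :: real
      by (simp add: mult_ac)
    then show ?thesis unfolding e .
  qed
  finally show ?thesis .
qed

lemma rising2_shift:
  assumes "\<And>i. u + 2 * of_int i \<noteq> 0"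
  shows "rising2 (u + 2) n * u = rising2 u n * (u + 2 * of_int n)"
proof (cases "0 \<le> n")
  case True
  define k where "k = nat n"
  have n: "n = int k" using True by (simp add: k_def)
  have "(\<Prod>i<k. u + 2 + 2 * real i) * u = (\<Prod>i<k. u + 2 * real i) * (u + 2 * real k)"
  proof (induction k)
    case (Suc k)
    have "(\<Prod>i<Suc k. u + 2 + 2 * real i) * u = ((\<Prod>i<k. u + 2 + 2 * real i) * u) * (u + 2 * real (Suc k))" by simp
    then show ?case unfolding Suc by simp
  qed simp
  then show ?thesis by (simp add: rising2_def n)
next
  case False
  define k where "k = nat (- n)"
  have n: "n = - int k" using False by (simp add: k_def)
  have nz: "(\<Prod>i=1..k. u - 2 * real i) \<noteq> 0" "(\<Prod>i=1..k. u + 2 - 2 * real i) \<noteq> 0" for k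
  proof -
    have "u - 2 * real i \<noteq> 0" "u + 2 - 2 * real i \<noteq> 0" for i
      using assms[of "- int i"] assms[of "1 - int i"] by simp_all
    then show "(\<Prod>i=1..k. u - 2 * real i) \<noteq> 0" "(\<Prod>i=1..k. u + 2 - 2 * real i) \<noteq> 0" by simp_all
  qed
  have "u * (\<Prod>i=1..k. u - 2 * real i) = (\<Prod>i=1..k. u + 2 - 2 * real i) * (u - 2 * real k)"
  proof (induction k)
    case (Suc k)
    have "u * (\<Prod>i=1..Suc k. u - 2 * real i) = (u * (\<Prod>i=1..k. u - 2 * real i)) * (u - 2 * real (Suc k))" by simp
    then show ?case unfolding Suc by simp
  qed simp
  then show ?thesis using False nz[of k] by (simp add: rising2_def n divide_simps mult_ac)
qed


lemma rising2_nonzero: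
  assumes "\<And>i. u + 2 * of_int i \<noteq> 0"
  shows "rising2 u n \<noteq> 0"
proof -
  have "u + 2 * real i \<noteq> 0" "u - 2 * real i \<noteq> 0" for i
    using assms[of "int i"] assms[of "- int i"] by simp_all
  then show ?thesis by (simp add: rising2_def)
qed

text \<open>The factors of V are odd integers, hence not zero even where an exponent is
  negative.\<close>

lemma odd_nonzero: "real (2 * k + 1) + 2 * of_int i \<noteq> 0"
proof
  assume "real (2 * k + 1) + 2 * of_int i = 0"
  then have "of_int (2 * (int k + i) + 1) = (0 :: real)" by simp
  then have "2 * (int k + i) + 1 = 0" by (simp only: of_int_eq_0_iff)
  then show False by presburger
qed

lemma V_prod_nonzero: "V_prod (real (2 * k + 1)) n y \<noteq> 0"
  unfolding V_prod_def
proof (subst prod_zero_iff, simp, clarify)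
  fix i
  assume "rising2 (real (2 * k + 1) + 2 * real i) (n - 2 * int i) = 0"
  moreover have "real (2 * k + 1) + 2 * real i = real (2 * (k + i) + 1)" by simp
  ultimately show False using rising2_nonzero[OF odd_nonzero] by metis
qed

text \<open>The double factorial of 2j - 1.\<close>

definition odds :: "nat \<Rightarrow> real" where
  "odds j = (\<Prod>i<j. 2 * real i + 1)"

lemma odds_pos: "odds j > 0"
  unfolding odds_def by (intro prod_pos) auto

lemma odds_fact: "fct (2 * j) = 2 ^ j * fct j * odds j" "fct (2 * j + 1) = 2 ^ j * fct j * odds (j + 1)"
proof -
  show 1: "fct (2 * j) = 2 ^ j * fct j * odds j" for j
    by (induction j) (simp_all add: odds_def algebra_simps)
  show "fct (2 * j + 1) = 2 ^ j * fct j * odds (j + 1)"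
    using 1[of j] by (simp add: odds_def algebra_simps)
qed

lemma V_prod_shift_odds:
  "V_prod (real (2 * c + 5)) (int y + int z - 2) y / V_prod (real (2 * c + 3)) (int y + int z - 2) y =
    odds (c + z + y) * odds (c + 1) / (odds (c + z) * odds (c + y + 1))"
proof -
  let ?n = "int y + int z - 2"
  have split: "(\<Prod>i<y. 2 * real (v + i) + 1) = odds (v + y) / odds v" for v
  proof -
    have "odds (v + y) = odds v * (\<Prod>i<y. 2 * real (v + i) + 1)"
      unfolding odds_def by (induction y) (simp_all add: mult.assoc)
    then show ?thesis using odds_pos[of v] by simp
  qed
  have "V_prod (real (2 * c + 5)) ?n y / V_prod (real (2 * c + 3)) ?n y =
      (\<Prod>i<y. (2 * real (c + z + (y - Suc i)) + 1) / (2 * real (c + 1 + i) + 1))"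
    unfolding V_prod_def prod_dividef[symmetric]
  proof (intro prod.cong refl)
    fix i assume "i \<in> {..<y}"
    then have i: "i < y" by simp
    let ?u = "real (2 * (c + 1 + i) + 1)" and ?k = "int y + int z - 2 - 2 * int i"
    have u: "real (2 * c + 3) + 2 * real i = ?u" "real (2 * c + 5) + 2 * real i = ?u + 2" by simp_all
    have "rising2 (?u + 2) ?k * ?u = rising2 ?u ?k * (?u + 2 * of_int ?k)"
      by (rule rising2_shift) (rule odd_nonzero)
    moreover have "rising2 ?u ?k \<noteq> 0" by (rule rising2_nonzero) (rule odd_nonzero)
    moreover have "?u \<noteq> 0" by simp
    moreover have "?u + 2 * of_int ?k = 2 * real (c + z + (y - Suc i)) + 1" using i by (simp add: of_nat_diff)
    moreover have "2 * real (c + 1 + i) + 1 = ?u" by simp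
    moreover have "p / q = r / s" if "p * s = q * r" "q \<noteq> 0" "s \<noteq> 0" for p q r s :: real
      using that by (simp add: field_simps)
    ultimately show "rising2 (real (2 * c + 5) + 2 * real i) ?k / rising2 (real (2 * c + 3) + 2 * real i) ?k =
        (2 * real (c + z + (y - Suc i)) + 1) / (2 * real (c + 1 + i) + 1)"
      unfolding u by metis
  qed
  also have "\<dots> = (\<Prod>i<y. 2 * real (c + z + (y - Suc i)) + 1) / (\<Prod>i<y. 2 * real (c + 1 + i) + 1)"
    by (rule prod_dividef)
  also have "(\<Prod>i<y. 2 * real (c + z + (y - Suc i)) + 1) = (\<Prod>i<y. 2 * real (c + z + i) + 1)"
    by (rule prod.nat_diff_reindex)
  also have "(\<Prod>i<y. 2 * real (c + z + i) + 1) = odds (c + z + y) / odds (c + z)"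
    by (rule split)
  also have "(\<Prod>i<y. 2 * real (c + 1 + i) + 1) = odds (c + 1 + y) / odds (c + 1)"
    by (rule split)
  finally show ?thesis by (simp add: add_ac)
qed

lemma V_prod_shift:
  "V_prod (real (2 * c + 5)) (int y + int z - 2) y / V_prod (real (2 * c + 3)) (int y + int z - 2) y =
    fct (2*c+2*(y+z)) * fct (2*c+1) * fct (c+z) * fct (c+y) /
    (fct (c+(y+z)) * fct c * fct (2*c+2*z) * fct (2*c+2*y+1))"
proof -
  have f: "fct (2*c+2*(y+z)) = 2 ^ (c+(y+z)) * fct (c+(y+z)) * odds (c+z+y)"
    "fct (2*c+1) = 2 ^ c * fct c * odds (c + 1)"
    "fct (2*c+2*z) = 2 ^ (c+z) * fct (c+z) * odds (c+z)"
    "fct (2*c+2*y+1) = 2 ^ (c+y) * fct (c+y) * odds (c+y+1)"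
    using odds_fact(1)[of "c+(y+z)"] odds_fact(2)[of c] odds_fact(1)[of "c+z"] odds_fact(2)[of "c+y"]
    by (simp_all only: distrib_left add_ac)
  have p: "(2::real) ^ (c+(y+z)) * 2 ^ c = 2 ^ (c+z) * 2 ^ (c+y)" by (simp add: power_add)
  have "o1 * o2 / (o3 * o4) = (p1 * f1 * o1) * (p2 * f2 * o2) * f3 * f4 / (f1 * f2 * (p3 * f3 * o3) * (p4 * f4 * o4))"
    if "p1 * p2 = p3 * p4" "p3 \<noteq> 0" "p4 \<noteq> 0" "f1 \<noteq> 0" "f2 \<noteq> 0" "f3 \<noteq> 0" "f4 \<noteq> 0"
    for o1 o2 o3 o4 p1 p2 p3 p4 f1 f2 f3 f4 :: real
  proof -
    have "(p1 * f1 * o1) * (p2 * f2 * o2) * f3 * f4 = (p1 * p2) * (f1 * f2 * f3 * f4) * (o1 * o2)"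
      "f1 * f2 * (p3 * f3 * o3) * (p4 * f4 * o4) = (p3 * p4) * (f1 * f2 * f3 * f4) * (o3 * o4)" by simp_all
    moreover have nz: "(p3 * p4) * (f1 * f2 * f3 * f4) \<noteq> 0" using that by simp
    ultimately show ?thesis unfolding that(1) by (simp only: mult_divide_mult_cancel_left[OF nz])
  qed
  from this[OF p] show ?thesis
    unfolding V_prod_shift_odds f by (simp only: fact_nonzero power_eq_0_iff zero_neq_numeral[symmetric] simp_thms)
qed


text \<open>The part of the weighted tiling number for the fern (a,b) that depends on x, up to a
  constant factor.\<close>

definition region_factor :: "nat \<Rightarrow> nat \<Rightarrow> nat \<Rightarrow> nat \<Rightarrow> nat \<Rightarrow> real" where
  "region_factor a b y z x =
    cr {1..a} (ext_up (a+b) x y z) * cr {a+1..a+b} (ext_up (a+b) x z y) *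
    ((\<Prod>p\<in>ext_up (a+b) x y z. val p) * sqd (ext_up (a+b) x y z) * sqd (ext_up (a+b) x z y)) *
    Zprod (a+b) (min y z) (x + min y z) (max y z - min y z)"

text \<open>The part of the product formula for the fern (a,b) that depends on x, up to a constant
  factor.\<close>

definition formula_factor :: "nat \<Rightarrow> nat \<Rightarrow> nat \<Rightarrow> nat \<Rightarrow> nat \<Rightarrow> real" where
  "formula_factor a b y z x =
    sqd {a+b+x+1..a+b+x+(y+z)} * cr {a+1..a+b} {a+b+x+1..a+b+x+(y+z)} *
    (tprod (x+b+1) (z+2*a) y / (tprod (x+2*a+b+1) y b * tprod (x+z+1) y b)) /
    V_prod (real (2*(a+b+x)+3)) (int y + int z - 2) y"

text \<open>The common ratio of both when x grows by 1.\<close>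

definition step_ratio :: "nat \<Rightarrow> nat \<Rightarrow> nat \<Rightarrow> nat \<Rightarrow> nat \<Rightarrow> real" where
  "step_ratio a b y z x = (let c = a + b + x in
    fct x * fct (2*a+2*b+x+(y+z)) * fct (2*a+b+x+y) * fct (x+z+b) *
      (fct (c+(y+z)) * fct c * fct (2*c+2*z) * fct (2*c+2*y+1)) /
    (fct (2*c+(y+z)) * fct (2*c+1+(y+z)) * fct (2*a+b+x+z) * fct (x+b+y) * fct (2*a+2*b+x+y) * fct (x+z) *
      fct (c+z) * fct (c+y)))"

lemma formula_factor_step: "formula_factor a b y z (Suc x) / formula_factor a b y z x = step_ratio a b y z x"
proof -
  define c where "c = a + b + x"
  let ?F = "{c+1..c+(y+z)}" and ?F' = "{c+2..c+1+(y+z)}" and ?B = "{a+1..a+b}"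
  have K1: "sqd ?F' / sqd ?F = fct (2*c+2*(y+z)) * fct (2*c+1) / (fct (2*c+(y+z)) * fct (2*c+1+(y+z)))"
    by (rule sqd_shift)
  have K2: "cr ?B ?F' / cr ?B ?F = fct (x+(y+z)+b) * fct x / (fct (x+(y+z)) * fct (x+b)) *
    (fct (2*a+2*b+x+(y+z)) * fct (2*a+b+x) / (fct (2*a+b+x+(y+z)) * fct (2*a+2*b+x)))"
    using cr_shift[of a b x "y+z"] by (simp only: c_def)
  have T1: "tprod (Suc x+b+1) (z+2*a) y / tprod (x+b+1) (z+2*a) y =
      fct (2*a+b+x+(y+z)) * fct (x+b) / (fct (2*a+b+x+z) * fct (x+b+y))"
  proof -
    have "x+b+2 = Suc x+b+1" "x+b+(z+2*a)+y = 2*a+b+x+(y+z)" "x+b+(z+2*a) = 2*a+b+x+z" by simp_all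
    then show ?thesis using tprod_shift[of "x+b" "z+2*a" y] by (simp only:)
  qed
  have T2: "tprod (Suc x+2*a+b+1) y b / tprod (x+2*a+b+1) y b =
      fct (2*a+2*b+x+y) * fct (2*a+b+x) / (fct (2*a+b+x+y) * fct (2*a+2*b+x))"
  proof -
    have "x+2*a+b+2 = Suc x+2*a+b+1" "x+2*a+b+y+b = 2*a+2*b+x+y" "x+2*a+b+y = 2*a+b+x+y" "x+2*a+b+b = 2*a+2*b+x" "x+2*a+b = 2*a+b+x"
      by simp_all
    then show ?thesis using tprod_shift[of "x+2*a+b" y b] by (simp only:)
  qed
  have T3: "tprod (Suc x+z+1) y b / tprod (x+z+1) y b = fct (x+(y+z)+b) * fct (x+z) / (fct (x+(y+z)) * fct (x+z+b))"
  proof -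
    have "x+z+2 = Suc x+z+1" "x+z+y+b = x+(y+z)+b" "x+z+y = x+(y+z)" by simp_all
    then show ?thesis using tprod_shift[of "x+z" y b] by (simp only:)
  qed
  have e: "a + b + Suc x + 1 = c + 2" "a + b + Suc x + (y+z) = c + 1 + (y+z)" "2 * (a + b + Suc x) + 3 = 2 * c + 5"
    "a + b + x = c" by (simp_all add: c_def)
  have quot: "(s' * k' * (p' / (q' * r')) / v') / (s * k * (p / (q * r)) / v) =
      (s' / s) * (k' / k) * (p' / p) / ((q' / q) * (r' / r)) / (v' / v)" for s s' k k' p p' q q' r r' v v' :: real
    by (simp add: mult_ac)
  have alg: "(q1 * q2 / (q3 * q4)) * (w1 * w2 / (w3 * w4) * (w5 * w6 / (w7 * w8))) * (w7 * w4 / (t1 * t2)) /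
      ((t3 * w6 / (t4 * w8)) * (w1 * t5 / (w3 * t6))) / (q1 * q2 * v1 * v2 / (v3 * v4 * v5 * v6)) =
      w2 * w5 * t4 * t6 * (v3 * v4 * v5 * v6) / (q3 * q4 * t1 * t2 * t3 * t5 * v1 * v2)"
    if "q1 \<noteq> 0" "q2 \<noteq> 0" "w1 \<noteq> 0" "w3 \<noteq> 0" "w4 \<noteq> 0" "w6 \<noteq> 0" "w7 \<noteq> 0" "w8 \<noteq> 0"
    for q1 q2 q3 q4 w1 w2 w3 w4 w5 w6 w7 w8 t1 t2 t3 t4 t5 t6 v1 v2 v3 v4 v5 v6 :: real
    using that by simp
  show ?thesis
    unfolding formula_factor_def e quot K1 K2 T1 T2 T3 V_prod_shift step_ratio_def Let_def
    by (subst alg; (rule fact_nonzero | rule refl)?)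
qed


lemma region_factor_step: "region_factor a b y z (Suc x) / region_factor a b y z x = step_ratio a b y z x"
proof (cases "z \<le> y")
  case True
  define c where "c = a + b + x"
  define u where "u = y - z"
  have y: "y = z + u" using True by (simp add: u_def)
  let ?F = "{c+z+1..c+z+u}" and ?F' = "{c+z+2..c+z+1+u}" and ?A = "{1..a}"
  have E: "ext_up (a+b) x y z = ?F" "ext_up (a+b) (Suc x) y z = ?F'" "ext_up (a+b) x z y = {}" "ext_up (a+b) (Suc x) z y = {}"
    by (simp_all add: ext_up_def c_def y)
  have mm: "min y z = z" "max y z - z = u" by (simp_all add: y)
  have A: "cr ?A ?F' / cr ?A ?F = fct (c+y) * fct (x+z+b) / (fct (x+b+y) * fct (c+z)) *
    (fct (2*a+b+x+y) * fct (c+z) / (fct (c+y) * fct (2*a+b+x+z)))"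
  proof -
    have "0+a+(x+z+b) = c+z" "x+z+b+u+a = c+y" "x+z+b+u = x+b+y" "x+z+b+a = c+z" "2*0+2*a+(x+z+b)+u = 2*a+b+x+y"
      "2*0+a+(x+z+b) = c+z" "c+z+u = c+y" "2*0+2*a+(x+z+b) = 2*a+b+x+z" "{0+1..0+a} = {1..a}" by (simp_all add: y c_def)
    then show ?thesis using cr_shift[of 0 a "x+z+b" u] by (simp only:)
  qed
  have B: "(\<Prod>p\<in>?F'. val p) / (\<Prod>p\<in>?F. val p) = fct (2*c+2*y+1) * fct (2*c+2*z) / (fct (2*c+2*y) * fct (2*c+2*z+1))"
  proof -
    have "fct (2*c+2*y+1) = (2 * real (c+z) + 2 * real u + 1) * fct (2*c+2*y)" "fct (2*c+2*z+1) = (2 * real (c+z) + 1) * fct (2*c+2*z)"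
      by (simp_all add: y)
    then have "fct (2*c+2*y+1) * fct (2*c+2*z) / (fct (2*c+2*y) * fct (2*c+2*z+1)) =
        ((2 * real (c+z) + 2 * real u + 1) * fct (2*c+2*y)) * fct (2*c+2*z) / (fct (2*c+2*y) * ((2 * real (c+z) + 1) * fct (2*c+2*z)))"
      by (simp only:)
    also have "\<dots> = (2 * real (c+z) + 2 * real u + 1) / (2 * real (c+z) + 1)"
    proof -
      have "(p * f) * g / (f * (q * g)) = p / q" if "f \<noteq> 0" "g \<noteq> 0" for p q f g :: real
        using that by simp
      then show ?thesis using fact_nonzero by blast
    qed
    finally have "fct (2*c+2*y+1) * fct (2*c+2*z) / (fct (2*c+2*y) * fct (2*c+2*z+1)) =
        (2 * real (c+z) + 2 * real u + 1) / (2 * real (c+z) + 1)" .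
    then show ?thesis using val_shift[of "c+z" u] by (simp only:)
  qed
  have C: "sqd ?F' / sqd ?F = fct (2*c+2*y) * fct (2*c+2*z+1) / (fct (2*c+(y+z)) * fct (2*c+1+(y+z)))"
  proof -
    have "2*(c+z)+2*u = 2*c+2*y" "2*(c+z)+1 = 2*c+2*z+1" "2*(c+z)+u = 2*c+(y+z)" "2*c+2*z+1+u = 2*c+1+(y+z)" by (simp_all add: y)
    then show ?thesis using sqd_shift[of "c+z" u] by (simp only:)
  qed
  have D: "Zprod (a+b) z (x+1+z) u / Zprod (a+b) z (x+z) u = fct (c+(y+z)) * fct x / (fct (c+y) * fct (x+z)) *
      (fct (2*a+2*b+x+(y+z)) * fct c / (fct (2*a+2*b+x+y) * fct (c+z)))"
  proof -
    have "x+2*z+u+(a+b) = c+(y+z)" "x+z+u+(a+b) = c+y" "x+2*z+u+2*(a+b) = 2*a+2*b+x+(y+z)" "x+(a+b) = c"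
      "x+z+u+2*(a+b) = 2*a+2*b+x+y" "x+z+(a+b) = c+z" by (simp_all add: y c_def)
    then show ?thesis using Zprod_shift[of "a+b" z x u] by (simp only:)
  qed
  have s: "Suc x + z = x + 1 + z" by simp
  have quot: "(k' * 1 * (v' * s' * 1) * r') / (k * 1 * (v * s * 1) * r) = (k' / k) * (v' / v) * (s' / s) * (r' / r)"
    for k k' v v' s s' r r' :: real
    by (simp add: mult_ac)
  have alg: "(cy * w6 / (t2 * v1) * (t4 * v1 / (cy * t1))) * (v6 * v5 / (p1 * p2)) * (p1 * p2 / (q3 * q4)) *
      (v3 * w2 / (cy * t5) * (w5 * v4 / (t3 * v1))) = w2 * w5 * t4 * w6 * (v3 * v4 * v5 * v6) / (q3 * q4 * t1 * t2 * t3 * t5 * v1 * cy)"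
    if "cy \<noteq> 0" "v1 \<noteq> 0" "p1 \<noteq> 0" "p2 \<noteq> 0"
    for cy w6 t2 v1 t4 t1 v6 v5 p1 p2 q3 q4 v3 w2 t5 w5 v4 t3 :: real
    using that by (simp add: mult_ac)
  show ?thesis
    unfolding region_factor_def E mm s sqd_empty cr_empty quot A B C D step_ratio_def Let_def c_def[symmetric]
    by (subst alg; (rule fact_nonzero | rule refl)?)
next
  case False
  define c where "c = a + b + x"
  define u where "u = z - y"
  have z: "z = y + u" using False by (simp add: u_def)
  let ?F = "{c+y+1..c+y+u}" and ?F' = "{c+y+2..c+y+1+u}" and ?B = "{a+1..a+b}"
  have E: "ext_up (a+b) x z y = ?F" "ext_up (a+b) (Suc x) z y = ?F'" "ext_up (a+b) x y z = {}" "ext_up (a+b) (Suc x) y z = {}"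
    by (simp_all add: ext_up_def c_def z)
  have mm: "min y z = y" "max y z - y = u" by (simp_all add: z)
  have A: "cr ?B ?F' / cr ?B ?F = fct (x+z+b) * fct (x+y) / (fct (x+z) * fct (x+b+y)) *
    (fct (2*a+2*b+x+z) * fct (2*a+b+x+y) / (fct (2*a+b+x+z) * fct (2*a+2*b+x+y)))"
  proof -
    have "a+b+(x+y) = c+y" "x+y+u+b = x+z+b" "x+y+u = x+z" "x+y+b = x+b+y" "2*a+2*b+(x+y)+u = 2*a+2*b+x+z"
      "2*a+b+(x+y)+u = 2*a+b+x+z" "2*a+b+(x+y) = 2*a+b+x+y" "2*a+2*b+(x+y) = 2*a+2*b+x+y" by (simp_all add: z c_def)
    then show ?thesis using cr_shift[of a b "x+y" u] by (simp only:)
  qed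
  have C: "sqd ?F' / sqd ?F = fct (2*c+2*z) * fct (2*c+2*y+1) / (fct (2*c+(y+z)) * fct (2*c+1+(y+z)))"
  proof -
    have "2*(c+y)+2*u = 2*c+2*z" "2*(c+y)+1 = 2*c+2*y+1" "2*(c+y)+u = 2*c+(y+z)" "2*c+2*y+1+u = 2*c+1+(y+z)" by (simp_all add: z)
    then show ?thesis using sqd_shift[of "c+y" u] by (simp only:)
  qed
  have D: "Zprod (a+b) y (x+1+y) u / Zprod (a+b) y (x+y) u = fct (c+(y+z)) * fct x / (fct (c+z) * fct (x+y)) *
      (fct (2*a+2*b+x+(y+z)) * fct c / (fct (2*a+2*b+x+z) * fct (c+y)))"
  proof -
    have "x+2*y+u+(a+b) = c+(y+z)" "x+y+u+(a+b) = c+z" "x+2*y+u+2*(a+b) = 2*a+2*b+x+(y+z)" "x+(a+b) = c"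
      "x+y+u+2*(a+b) = 2*a+2*b+x+z" "x+y+(a+b) = c+y" by (simp_all add: z c_def)
    then show ?thesis using Zprod_shift[of "a+b" y x u] by (simp only:)
  qed
  have s: "Suc x + y = x + 1 + y" by simp
  have quot: "(1 * k' * (1 * 1 * s') * r') / (1 * k * (1 * 1 * s) * r) = (k' / k) * (s' / s) * (r' / r)"
    for k k' s s' r r' :: real
    by (simp add: mult_ac)
  have alg: "(w6 * xy / (t5 * t2) * (p1 * t4 / (t1 * t3))) * (v5 * v6 / (q3 * q4)) *
      (v3 * w2 / (v1 * xy) * (w5 * v4 / (p1 * cy))) = w2 * w5 * t4 * w6 * (v3 * v4 * v5 * v6) / (q3 * q4 * t1 * t2 * t3 * t5 * v1 * cy)"
    if "xy \<noteq> 0" "p1 \<noteq> 0"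
    for xy cy w6 t2 v1 t4 t1 v6 v5 p1 q3 q4 v3 w2 t5 w5 v4 t3 :: real
    using that by (simp add: mult_ac)
  show ?thesis
    unfolding region_factor_def E mm s sqd_empty cr_empty prod.empty quot A C D step_ratio_def Let_def c_def[symmetric]
    by (subst alg; (rule fact_nonzero | rule refl)?)
qed

lemma region_factor_pos: "region_factor a b y z x > 0"
  unfolding region_factor_def
proof (intro mult_pos_pos Zprod_pos)
  show "cr {1..a} (ext_up (a+b) x y z) > 0" "cr {a+1..a+b} (ext_up (a+b) x z y) > 0"
    by (rule cr_pos; auto simp: ext_up_def)+
  show "(\<Prod>p\<in>ext_up (a+b) x y z. val p) > 0" by (intro prod_pos val_pos) (simp add: ext_up_def)
  show "sqd (ext_up (a+b) x y z) > 0" "sqd (ext_up (a+b) x z y) > 0" by (rule sqd_pos; auto simp: ext_up_def)+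
qed simp

lemma formula_factor_nonzero: "formula_factor a b y z x \<noteq> 0"
proof -
  have "sqd {a+b+x+1..a+b+x+(y+z)} > 0" by (rule sqd_pos) auto
  moreover have "cr {a+1..a+b} {a+b+x+1..a+b+x+(y+z)} > 0" by (rule cr_pos) auto
  moreover have "V_prod (real (2*(a+b+x)+3)) (int y + int z - 2) y \<noteq> 0"
    using V_prod_nonzero[of "a+b+x+1"] by (simp add: add_ac)
  moreover have "tprod (x+b+1) (z+2*a) y > 0" "tprod (x+2*a+b+1) y b > 0" "tprod (x+z+1) y b > 0" by (simp_all add: tprod_pos)
  ultimately show ?thesis unfolding formula_factor_def by simp
qed

lemma factors_proportional:
  "region_factor a b y z x / region_factor a b y z 0 = formula_factor a b y z x / formula_factor a b y z 0"
proof (induction x)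
  case 0
  show ?case using region_factor_pos[of a b y z 0] formula_factor_nonzero[of a b y z 0] by simp
next
  case (Suc x)
  have "r' / r0 = g' / g0" if "r / r0 = g / g0" "r' / r = q" "g' / g = q" "r \<noteq> 0" "g \<noteq> 0" for r r' r0 g g' g0 q :: real
  proof -
    have "r' = q * r" "g' = q * g" using that(2-5) by (simp_all add: divide_eq_eq)
    then show ?thesis using that(1) by (metis times_divide_eq_right)
  qed
  from this[OF Suc region_factor_step formula_factor_step] show ?case
    using region_factor_pos[of a b y z x] formula_factor_nonzero[of a b y z x] by simp
qed


lemma M_H6_width:
  assumes "z + b \<ge> 1"
  shows "M_H6 x y z [a, b] / M_H6 0 y z [a, b] = region_factor a b y z x / region_factor a b y z 0"
    and "M_H6 0 y z [a, b] > 0"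
proof -
  let ?n = "min y z" and ?d = "max y z - min y z" and ?m = "a + b"
  define D where "D = 2 ^ a * (dent_const (2 * (y + a)) * dent_const (2 * (z + b) - 1)) *
    ((\<Prod>p\<in>{1..a}. val p) * sqd {1..a} * sqd {a+1..a+b})"
  have D: "D > 0"
  proof -
    have "(\<Prod>p\<in>{1..a}. val p) > 0" by (intro prod_pos val_pos) simp
    moreover have "sqd {1..a} > 0" "sqd {a+1..a+b} > 0" by (rule sqd_pos; simp)+
    ultimately show ?thesis unfolding D_def by (intro mult_pos_pos dent_const_pos) simp_all
  qed
  \<comment> \<open>The case x = 0 gives the constant of proportionality.\<close>
  define c where "c = Zsum ?m ?n ?n ?d / Zprod ?m ?n ?n ?d"
  have M: "M_H6 x y z [a, b] = D * c * region_factor a b y z x" for x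
  proof -
    have "Zsum ?m ?n (x + ?n) ?d = c * Zprod ?m ?n (x + ?n) ?d"
      using Zsum_ratio[of ?n ?n "x + ?n" ?m ?d] Zprod_pos[of ?n ?n ?m ?d] by (simp add: c_def field_simps)
    then show ?thesis
      using M_H6_formula[of z "[a, b]" x y] assms unfolding two_blocks D_def region_factor_def by (simp add: mult_ac)
  qed
  have c: "c > 0"
  proof -
    have "Zsum ?m ?n ?n ?d > 0"
      unfolding Zsum_base
    proof (intro mult_pos_pos zero_less_power sqd_pos prod_pos)
      fix p assume p: "p \<in> {?m+1..?m+?n}"
      show "0 < wt ?m ?n ?d p" unfolding wt_def
        by (intro mult_pos_pos prod_pos) (use p in \<open>auto intro: val_pos val_less\<close>)
    qed simp
    then show ?thesis using Zprod_pos[of ?n ?n ?m ?d] by (simp add: c_def)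
  qed
  show "M_H6 x y z [a, b] / M_H6 0 y z [a, b] = region_factor a b y z x / region_factor a b y z 0"
    unfolding M using D c by simp
  show "M_H6 0 y z [a, b] > 0"
    unfolding M using D c region_factor_pos by simp
qed

text \<open>For x = 0 there is no choice for S, and the region falls apart into two regions of known
  type.\<close>

lemma M_H6_width_0:
  assumes "z + b \<ge> 1"
  shows "M_H6 0 y z [a, b] = P'_num y (y + 2 * a) b * P_num (z + b - 1) (z + b - 1) a"
proof -
  let ?m = "a + b" and ?n = "min y z"
  have S: "{S \<in> Pow {?m+1..?m+(0+?n)}. card S = ?n} = {{?m+1..?m+?n}}"
  proof -
    have "S = {?m+1..?m+?n}" if "S \<subseteq> {?m+1..?m+?n}" "card S = ?n" for S
      using that by (intro card_subset_eq) auto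
    then show ?thesis by auto
  qed
  have u: "{1..a} \<union> {?m+1..?m+?n} \<union> {?m+0+z+1..?m+0+y} = {1..a} \<union> {a+b+1..a+b+y}"
    "{a+1..a+b} \<union> {?m+1..?m+?n} \<union> {?m+0+y+1..?m+0+z} = {a+1..a+(z+b)}"
    unfolding set_eq_iff Un_iff atLeastAtMost_iff by (auto simp: min_def)
  have "M_H6 0 y z [a, b] = 2 ^ a * (Qd (y+a) b ({1..a} \<union> {a+b+1..a+b+y}) * Kd (z+b) a {a+1..a+(z+b)})"
    using M_H6_sum[of z "[a, b]" 0 y] assms unfolding two_blocks S u[symmetric] by simp
  also have "Kd (z+b) a {a+1..a+(z+b)} = P_num (z + b - 1) (z + b - 1) a"
  proof -
    have e: "z + b - 1 + 1 = z + b" "a + (z + b - 1) + 1 = a + (z + b)" using assms by simp_all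
    show ?thesis unfolding P_num_positions e ..
  qed
  finally show ?thesis unfolding P'_num_positions by simp
qed

lemma K_num_four:
  assumes "b + w \<ge> 1"
  shows "K_num [a, b, x, w] = dent_const (2 * (b + w) - 1) * sqd {a+1..a+b} *
    (sqd {a+b+x+1..a+b+x+w} * cr {a+1..a+b} {a+b+x+1..a+b+x+w})"
proof -
  have l: "[a, b, x, w] = ([a, b] @ [x]) @ [w]" by simp
  have s: "s_sum (Suc (Suc (Suc 0))) [a, b, x] = a + b + x" "even_sum [a, b, x] = b" "odd_sum [a, b, x] = a + x"
    using s_sum_length[of "[a, b] @ [x]"] even_sum_snoc[of "[a, b]" x] odd_sum_snoc[of "[a, b]" x] by (simp_all add: two_blocks)
  have ev: "even_sum [a, b, x, w] = b + w" "odd_sum [a, b, x, w] = a + x" "evpos [a, b, x, w] = {a+1..a+b} \<union> {a+b+x+1..a+b+x+w}"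
    unfolding l even_sum_snoc odd_sum_snoc evpos_snoc by (simp_all add: two_blocks s)
  let ?X = "{a+1..a+b} \<union> {a+b+x+1..a+b+x+w}"
  have "card ?X = b + w" by (subst card_Un_disjoint) auto
  then have "Kd (b + w) (a + x) ?X = dent_const (2 * (b + w) - 1) * sqd ?X"
    by (intro Kd_formula) (use assms in auto)
  moreover have "sqd ?X = sqd {a+1..a+b} * sqd {a+b+x+1..a+b+x+w} * cr {a+1..a+b} {a+b+x+1..a+b+x+w}"
    by (rule sqd_Un) auto
  ultimately show ?thesis using K_num_positions[of "[a, b, x, w]"] assms by (simp add: ev mult.assoc)
qed

text \<open>Both sides agree for x = 0 and change by the same ratio from x to x + 1.\<close>

theorem two_blocks_formula:
  assumes zb: "z + b \<ge> 1"
  shows "M_H6 x y z [a, b] =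
          P'_num y (y + 2 * a) b * P_num (z + b - 1) (z + b - 1) a * K_num [a, b, x, y + z]
            / P_num (y + z + b - 1) (y + z + b - 1) a
          * (V_prod (of_nat (2 * a + 2 * b + 3)) (int y + int z - 2) y
             / V_prod (of_nat (2 * x + 2 * a + 2 * b + 3)) (int y + int z - 2) y)
          * ((T_prod (of_nat (x + b + 1)) (int y + int z + 2 * int a - 1) y
              * T_prod (of_nat (2 * a + b + 1)) (int y + int b - 1) b
              * T_prod (of_nat (z + 1)) (int y + int b - 1) b)
             / (T_prod (of_nat (b + 1)) (int y + int z + 2 * int a - 1) y
                * T_prod (of_nat (x + 2 * a + b + 1)) (int y + int b - 1) b
                * T_prod (of_nat (x + z + 1)) (int y + int b - 1) b))"
proof -
  have T1: "T_prod (of_nat (w + b + 1)) (int y + int z + 2 * int a - 1) y = tprod (w + b + 1) (z + 2 * a) y" for w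
    using T_prod_tprod[of "w + b + 1" "z + 2 * a" y] by (simp add: add_ac)
  have T: "T_prod (of_nat (w + 1)) (int y + int b - 1) b = tprod (w + 1) y b" for w
    using T_prod_tprod[of "w + 1" y b] by simp
  have T0: "T_prod (of_nat (b + 1)) (int y + int z + 2 * int a - 1) y = tprod (0 + b + 1) (z + 2 * a) y"
    using T1[of 0] by simp
  define k where "k = dent_const (2 * (b + (y + z)) - 1) * sqd {a+1..a+b}"
  define F where "F x = sqd {a+b+x+1..a+b+x+(y+z)} * cr {a+1..a+b} {a+b+x+1..a+b+x+(y+z)}" for x
  have byz: "b + (y + z) \<ge> 1" using zb by simp
  have K: "K_num [a, b, x, y + z] = k * F x"
    unfolding K_num_four[OF byz] k_def F_def ..
  have P: "P_num (y + z + b - 1) (y + z + b - 1) a = k * F 0"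
  proof -
    have e: "y + z + b - 1 + 1 = b + (y + z)" "a + (y + z + b - 1) + 1 = a + (b + (y + z))" using zb by simp_all
    have u: "{a+1..a+(b+(y+z))} = {a+1..a+b} \<union> {a+b+1..a+b+(y+z)}" by auto
    have "P_num (y + z + b - 1) (y + z + b - 1) a = Kd (b + (y + z)) a {a+1..a+(b+(y+z))}"
      unfolding P_num_positions e ..
    also have "\<dots> = dent_const (2 * (b + (y + z)) - 1) * sqd {a+1..a+(b+(y+z))}"
      by (intro Kd_formula) (use byz in auto)
    also have "sqd {a+1..a+(b+(y+z))} = sqd {a+1..a+b} * sqd {a+b+1..a+b+(y+z)} * cr {a+1..a+b} {a+b+1..a+b+(y+z)}"
      unfolding u by (rule sqd_Un) auto
    finally show ?thesis by (simp add: k_def F_def mult_ac)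
  qed
  have k: "k > 0" unfolding k_def by (intro mult_pos_pos dent_const_pos sqd_pos) simp
  let ?V = "\<lambda>x. V_prod (real (2 * (a + b + x) + 3)) (int y + int z - 2) y"
  have V: "of_nat (2 * a + 2 * b + 3) = real (2 * (a + b + 0) + 3)" "of_nat (2 * x + 2 * a + 2 * b + 3) = real (2 * (a + b + x) + 3)"
    by simp_all
  have M0: "M_H6 0 y z [a, b] > 0" by (rule M_H6_width(2)[OF zb])
  have "M_H6 x y z [a, b] = M_H6 0 y z [a, b] * (M_H6 x y z [a, b] / M_H6 0 y z [a, b])"
    using M0 by simp
  also have "M_H6 x y z [a, b] / M_H6 0 y z [a, b] = formula_factor a b y z x / formula_factor a b y z 0"
    unfolding M_H6_width(1)[OF zb] factors_proportional ..
  also have "\<dots> = F x / F 0 * (?V 0 / ?V x) *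
      (tprod (x + b + 1) (z + 2 * a) y * tprod (2 * a + b + 1) y b * tprod (z + 1) y b /
      (tprod (0 + b + 1) (z + 2 * a) y * tprod (x + 2 * a + b + 1) y b * tprod (x + z + 1) y b))"
    unfolding formula_factor_def F_def[symmetric] by (simp add: mult_ac)
  also have "F x / F 0 = (k * F x) / (k * F 0)" using k by simp
  finally show ?thesis
    unfolding K P V T0 T1 T M_H6_width_0[OF zb] by (simp only: times_divide_eq_right times_divide_eq_left mult.assoc)
qed

theorem theorem2p7:
  fixes x y z :: nat
  shows
    "(\<forall>a b :: nat. z + b \<ge> 1 \<longrightarrow>
        M_H6 x y z [a, b] =
          P'_num y (y + 2 * a) b * P_num (z + b - 1) (z + b - 1) a * K_num [a, b, x, y + z]
            / P_num (y + z + b - 1) (y + z + b - 1) a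
          * (V_prod (of_nat (2 * a + 2 * b + 3)) (int y + int z - 2) y
             / V_prod (of_nat (2 * x + 2 * a + 2 * b + 3)) (int y + int z - 2) y)
          * ((T_prod (of_nat (x + b + 1)) (int y + int z + 2 * int a - 1) y
              * T_prod (of_nat (2 * a + b + 1)) (int y + int b - 1) b
              * T_prod (of_nat (z + 1)) (int y + int b - 1) b)
             / (T_prod (of_nat (b + 1)) (int y + int z + 2 * int a - 1) y
                * T_prod (of_nat (x + 2 * a + b + 1)) (int y + int b - 1) b
                * T_prod (of_nat (x + z + 1)) (int y + int b - 1) b)))
     \<and>
     (\<forall>(k :: nat) (a :: nat list). k \<ge> 2 \<longrightarrow> length a = 2 * k \<longrightarrow> z + even_sum a \<ge> 1 \<longrightarrow>
        M_H6 x y z a =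
          2 ^ entry a 1 * M_H6 x y z [odd_sum a, even_sum a]
          * (Q'_num (0 # a @ [y]) * K_num (butlast a @ [last a + z])
             / (P'_num y (y + 2 * odd_sum a) (even_sum a)
                * P_num (z + even_sum a - 1) (z + even_sum a - 1) (odd_sum a)))
          * (\<Prod>i=2..k.
               (T_seq a i (x + z + e_sum i a + 1) * T_seq a i (y + e_sum i a + 1))
               / (T_seq a i (x + y + e_sum i a + 1) * T_seq a i (z + e_sum i a + 1))
               * ((T_seq a i (x + y + sigma a i + 1) * T_seq a i (z + sigma a i + 1))
                  / (T_seq a i (x + z + sigma a i + 1) * T_seq a i (y + sigma a i + 1)))))"
  by (intro conjI allI impI two_blocks_formula many_blocks) simp_all

end
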